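(* Let $R$ be a quasilocal domain with quotient field $F$, and let $n>1$ be an integer. Then the following statements are equivalent. (1) $R$ is a bad Noetherian stable domain of embedding dimension $n$. (2) $\overline R$ is a DVR and $\overline R/R$ is a direct sum of $n-1$ divisible Artinian uniserial $R$-modules. (3) $\overline R$ is a DVR and $\overline R/R\cong\bigoplus_{i=1}^{n-1}F/\overline R$ as $R$-modules.
   Context: All rings are commutative with identity. A quasilocal ring is a ring with a unique maximal ideal (not necessarily Noetherian); its embedding dimension is the cardinality of a minimal generating set of its maximal ideal. $\overline R$ denotes the integral closure of $R$ in its total ring of quotients (here $F$). An $R$-module $K$ is uniserial if the set of all $R$-submodules of $K$ is linearly ordered by inclusion. An $R$-module $L$ over a domain $R$ is divisible if $rL=L$ for all nonzero $r\in R$. An ideal is stable if it is projective over its ring of endomorphisms; a domain is stable if every nonzero ideal is stable. $R$ has finite normalization if $\overline R$ is a finite (that is, finitely generated) $R$-module. A bad stable domain is a quasilocal stable domain of Krull dimension $1$ that does not have finite normalization; it is a bad Noetherian stable domain if it is also Noetherian.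
   Formalization: In (2) the n−1 divisible Artinian uniserial summands are required to be nonzero; if zero summands were allowed, (2) would not imply (1), e.g. for R a DVR and n = 2. *)

theory Defs
  imports "HOL-Algebra.Algebra" "HOL-Library.Extended_Nat"
begin

section \<open>Modules\<close>

text \<open>
  The record \<^typ>\<open>('a, 'b) module\<close> extends the ring record, so a module carries the ring fields
  \<open>mult\<close> and \<open>one\<close>. They play no role in the notion of module and are left \<open>undefined\<close> in the
  constructions below.
\<close>

definition mult_module :: "('a, 'm) ring_scheme \<Rightarrow> 'a set \<Rightarrow> ('a, 'a) module"
  \<comment> \<open>the additive subgroup \<open>S\<close> of the ring \<open>A\<close>, on which scalars from \<open>A\<close> or from a subring of
      \<open>A\<close> act by the multiplication of \<open>A\<close>\<close>
  where "mult_module A S =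
    \<lparr> carrier = S, monoid.mult = undefined, one = undefined,
      ring.zero = \<zero>\<^bsub>A\<^esub>, ring.add = ring.add A, smult = monoid.mult A \<rparr>"

definition quot_module :: "('r, 'b) module \<Rightarrow> 'b set \<Rightarrow> ('r, 'b set) module"
  \<comment> \<open>for a coset \<open>C = N + x\<close>, the union in \<open>smult\<close> is the coset \<open>N + r x\<close>\<close>
  where "quot_module M N =
    \<lparr> carrier = a_rcosets\<^bsub>M\<^esub> N, monoid.mult = undefined, one = undefined,
      ring.zero = N, ring.add = set_add M,
      smult = (\<lambda>r C. \<Union>x\<in>C. N +>\<^bsub>M\<^esub> (r \<odot>\<^bsub>M\<^esub> x)) \<rparr>"

definition direct_sum_module :: "'i set \<Rightarrow> ('i \<Rightarrow> ('r, 'b) module) \<Rightarrow> ('r, 'i \<Rightarrow> 'b) module"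
  where "direct_sum_module I M =
    \<lparr> carrier = {f \<in> (\<Pi>\<^sub>E i\<in>I. carrier (M i)). finite {i \<in> I. f i \<noteq> \<zero>\<^bsub>M i\<^esub>}},
      monoid.mult = undefined, one = undefined,
      ring.zero = (\<lambda>i\<in>I. \<zero>\<^bsub>M i\<^esub>),
      ring.add = (\<lambda>f g. \<lambda>i\<in>I. f i \<oplus>\<^bsub>M i\<^esub> g i),
      smult = (\<lambda>r f. \<lambda>i\<in>I. r \<odot>\<^bsub>M i\<^esub> f i) \<rparr>"

definition module_hom :: "('r, 'm) ring_scheme \<Rightarrow> ('r, 'b) module \<Rightarrow> ('r, 'c) module \<Rightarrow> ('b \<Rightarrow> 'c) set"
  where "module_hom A M N =
    {f \<in> carrier M \<rightarrow> carrier N.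
       (\<forall>x\<in>carrier M. \<forall>y\<in>carrier M. f (x \<oplus>\<^bsub>M\<^esub> y) = f x \<oplus>\<^bsub>N\<^esub> f y) \<and>
       (\<forall>r\<in>carrier A. \<forall>x\<in>carrier M. f (r \<odot>\<^bsub>M\<^esub> x) = r \<odot>\<^bsub>N\<^esub> f x)}"

definition module_isomorphic :: "('r, 'm) ring_scheme \<Rightarrow> ('r, 'b) module \<Rightarrow> ('r, 'c) module \<Rightarrow> bool"
  where "module_isomorphic A M N \<longleftrightarrow> (\<exists>f\<in>module_hom A M N. bij_betw f (carrier M) (carrier N))"

definition fg_module :: "('r, 'm) ring_scheme \<Rightarrow> ('r, 'b) module \<Rightarrow> bool"
  where "fg_module A M \<longleftrightarrow>
    (\<exists>S \<subseteq> carrier M. finite S \<and> (\<forall>N. submodule N A M \<and> S \<subseteq> N \<longrightarrow> N = carrier M))"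

definition divisible_module :: "('r, 'm) ring_scheme \<Rightarrow> ('r, 'b) module \<Rightarrow> bool"
  where "divisible_module A M \<longleftrightarrow>
    (\<forall>r \<in> carrier A - {\<zero>\<^bsub>A\<^esub>}. (\<lambda>x. r \<odot>\<^bsub>M\<^esub> x) ` carrier M = carrier M)"

definition artinian_module :: "('r, 'm) ring_scheme \<Rightarrow> ('r, 'b) module \<Rightarrow> bool"
  where "artinian_module A M \<longleftrightarrow>
    (\<forall>N :: nat \<Rightarrow> 'b set. (\<forall>i. submodule (N i) A M) \<and> (\<forall>i. N (Suc i) \<subseteq> N i)
       \<longrightarrow> (\<exists>k. \<forall>i\<ge>k. N i = N k))"

definition uniserial_module :: "('r, 'm) ring_scheme \<Rightarrow> ('r, 'b) module \<Rightarrow> bool"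
  where "uniserial_module A M \<longleftrightarrow>
    (\<forall>N N'. submodule N A M \<and> submodule N' A M \<longrightarrow> N \<subseteq> N' \<or> N' \<subseteq> N)"

definition projective_module :: "('r, 'm) ring_scheme \<Rightarrow> ('r, 'b) module \<Rightarrow> bool"
  \<comment> \<open>\<open>P\<close> is a direct summand of a free module. It is no restriction that the basis \<open>B\<close> is taken
      in the type of elements of \<open>P\<close>: a projective module splits off from the free module on
      its own carrier.\<close>
  where "projective_module A P \<longleftrightarrow>
    (\<exists>B :: 'b set. let free = direct_sum_module B (\<lambda>_. mult_module A (carrier A)) in
       \<exists>i \<in> module_hom A P free. \<exists>p \<in> module_hom A free P. \<forall>x\<in>carrier P. p (i x) = x)"


section \<open>Stability\<close>

definition endo_ring :: "('r, 'm) ring_scheme \<Rightarrow> ('r, 'b) module \<Rightarrow> ('b \<Rightarrow> 'b) ring"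
  where "endo_ring A M =
    \<lparr> carrier = module_hom A M M \<inter> extensional (carrier M),
      monoid.mult = compose (carrier M),
      one = (\<lambda>x\<in>carrier M. x),
      ring.zero = (\<lambda>x\<in>carrier M. \<zero>\<^bsub>M\<^esub>),
      ring.add = (\<lambda>f g. \<lambda>x\<in>carrier M. f x \<oplus>\<^bsub>M\<^esub> g x) \<rparr>"

definition endo_module :: "('r, 'b) module \<Rightarrow> ('b \<Rightarrow> 'b, 'b) module"
  \<comment> \<open>\<open>M\<close> as a module over its ring of endomorphisms\<close>
  where "endo_module M =
    \<lparr> carrier = carrier M, monoid.mult = undefined, one = undefined,
      ring.zero = \<zero>\<^bsub>M\<^esub>, ring.add = ring.add M,
      smult = (\<lambda>f x. f x) \<rparr>"

definition stable_ideal :: "('a, 'm) ring_scheme \<Rightarrow> 'a set \<Rightarrow> bool"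
  where "stable_ideal A I \<longleftrightarrow>
    projective_module (endo_ring A (mult_module A I)) (endo_module (mult_module A I))"

definition stable_domain :: "('a, 'm) ring_scheme \<Rightarrow> bool"
  where "stable_domain A \<longleftrightarrow> domain A \<and> (\<forall>I. ideal I A \<and> I \<noteq> {\<zero>\<^bsub>A\<^esub>} \<longrightarrow> stable_ideal A I)"


section \<open>Quasilocal rings, dimension and normalization\<close>

definition quasilocal :: "('a, 'm) ring_scheme \<Rightarrow> bool"
  where "quasilocal A \<longleftrightarrow> cring A \<and> (\<exists>!M. maximalideal M A)"

definition has_embedding_dim :: "('a, 'm) ring_scheme \<Rightarrow> nat \<Rightarrow> bool"
  \<comment> \<open>Generating sets are minimal with respect to inclusion; by Nakayama's lemma the finite ones
      of the maximal ideal of a quasilocal ring all have the same cardinality.\<close>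
  where "has_embedding_dim A n \<longleftrightarrow> quasilocal A \<and>
    (\<exists>M S. maximalideal M A \<and> S \<subseteq> carrier A \<and> Idl\<^bsub>A\<^esub> S = M \<and> (\<forall>T. T \<subset> S \<longrightarrow> Idl\<^bsub>A\<^esub> T \<noteq> M) \<and>
           finite S \<and> card S = n)"

definition krull_dim :: "('a, 'm) ring_scheme \<Rightarrow> enat"
  \<comment> \<open>supremum of the lengths \<open>n\<close> of chains \<open>P 0 \<subset> \<dots> \<subset> P n\<close> of prime ideals\<close>
  where "krull_dim A =
    (SUP n \<in> {n. \<exists>P. (\<forall>i\<le>n. primeideal (P i) A) \<and> (\<forall>i<n. P i \<subset> P (Suc i))}. enat n)"

definition dvr :: "('a, 'm) ring_scheme \<Rightarrow> bool"
  where "dvr V \<longleftrightarrow> principal_domain V \<and> quasilocal V \<and> \<not> field V"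

definition quotient_field :: "('a, 'm) ring_scheme \<Rightarrow> 'a set \<Rightarrow> bool"
  \<comment> \<open>\<open>F\<close> is the quotient field of its subring \<open>R\<close>\<close>
  where "quotient_field F R \<longleftrightarrow> field F \<and> subdomain R F \<and>
    (\<forall>x\<in>carrier F. \<exists>a\<in>R. \<exists>b\<in>R - {\<zero>\<^bsub>F\<^esub>}. x = a \<otimes>\<^bsub>F\<^esub> inv\<^bsub>F\<^esub> b)"

definition integral_closure :: "('a, 'm) ring_scheme \<Rightarrow> 'a set \<Rightarrow> 'a set"
  \<comment> \<open>the elements of \<open>F\<close> that are roots of a monic polynomial over \<open>R\<close>\<close>
  where "integral_closure F R =
    {x \<in> carrier F. \<exists>p. polynomial\<^bsub>F\<^esub> R p \<and> p \<noteq> [] \<and> lead_coeff p = \<one>\<^bsub>F\<^esub> \<and> ring.eval F p x = \<zero>\<^bsub>F\<^esub>}"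

definition finite_normalization :: "('a, 'm) ring_scheme \<Rightarrow> 'a set \<Rightarrow> bool"
  where "finite_normalization F R \<longleftrightarrow>
    fg_module (F\<lparr>carrier := R\<rparr>) (mult_module F (integral_closure F R))"

definition bad_stable_domain :: "('a, 'm) ring_scheme \<Rightarrow> 'a set \<Rightarrow> bool"
  \<comment> \<open>for a subring \<open>R\<close> with quotient field \<open>F\<close>\<close>
  where "bad_stable_domain F R \<longleftrightarrow>
    quasilocal (F\<lparr>carrier := R\<rparr>) \<and> stable_domain (F\<lparr>carrier := R\<rparr>) \<and>
    krull_dim (F\<lparr>carrier := R\<rparr>) = 1 \<and> \<not> finite_normalization F R"

definition bad_noetherian_stable_domain :: "('a, 'm) ring_scheme \<Rightarrow> 'a set \<Rightarrow> bool"
  where "bad_noetherian_stable_domain F R \<longleftrightarrow>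
    bad_stable_domain F R \<and> noetherian_ring (F\<lparr>carrier := R\<rparr>)"

end

theory Submission imports Defs begin

text \<open>
  Let \<open>m\<close> be the maximal ideal of \<open>R\<close> and \<open>V\<close> its integral closure. Each of the three conditions is
  equivalent to the following one: \<open>V\<close> is a DVR with a uniformizer \<open>z\<close> that lies in \<open>R\<close>,
  \<open>V = R + z V\<close>, every \<open>R\<close>-module between \<open>R\<close> and \<open>V\<close> is a ring, and \<open>m / z R\<close> is a vector space
  over \<open>R / m\<close> with a basis given by elements \<open>r\<^sub>1, \<dots>, r\<^sub>n\<^sub>-\<^sub>1\<close>.

  From (1): for \<open>x, y \<in> V\<close>, stability of (a multiple of) \<open>J = R + R x + R y\<close> makes the conductor of
  \<open>J\<close> in \<open>(J : J)\<close> the unit ideal, so \<open>J\<close> is a ring. For \<open>n = m + m y\<close> and \<open>E = (n : n)\<close>, the ring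
  \<open>E / n\<close> is not reduced because \<open>V\<close> is not finite over \<open>R\<close>; a nilpotent \<open>\<epsilon>\<close> shows that \<open>E\<close> is local
  with residue field \<open>R / m\<close> and maximal ideal \<open>N = {e. \<epsilon> e \<in> n}\<close>, where squares of elements of \<open>N\<close>
  lie in \<open>n\<close>. Stability gives \<open>n = z E\<close>, and then \<open>N \<subseteq> z V\<close>, so \<open>y \<in> R + z V\<close>.

  From (2): divisibility gives \<open>V = R + r V\<close> for all \<open>r \<noteq> 0\<close> in \<open>R\<close>. As a summand \<open>K\<^sub>i\<close> is uniserial,
  the annihilators in \<open>K\<^sub>i\<close> of the elements of \<open>R\<close> form a chain, which makes them compatible with
  divisibility in \<open>V\<close>; hence modules between \<open>R\<close> and \<open>V\<close> are rings. The elements of \<open>K\<^sub>i\<close> killed by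
  \<open>z\<close> provide the basis of \<open>m / z R\<close>.

  Conversely, an element of minimal value generates an ideal of \<open>R\<close> over its endomorphism ring,
  which gives stability. For (3), one chooses \<open>Y\<^sub>i(k) \<in> V\<close> with \<open>Y\<^sub>i(0) = 0\<close>, \<open>z Y\<^sub>i(1) = r\<^sub>i\<close> and
  \<open>Y\<^sub>i(k) - z Y\<^sub>i(k + 1) \<in> R\<close>. Every \<open>v \<in> V\<close> is congruent modulo \<open>R\<close> to some \<open>\<Sum>\<^sub>i c\<^sub>i Y\<^sub>i(k)\<close> with
  \<open>c\<^sub>i \<in> R\<close>, and \<open>v\<close> is sent to the classes of \<open>c\<^sub>i / z\<^sup>k\<close>. Finally (3) implies (2) since an
  \<open>R\<close>-submodule of \<open>F / V\<close> is a \<open>V\<close>-submodule by \<open>V = R + z\<^sup>k V\<close>.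
\<close>

section \<open>Submodules of the quotient field and integral elements\<close>

text \<open>Everything takes place inside the field \<open>F\<close>: ideals, overrings and
  fractional ideals are subsets closed under addition and under scalars, and quotients are mostly
  replaced by congruences modulo such subsets. That \<open>V\<close> is a ring is never presupposed:
  from (1) it falls out of the rings \<open>R + R x + R y\<close>, from (2) and (3) it is part of
  \<open>V\<close> being a DVR. The recurring tool is that for an ideal \<open>C\<close> of an
  overring \<open>S\<close> and \<open>x\<close> integral over \<open>R\<close>, the multiples
  \<open>c x\<close> in \<open>S\<close> with \<open>c\<close> in \<open>C\<close> are nilpotent
  modulo \<open>C\<close>; it stands in for lying over. The main obstacle is the residue field of
  \<open>V\<close>: the \<open>z\<close> with \<open>n = z E\<close> depends on \<open>y\<close>,
  but the case \<open>y = 0\<close> yields one \<open>z\<close> with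
  \<open>m \<subseteq> z V\<close>, and then \<open>n \<subseteq> z V\<close> for every
  \<open>y\<close>. The residue characteristic may be 2, so nilpotence arguments cannot polarize
  \<open>(x + y)^2\<close>; the relations \<open>x y = a + b x + c y\<close> and
  \<open>x^2 = a + b x\<close> do this work. From (2), a uniformizer in \<open>R\<close> has to be
  constructed: write one of \<open>V\<close> as \<open>t = a / b\<close> and divide \<open>t\<close>
  by \<open>a^2\<close> with remainder in \<open>R\<close>.\<close>

lemma (in cring) exists_maximalideal:
  assumes I: "ideal I R" "\<one> \<notin> I"
  shows "\<exists>M. maximalideal M R \<and> I \<subseteq> M"
proof -
  let ?C = "{J. ideal J R \<and> I \<subseteq> J \<and> \<one> \<notin> J}"
  have "\<exists>M\<in>?C. \<forall>J\<in>?C. M \<subseteq> J \<longrightarrow> J = M"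
  proof (rule subset_Zorn_nonempty)
    show "?C \<noteq> {}" using I by auto
    fix K assume K: "K \<noteq> {}" "subset.chain ?C K"
    have "subset.chain {I. ideal I R} K"
      using K(2) by (auto simp: subset.chain_def)
    then have "ideal (\<Union>K) R"
      using chain_Union_is_ideal[of K] K(1) by simp
    moreover have "I \<subseteq> \<Union>K" "\<one> \<notin> \<Union>K"
      using K unfolding subset.chain_def by blast+
    ultimately show "\<Union>K \<in> ?C" by auto
  qed
  then obtain M where M: "ideal M R" "I \<subseteq> M" "\<one> \<notin> M"
    "\<And>J. ideal J R \<Longrightarrow> I \<subseteq> J \<Longrightarrow> \<one> \<notin> J \<Longrightarrow> M \<subseteq> J \<Longrightarrow> J = M"
    by auto
  have "maximalideal M R"
  proof (rule maximalidealI[OF M(1)])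
    show "carrier R \<noteq> M" using M(3) by auto
    fix J assume J: "ideal J R" "M \<subseteq> J" "J \<subseteq> carrier R"
    show "J = M \<or> J = carrier R"
      using M(2,4) J ideal.one_imp_carrier by blast
  qed
  with M show ?thesis by auto
qed

lemma (in cring) nonunit_in_maximalideal:
  assumes "r \<in> carrier R" "r \<notin> Units R"
  shows "\<exists>M. maximalideal M R \<and> r \<in> M"
proof -
  have "\<one> \<notin> PIdl r"
    using assms by (auto simp: cgenideal_def Units_def) (metis m_comm)
  then obtain M where "maximalideal M R" "PIdl r \<subseteq> M"
    using exists_maximalideal[OF cgenideal_ideal[OF assms(1)]] by auto
  then show ?thesis using cgenideal_self[OF assms(1)] by auto
qed

text \<open>Scalars and members are subsets of one ring, so the same notion covers ideals of
  \<open>R\<close>, ideals of overrings and fractional ideals. Closure under negation is not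
  demanded; it follows from the scalar \<open>\<ominus> \<one>\<close> once \<open>S\<close> is a
  subring.\<close>

definition (in ring) smod :: "'a set \<Rightarrow> 'a set \<Rightarrow> bool"
  where "smod S L \<longleftrightarrow> L \<subseteq> carrier R \<and> \<zero> \<in> L \<and> (\<forall>x\<in>L. \<forall>y\<in>L. x \<oplus> y \<in> L) \<and> (\<forall>r\<in>S. \<forall>x\<in>L. r \<otimes> x \<in> L)"

context ring
begin

lemma smodI:
  assumes "\<And>x. x \<in> L \<Longrightarrow> x \<in> carrier R" "\<zero> \<in> L" "\<And>x y. x \<in> L \<Longrightarrow> y \<in> L \<Longrightarrow> x \<oplus> y \<in> L"
    "\<And>r x. r \<in> S \<Longrightarrow> x \<in> L \<Longrightarrow> r \<otimes> x \<in> L"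
  shows "smod S L"
  using assms by (auto simp: smod_def)

lemma smodD:
  assumes "smod S L"
  shows smod_carrier: "x \<in> L \<Longrightarrow> x \<in> carrier R"
    and smod_zero: "\<zero> \<in> L"
    and smod_add: "x \<in> L \<Longrightarrow> y \<in> L \<Longrightarrow> x \<oplus> y \<in> L"
    and smod_smult: "r \<in> S \<Longrightarrow> x \<in> L \<Longrightarrow> r \<otimes> x \<in> L"
  using assms by (auto simp: smod_def)

lemma smod_mono: "smod S L \<Longrightarrow> T \<subseteq> S \<Longrightarrow> smod T L"
  by (auto simp: smod_def)

lemma smod_neg:
  assumes "smod S L" "subring S R" "x \<in> L"
  shows "\<ominus> x \<in> L"
proof -
  have "\<ominus> \<one> \<otimes> x \<in> L"
    using assms by (intro smod_smult[OF assms(1)]) (auto intro: subringE)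
  then show ?thesis using smod_carrier[OF assms(1,3)] by (simp add: l_minus)
qed

lemma smod_diff:
  assumes "smod S L" "subring S R" "x \<in> L" "y \<in> L"
  shows "x \<ominus> y \<in> L"
  unfolding a_minus_def using assms smod_add smod_neg by metis

text \<open>Congruence bookkeeping: a summand known to lie in \<open>L\<close> may be dropped. This
  is how equations modulo \<open>L\<close> are solved below.\<close>

lemma smod_cancel:
  assumes "smod S L" "subring S R" "x \<in> L" "y \<in> carrier R" "x \<oplus> y \<in> L"
  shows "y \<in> L"
proof -
  have "\<ominus> x \<oplus> (x \<oplus> y) \<in> L" using assms smod_neg smod_add by metis
  then show ?thesis using assms smod_carrier[OF assms(1,3)] by (simp add: r_neg2 r_neg1)
qed

lemma smod_finsum:
  assumes "smod S L" "\<And>i. i \<in> I \<Longrightarrow> f i \<in> L"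
  shows "(\<Oplus>i\<in>I. f i) \<in> L"
  using assms(2)
proof (induction I rule: infinite_finite_induct)
  case (insert i I)
  then show ?case using smodD[OF assms(1)] by (subst finsum_insert) auto
qed (use smod_zero[OF assms(1)] in auto)

end

section \<open>Subrings of their field of fractions and integral elements\<close>

locale frac_field = field F for F (structure) +
  fixes R
  assumes subring: "subring R F"
    and frac: "x \<in> carrier F \<Longrightarrow> \<exists>a\<in>R. \<exists>b\<in>R - {\<zero>}. x = a \<otimes> inv b"
begin

abbreviation "A \<equiv> F\<lparr>carrier := R\<rparr>"
abbreviation "V \<equiv> integral_closure F R"

lemma R_carrier [simp, intro]: "x \<in> R \<Longrightarrow> x \<in> carrier F"
  using subringE(1)[OF subring] by auto

lemma R_closed [simp, intro]:
  "\<zero> \<in> R" "\<one> \<in> R" "x \<in> R \<Longrightarrow> y \<in> R \<Longrightarrow> x \<oplus> y \<in> R" "x \<in> R \<Longrightarrow> y \<in> R \<Longrightarrow> x \<otimes> y \<in> R"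
  "x \<in> R \<Longrightarrow> \<ominus> x \<in> R" "x \<in> R \<Longrightarrow> y \<in> R \<Longrightarrow> x \<ominus> y \<in> R"
  unfolding a_minus_def using subringE[OF subring] by auto

lemma R_pow [simp, intro]: "x \<in> R \<Longrightarrow> x [^] (n::nat) \<in> R"
  by (induction n) auto

lemma smod_R: "smod R R"
  by (rule smodI) auto

lemma inv_F [simp]:
  assumes "x \<in> carrier F" "x \<noteq> \<zero>"
  shows "inv x \<in> carrier F" "x \<otimes> inv x = \<one>" "inv x \<otimes> x = \<one>" "inv x \<noteq> \<zero>"
  using assms field_Units by auto

lemma cring_A: "cring A" and domain_A: "domain A"
  using subring_is_domain[OF subring] by (auto simp: domain_def)

lemma denom:
  assumes "x \<in> carrier F"
  obtains s where "s \<in> R" "s \<noteq> \<zero>" "s \<otimes> x \<in> R"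
proof -
  obtain a b where ab: "a \<in> R" "b \<in> R" "b \<noteq> \<zero>" "x = a \<otimes> inv b"
    using frac[OF assms] by auto
  have "b \<otimes> x = a \<otimes> (b \<otimes> inv b)" using ab by (simp add: m_ac)
  then show ?thesis using that[of b] ab by simp
qed

lemma ideal_A_iff: "ideal I A \<longleftrightarrow> I \<subseteq> R \<and> smod R I"
proof
  assume I: "ideal I A"
  then interpret I: ideal I A .
  have IR: "I \<subseteq> R" using I.a_subset by simp
  moreover have "smod R I"
  proof (rule smodI)
    show "\<zero> \<in> I" using additive_subgroup.zero_closed[OF ideal.axioms(1)[OF I]] by simp
    show "x \<oplus> y \<in> I" if "x \<in> I" "y \<in> I" for x y
      using additive_subgroup.a_closed[OF ideal.axioms(1)[OF I] that] by simp
    show "r \<otimes> x \<in> I" if "r \<in> R" "x \<in> I" for r x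
      using I.I_l_closed[OF that(2), of r] that(1) by simp
  qed (use IR in auto)
  ultimately show "I \<subseteq> R \<and> smod R I" ..
next
  assume I: "I \<subseteq> R \<and> smod R I"
  interpret A: cring A by (rule cring_A)
  show "ideal I A"
  proof (rule idealI[OF A.ring_axioms])
    show "subgroup I (add_monoid A)"
    proof (rule A.add.subgroupI)
      show "I \<noteq> {}" using I smod_zero by blast
      fix a assume a: "a \<in> I"
      have "\<ominus>\<^bsub>A\<^esub> a = \<ominus> a"
      proof (rule A.minus_equality)
        have "a \<in> carrier F" using a I by auto
        then show "\<ominus> a \<oplus>\<^bsub>A\<^esub> a = \<zero>\<^bsub>A\<^esub>" by (simp add: l_neg)
      qed (use a I in auto)
      then show "\<ominus>\<^bsub>A\<^esub> a \<in> I" using smod_neg[OF _ subring] a I by auto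
    qed (use I smodD in auto)
  next
    fix a x assume a: "a \<in> I" "x \<in> carrier A"
    then have "x \<otimes> a \<in> I" using I smod_smult by auto
    then show "x \<otimes>\<^bsub>A\<^esub> a \<in> I" "a \<otimes>\<^bsub>A\<^esub> x \<in> I"
      using a I by (auto simp: m_comm subsetD)
  qed
qed


lemma V_carrier [simp, intro]: "x \<in> V \<Longrightarrow> x \<in> carrier F"
  by (auto simp: integral_closure_def)

lemma R_V [simp, intro]: "r \<in> R \<Longrightarrow> r \<in> V"
proof -
  assume r: "r \<in> R"
  have "polynomial R [\<one>, \<ominus> r]" using r by (auto simp: polynomial_def)
  moreover have "eval [\<one>, \<ominus> r] r = \<zero>" using r by (simp add: r_neg)
  ultimately show ?thesis using r unfolding integral_closure_def
    by (auto intro!: exI[of _ "[\<one>, \<ominus> r]"])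
qed

text \<open>The monic equation of \<open>x\<close>, homogenized by \<open>s [^] n\<close>. The
  degree \<open>n\<close> depends on \<open>x\<close> alone, so one \<open>n\<close> serves every
  \<open>s\<close> and every \<open>C\<close>. Later \<open>C\<close> is an ideal of an overring,
  but also the annihilator in \<open>R\<close> of an element of a module.\<close>

lemma integral_power:
  assumes "x \<in> V"
  shows "\<exists>n. \<forall>s\<in>carrier F. \<forall>C. smod R C \<longrightarrow>
    (\<forall>i<n. (s \<otimes> x) [^] i \<otimes> s [^] (n - i) \<in> C) \<longrightarrow> (s \<otimes> x) [^] (n::nat) \<in> C"
proof -
  obtain p where p: "polynomial R p" "p \<noteq> []" "hd p = \<one>" "eval p x = \<zero>" and x: "x \<in> carrier F"
    using assms unfolding integral_closure_def by blast
  then obtain q where q: "p = \<one> # q" by (cases p) auto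
  have qR: "set q \<subseteq> R" using p(1) q by (auto simp: polynomial_def)
  \<comment> \<open>Induction on the coefficient list. The surplus \<open>k\<close> of the exponent
    of \<open>s\<close> over the length of the list grows by one with each leading coefficient split
    off.\<close>
  have aux: "(\<forall>i<length q. (s \<otimes> x) [^] i \<otimes> s [^] (k + length q - i) \<in> C) \<Longrightarrow>
      s [^] (k + length q) \<otimes> eval q x \<in> C" if s: "s \<in> carrier F" and C: "smod R C" for s C and k :: nat
    using qR
  proof (induction q arbitrary: k)
    case Nil
    then show ?case using s smod_zero[OF C] by simp
  next
    case (Cons a q)
    let ?l = "length q"
    have a: "a \<in> R" and q: "set q \<subseteq> R" using Cons.prems by auto
    have e: "eval q x \<in> carrier F" using q x by (intro eval_in_carrier) auto
    have "s [^] (Suc k + ?l) \<otimes> eval q x \<in> C"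
      using Cons.prems q by (intro Cons.IH) (auto simp: less_Suc_eq)
    moreover have "a \<otimes> ((s \<otimes> x) [^] ?l \<otimes> s [^] (Suc k)) \<in> C"
      using Cons.prems(1) smod_smult[OF C a] by (auto dest!: spec[of _ ?l])
    ultimately have "a \<otimes> ((s \<otimes> x) [^] ?l \<otimes> s [^] (Suc k)) \<oplus> s [^] (Suc k + ?l) \<otimes> eval q x \<in> C"
      using smod_add[OF C] by blast
    moreover have "a \<otimes> ((s \<otimes> x) [^] ?l \<otimes> s [^] (Suc k)) = s [^] (Suc k + ?l) \<otimes> (a \<otimes> x [^] ?l)"
      using s x a by (simp add: nat_pow_distrib nat_pow_mult[symmetric] m_ac)
    ultimately show ?case using s x a e by (simp add: r_distr)
  qed
  have "(s \<otimes> x) [^] length q \<in> C"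
    if s: "s \<in> carrier F" and C: "smod R C"
      and i: "\<forall>i<length q. (s \<otimes> x) [^] i \<otimes> s [^] (length q - i) \<in> C" for s C
  proof -
    have e: "eval q x \<in> carrier F" using qR x by (intro eval_in_carrier) auto
    have "x [^] length q \<oplus> eval q x = \<zero>" using p(4) q x by simp
    then have "x [^] length q = \<ominus> eval q x"
      using e x by (intro minus_equality[symmetric]) (simp_all add: a_comm)
    then have "(s \<otimes> x) [^] length q = \<ominus> (s [^] length q \<otimes> eval q x)"
      using s x e by (simp add: nat_pow_distrib r_minus)
    moreover have "s [^] length q \<otimes> eval q x \<in> C" using aux[OF s C, of 0] i by simp
    ultimately show ?thesis using smod_neg[OF C subring] by simp
  qed
  then show ?thesis by blast
qed


text \<open>Lying over in elementary form: \<open>c V \<inter> S\<close> is contained in the radical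
  of the ideal \<open>C\<close> of \<open>S\<close>. In the homogenized equation every lower term
  carries a positive power of \<open>c\<close>, and the cofactor is a power of \<open>c x\<close>,
  which is in \<open>S\<close>.\<close>

lemma integral_radical:
  assumes x: "x \<in> V" and S: "subring S F" "R \<subseteq> S" and C: "smod S C" "C \<subseteq> S" "c \<in> C" "c \<otimes> x \<in> S"
  shows "\<exists>n::nat. (c \<otimes> x) [^] n \<in> C"
proof -
  have cF: "c \<in> carrier F" using C smod_carrier by blast
  have cC: "c [^] (Suc k) \<in> C" for k
  proof (induction k)
    case (Suc k)
    then have "c \<otimes> c [^] (Suc k) \<in> C" using C by (intro smod_smult[OF C(1)]) auto
    then show ?case using cF by (simp add: m_comm)
  qed (use C cF in simp)
  obtain n :: nat where n: "\<And>s C. s \<in> carrier F \<Longrightarrow> smod R C \<Longrightarrow>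
    (\<forall>i<n. (s \<otimes> x) [^] i \<otimes> s [^] (n - i) \<in> C) \<Longrightarrow> (s \<otimes> x) [^] n \<in> C"
    using integral_power[OF x] by auto
  have pw: "(c \<otimes> x) [^] (i::nat) \<in> S" for i
    using S(1) C(4) by (induction i) (simp_all add: subringE)
  have "(c \<otimes> x) [^] i \<otimes> c [^] (n - i) \<in> C" if "i < n" for i
    using smod_smult[OF C(1) pw cC[of "n - i - 1"]] that by (simp add: Suc_diff_Suc)
  then show ?thesis using n[OF cF smod_mono[OF C(1) S(2)]] by blast
qed

end

section \<open>Quasilocal and Noetherian domains\<close>

locale quasi = frac_field +
  assumes ql: "quasilocal A"
begin

definition "m = (THE M. maximalideal M A)"

lemma m_max: "maximalideal m A" and m_unique: "maximalideal M A \<Longrightarrow> M = m"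
proof -
  have u: "\<exists>!M. maximalideal M A" using ql by (auto simp: quasilocal_def)
  show "maximalideal m A" unfolding m_def by (rule theI'[OF u])
  then show "maximalideal M A \<Longrightarrow> M = m" using u by auto
qed

lemma m_ideal: "ideal m A"
  using m_max maximalideal.axioms(1) by blast

lemma m_R [simp, intro]: "x \<in> m \<Longrightarrow> x \<in> R" and smod_m: "smod R m"
  using m_ideal ideal_A_iff by auto

lemma max_closed [simp, intro]:
  "\<zero> \<in> m" "x \<in> m \<Longrightarrow> y \<in> m \<Longrightarrow> x \<oplus> y \<in> m" "r \<in> R \<Longrightarrow> x \<in> m \<Longrightarrow> r \<otimes> x \<in> m"
  "r \<in> R \<Longrightarrow> x \<in> m \<Longrightarrow> x \<otimes> r \<in> m"
  "x \<in> m \<Longrightarrow> \<ominus> x \<in> m" "x \<in> m \<Longrightarrow> y \<in> m \<Longrightarrow> x \<ominus> y \<in> m"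
  using smodD[OF smod_m] smod_neg[OF smod_m subring] smod_diff[OF smod_m subring]
  by (auto simp: m_comm)

lemma one_notin_m [simp]: "\<one> \<notin> m"
proof
  assume "\<one> \<in> m"
  then have "m = carrier A" using ideal.one_imp_carrier[OF m_ideal] by simp
  then show False using maximalideal.I_notcarr[OF m_max] by simp
qed

lemma unit_R:
  assumes "r \<in> R" "r \<notin> m"
  shows "inv r \<in> R" "r \<noteq> \<zero>"
proof -
  interpret A: cring A by (rule cring_A)
  show r0: "r \<noteq> \<zero>" using assms max_closed(1) by blast
  have "r \<in> Units A"
  proof (rule ccontr)
    assume "r \<notin> Units A"
    then obtain M where "maximalideal M A" "r \<in> M"
      using A.nonunit_in_maximalideal[of r] assms(1) by auto
    then show False using m_unique assms(2) by auto
  qed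
  then obtain s where "s \<in> R" "s \<otimes> r = \<one>" by (auto simp: Units_def)
  then have "inv r = s" using assms(1) r0 comm_inv_char[of r s] by (simp add: m_comm)
  then show "inv r \<in> R" using \<open>s \<in> R\<close> by simp
qed

lemma m_prime:
  assumes "x \<in> R" "y \<in> R" "x \<otimes> y \<in> m"
  shows "x \<in> m \<or> y \<in> m"
proof (rule ccontr)
  assume n: "\<not> ?thesis"
  then have i: "inv x \<in> R" "inv y \<in> R" "x \<noteq> \<zero>" "y \<noteq> \<zero>" using unit_R assms by auto
  have "(inv x \<otimes> inv y) \<otimes> (x \<otimes> y) \<in> m" using i assms by (intro max_closed(3)[OF _ assms(3)]) auto
  moreover have "(inv x \<otimes> inv y) \<otimes> (x \<otimes> y) = (inv x \<otimes> x) \<otimes> (inv y \<otimes> y)"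
    using i assms by (simp add: m_ac)
  ultimately show False using i assms by simp
qed

lemma m_prime_pow: "x \<in> R \<Longrightarrow> x [^] (n::nat) \<in> m \<Longrightarrow> x \<in> m"
proof (induction n)
  case (Suc n)
  then show ?case using m_prime[of "x [^] n" x] by auto
qed simp

text \<open>By \<open>integral_radical\<close> a power of \<open>p \<otimes> v\<close> lies in
  \<open>m\<close>, which is prime. So a nonunit of \<open>R\<close> does not become a unit of
  \<open>R\<close> through a factor from \<open>V\<close>.\<close>

lemma m_V_nonunit: "p \<in> m \<Longrightarrow> v \<in> V \<Longrightarrow> p \<otimes> v \<in> R \<Longrightarrow> p \<otimes> v \<in> m"
  using integral_radical[of v R m p] subring smod_m m_prime_pow[of "p \<otimes> v"] by blast

end

section \<open>Integrality through the spans of powers\<close>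

context frac_field
begin

text \<open>\<open>sp x n\<close> is the \<open>R\<close>-span of \<open>1, x, ..., x^(n-1)\<close>.
  Splitting off the top power matches the evaluation of coefficient lists, whose head is the leading
  coefficient.\<close>

primrec sp :: "'a \<Rightarrow> nat \<Rightarrow> 'a set" where
  "sp x 0 = {\<zero>}"
| "sp x (Suc n) = {y. \<exists>a\<in>R. \<exists>e\<in>sp x n. y = a \<otimes> x [^] n \<oplus> e}"

lemma smod_sp: "x \<in> carrier F \<Longrightarrow> smod R (sp x n)"
proof (induction n)
  case 0
  then show ?case by (intro smodI) auto
next
  case (Suc n)
  note IH = Suc.IH[OF Suc.prems]
  note c = smod_carrier[OF IH]
  show ?case
  proof (rule smodI)
    fix y assume "y \<in> sp x (Suc n)"
    then show "y \<in> carrier F" using c Suc.prems by auto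
  next
    have "\<zero> = \<zero> \<otimes> x [^] n \<oplus> \<zero>" using Suc.prems by simp
    then show "\<zero> \<in> sp x (Suc n)" using smod_zero[OF IH] by fastforce
  next
    fix y y' assume "y \<in> sp x (Suc n)" "y' \<in> sp x (Suc n)"
    then obtain a e a' e' where h: "a \<in> R" "a' \<in> R" "e \<in> sp x n" "e' \<in> sp x n"
      "y = a \<otimes> x [^] n \<oplus> e" "y' = a' \<otimes> x [^] n \<oplus> e'" by auto
    then have "y \<oplus> y' = (a \<oplus> a') \<otimes> x [^] n \<oplus> (e \<oplus> e')"
      using c Suc.prems by (simp add: l_distr a_ac)
    moreover have "e \<oplus> e' \<in> sp x n" using h smod_add[OF IH] by blast
    ultimately show "y \<oplus> y' \<in> sp x (Suc n)" using h by auto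
  next
    fix r y assume "r \<in> R" "y \<in> sp x (Suc n)"
    then obtain a e where h: "r \<in> R" "a \<in> R" "e \<in> sp x n" "y = a \<otimes> x [^] n \<oplus> e" by auto
    then have "r \<otimes> y = (r \<otimes> a) \<otimes> x [^] n \<oplus> r \<otimes> e"
      using c Suc.prems by (simp add: r_distr m_assoc)
    moreover have "r \<otimes> e \<in> sp x n" using h smod_smult[OF IH] by blast
    ultimately show "r \<otimes> y \<in> sp x (Suc n)" using h by auto
  qed
qed

lemma sp_mono: "x \<in> carrier F \<Longrightarrow> n \<le> k \<Longrightarrow> sp x n \<subseteq> sp x k"
proof (induction k)
  case (Suc k)
  have "y = \<zero> \<otimes> x [^] k \<oplus> y" if "y \<in> sp x k" for y
    using Suc.prems smod_carrier[OF smod_sp that] by simp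
  then have "sp x k \<subseteq> sp x (Suc k)" by fastforce
  then show ?case using Suc by (auto simp: le_Suc_eq)
qed simp

lemma sp_eval: "x \<in> carrier F \<Longrightarrow> y \<in> sp x n \<Longrightarrow> \<exists>q. set q \<subseteq> R \<and> length q = n \<and> eval q x = y"
proof (induction n arbitrary: y)
  case 0
  then show ?case by simp
next
  case (Suc n)
  then obtain a e where a: "a \<in> R" "e \<in> sp x n" "y = a \<otimes> x [^] n \<oplus> e" by auto
  then obtain q where "set q \<subseteq> R" "length q = n" "eval q x = e" using Suc by blast
  then show ?case using a by (intro exI[of _ "a # q"]) auto
qed

lemma integralI:
  assumes x: "x \<in> carrier F" "x [^] n \<in> sp x n"
  shows "x \<in> V"
proof -
  have "\<ominus> (x [^] n) \<in> sp x n" using smod_neg[OF smod_sp subring] x by blast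
  then obtain q where q: "set q \<subseteq> R" "length q = n" "eval q x = \<ominus> (x [^] n)"
    using sp_eval x by blast
  have "polynomial R (\<one> # q)" using q by (auto simp: polynomial_def)
  moreover have "eval (\<one> # q) x = \<zero>" using q x by (simp add: r_neg)
  ultimately show ?thesis using x unfolding integral_closure_def
    by (auto intro!: exI[of _ "\<one> # q"])
qed

lemma smod_scale:
  assumes L: "smod R L" and s: "s \<in> carrier F"
  shows "smod R ((\<otimes>) s ` L)"
proof (rule smodI)
  show "\<zero> \<in> (\<otimes>) s ` L" using smod_zero[OF L] s by (force simp: image_iff)
  fix x y assume "x \<in> (\<otimes>) s ` L" "y \<in> (\<otimes>) s ` L"
  then obtain a b where "a \<in> L" "b \<in> L" "x = s \<otimes> a" "y = s \<otimes> b" by auto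
  then show "x \<oplus> y \<in> (\<otimes>) s ` L"
    using s smod_carrier[OF L] smod_add[OF L] by (auto simp: r_distr[symmetric])
next
  fix r x assume "r \<in> R" "x \<in> (\<otimes>) s ` L"
  then obtain a where "a \<in> L" "x = s \<otimes> a" by auto
  then have "r \<otimes> x = s \<otimes> (r \<otimes> a)" using s \<open>r \<in> R\<close> smod_carrier[OF L] by (simp add: m_ac)
  then show "r \<otimes> x \<in> (\<otimes>) s ` L" using \<open>a \<in> L\<close> smod_smult[OF L \<open>r \<in> R\<close>] by auto
qed (use s smod_carrier[OF L] in auto)

text \<open>For \<open>s \<noteq> \<zero>\<close> this is the module \<open>L / s\<close>. With
  \<open>L = R\<close> and \<open>s\<close> in \<open>R\<close> it contains \<open>R\<close>, so
  that a statement about denominators becomes one about modules above \<open>R\<close>.\<close>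

lemma smod_preimage:
  assumes L: "smod R L" and s: "s \<in> carrier F"
  shows "smod R {x \<in> carrier F. s \<otimes> x \<in> L}"
proof (rule smodI)
  fix r x assume "r \<in> R" "x \<in> {x \<in> carrier F. s \<otimes> x \<in> L}"
  then have "r \<otimes> (s \<otimes> x) \<in> L" "x \<in> carrier F" using smod_smult[OF L] by auto
  then show "r \<otimes> x \<in> {x \<in> carrier F. s \<otimes> x \<in> L}"
    using \<open>r \<in> R\<close> s by (simp add: m_lcomm)
qed (use s smod_zero[OF L] smod_add[OF L] in \<open>auto simp: r_distr\<close>)

lemma smod_Int: "smod R L \<Longrightarrow> smod R N \<Longrightarrow> smod R (L \<inter> N)"
  by (auto simp: smod_def)

end

section \<open>Noetherian domains and dimension one\<close>

locale noeth = frac_field +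
  assumes noetherian: "noetherian_ring A"
begin

lemma ideal_family_max:
  assumes "I \<in> C" "\<And>J. J \<in> C \<Longrightarrow> ideal J A"
  shows "\<exists>M\<in>C. \<forall>J\<in>C. M \<subseteq> J \<longrightarrow> J = M"
proof (rule subset_Zorn_nonempty)
  show "C \<noteq> {}" using assms by auto
  fix K assume K: "K \<noteq> {}" "subset.chain C K"
  then have "subset.chain {I. ideal I A} K"
    using assms(2) by (auto simp: subset.chain_def)
  then have "\<Union>K \<in> K"
    using noetherian_ring.ideal_chain_is_trivial[OF noetherian K(1)] by simp
  then show "\<Union>K \<in> C" using K by (auto simp: subset.chain_def)
qed

text \<open>The ascending chain condition takes the place of the determinant trick: with
  \<open>w = s l\<close> all \<open>w e^i\<close> lie in \<open>R\<close>, so the ideals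
  \<open>w (R + R e + ... + R e^(n-1))\<close> become constant, and cancelling \<open>w\<close>
  gives an integral equation for \<open>e\<close>.\<close>

lemma stabilizer_integral:
  assumes L: "smod R L" "l \<in> L" "l \<noteq> \<zero>" and s: "s \<in> R" "s \<noteq> \<zero>" "\<And>x. x \<in> L \<Longrightarrow> s \<otimes> x \<in> R"
    and e: "e \<in> carrier F" "\<And>x. x \<in> L \<Longrightarrow> e \<otimes> x \<in> L"
  shows "e \<in> V"
proof -
  note lF = smod_carrier[OF L(1)]
  have el: "e [^] (i::nat) \<otimes> l \<in> L" for i
  proof (induction i)
    case 0 then show ?case using L lF by simp
  next
    case (Suc i)
    have "e \<otimes> (e [^] i \<otimes> l) \<in> L" using Suc e by blast
    then show ?case using e(1) lF[OF L(2)] by (simp add: m_ac)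
  qed
  define w where "w = s \<otimes> l"
  have w: "w \<in> R" "w \<noteq> \<zero>" using s L lF by (auto simp: w_def integral_iff)
  have we: "w \<otimes> e [^] (i::nat) \<in> R" for i
  proof -
    have "w \<otimes> e [^] i = s \<otimes> (e [^] i \<otimes> l)"
      using s(1) e(1) lF[OF L(2)] by (simp add: w_def m_ac)
    then show ?thesis using s(3) el by simp
  qed
  have sub: "w \<otimes> y \<in> R" if "y \<in> sp e n" for y n
    using that
  proof (induction n arbitrary: y)
    case (Suc n)
    then obtain a y' where y: "a \<in> R" "y' \<in> sp e n" "y = a \<otimes> e [^] n \<oplus> y'" by auto
    then have "w \<otimes> y = a \<otimes> (w \<otimes> e [^] n) \<oplus> w \<otimes> y'"
      using w e(1) smod_carrier[OF smod_sp[OF e(1)]] by (simp add: r_distr m_lcomm)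
    then show ?case using y we Suc.IH by simp
  qed (use w in simp)
  define I where "I n = (\<otimes>) w ` sp e n" for n
  have I: "ideal (I n) A" for n
    unfolding ideal_A_iff I_def using sub smod_scale[OF smod_sp[OF e(1)]] w(1) by auto
  have "subset.chain {I. ideal I A} (range I)"
    unfolding subset.chain_def
  proof (intro conjI ballI)
    fix B C assume "B \<in> range I" "C \<in> range I"
    then obtain n k where "B = I n" "C = I k" by auto
    then show "(\<subset>)\<^sup>=\<^sup>= B C \<or> (\<subset>)\<^sup>=\<^sup>= C B"
      using sp_mono[OF e(1), of n k] sp_mono[OF e(1), of k n] unfolding I_def
      by (cases "n \<le> k") (auto simp: image_mono psubset_eq)
  qed (use I in auto)
  then have "\<Union>(range I) \<in> range I"
    using noetherian_ring.ideal_chain_is_trivial[OF noetherian] by blast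
  then obtain N where N: "\<And>n. I n \<subseteq> I N" by blast
  have "\<one> \<otimes> e [^] N \<oplus> \<zero> \<in> sp e (Suc N)"
    using smod_zero[OF smod_sp[OF e(1)]] by auto
  then have "e [^] N \<in> sp e (Suc N)" using e(1) by simp
  then have "w \<otimes> e [^] N \<in> I (Suc N)" unfolding I_def by (rule imageI)
  then have "w \<otimes> e [^] N \<in> I N" using N by blast
  then obtain y where "y \<in> sp e N" "w \<otimes> e [^] N = w \<otimes> y" by (auto simp: I_def)
  moreover then have "e [^] N = y"
    using w e(1) smod_carrier[OF smod_sp[OF e(1)]] by (metis R_carrier m_lcancel nat_pow_closed)
  ultimately show ?thesis using integralI[OF e(1), of N] by simp
qed

text \<open>\<open>s L\<close> is an ideal, and its finitely many generators divided by
  \<open>s\<close> generate \<open>L\<close>.\<close>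

lemma fractional_finite:
  assumes L: "smod R L" and s: "s \<in> R" "s \<noteq> \<zero>" "\<And>x. x \<in> L \<Longrightarrow> s \<otimes> x \<in> R"
  shows "\<exists>S\<subseteq>L. finite S \<and> (\<forall>N. smod R N \<and> S \<subseteq> N \<longrightarrow> L \<subseteq> N)"
proof -
  have "ideal ((\<otimes>) s ` L) A" unfolding ideal_A_iff using s smod_scale[OF L] by auto
  then obtain T where T: "T \<subseteq> R" "finite T" "(\<otimes>) s ` L = Idl\<^bsub>A\<^esub> T"
    using noetherian_ring.finetely_gen[OF noetherian, of "(\<otimes>) s ` L"] by auto
  interpret A: cring A by (rule cring_A)
  have "T \<subseteq> (\<otimes>) s ` L" using T A.genideal_self[of T] by auto
  then obtain S where S: "S \<subseteq> L" "finite S" "T = (\<otimes>) s ` S"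
    using finite_subset_image[OF T(2)] by blast
  have "L \<subseteq> N" if N: "smod R N" "S \<subseteq> N" for N
  proof
    fix x assume x: "x \<in> L"
    define J where "J = R \<inter> {y \<in> carrier F. inv s \<otimes> y \<in> N}"
    have iF: "inv s \<in> carrier F" using s by simp
    have "ideal J A" unfolding ideal_A_iff J_def
      using smod_Int[OF smod_R smod_preimage[OF N(1) iF]] by auto
    moreover have c: "inv s \<otimes> (s \<otimes> y) = y" if "y \<in> L" for y
      using s that smod_carrier[OF L] by (simp add: m_assoc[symmetric])
    have "T \<subseteq> J"
    proof
      fix t assume "t \<in> T"
      then obtain y where "y \<in> S" "t = s \<otimes> y" "t \<in> R" using S T by auto
      moreover then have "inv s \<otimes> t \<in> N" using c[of y] S(1) N(2) by (simp add: subsetD)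
      ultimately show "t \<in> J" by (auto simp: J_def)
    qed
    ultimately have "(\<otimes>) s ` L \<subseteq> J" using A.genideal_minimal T(3) by auto
    then show "x \<in> N" using x c by (auto simp: J_def)
  qed
  then show ?thesis using S by blast
qed

end

locale noeth1 = noeth + quasi +
  assumes dim1: "primeideal P A \<Longrightarrow> P \<noteq> {\<zero>} \<Longrightarrow> P = m"
begin

text \<open>The class of \<open>v\<close> modulo \<open>L\<close> is nonzero and killed by
  \<open>s \<noteq> \<zero>\<close>. A maximal annihilator among its nonzero multiples
  \<open>b v\<close> is a prime ideal containing \<open>s\<close>, so it is
  \<open>m\<close>.\<close>

lemma associated_m:
  assumes L: "smod R L" and v: "v \<in> carrier F" "v \<notin> L" and s: "s \<in> R" "s \<noteq> \<zero>" "s \<otimes> v \<in> L"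
  shows "\<exists>b\<in>R. b \<otimes> v \<notin> L \<and> (\<forall>p\<in>m. p \<otimes> (b \<otimes> v) \<in> L)"
proof -
  define ann where "ann b = {a \<in> R. a \<otimes> (b \<otimes> v) \<in> L}" for b
  have ann: "ideal (ann b) A" if b: "b \<in> R" for b
  proof -
    have "ann b = R \<inter> {a \<in> carrier F. (b \<otimes> v) \<otimes> a \<in> L}"
    proof (rule Set.set_eqI)
      fix a
      have "a \<otimes> (b \<otimes> v) = (b \<otimes> v) \<otimes> a" if "a \<in> R" using that b v by (simp add: m_comm)
      then show "a \<in> ann b \<longleftrightarrow> a \<in> R \<inter> {a \<in> carrier F. (b \<otimes> v) \<otimes> a \<in> L}"
        by (auto simp: ann_def)
    qed
    then show ?thesis unfolding ideal_A_iff
      using smod_Int[OF smod_R smod_preimage[OF L, of "b \<otimes> v"]] b v(1) by simp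
  qed
  let ?C = "{ann b | b. b \<in> R \<and> b \<otimes> v \<notin> L}"
  have "ann \<one> \<in> ?C" using v by (auto intro!: exI[of _ \<one>])
  moreover have "ideal J A" if "J \<in> ?C" for J using that ann by auto
  ultimately have "\<exists>M\<in>?C. \<forall>J\<in>?C. M \<subseteq> J \<longrightarrow> J = M"
    by (rule ideal_family_max)
  then obtain M where M: "M \<in> ?C" "\<forall>J\<in>?C. M \<subseteq> J \<longrightarrow> J = M" ..
  from M(1) obtain b where b: "b \<in> R" "b \<otimes> v \<notin> L" "M = ann b" by auto
  have bF: "b \<in> carrier F" "v \<in> carrier F" using b v by auto
  have "primeideal M A"
  proof (rule primeidealI)
    show "ideal M A" using ann b by auto
    show "cring A" by (rule cring_A)
    have "\<one> \<notin> M" using b v by (simp add: ann_def)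
    then show "carrier A \<noteq> M" by auto
    fix x y assume xy: "x \<in> carrier A" "y \<in> carrier A" "x \<otimes>\<^bsub>A\<^esub> y \<in> M"
    show "x \<in> M \<or> y \<in> M"
    proof (cases "y \<in> M")
      case False
      have xyF: "x \<in> carrier F" "y \<in> carrier F" "x \<in> R" "y \<in> R" using xy by auto
      have e: "(b \<otimes> y) \<otimes> v = y \<otimes> (b \<otimes> v)" using bF xyF by (simp add: m_ac)
      have y: "(b \<otimes> y) \<otimes> v \<notin> L" using False xy b(3) by (simp add: ann_def e)
      have "M \<subseteq> ann (b \<otimes> y)"
      proof
        fix a assume a: "a \<in> M"
        then have a': "a \<in> R" "a \<in> carrier F" "a \<otimes> (b \<otimes> v) \<in> L" using b by (auto simp: ann_def)
        then have "y \<otimes> (a \<otimes> (b \<otimes> v)) \<in> L" using xy smod_smult[OF L] by simp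
        moreover have "y \<otimes> (a \<otimes> (b \<otimes> v)) = a \<otimes> ((b \<otimes> y) \<otimes> v)"
          using a'(2) bF xyF by (simp add: m_ac)
        ultimately show "a \<in> ann (b \<otimes> y)" using a' by (simp add: ann_def)
      qed
      moreover have "ann (b \<otimes> y) \<in> ?C" using y b xyF by blast
      ultimately have "ann (b \<otimes> y) = M" using M(2) by blast
      moreover have "x \<otimes> ((b \<otimes> y) \<otimes> v) = (x \<otimes> y) \<otimes> (b \<otimes> v)" using bF xyF by (simp add: m_ac)
      then have "x \<in> ann (b \<otimes> y)" using xy(3) xyF b(3) by (simp add: ann_def)
      ultimately show ?thesis by simp
    qed simp
  qed
  moreover have "s \<in> M"
  proof -
    have "b \<otimes> (s \<otimes> v) \<in> L" using s b smod_smult[OF L] by simp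
    moreover have "b \<otimes> (s \<otimes> v) = s \<otimes> (b \<otimes> v)" using bF s by (simp add: m_lcomm)
    ultimately show ?thesis using b s by (simp add: ann_def)
  qed
  ultimately have "M = m" using dim1 s by auto
  then show ?thesis using b by (auto simp: ann_def)
qed

text \<open>\<open>L\<close> is the saturation of \<open>r R\<close> with respect to
  \<open>z\<close>. If it were proper, some \<open>b\<close> outside it would satisfy
  \<open>m b \<subseteq> L\<close>; then \<open>z b\<close>, and hence \<open>b\<close> itself,
  would belong to the saturation.\<close>

lemma power_in_principal:
  assumes z: "z \<in> m" and r: "r \<in> R" "r \<noteq> \<zero>"
  shows "\<exists>k. \<exists>a\<in>R. z [^] (k::nat) = r \<otimes> a"
proof (rule ccontr)
  assume n: "\<not> ?thesis"
  define L where "L = {x \<in> R. \<exists>k. \<exists>a\<in>R. z [^] (k::nat) \<otimes> x = r \<otimes> a}"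
  have zR: "z \<in> R" using z by simp
  have L: "smod R L"
  proof (rule smodI)
    have "z [^] (0::nat) \<otimes> \<zero> = r \<otimes> \<zero>" using r by simp
    then show "\<zero> \<in> L" unfolding L_def by blast
  next
    fix x y assume "x \<in> L" "y \<in> L"
    then obtain k l :: nat and a b where h: "x \<in> R" "y \<in> R" "a \<in> R" "b \<in> R"
      "z [^] k \<otimes> x = r \<otimes> a" "z [^] l \<otimes> y = r \<otimes> b" by (auto simp: L_def)
    have "z [^] (k + l) \<otimes> (x \<oplus> y) = z [^] l \<otimes> (z [^] k \<otimes> x) \<oplus> z [^] k \<otimes> (z [^] l \<otimes> y)"
      using h(1-4) zR by (simp add: nat_pow_mult[symmetric] r_distr m_ac)
    also have "\<dots> = r \<otimes> (z [^] l \<otimes> a \<oplus> z [^] k \<otimes> b)"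
      using h zR r by (simp add: r_distr m_ac)
    finally have "z [^] (k + l) \<otimes> (x \<oplus> y) = r \<otimes> (z [^] l \<otimes> a \<oplus> z [^] k \<otimes> b)" .
    moreover have "x \<oplus> y \<in> R" "z [^] l \<otimes> a \<oplus> z [^] k \<otimes> b \<in> R" using h(1-4) zR by auto
    ultimately show "x \<oplus> y \<in> L" unfolding L_def by blast
  next
    fix c x assume "c \<in> R" "x \<in> L"
    then obtain k :: nat and a where h: "c \<in> R" "x \<in> R" "a \<in> R" "z [^] k \<otimes> x = r \<otimes> a"
      by (auto simp: L_def)
    have "z [^] k \<otimes> (c \<otimes> x) = c \<otimes> (z [^] k \<otimes> x)" using h(1-3) zR by (simp add: m_ac)
    also have "\<dots> = r \<otimes> (c \<otimes> a)" using h r by (simp add: m_ac)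
    finally have "z [^] k \<otimes> (c \<otimes> x) = r \<otimes> (c \<otimes> a)" .
    moreover have "c \<otimes> x \<in> R" "c \<otimes> a \<in> R" using h(1-3) by auto
    ultimately show "c \<otimes> x \<in> L" unfolding L_def by blast
  qed (auto simp: L_def)
  have "\<one> \<notin> L" using n zR by (auto simp: L_def)
  moreover have "z [^] (0::nat) \<otimes> (r \<otimes> \<one>) = r \<otimes> \<one>" using r by simp
  then have "r \<otimes> \<one> \<in> L" unfolding L_def using r by blast
  ultimately obtain b where b: "b \<in> R" "b \<otimes> \<one> \<notin> L" "\<forall>p\<in>m. p \<otimes> (b \<otimes> \<one>) \<in> L"
    using associated_m[OF L, of \<one> r] r by blast
  then have "z \<otimes> b \<in> L" using z by simp
  then obtain k :: nat and a where "a \<in> R" "z [^] k \<otimes> (z \<otimes> b) = r \<otimes> a" by (auto simp: L_def)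
  then have "z [^] Suc k \<otimes> b = r \<otimes> a" using zR b by (simp add: m_ac)
  then have "b \<in> L" using b(1) \<open>a \<in> R\<close> unfolding L_def by blast
  then show False using b by simp
qed

end

section \<open>Discrete valuation rings with the residue field of the base\<close>

text \<open>The axioms say that \<open>V\<close> is a DVR with uniformizer \<open>z\<close> and the same residue field as \<open>R\<close>.\<close>

locale val_quasi = quasi +
  fixes z
  assumes V_ring: "subring V F"
    and z_m [simp, intro]: "z \<in> m"
    and z_nz [simp]: "z \<noteq> \<zero>"
    and V_unit: "x \<in> V \<Longrightarrow> (\<And>v. v \<in> V \<Longrightarrow> x \<noteq> z \<otimes> v) \<Longrightarrow> inv x \<in> V"
    and V_sep: "x \<in> V \<Longrightarrow> x \<noteq> \<zero> \<Longrightarrow> \<exists>k::nat. \<forall>v\<in>V. x \<noteq> z [^] k \<otimes> v"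
    and V_res: "x \<in> V \<Longrightarrow> \<exists>r\<in>R. \<exists>v\<in>V. x = r \<oplus> z \<otimes> v"
begin

lemma V_closed [simp, intro]:
  "x \<in> V \<Longrightarrow> y \<in> V \<Longrightarrow> x \<oplus> y \<in> V" "x \<in> V \<Longrightarrow> y \<in> V \<Longrightarrow> x \<otimes> y \<in> V"
  "x \<in> V \<Longrightarrow> \<ominus> x \<in> V" "x \<in> V \<Longrightarrow> y \<in> V \<Longrightarrow> x \<ominus> y \<in> V"
  unfolding a_minus_def using subringE[OF V_ring] by auto

lemma z_R [simp, intro]: "z \<in> R" by blast

lemma z_F [simp, intro]: "z \<in> carrier F" by blast

lemma zk_nz [simp]: "z [^] (k::nat) \<noteq> \<zero>"
  by (induction k) (auto simp: integral_iff)

lemma z_noninv: "v \<in> V \<Longrightarrow> z \<otimes> v \<noteq> \<one>"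
  using m_V_nonunit[OF z_m, of v] by auto

lemma z_cancel: "x \<in> carrier F \<Longrightarrow> y \<in> carrier F \<Longrightarrow> z [^] (k::nat) \<otimes> x = z [^] k \<otimes> y \<longleftrightarrow> x = y"
  using m_lcancel[of "z [^] k" x y] by auto

lemma factor_z:
  assumes "x \<in> V" "x \<noteq> \<zero>"
  obtains k :: nat and u where "u \<in> V" "u \<noteq> \<zero>" "inv u \<in> V" "x = z [^] k \<otimes> u"
proof -
  define k where "k = (LEAST k::nat. \<forall>v\<in>V. x \<noteq> z [^] k \<otimes> v)"
  have k: "\<forall>v\<in>V. x \<noteq> z [^] k \<otimes> v" unfolding k_def using LeastI_ex[OF V_sep[OF assms]] .
  have "k \<noteq> 0"
  proof
    assume "k = 0"
    then have "x \<noteq> z [^] (0::nat) \<otimes> x" using k assms by blast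
    then show False using assms by simp
  qed
  then obtain j where j: "k = Suc j" by (cases k) auto
  then have "\<not> (\<forall>v\<in>V. x \<noteq> z [^] j \<otimes> v)" using not_less_Least[of j "\<lambda>k. \<forall>v\<in>V. x \<noteq> z [^] k \<otimes> v"] k_def by simp
  then obtain u where u: "u \<in> V" "x = z [^] j \<otimes> u" by auto
  have "u \<noteq> z \<otimes> v" if "v \<in> V" for v
  proof
    assume "u = z \<otimes> v"
    then have "x = z [^] k \<otimes> v" using u j that by (simp add: m_assoc)
    then show False using k that by blast
  qed
  then have "inv u \<in> V" using V_unit u by blast
  moreover have "u \<noteq> \<zero>" using u assms by auto
  ultimately show ?thesis using that u by blast
qed

text \<open>Write a denominator as \<open>s = z^k u\<close> with \<open>u\<close> a unit of
  \<open>V\<close>. Then \<open>z^k = s u^(-1)\<close> is an element of \<open>R\<close> and a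
  \<open>V\<close>-multiple of \<open>s\<close>, so a power of it lies in \<open>s R\<close>; this
  power clears the denominator as well.\<close>

lemma z_pow_denom:
  assumes "x \<in> carrier F"
  obtains k :: nat where "z [^] k \<otimes> x \<in> R"
proof -
  obtain s where s: "s \<in> R" "s \<noteq> \<zero>" "s \<otimes> x \<in> R" using denom[OF assms] by blast
  obtain k :: nat and u where u: "u \<in> V" "u \<noteq> \<zero>" "inv u \<in> V" "s = z [^] k \<otimes> u"
    using factor_z[of s] s by blast
  have e: "s \<otimes> inv u = z [^] k" using u by (simp add: m_assoc)
  let ?C = "(\<otimes>) s ` R"
  have C: "smod R ?C" using smod_scale[OF smod_R, of s] s by simp
  have "s = s \<otimes> \<one>" using s by simp
  then have "s \<in> ?C" by blast
  then have "\<exists>n::nat. (s \<otimes> inv u) [^] n \<in> ?C"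
    using integral_radical[OF u(3) subring subset_refl C, of s] s e by auto
  then obtain n :: nat and a where a: "a \<in> R" "z [^] (k * n) = s \<otimes> a"
    by (auto simp: e nat_pow_pow)
  have "z [^] (k * n) \<otimes> x = a \<otimes> (s \<otimes> x)" using a s assms by (simp add: m_ac)
  then show ?thesis using that[of "k * n"] a s by simp
qed

lemma z_pow_mono: "z [^] (k::nat) \<otimes> x \<in> R \<Longrightarrow> x \<in> carrier F \<Longrightarrow> k \<le> l \<Longrightarrow> z [^] l \<otimes> x \<in> R"
proof (induction l)
  case (Suc l)
  show ?case
  proof (cases "k \<le> l")
    case True
    then have "z \<otimes> (z [^] l \<otimes> x) \<in> R" using Suc by blast
    then show ?thesis using Suc.prems by (simp add: m_ac)
  next
    case False
    then have "k = Suc l" using Suc.prems by simp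
    then show ?thesis using Suc.prems by simp
  qed
qed simp

lemma V_res_pow:
  assumes "x \<in> V"
  shows "\<exists>r\<in>R. \<exists>v\<in>V. x = r \<oplus> z [^] (k::nat) \<otimes> v"
proof (induction k)
  case 0
  have "x = \<zero> \<oplus> z [^] (0::nat) \<otimes> x" using assms by simp
  then show ?case using assms by blast
next
  case (Suc k)
  then obtain r v where h: "r \<in> R" "v \<in> V" "x = r \<oplus> z [^] k \<otimes> v" by blast
  obtain r' v' where h': "r' \<in> R" "v' \<in> V" "v = r' \<oplus> z \<otimes> v'" using V_res h by blast
  have "x = (r \<oplus> z [^] k \<otimes> r') \<oplus> z [^] Suc k \<otimes> v'"
    using h h' by (simp add: r_distr m_assoc a_assoc)
  then show ?case using h h' by blast
qed

text \<open>Both inclusions rest on \<open>m_V_nonunit\<close>: an element of \<open>m\<close> not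
  divisible by \<open>z\<close> would have its inverse in \<open>V\<close>.\<close>

lemma m_iff: "r \<in> m \<longleftrightarrow> r \<in> R \<and> (\<exists>v\<in>V. r = z \<otimes> v)"
proof
  assume r: "r \<in> m"
  have "\<exists>v\<in>V. r = z \<otimes> v"
  proof (rule ccontr)
    assume n: "\<not> ?thesis"
    then have i: "inv r \<in> V" using V_unit r by blast
    have "z \<otimes> \<zero> = \<zero>" by simp
    then have r0: "r \<noteq> \<zero>" using n by (metis R_V R_closed(1))
    then show False using m_V_nonunit[OF r i] r by simp
  qed
  then show "r \<in> R \<and> (\<exists>v\<in>V. r = z \<otimes> v)" using r by simp
qed (use m_V_nonunit in auto)

text \<open>This is what makes \<open>V\<close> a valuation ring of \<open>F\<close>: after clearing
  denominators by a common \<open>z^N\<close>, both elements are powers of \<open>z\<close> times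
  units of \<open>V\<close>, and the exponents decide.\<close>

lemma V_total:
  assumes x: "x \<in> carrier F" and y: "y \<in> carrier F"
  shows "(\<exists>v\<in>V. x = y \<otimes> v) \<or> (\<exists>v\<in>V. y = x \<otimes> v)"
proof (cases "x = \<zero> \<or> y = \<zero>")
  case True
  then have "x = y \<otimes> \<zero> \<or> y = x \<otimes> \<zero>" using x y by auto
  then show ?thesis by (metis R_V R_closed(1))
next
  case False
  obtain k :: nat where "z [^] k \<otimes> x \<in> R" using z_pow_denom[of x] x by blast
  moreover obtain l :: nat where "z [^] l \<otimes> y \<in> R" using z_pow_denom[of y] y by blast
  ultimately have n: "z [^] (k + l) \<otimes> x \<in> R" "z [^] (k + l) \<otimes> y \<in> R" using z_pow_mono x y by auto
  define N where "N = k + l"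
  obtain i :: nat and u where u: "u \<in> V" "u \<noteq> \<zero>" "inv u \<in> V" "z [^] N \<otimes> x = z [^] i \<otimes> u"
    using factor_z[OF R_V[OF n(1)]] False x unfolding N_def
    by (metis integral_iff nat_pow_closed z_F zk_nz)
  obtain j :: nat and w where w: "w \<in> V" "w \<noteq> \<zero>" "inv w \<in> V" "z [^] N \<otimes> y = z [^] j \<otimes> w"
    using factor_z[OF R_V[OF n(2)]] False y unfolding N_def
    by (metis integral_iff nat_pow_closed z_F zk_nz)
  have main: "\<exists>v\<in>V. x = y \<otimes> v"
    if x: "x \<in> carrier F" and y: "y \<in> carrier F" and ij: "j \<le> i"
      and u: "u \<in> V" "u \<noteq> \<zero>" "inv u \<in> V" "z [^] N \<otimes> x = z [^] i \<otimes> u"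
      and w: "w \<in> V" "w \<noteq> \<zero>" "inv w \<in> V" "z [^] N \<otimes> y = z [^] j \<otimes> w"
    for x y u w and i j :: nat
  proof -
    define w' where "w' = inv w"
    have w': "w' \<in> V" "w \<otimes> w' = \<one>" using w by (auto simp: w'_def)
    define v where "v = z [^] (i - j) \<otimes> (u \<otimes> w')"
    have vV: "v \<in> V" using u w' by (auto simp: v_def)
    have "z [^] N \<otimes> (y \<otimes> v) = (z [^] j \<otimes> w) \<otimes> v" using y vV by (simp add: m_assoc[symmetric] w(4))
    also have "\<dots> = (z [^] j \<otimes> z [^] (i - j)) \<otimes> u \<otimes> (w \<otimes> w')"
      unfolding v_def using u(1-3) w(1) w'(1) by (simp add: m_ac)
    also have "\<dots> = z [^] N \<otimes> x" using u w' ij by (simp add: nat_pow_mult)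
    finally have "x = y \<otimes> v" using x y vV z_cancel[of x "y \<otimes> v" N] by simp
    then show ?thesis using vV by blast
  qed
  show ?thesis
    using main[OF x y _ u w] main[OF y x _ w u] by (cases "j \<le> i") auto
qed

text \<open>The hypothesis only concerns elements of \<open>V\<close> with a common denominator
  \<open>s\<close>, and claims that \<open>s\<close> also clears their product. Arbitrary
  \<open>x\<close> and \<open>y\<close> are brought into this form by \<open>V = R + t V\<close> for
  a common denominator \<open>t\<close> of both.\<close>

lemma Q_from_torsion:
  assumes h: "\<And>s v y. s \<in> R \<Longrightarrow> v \<in> V \<Longrightarrow> y \<in> V \<Longrightarrow> s \<otimes> y \<in> R \<Longrightarrow> s \<otimes> v \<in> R \<Longrightarrow> s \<otimes> (v \<otimes> y) \<in> R"
    and x: "x \<in> V" and y: "y \<in> V" and J: "smod R J" "\<one> \<in> J" "x \<in> J" "y \<in> J"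
  shows "x \<otimes> y \<in> J"
proof -
  obtain k :: nat where "z [^] k \<otimes> x \<in> R" using z_pow_denom[of x] x by blast
  moreover obtain l :: nat where "z [^] l \<otimes> y \<in> R" using z_pow_denom[of y] y by blast
  ultimately have n: "z [^] (k + l) \<otimes> x \<in> R" "z [^] (k + l) \<otimes> y \<in> R" using z_pow_mono x y by auto
  define t where "t = z [^] (k + l)"
  have t: "t \<in> R" "t \<in> carrier F" "t \<otimes> x \<in> R" "t \<otimes> y \<in> R" using n by (auto simp: t_def)
  obtain c u where u: "c \<in> R" "u \<in> V" "y = c \<oplus> t \<otimes> u" using V_res_pow[OF y] t_def by blast
  obtain e w where w: "e \<in> R" "w \<in> V" "x = e \<oplus> t \<otimes> w" using V_res_pow[OF x] t_def by blast
  note car = R_carrier[OF u(1)] V_carrier[OF u(2)] R_carrier[OF w(1)] V_carrier[OF w(2)] t(2)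
  have "t \<otimes> y = t \<otimes> c \<oplus> (t \<otimes> t) \<otimes> u" unfolding u(3) using car by (simp add: r_distr m_assoc)
  then have "t \<otimes> c \<oplus> (t \<otimes> t) \<otimes> u \<in> R" using t(4) by simp
  then have 1: "(t \<otimes> t) \<otimes> u \<in> R"
    by (rule smod_cancel[OF smod_R subring, rotated -1]) (use t(1) u(1,2) in auto)
  have "t \<otimes> x = t \<otimes> e \<oplus> (t \<otimes> t) \<otimes> w" unfolding w(3) using car by (simp add: r_distr m_assoc)
  then have "t \<otimes> e \<oplus> (t \<otimes> t) \<otimes> w \<in> R" using t(3) by simp
  then have 2: "(t \<otimes> t) \<otimes> w \<in> R"
    by (rule smod_cancel[OF smod_R subring, rotated -1]) (use t(1) w(1,2) in auto)
  have 3: "(t \<otimes> t) \<otimes> (w \<otimes> u) \<in> R" using h[of "t \<otimes> t" w u] 1 2 t(1) u(2) w(2) by simp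
  have RJ: "r \<in> J" if "r \<in> R" for r using smod_smult[OF J(1) that J(2)] that by simp
  \<comment> \<open>The product \<open>x y\<close> agrees with \<open>t^2 w u\<close> up to
    \<open>R\<close>-multiples of \<open>x\<close>, \<open>y\<close> and
    \<open>\<one>\<close>.\<close>
  have "e \<otimes> c \<oplus> x \<otimes> y = (t \<otimes> t) \<otimes> (w \<otimes> u) \<oplus> c \<otimes> x \<oplus> e \<otimes> y"
    unfolding u(3) w(3) using car by (simp add: l_distr r_distr m_ac a_ac)
  moreover have "\<dots> \<in> J"
    using 3 RJ u(1) w(1) J smod_smult[OF J(1)] by (intro smod_add[OF J(1)]) auto
  ultimately have "e \<otimes> c \<oplus> x \<otimes> y \<in> J" by simp
  then show ?thesis
    by (rule smod_cancel[OF J(1) subring, rotated -1]) (use RJ u(1) w(1) x y in auto)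
qed

end

text \<open>The common core of the three conditions: every \<open>R\<close>-module between \<open>R\<close> and \<open>V\<close> is a ring.\<close>

locale hub = val_quasi +
  assumes Q: "x \<in> V \<Longrightarrow> y \<in> V \<Longrightarrow> smod R J \<Longrightarrow> \<one> \<in> J \<Longrightarrow> x \<in> J \<Longrightarrow> y \<in> J \<Longrightarrow> x \<otimes> y \<in> J"
begin

text \<open>The module \<open>{w. s w \<in> R}\<close> contains \<open>R\<close>, so
  \<open>Q\<close> applies to it.\<close>

lemma torsion_annihilator:
  assumes "s \<in> R" "v \<in> V" "y \<in> V" "s \<otimes> y \<in> R" "s \<otimes> v \<in> R"
  shows "s \<otimes> (v \<otimes> y) \<in> R"
  using Q[of v y "{w \<in> carrier F. s \<otimes> w \<in> R}"] smod_preimage[OF smod_R, of s] assms by simp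

end

section \<open>Consequences of stability\<close>

context quasi
begin

lemma smod_unit:
  assumes C: "smod R C" and a: "a \<in> R" "a \<notin> m" and w: "w \<in> carrier F" "a \<otimes> w \<in> C"
  shows "w \<in> C"
proof -
  have "inv a \<otimes> (a \<otimes> w) \<in> C" using smod_smult[OF C unit_R(1)[OF a]] w by simp
  moreover have "inv a \<otimes> (a \<otimes> w) = w" using a unit_R[OF a] w by (simp add: m_assoc[symmetric])
  ultimately show ?thesis by simp
qed

end

section \<open>Modules generated by 1 and two more elements\<close>

context frac_field
begin

text \<open>The module \<open>R + R x + R y\<close>; \<open>gen2 x x\<close> serves as
  \<open>R + R x\<close>.\<close>

definition gen2 :: "'a \<Rightarrow> 'a \<Rightarrow> 'a set" where
  "gen2 x y = {w. \<exists>a\<in>R. \<exists>b\<in>R. \<exists>c\<in>R. w = a \<oplus> b \<otimes> x \<oplus> c \<otimes> y}"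

lemma smod_gen2:
  assumes xy: "x \<in> carrier F" "y \<in> carrier F"
  shows "smod R (gen2 x y)"
proof (rule smodI)
  have "\<zero> = \<zero> \<oplus> \<zero> \<otimes> x \<oplus> \<zero> \<otimes> y" using xy by simp
  then show "\<zero> \<in> gen2 x y" unfolding gen2_def by blast
next
  fix u v assume "u \<in> gen2 x y" "v \<in> gen2 x y"
  then obtain a b c a' b' c' where h: "a \<in> R" "b \<in> R" "c \<in> R" "u = a \<oplus> b \<otimes> x \<oplus> c \<otimes> y"
    "a' \<in> R" "b' \<in> R" "c' \<in> R" "v = a' \<oplus> b' \<otimes> x \<oplus> c' \<otimes> y" unfolding gen2_def by blast
  then have "u \<oplus> v = (a \<oplus> a') \<oplus> (b \<oplus> b') \<otimes> x \<oplus> (c \<oplus> c') \<otimes> y"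
    using xy by (simp add: l_distr a_ac)
  then show "u \<oplus> v \<in> gen2 x y" using h R_closed(3) unfolding gen2_def by blast
next
  fix r u assume r: "r \<in> R" and "u \<in> gen2 x y"
  then obtain a b c where h: "a \<in> R" "b \<in> R" "c \<in> R" "u = a \<oplus> b \<otimes> x \<oplus> c \<otimes> y"
    unfolding gen2_def by blast
  then have "r \<otimes> u = r \<otimes> a \<oplus> (r \<otimes> b) \<otimes> x \<oplus> (r \<otimes> c) \<otimes> y"
    using xy r by (simp add: r_distr m_assoc)
  then show "r \<otimes> u \<in> gen2 x y" using h r R_closed(4) unfolding gen2_def by blast
qed (use xy in \<open>auto simp: gen2_def\<close>)

lemma gen2_gens:
  assumes xy: "x \<in> carrier F" "y \<in> carrier F"
  shows "r \<in> R \<Longrightarrow> r \<in> gen2 x y" "x \<in> gen2 x y" "y \<in> gen2 x y"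
proof -
  have "r = r \<oplus> \<zero> \<otimes> x \<oplus> \<zero> \<otimes> y" if "r \<in> R" using xy that by simp
  then show "r \<in> R \<Longrightarrow> r \<in> gen2 x y" unfolding gen2_def by blast
  have "x = \<zero> \<oplus> \<one> \<otimes> x \<oplus> \<zero> \<otimes> y" using xy by simp
  then show "x \<in> gen2 x y" unfolding gen2_def by blast
  have "y = \<zero> \<oplus> \<zero> \<otimes> x \<oplus> \<one> \<otimes> y" using xy by simp
  then show "y \<in> gen2 x y" unfolding gen2_def by blast
qed

lemma gen2_minimal:
  assumes J: "smod R J" "\<one> \<in> J" "x \<in> J" "y \<in> J"
  shows "gen2 x y \<subseteq> J"
proof
  fix w assume "w \<in> gen2 x y"
  then obtain a b c where h: "a \<in> R" "b \<in> R" "c \<in> R" "w = a \<oplus> b \<otimes> x \<oplus> c \<otimes> y"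
    unfolding gen2_def by blast
  have "a \<otimes> \<one> \<in> J" using J h smod_smult by blast
  then have "a \<in> J" using h by simp
  then show "w \<in> J" using J h smod_smult smod_add by metis
qed

text \<open>The binomial argument without binomial coefficients: an induction on \<open>l\<close>
  for \<open>(p + q)^l p^i q^j\<close> splits off one factor \<open>p + q\<close> at a time, until
  one of the exponents \<open>i\<close> and \<open>j\<close> is large enough.\<close>

lemma radical_add:
  assumes E: "subring E F" and C: "smod E C" "C \<subseteq> E" and pq: "p \<in> E" "q \<in> E"
    and n: "p [^] (n::nat) \<in> C" "q [^] (k::nat) \<in> C"
  shows "(p \<oplus> q) [^] (n + k) \<in> C"
proof -
  have EF: "e \<in> carrier F" if "e \<in> E" for e using subringE(1)[OF E] that by auto
  have Ep: "e [^] (i::nat) \<in> E" if "e \<in> E" for e i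
    using that E by (induction i) (simp_all add: subringE)
  have pF: "p \<in> carrier F" "q \<in> carrier F" using pq EF by auto
  have s: "p \<oplus> q \<in> E" using pq E by (simp add: subringE)
  have pC: "p [^] i \<in> C" if "n \<le> i" for i
  proof -
    have "p [^] (i - n) \<otimes> p [^] n \<in> C" using smod_smult[OF C(1)] Ep pq n by blast
    then show ?thesis using that pF by (simp add: nat_pow_mult)
  qed
  have qC: "q [^] i \<in> C" if "k \<le> i" for i
  proof -
    have "q [^] (i - k) \<otimes> q [^] k \<in> C" using smod_smult[OF C(1)] Ep pq n by blast
    then show ?thesis using that pF by (simp add: nat_pow_mult)
  qed
  have "(p \<oplus> q) [^] l \<otimes> (p [^] i \<otimes> q [^] j) \<in> C" if "n + k \<le> l + i + j" for l i j
    using that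
  proof (induction l arbitrary: i j)
    case 0
    then consider "n \<le> i" | "k \<le> j" by linarith
    then have "p [^] i \<otimes> q [^] j \<in> C"
    proof cases
      case 1
      have "q [^] j \<otimes> p [^] i \<in> C" using smod_smult[OF C(1)] Ep pq pC[OF 1] by blast
      then show ?thesis using pF by (simp add: m_comm)
    qed (use smod_smult[OF C(1)] Ep pq qC in blast)
    then show ?case using pF by simp
  next
    case (Suc l)
    have "(p \<oplus> q) [^] l \<otimes> (p [^] Suc i \<otimes> q [^] j) \<oplus> (p \<oplus> q) [^] l \<otimes> (p [^] i \<otimes> q [^] Suc j) \<in> C"
      using Suc by (intro smod_add[OF C(1)] Suc.IH) auto
    moreover have "(p \<oplus> q) [^] Suc l \<otimes> (p [^] i \<otimes> q [^] j) =
      (p \<oplus> q) [^] l \<otimes> ((p \<oplus> q) \<otimes> (p [^] i \<otimes> q [^] j))" using pF by (simp add: m_assoc)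
    moreover have "(p \<oplus> q) \<otimes> (p [^] i \<otimes> q [^] j) = p \<otimes> (p [^] i \<otimes> q [^] j) \<oplus> q \<otimes> (p [^] i \<otimes> q [^] j)"
      using pF by (intro l_distr) auto
    moreover have "\<dots> = p [^] Suc i \<otimes> q [^] j \<oplus> p [^] i \<otimes> q [^] Suc j"
      using pF by (simp add: m_ac)
    ultimately show ?case using pF by (simp add: r_distr)
  qed
  from this[of "n + k" 0 0] show ?thesis using pF by simp
qed

end

text \<open>\<open>invertible\<close> is stability of \<open>I\<close>: the products \<open>q x\<close> with \<open>x \<in> I\<close> and \<open>q I \<subseteq> (I : I)\<close> generate the
  unit ideal of \<open>(I : I)\<close>. Here \<open>smod {} D\<close> only asks \<open>D\<close> to be closed under addition, and \<open>notfin\<close>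
  says that \<open>V\<close> is not a finitely generated \<open>R\<close>-module.\<close>

locale bad = noeth1 +
  assumes m_nz: "m \<noteq> {\<zero>}"
    and invertible: "ideal I A \<Longrightarrow> I \<noteq> {\<zero>} \<Longrightarrow> smod {} D \<Longrightarrow>
      (\<And>q x. q \<in> carrier F \<Longrightarrow> x \<in> I \<Longrightarrow> (\<And>x w. x \<in> I \<Longrightarrow> w \<in> I \<Longrightarrow> q \<otimes> x \<otimes> w \<in> I) \<Longrightarrow> q \<otimes> x \<in> D)
      \<Longrightarrow> \<one> \<in> D"
    and notfin: "S \<subseteq> V \<Longrightarrow> finite S \<Longrightarrow> \<exists>N\<subseteq>V. smod R N \<and> S \<subseteq> N \<and> N \<noteq> V"
begin

text \<open>Scaling by \<open>s\<close> turns \<open>L\<close> into an ideal, and a multiplier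
  \<open>q\<close> of that ideal corresponds to the multiplier \<open>q s\<close> of
  \<open>L\<close>.\<close>

lemma invertible_fractional:
  assumes L: "smod R L" "l \<in> L" "l \<noteq> \<zero>" and s: "s \<in> R" "s \<noteq> \<zero>" "\<And>x. x \<in> L \<Longrightarrow> s \<otimes> x \<in> R"
    and D: "smod {} D"
    and h: "\<And>c x. c \<in> carrier F \<Longrightarrow> x \<in> L \<Longrightarrow> (\<And>x w. x \<in> L \<Longrightarrow> w \<in> L \<Longrightarrow> c \<otimes> x \<otimes> w \<in> L) \<Longrightarrow> c \<otimes> x \<in> D"
  shows "\<one> \<in> D"
proof (rule invertible[OF _ _ D])
  let ?I = "(\<otimes>) s ` L"
  have LF: "x \<in> carrier F" if "x \<in> L" for x using smod_carrier[OF L(1) that] .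
  show "ideal ?I A" unfolding ideal_A_iff using s smod_scale[OF L(1)] by auto
  have "s \<otimes> l \<noteq> \<zero>" using s L LF by (simp add: integral_iff)
  then show "?I \<noteq> {\<zero>}" using L by blast
  fix q x assume q: "q \<in> carrier F" and x: "x \<in> ?I"
    and qI: "\<And>x w. x \<in> ?I \<Longrightarrow> w \<in> ?I \<Longrightarrow> q \<otimes> x \<otimes> w \<in> ?I"
  obtain x0 where x0: "x0 \<in> L" "x = s \<otimes> x0" using x by auto
  have "(q \<otimes> s) \<otimes> x0 \<in> D"
  proof (rule h)
    fix u w assume uw: "u \<in> L" "w \<in> L"
    then have "q \<otimes> (s \<otimes> u) \<otimes> (s \<otimes> w) \<in> ?I" using qI by blast
    then obtain t where t: "t \<in> L" "q \<otimes> (s \<otimes> u) \<otimes> (s \<otimes> w) = s \<otimes> t" by blast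
    have "s \<otimes> (q \<otimes> s \<otimes> u \<otimes> w) = q \<otimes> (s \<otimes> u) \<otimes> (s \<otimes> w)"
      using q s(1) uw LF by (simp add: m_ac)
    then have "s \<otimes> (q \<otimes> s \<otimes> u \<otimes> w) = s \<otimes> t" using t by simp
    then have "q \<otimes> s \<otimes> u \<otimes> w = t"
      using s uw t LF q m_lcancel[of s "q \<otimes> s \<otimes> u \<otimes> w" t] by simp
    then show "q \<otimes> s \<otimes> u \<otimes> w \<in> L" using t by simp
  qed (use q s x0 in auto)
  then show "q \<otimes> x \<in> D" using x0 LF q s by (simp add: m_assoc)
qed

text \<open>For \<open>J = gen2 x y\<close>, \<open>E\<close> is \<open>(J : J)\<close> and
  \<open>C\<close> is its ideal of all \<open>c\<close> with \<open>c J J \<subseteq> J\<close>; the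
  aim is \<open>\<one> \<in> C\<close>. By \<open>integral_radical\<close>, multiples of
  \<open>c\<close> by integral elements of \<open>J\<close> are in the radical \<open>D\<close> of
  \<open>C\<close>, but nothing says yet that \<open>J\<close> consists of integral elements. Hence
  only \<open>c x\<close>, \<open>c y\<close> and \<open>c\<close> are treated this way, and
  additivity of \<open>D\<close> gives the rest of \<open>c J\<close>.\<close>

lemma gen2_ring:
  assumes x: "x \<in> V" and y: "y \<in> V" and jw: "j \<in> gen2 x y" "w \<in> gen2 x y"
  shows "j \<otimes> w \<in> gen2 x y" "j \<in> V"
proof -
  let ?J = "gen2 x y"
  obtain s1 where s1: "s1 \<in> R" "s1 \<noteq> \<zero>" "s1 \<otimes> x \<in> R" using denom x V_carrier by metis
  obtain s2 where s2: "s2 \<in> R" "s2 \<noteq> \<zero>" "s2 \<otimes> y \<in> R" using denom y V_carrier by metis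
  define s where "s = s1 \<otimes> s2"
  have xy: "x \<in> carrier F" "y \<in> carrier F" using x y by auto
  have s: "s \<in> R" "s \<noteq> \<zero>" using s1 s2 by (auto simp: s_def integral_iff)
  have "s \<otimes> x = s2 \<otimes> (s1 \<otimes> x)" "s \<otimes> y = s1 \<otimes> (s2 \<otimes> y)"
    using s1(1) s2(1) xy by (simp_all add: s_def m_ac)
  then have sxy: "s \<otimes> x \<in> R" "s \<otimes> y \<in> R" using s1 s2 by simp_all
  have sJ: "s \<otimes> w \<in> R" if "w \<in> ?J" for w
    using gen2_minimal[of "{w \<in> carrier F. s \<otimes> w \<in> R}" x y] smod_preimage[OF smod_R, of s]
      s xy sxy that by auto
  note J = smod_gen2[OF xy]
  note JF = smod_carrier[OF J]
  have J1: "\<one> \<in> ?J" using gen2_gens(1)[OF xy, of \<one>] by simp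
  define E where "E = {e \<in> carrier F. \<forall>w\<in>?J. e \<otimes> w \<in> ?J}"
  have E: "subring E F"
  proof (rule subringI)
    show "\<one> \<in> E" using JF by (auto simp: E_def)
    show "\<ominus> h \<in> E" if "h \<in> E" for h
      using that smod_neg[OF J subring] JF by (auto simp: E_def l_minus)
    show "h1 \<otimes> h2 \<in> E" "h1 \<oplus> h2 \<in> E" if "h1 \<in> E" "h2 \<in> E" for h1 h2
      using that smod_add[OF J] JF by (auto simp: E_def m_assoc l_distr)
  qed (auto simp: E_def)
  have RE: "R \<subseteq> E" using smod_smult[OF J] by (auto simp: E_def)
  define C where "C = {c \<in> carrier F. \<forall>u\<in>?J. \<forall>w\<in>?J. c \<otimes> u \<otimes> w \<in> ?J}"
  have C: "smod E C"
  proof (rule smodI)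
    show "\<zero> \<in> C" using JF smod_zero[OF J] by (auto simp: C_def)
    show "a \<oplus> b \<in> C" if "a \<in> C" "b \<in> C" for a b
      using that smod_add[OF J] JF by (auto simp: C_def l_distr)
    show "e \<otimes> c \<in> C" if "e \<in> E" "c \<in> C" for e c
      using that JF by (auto simp: C_def E_def m_assoc)
  qed (auto simp: C_def)
  have CE: "C \<subseteq> E"
  proof
    fix c assume c: "c \<in> C"
    have "c \<otimes> w \<in> ?J" if "w \<in> ?J" for w
    proof -
      have "c \<otimes> \<one> \<otimes> w \<in> ?J" using c J1 that by (auto simp: C_def)
      then show ?thesis using c by (simp add: C_def)
    qed
    then show "c \<in> E" using c by (auto simp: C_def E_def)
  qed
  define D where "D = {p \<in> E. \<exists>n::nat. p [^] n \<in> C}"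
  have EF: "e \<in> carrier F" if "e \<in> E" for e using that by (auto simp: E_def)
  have DR: "smod R D"
  proof (rule smodI)
    have "\<zero> [^] (1::nat) \<in> C" using smod_zero[OF C] by simp
    then show "\<zero> \<in> D" using subringE(2)[OF E] unfolding D_def by blast
    show "p \<oplus> q \<in> D" if "p \<in> D" "q \<in> D" for p q
      using that radical_add[OF E C CE] subringE(7)[OF E] unfolding D_def by blast
    show "r \<otimes> p \<in> D" if r: "r \<in> R" "p \<in> D" for r p
    proof -
      obtain n :: nat where n: "p \<in> E" "p [^] n \<in> C" using r by (auto simp: D_def)
      have "r [^] n \<in> E" using r(1) RE R_pow by blast
      then have "r [^] n \<otimes> p [^] n \<in> C" using smod_smult[OF C] n by blast
      then have "(r \<otimes> p) [^] n \<in> C" using r(1) EF n by (simp add: nat_pow_distrib)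
      moreover have "r \<otimes> p \<in> E" using r(1) n RE subringE(6)[OF E] by blast
      ultimately show ?thesis unfolding D_def by blast
    qed
  qed (auto simp: D_def E_def)
  have cJ: "c \<otimes> u \<in> D" if c: "c \<in> C" and u: "u \<in> ?J" for c u
  proof -
    have cF: "c \<in> carrier F" using c by (simp add: C_def)
    have cE: "c \<otimes> u \<in> E" if "u \<in> ?J" for u
      using c that JF cF by (auto simp: C_def E_def)
    have "c \<otimes> v \<in> D" if "v \<in> V" "v \<in> ?J" for v
      using integral_radical[OF that(1) E RE C CE c cE[OF that(2)]] cE[OF that(2)]
      unfolding D_def by blast
    then have "c \<otimes> x \<in> D" "c \<otimes> y \<in> D" "c \<otimes> \<one> \<in> D"
      using x y gen2_gens[OF xy] J1 R_V[OF R_closed(2)] by blast+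
    then have "?J \<subseteq> {u \<in> carrier F. c \<otimes> u \<in> D}"
      by (intro gen2_minimal smod_preimage[OF DR cF]) (use xy in auto)
    then show ?thesis using u by auto
  qed
  \<comment> \<open>Stability says that the products from \<open>C\<close> and \<open>J\<close>
    generate the unit ideal of \<open>E\<close>. As they lie in the radical of \<open>C\<close>,
    this forces \<open>C = E\<close>.\<close>
  have "\<one> \<in> D"
  proof (rule invertible_fractional[OF J J1 _ s sJ])
    show "smod {} D" using smod_mono[OF DR] by simp
    fix c u assume "c \<in> carrier F" "u \<in> ?J" "\<And>x w. x \<in> ?J \<Longrightarrow> w \<in> ?J \<Longrightarrow> c \<otimes> x \<otimes> w \<in> ?J"
    then show "c \<otimes> u \<in> D" using cJ[of c u] by (auto simp: C_def)
  qed auto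
  then have "\<one> \<in> C" by (auto simp: D_def)
  then have mult: "j \<otimes> w \<in> ?J" if "j \<in> ?J" "w \<in> ?J" for j w
  proof -
    have "\<one> \<otimes> j \<otimes> w \<in> ?J" using \<open>\<one> \<in> C\<close> that by (auto simp: C_def)
    then show ?thesis using JF that by simp
  qed
  show "j \<otimes> w \<in> ?J" using mult jw by blast
  \<comment> \<open>\<open>J\<close> is now a ring, so each of its elements stabilizes it and is
    integral.\<close>
  show "j \<in> V"
    by (rule stabilizer_integral[OF J J1 _ s sJ]) (use mult jw JF in auto)
qed

text \<open>Sums, products and negatives formed from \<open>x\<close> and \<open>y\<close> stay in
  \<open>gen2 x y\<close>, all of whose elements are integral.\<close>

lemma V_subring: "subring V F"
proof (rule subringI)
  fix x y assume xy: "x \<in> V" "y \<in> V"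
  have c: "x \<in> carrier F" "y \<in> carrier F" using xy by auto
  note g = gen2_gens[OF c] smod_gen2[OF c]
  show "\<ominus> x \<in> V" by (rule gen2_ring(2)[OF xy smod_neg[OF g(4) subring g(2)] g(2)])
  show "x \<oplus> y \<in> V" by (rule gen2_ring(2)[OF xy smod_add[OF g(4) g(2,3)] g(2)])
  show "x \<otimes> y \<in> V" by (rule gen2_ring(2)[OF xy gen2_ring(1)[OF xy g(2,3)] g(2)])
qed auto

lemma quadratic:
  assumes "x \<in> V"
  obtains a b where "a \<in> R" "b \<in> R" "x \<otimes> x = a \<oplus> b \<otimes> x"
proof -
  have x: "x \<in> carrier F" using assms by simp
  have "x \<otimes> x \<in> gen2 x x"
    by (rule gen2_ring(1)[OF assms assms gen2_gens(2)[OF x x] gen2_gens(2)[OF x x]])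
  then obtain a b c where h: "a \<in> R" "b \<in> R" "c \<in> R" "x \<otimes> x = a \<oplus> b \<otimes> x \<oplus> c \<otimes> x"
    unfolding gen2_def by blast
  then have "x \<otimes> x = a \<oplus> (b \<oplus> c) \<otimes> x" using assms by (simp add: l_distr a_ac)
  then show ?thesis using that h R_closed(3) by blast
qed

lemma product_relation:
  assumes "x \<in> V" "y \<in> V"
  obtains a b c where "a \<in> R" "b \<in> R" "c \<in> R" "x \<otimes> y = a \<oplus> b \<otimes> x \<oplus> c \<otimes> y"
proof -
  have c: "x \<in> carrier F" "y \<in> carrier F" using assms by auto
  have "x \<otimes> y \<in> gen2 x y" by (rule gen2_ring(1)[OF assms gen2_gens(2,3)[OF c]])
  then show ?thesis using that unfolding gen2_def by blast
qed

text \<open>A common denominator would make \<open>V\<close> a fractional ideal, hence finitely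
  generated over the Noetherian ring \<open>R\<close>.\<close>

lemma V_not_fractional:
  assumes "s \<in> R" "s \<noteq> \<zero>" shows "\<exists>x\<in>V. s \<otimes> x \<notin> R"
proof (rule ccontr)
  assume n: "\<not> ?thesis"
  have "smod R V" using V_subring by (auto intro!: smodI simp: subringE)
  then have "\<exists>S\<subseteq>V. finite S \<and> (\<forall>N. smod R N \<and> S \<subseteq> N \<longrightarrow> V \<subseteq> N)"
    by (rule fractional_finite[OF _ assms]) (use n in auto)
  then obtain S where S: "S \<subseteq> V" "finite S" "\<forall>N. smod R N \<and> S \<subseteq> N \<longrightarrow> V \<subseteq> N"
    by auto
  then show False using notfin[OF S(1,2)] by blast
qed

end

lemma (in ring) add_minus_cancel: "x \<in> carrier R \<Longrightarrow> y \<in> carrier R \<Longrightarrow> x \<oplus> (y \<ominus> x) = y"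
proof -
  assume xy: "x \<in> carrier R" "y \<in> carrier R"
  then have "x \<oplus> (y \<ominus> x) = y \<oplus> (x \<oplus> \<ominus> x)"
    unfolding a_minus_def by (intro a_lcomm) auto
  then show ?thesis using xy by (simp add: r_neg)
qed

section \<open>The residue field of the normalization\<close>

context bad
begin

text \<open>Expanding \<open>(x + y)^2\<close> would only control \<open>2 x y\<close>. Instead the
  relation \<open>x y = a + b x + c y\<close> is multiplied by \<open>x\<close>, by \<open>y\<close>
  and by \<open>x y\<close>, and the cases are distinguished by which coefficient is a unit of
  \<open>R\<close>.\<close>

lemma square_zero_mult:
  assumes T: "subring T F" "R \<subseteq> T" "T \<subseteq> V" and C: "smod T C"
    and mC: "m \<subseteq> C" and xy: "x \<in> T" "y \<in> T" "x \<otimes> x \<in> C" "y \<otimes> y \<in> C"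
  shows "x \<otimes> y \<in> C"
proof -
  have CR: "smod R C" using smod_mono[OF C T(2)] .
  have TF: "t \<in> carrier F" if "t \<in> T" for t using subringE(1)[OF T(1)] that by auto
  have CF: "c \<in> carrier F" if "c \<in> C" for c using smod_carrier[OF C that] .
  have xyV: "x \<in> V" "y \<in> V" using xy T by auto
  obtain a b c where h: "a \<in> R" "b \<in> R" "c \<in> R" "x \<otimes> y = a \<oplus> b \<otimes> x \<oplus> c \<otimes> y"
    by (rule product_relation[OF xyV])
  have abc: "a \<in> carrier F" "b \<in> carrier F" "c \<in> carrier F" using h by auto
  have xyF: "x \<in> carrier F" "y \<in> carrier F" using xy TF by auto
  have xyT: "x \<otimes> y \<in> T" using subringE(6)[OF T(1)] xy by blast
  note cl = smod_add[OF C] smod_smult[OF C] smod_smult[OF CR]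
  note canc = smod_cancel[OF C T(1)]
  have yxx: "y \<otimes> (x \<otimes> x) \<in> C" "x \<otimes> (y \<otimes> y) \<in> C" using cl xy by auto
  have ex: "y \<otimes> (x \<otimes> x) = b \<otimes> (x \<otimes> x) \<oplus> (a \<otimes> x \<oplus> c \<otimes> (x \<otimes> y))"
  proof -
    have "y \<otimes> (x \<otimes> x) = x \<otimes> (x \<otimes> y)" using xyF by (simp add: m_ac)
    also have "\<dots> = x \<otimes> (a \<oplus> b \<otimes> x \<oplus> c \<otimes> y)" using h(4) by simp
    finally show ?thesis using xyF abc by (simp add: r_distr m_ac a_ac)
  qed
  have ey: "x \<otimes> (y \<otimes> y) = c \<otimes> (y \<otimes> y) \<oplus> (a \<otimes> y \<oplus> b \<otimes> (x \<otimes> y))"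
  proof -
    have "x \<otimes> (y \<otimes> y) = y \<otimes> (x \<otimes> y)" using xyF by (simp add: m_ac)
    also have "\<dots> = y \<otimes> (a \<oplus> b \<otimes> x \<oplus> c \<otimes> y)" using h(4) by simp
    finally show ?thesis using xyF abc by (simp add: r_distr m_ac a_ac)
  qed
  have bxx: "b \<otimes> (x \<otimes> x) \<in> C" "c \<otimes> (y \<otimes> y) \<in> C" using cl h xy by auto
  have 1: "a \<otimes> x \<oplus> c \<otimes> (x \<otimes> y) \<in> C"
    by (rule canc[OF bxx(1)]) (use yxx(1) ex xyF abc in auto)
  have 2: "a \<otimes> y \<oplus> b \<otimes> (x \<otimes> y) \<in> C"
    by (rule canc[OF bxx(2)]) (use yxx(2) ey xyF abc in auto)
  show ?thesis
  proof (cases "a \<in> m")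
    \<comment> \<open>Both \<open>(x y)^2\<close> and all terms of its expansion by the relation
      except \<open>a x y\<close> are in \<open>C\<close>, and \<open>a\<close> is a unit.\<close>
    case False
    have "x \<otimes> y \<otimes> (x \<otimes> y) = y \<otimes> (y \<otimes> (x \<otimes> x))" using xyF by (simp add: m_ac)
    then have "x \<otimes> y \<otimes> (x \<otimes> y) \<in> C" using yxx cl xy by simp
    moreover have "x \<otimes> y \<otimes> (x \<otimes> y) = (b \<otimes> (y \<otimes> (x \<otimes> x)) \<oplus> c \<otimes> (x \<otimes> (y \<otimes> y))) \<oplus> a \<otimes> (x \<otimes> y)"
    proof -
      have "x \<otimes> y \<otimes> (x \<otimes> y) = (a \<oplus> b \<otimes> x \<oplus> c \<otimes> y) \<otimes> (x \<otimes> y)"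
        by (rule arg_cong2[OF h(4) refl])
      also have "\<dots> = a \<otimes> (x \<otimes> y) \<oplus> b \<otimes> x \<otimes> (x \<otimes> y) \<oplus> c \<otimes> y \<otimes> (x \<otimes> y)"
        using xyF abc by (simp only: l_distr m_closed a_closed)
      finally show ?thesis using xyF abc by (simp add: m_ac a_ac)
    qed
    moreover have "b \<otimes> (y \<otimes> (x \<otimes> x)) \<oplus> c \<otimes> (x \<otimes> (y \<otimes> y)) \<in> C"
      using cl h yxx by auto
    ultimately have "a \<otimes> (x \<otimes> y) \<in> C"
      using canc[of "b \<otimes> (y \<otimes> (x \<otimes> x)) \<oplus> c \<otimes> (x \<otimes> (y \<otimes> y))" "a \<otimes> (x \<otimes> y)"] xyF abc by simp
    then show ?thesis using smod_unit[OF CR h(1) False] xyF by simp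
  next
    case True
    then have aC: "a \<in> C" using mC by blast
    have "a \<otimes> x = x \<otimes> a" "a \<otimes> y = y \<otimes> a" using xyF abc by (simp_all add: m_comm)
    then have axy: "a \<otimes> x \<in> C" "a \<otimes> y \<in> C" using smod_smult[OF C _ aC] xy by simp_all
    have c: "c \<otimes> (x \<otimes> y) \<in> C" by (rule canc[OF axy(1) _ 1]) (use xyF abc in auto)
    have b: "b \<otimes> (x \<otimes> y) \<in> C" by (rule canc[OF axy(2) _ 2]) (use xyF abc in auto)
    show ?thesis
    proof (cases "b \<in> m \<and> c \<in> m")
      case False
      then show ?thesis using smod_unit[OF CR h(3) _ _ c] smod_unit[OF CR h(2) _ _ b] xyF by auto
    next
      case True
      have "b \<otimes> x = x \<otimes> b" "c \<otimes> y = y \<otimes> c" using xyF abc by (simp_all add: m_comm)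
      moreover have "x \<otimes> b \<in> C" "y \<otimes> c \<in> C" using smod_smult[OF C] True mC xy by blast+
      ultimately show ?thesis using h(4) aC cl(1) by simp
    qed
  qed
qed

text \<open>Multiplying \<open>c + t\<close> by its conjugate \<open>c + k - t\<close> gives the
  norm \<open>c (c + k) - l\<close>, which is a unit of \<open>R\<close> because \<open>k\<close>
  and \<open>l\<close> are in \<open>m\<close>.\<close>

lemma perturbed_unit:
  assumes c: "c \<in> R" "c \<notin> m" and t: "t \<in> carrier F" "t \<otimes> t = l \<oplus> k \<otimes> t" and lk: "l \<in> m" "k \<in> m"
  shows "\<exists>g\<in>gen2 t t. (c \<oplus> t) \<otimes> g = \<one>"
proof -
  have F: "c \<in> carrier F" "l \<in> carrier F" "k \<in> carrier F" using c lk by auto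
  note J = smod_gen2[OF t(1) t(1)]
  define g where "g = (c \<oplus> k) \<ominus> t"
  have g: "g \<in> gen2 t t" unfolding g_def
    using c lk gen2_gens[OF t(1) t(1)] by (intro smod_diff[OF J subring]) auto
  have gF: "g \<in> carrier F" using smod_carrier[OF J g] .
  have tg: "t \<oplus> g = c \<oplus> k" unfolding g_def using F t(1) by (intro add_minus_cancel) auto
  have "k \<otimes> t \<oplus> (l \<oplus> t \<otimes> g) = t \<otimes> t \<oplus> t \<otimes> g" unfolding t(2) using F t(1) gF by (simp add: a_ac)
  also have "\<dots> = t \<otimes> (t \<oplus> g)" using t(1) gF by (simp add: r_distr)
  also have "\<dots> = k \<otimes> t \<oplus> t \<otimes> c" unfolding tg using F t(1) by (simp add: r_distr m_comm a_comm)
  finally have tgl: "l \<oplus> t \<otimes> g = t \<otimes> c" using F t(1) gF by simp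
  have "l \<oplus> (c \<oplus> t) \<otimes> g = c \<otimes> g \<oplus> (l \<oplus> t \<otimes> g)" using F t(1) gF by (simp add: l_distr a_ac)
  also have "\<dots> = c \<otimes> (t \<oplus> g)" unfolding tgl using F t(1) gF by (simp add: r_distr m_comm a_comm)
  finally have e: "l \<oplus> (c \<oplus> t) \<otimes> g = c \<otimes> (c \<oplus> k)" unfolding tg .
  define w where "w = (c \<oplus> t) \<otimes> g"
  have wF: "w \<in> carrier F" using F t(1) gF by (simp add: w_def)
  have e': "l \<oplus> w = c \<otimes> (c \<oplus> k)" using e by (simp add: w_def)
  have "l \<oplus> w \<in> R" unfolding e' using c lk by simp
  then have wR: "w \<in> R" by (rule smod_cancel[OF smod_R subring, rotated -1]) (use lk wF in auto)
  have "w \<notin> m"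
  proof
    assume "w \<in> m"
    then have "c \<otimes> (c \<oplus> k) \<in> m" using e' lk max_closed(2) by metis
    moreover have "c \<oplus> k \<notin> m"
    proof
      assume "c \<oplus> k \<in> m"
      then have "k \<oplus> c \<in> m" using F by (simp add: a_comm)
      then have "c \<in> m" by (rule smod_cancel[OF smod_m subring, rotated -1]) (use lk F in auto)
      then show False using c by simp
    qed
    ultimately show False using m_prime[of c "c \<oplus> k"] c lk by auto
  qed
  then have wu: "inv w \<in> R" "w \<noteq> \<zero>" using unit_R wR by auto
  have "inv w \<otimes> g \<in> gen2 t t" using smod_smult[OF J wu(1) g] .
  moreover have "(c \<oplus> t) \<otimes> (inv w \<otimes> g) = inv w \<otimes> w" using F t(1) gF wu by (simp add: w_def m_lcomm)
  then have "(c \<oplus> t) \<otimes> (inv w \<otimes> g) = \<one>" using wu wF by simp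
  ultimately show ?thesis by blast
qed

text \<open>With \<open>y = \<zero>\<close>, where \<open>n\<close> is \<open>m\<close>, this yields
  a uniformizer in \<open>m\<close>. For general \<open>y\<close> it shows that \<open>y\<close> has
  the residue of an element of \<open>R\<close>, although with a \<open>z\<close> that still depends
  on \<open>y\<close>.\<close>

lemma residue_lift:
  assumes y: "y \<in> V"
  defines "n \<equiv> {w. \<exists>p\<in>m. \<exists>q\<in>m. w = p \<oplus> q \<otimes> y}"
  shows "\<exists>z\<in>n. z \<noteq> \<zero> \<and> (\<forall>w\<in>n. \<exists>v\<in>V. w = z \<otimes> v) \<and> (\<exists>r\<in>R. \<exists>v\<in>V. y \<oplus> r = z \<otimes> v)"
proof -
  define E where "E = {e \<in> carrier F. \<forall>w\<in>n. e \<otimes> w \<in> n}"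
  have yF: "y \<in> carrier F" using y by simp
  have nI: "p \<oplus> q \<otimes> y \<in> n" if "p \<in> m" "q \<in> m" for p q using that unfolding n_def by blast
  have n: "smod R n"
  proof (rule smodI)
    have "\<zero> \<oplus> \<zero> \<otimes> y \<in> n" by (rule nI) auto
    then show "\<zero> \<in> n" using yF by simp
  next
    fix u v assume "u \<in> n" "v \<in> n"
    then obtain p q p' q' where h: "p \<in> m" "q \<in> m" "p' \<in> m" "q' \<in> m"
      "u = p \<oplus> q \<otimes> y" "v = p' \<oplus> q' \<otimes> y" unfolding n_def by blast
    have "u \<oplus> v = (p \<oplus> p') \<oplus> (q \<oplus> q') \<otimes> y" unfolding h(5,6) using h(1-4) yF by (simp add: l_distr a_ac)
    then show "u \<oplus> v \<in> n" using nI h max_closed(2) by simp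
  next
    fix r u assume r: "r \<in> R" and "u \<in> n"
    then obtain p q where h: "p \<in> m" "q \<in> m" "u = p \<oplus> q \<otimes> y" unfolding n_def by blast
    have "r \<otimes> u = r \<otimes> p \<oplus> (r \<otimes> q) \<otimes> y" unfolding h(3) using h(1,2) r yF by (simp add: r_distr m_assoc)
    then show "r \<otimes> u \<in> n" using nI h r max_closed(3) by simp
  qed (use yF in \<open>auto simp: n_def\<close>)
  note nF = smod_carrier[OF n]
  have mn: "m \<subseteq> n"
  proof
    fix p assume p: "p \<in> m"
    have "p \<oplus> \<zero> \<otimes> y \<in> n" using nI p by auto
    then show "p \<in> n" using p yF by simp
  qed
  have EF: "e \<in> carrier F" if "e \<in> E" for e using that by (simp add: E_def)
  have E: "subring E F"
  proof (rule subringI)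
    show "\<one> \<in> E" using nF by (auto simp: E_def)
    show "\<ominus> h \<in> E" if "h \<in> E" for h
      using that smod_neg[OF n subring] nF by (auto simp: E_def l_minus)
    show "h1 \<otimes> h2 \<in> E" "h1 \<oplus> h2 \<in> E" if "h1 \<in> E" "h2 \<in> E" for h1 h2
      using that smod_add[OF n] nF by (auto simp: E_def m_assoc l_distr)
  qed (auto simp: E_def)
  note Ecl = subringE(6,7)[OF E]
  have RE: "R \<subseteq> E" using smod_smult[OF n] by (auto simp: E_def)
  have nE': "smod E n" using n by (auto simp: smod_def E_def)
  have yE: "y \<in> E"
  proof -
    obtain a b where ab: "a \<in> R" "b \<in> R" "y \<otimes> y = a \<oplus> b \<otimes> y" using quadratic[OF y] .
    have "y \<otimes> w \<in> n" if "w \<in> n" for w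
    proof -
      obtain p q where h: "p \<in> m" "q \<in> m" "w = p \<oplus> q \<otimes> y" using \<open>w \<in> n\<close> unfolding n_def by blast
      have "y \<otimes> w = p \<otimes> y \<oplus> q \<otimes> (y \<otimes> y)" unfolding h(3) using h(1,2) yF by (simp add: r_distr m_ac)
      also have "\<dots> = q \<otimes> a \<oplus> (p \<oplus> q \<otimes> b) \<otimes> y" unfolding ab(3) using h(1,2) ab(1,2) yF
        by (simp add: r_distr l_distr m_ac a_ac)
      finally show ?thesis using nI h ab max_closed by simp
    qed
    then show ?thesis using yF by (simp add: E_def)
  qed
  have nE: "n \<subseteq> E"
  proof
    fix w assume "w \<in> n"
    then obtain p q where h: "p \<in> m" "q \<in> m" "w = p \<oplus> q \<otimes> y" unfolding n_def by blast
    then have "p \<in> E" "q \<in> E" using RE by blast+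
    then show "w \<in> E" using h yE Ecl by simp
  qed
  have n1: "\<one> \<notin> n"
  proof
    assume "\<one> \<in> n"
    then obtain p q where h: "p \<in> m" "q \<in> m" "\<one> = p \<oplus> q \<otimes> y" unfolding n_def by blast
    have "p \<oplus> q \<otimes> y \<in> R" using h(3) R_closed(2) by simp
    then have "q \<otimes> y \<in> R" by (rule smod_cancel[OF smod_R subring, rotated -1]) (use h(1,2) yF in auto)
    then have "q \<otimes> y \<in> m" using m_V_nonunit h y by blast
    then have "\<one> \<in> m" using h max_closed(2) by simp
    then show False by simp
  qed
  have unit_n: "w \<in> n" if "a \<in> R" "a \<notin> m" "w \<in> carrier F" "a \<otimes> w \<in> n" for a w
    using smod_unit[OF n that] .
  obtain s where s: "s \<in> R" "s \<noteq> \<zero>" "s \<otimes> y \<in> R" using denom[OF yF] by blast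
  have sn: "s \<otimes> w \<in> R" if "w \<in> n" for w
  proof -
    obtain p q where h: "p \<in> m" "q \<in> m" "w = p \<oplus> q \<otimes> y" using \<open>w \<in> n\<close> unfolding n_def by blast
    have "s \<otimes> w = s \<otimes> p \<oplus> q \<otimes> (s \<otimes> y)" unfolding h(3) using h(1,2) s(1) yF by (simp add: r_distr m_ac)
    then show ?thesis using h s by simp
  qed
  obtain p0 where p0: "p0 \<in> m" "p0 \<noteq> \<zero>" using m_nz max_closed(1) by blast
  have p0n: "p0 \<in> n" using p0 mn by blast
  have s0: "s \<otimes> p0 \<in> R" "s \<otimes> p0 \<noteq> \<zero>" using s p0 by (auto simp: integral_iff)
  have sE: "s \<otimes> p0 \<otimes> e \<in> R" if "e \<in> E" for e
  proof -
    have "e \<otimes> p0 \<in> n" using that p0n by (simp add: E_def)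
    moreover have "s \<otimes> p0 \<otimes> e = s \<otimes> (e \<otimes> p0)" using s(1) p0 EF[OF that] by (simp add: m_ac)
    ultimately show ?thesis using sn by simp
  qed
  have EV: "E \<subseteq> V"
  proof
    fix e assume "e \<in> E"
    then show "e \<in> V"
      by (intro stabilizer_integral[OF n p0n p0(2) s(1,2) sn]) (auto simp: E_def)
  qed
  have ER: "smod R E" using RE Ecl EF subringE(2)[OF E] by (intro smodI) blast+
  \<comment> \<open>\<open>s \<otimes> p0\<close> is a common denominator of \<open>E\<close>,
    whereas \<open>V\<close> has none, so \<open>V\<close> exceeds \<open>E\<close>;
    \<open>associated_m\<close> then supplies an element just outside \<open>E\<close>.\<close>
  have "\<exists>v\<in>V. v \<notin> E \<and> (\<forall>w\<in>m. w \<otimes> v \<in> E)"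
  proof -
    obtain v0 where v0: "v0 \<in> V" "s \<otimes> p0 \<otimes> v0 \<notin> R" using V_not_fractional[OF s0] by blast
    then have v0E: "v0 \<notin> E" using sE by blast
    obtain s1 where s1: "s1 \<in> R" "s1 \<noteq> \<zero>" "s1 \<otimes> v0 \<in> R" using denom[of v0] v0 by blast
    then obtain b where b: "b \<in> R" "b \<otimes> v0 \<notin> E" "\<forall>p\<in>m. p \<otimes> (b \<otimes> v0) \<in> E"
      using associated_m[OF ER _ v0E s1(1,2)] v0(1) RE by blast
    then have "b \<otimes> v0 \<in> V" using subringE(6)[OF V_subring] v0(1) R_V by blast
    then show ?thesis using b by blast
  qed
  then obtain v where v: "v \<in> V" "v \<notin> E" "\<And>w. w \<in> m \<Longrightarrow> w \<otimes> v \<in> E" by blast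
  have vF: "v \<in> carrier F" using v by simp
  have nv: "w \<otimes> v \<in> E" if "w \<in> n" for w
  proof -
    obtain p q where h: "p \<in> m" "q \<in> m" "w = p \<oplus> q \<otimes> y" using \<open>w \<in> n\<close> unfolding n_def by blast
    have "w \<otimes> v = p \<otimes> v \<oplus> (q \<otimes> y) \<otimes> v" unfolding h(3) using h(1,2) yF vF by (intro l_distr) auto
    also have "(q \<otimes> y) \<otimes> v = y \<otimes> (q \<otimes> v)" using h(1,2) yF vF by (simp add: m_ac)
    finally have "w \<otimes> v = p \<otimes> v \<oplus> y \<otimes> (q \<otimes> v)" .
    then show ?thesis using v(3) h yE Ecl by simp
  qed
  txt \<open>If \<open>E / n\<close> were reduced, \<open>n v \<subseteq> E\<close> would imply \<open>n v \<subseteq> n\<close>, that is, \<open>v \<in> E\<close>.\<close>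
  obtain \<epsilon> where eps: "\<epsilon> \<in> E" "\<epsilon> \<notin> n" "\<epsilon> \<otimes> \<epsilon> \<in> n"
  proof -
    have "\<exists>w\<in>n. w \<otimes> v \<notin> n" using v(2) vF by (auto simp: E_def m_comm nF)
    then obtain w where w: "w \<in> n" "w \<otimes> v \<notin> n" by blast
    define x where "x = w \<otimes> v"
    have x: "x \<in> E" "x \<notin> n" using w nv by (auto simp: x_def)
    have xF: "x \<in> carrier F" using x EF by simp
    have "\<exists>k::nat. x [^] k \<in> n"
      unfolding x_def by (rule integral_radical[OF v(1) E RE nE' nE w(1) nv[OF w(1)]])
    define k where "k = (LEAST k::nat. x [^] k \<in> n)"
    have k: "x [^] k \<in> n" unfolding k_def by (rule LeastI_ex) fact
    have "x [^] (0::nat) \<notin> n" "x [^] (1::nat) \<notin> n" using n1 x xF by simp_all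
    then have k2: "k \<noteq> 0" "k \<noteq> 1" using k by metis+
    then have lt: "k - 1 < k" by simp
    \<comment> \<open>The last power outside \<open>n\<close> serves as \<open>\<epsilon>\<close>:
      because \<open>k \<ge> 2\<close>, its exponent doubled is at least \<open>k\<close>.\<close>
    have e1: "x [^] (k - 1) \<notin> n" using not_less_Least[OF lt[unfolded k_def], folded k_def] .
    have xE: "x [^] (i::nat) \<in> E" for i using x(1) E by (induction i) (simp_all add: subringE)
    have "x [^] (k - 2) \<otimes> x [^] k \<in> n" using smod_smult[OF nE' xE k] .
    moreover have "k - 2 + k = (k - 1) + (k - 1)" using k2 by linarith
    then have "x [^] (k - 2) \<otimes> x [^] k = x [^] (k - 1) \<otimes> x [^] (k - 1)"
      using xF by (simp only: nat_pow_mult)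
    ultimately show ?thesis using that[of "x [^] (k - 1)"] e1 xE by simp
  qed
  have eF: "\<epsilon> \<in> carrier F" using eps EF by simp
  define N where "N = {e \<in> E. \<epsilon> \<otimes> e \<in> n}"
  have aeps: "a \<in> m" if "a \<in> R" "a \<otimes> \<epsilon> \<in> n" for a
    using unit_n[OF that(1) _ eF that(2)] eps by blast
  have Nn: "n \<subseteq> N" using nE smod_smult[OF nE' eps(1)] by (auto simp: N_def)
  have NE: "N \<subseteq> E" by (auto simp: N_def)
  have N: "smod E N"
  proof (rule smodI)
    show "\<zero> \<in> N" using Nn smod_zero[OF n] by blast
    show "a \<oplus> b \<in> N" if "a \<in> N" "b \<in> N" for a b
      using that Ecl smod_add[OF n] EF eF by (auto simp: N_def r_distr)
    show "e \<otimes> a \<in> N" if "e \<in> E" "a \<in> N" for e a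
    proof -
      have "e \<otimes> (\<epsilon> \<otimes> a) \<in> n" using that smod_smult[OF nE'] by (auto simp: N_def)
      moreover have "e \<otimes> (\<epsilon> \<otimes> a) = \<epsilon> \<otimes> (e \<otimes> a)" using that EF eF by (auto simp: N_def m_lcomm)
      ultimately show ?thesis using that Ecl by (simp add: N_def)
    qed
  qed (auto simp: N_def EF)
  have epsN: "\<epsilon> \<in> N" using eps by (simp add: N_def)
  \<comment> \<open>Multiplying the relation \<open>\<epsilon> e = a + b \<epsilon> + c e\<close> by
    \<open>\<epsilon>\<close> leaves \<open>a \<epsilon> + c \<epsilon> e\<close> in
    \<open>n\<close>. If \<open>c\<close> is in \<open>m\<close>, then so is \<open>a\<close>, and
    \<open>r = - b\<close> works; if \<open>c\<close> is a unit, \<open>r = a / c\<close>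
    does.\<close>
  have lam: "\<exists>r\<in>R. e \<oplus> r \<in> N" if e: "e \<in> E" for e
  proof -
    have eF': "e \<in> carrier F" using e EF by simp
    have eV: "\<epsilon> \<in> V" "e \<in> V" using eps(1) e EV by auto
    obtain a b c where h: "a \<in> R" "b \<in> R" "c \<in> R" "\<epsilon> \<otimes> e = a \<oplus> b \<otimes> \<epsilon> \<oplus> c \<otimes> e"
      by (rule product_relation[OF eV])
    have abc: "a \<in> carrier F" "b \<in> carrier F" "c \<in> carrier F" using h by auto
    have "e \<otimes> (\<epsilon> \<otimes> \<epsilon>) = b \<otimes> (\<epsilon> \<otimes> \<epsilon>) \<oplus> (a \<otimes> \<epsilon> \<oplus> c \<otimes> (\<epsilon> \<otimes> e))"
    proof -
      have "e \<otimes> (\<epsilon> \<otimes> \<epsilon>) = \<epsilon> \<otimes> (\<epsilon> \<otimes> e)" using eF eF' by (simp add: m_ac)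
      also have "\<dots> = \<epsilon> \<otimes> (a \<oplus> b \<otimes> \<epsilon> \<oplus> c \<otimes> e)" using h(4) by simp
      finally show ?thesis using eF eF' abc by (simp add: r_distr m_ac a_ac)
    qed
    moreover have "e \<otimes> (\<epsilon> \<otimes> \<epsilon>) \<in> n" using smod_smult[OF nE' e eps(3)] .
    ultimately have st: "a \<otimes> \<epsilon> \<oplus> c \<otimes> (\<epsilon> \<otimes> e) \<in> n"
      using smod_cancel[OF n subring smod_smult[OF n h(2) eps(3)], of "a \<otimes> \<epsilon> \<oplus> c \<otimes> (\<epsilon> \<otimes> e)"]
        eF eF' abc by simp
    show ?thesis
    proof (cases "c \<in> m")
      case True
      have "c \<otimes> (\<epsilon> \<otimes> e) = (\<epsilon> \<otimes> e) \<otimes> c" using eF eF' abc by (simp add: m_comm)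
      then have "c \<otimes> (\<epsilon> \<otimes> e) \<in> n" using smod_smult[OF nE', of "\<epsilon> \<otimes> e" c] True mn eps(1) e Ecl by auto
      then have "a \<otimes> \<epsilon> \<in> n" using smod_cancel[OF n subring, of "c \<otimes> (\<epsilon> \<otimes> e)" "a \<otimes> \<epsilon>"] st eF eF' abc
        by (simp add: a_comm)
      then have am: "a \<in> m" using aeps h by blast
      have "c \<otimes> e = e \<otimes> c" using eF' abc by (simp add: m_comm)
      then have "c \<otimes> e \<in> n" using smod_smult[OF nE' e, of c] True mn by auto
      then have ac: "a \<oplus> c \<otimes> e \<in> n" using smod_add[OF n] am mn by blast
      have "\<epsilon> \<otimes> (e \<oplus> \<ominus> b) = a \<oplus> c \<otimes> e"
      proof -
        have "\<epsilon> \<otimes> (e \<oplus> \<ominus> b) = \<ominus> (b \<otimes> \<epsilon>) \<oplus> \<epsilon> \<otimes> e"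
          using eF eF' abc by (simp add: r_distr r_minus m_comm a_comm)
        also have "\<dots> = \<ominus> (b \<otimes> \<epsilon>) \<oplus> (b \<otimes> \<epsilon> \<oplus> (a \<oplus> c \<otimes> e))"
          unfolding h(4) using eF eF' abc by (simp add: a_ac)
        also have "\<dots> = a \<oplus> c \<otimes> e" using eF eF' abc by (intro r_neg1) auto
        finally show ?thesis .
      qed
      then have "e \<oplus> \<ominus> b \<in> N" using ac e Ecl RE h by (auto simp: N_def)
      then show ?thesis using h by blast
    next
      case False
      note cu = unit_R[OF h(3) False]
      define r where "r = inv c \<otimes> a"
      have r: "r \<in> R" "r \<in> carrier F" using cu h by (auto simp: r_def)
      have cr: "c \<otimes> r = a" using cu h by (simp add: r_def m_assoc[symmetric])
      have "c \<otimes> (\<epsilon> \<otimes> (e \<oplus> r)) = c \<otimes> (\<epsilon> \<otimes> e) \<oplus> (c \<otimes> r) \<otimes> \<epsilon>"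
        using eF eF' abc r by (simp add: r_distr m_ac)
      then have "c \<otimes> (\<epsilon> \<otimes> (e \<oplus> r)) \<in> n" using st eF eF' abc cr by (simp add: a_comm)
      then have "\<epsilon> \<otimes> (e \<oplus> r) \<in> n" using unit_n[OF h(3) False] eF eF' r by simp
      then have "e \<oplus> r \<in> N" using e Ecl RE r by (auto simp: N_def)
      then show ?thesis using r by blast
    qed
  qed
  \<comment> \<open>Multiplying \<open>e^2 = a + b e\<close> by \<open>\<epsilon>\<close> shows
    \<open>a \<in> m\<close>, so \<open>b\<close> is the issue. It is compared with the linear
    coefficient \<open>b'\<close> of the equation for \<open>u = e + \<epsilon>\<close>. If
    \<open>d = b - b'\<close> is a unit, \<open>e^2\<close> is forced into \<open>n\<close>; if
    \<open>d\<close> is in \<open>m\<close>, then so are \<open>b'\<close> and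
    \<open>b\<close>.\<close>
  have Nsq: "e \<otimes> e \<in> n" if e: "e \<in> N" for e
  proof -
    have eE: "e \<in> E" "\<epsilon> \<otimes> e \<in> n" using e by (auto simp: N_def)
    have eF': "e \<in> carrier F" using eE EF by simp
    obtain a b where h: "a \<in> R" "b \<in> R" "e \<otimes> e = a \<oplus> b \<otimes> e" using quadratic eE EV by blast
    have hF: "a \<in> carrier F" "b \<in> carrier F" using h by auto
    have am: "a \<in> m"
    proof -
      have "e \<otimes> (\<epsilon> \<otimes> e) = \<epsilon> \<otimes> (e \<otimes> e)" using eF eF' by (simp add: m_ac)
      also have "\<dots> = b \<otimes> (\<epsilon> \<otimes> e) \<oplus> a \<otimes> \<epsilon>" unfolding h(3) using eF eF' hF by (simp add: r_distr m_ac a_ac)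
      finally have "b \<otimes> (\<epsilon> \<otimes> e) \<oplus> a \<otimes> \<epsilon> \<in> n" using smod_smult[OF nE' eE] by simp
      then have "a \<otimes> \<epsilon> \<in> n"
        using smod_cancel[OF n subring smod_smult[OF n h(2) eE(2)]] eF hF by simp
      then show ?thesis using aeps h by blast
    qed
    define u where "u = e \<oplus> \<epsilon>"
    have u: "u \<in> E" "u \<in> carrier F" using eE eps Ecl EF eF' eF by (auto simp: u_def)
    obtain a' b' where h': "a' \<in> R" "b' \<in> R" "u \<otimes> u = a' \<oplus> b' \<otimes> u" using quadratic u EV by blast
    have hF': "a' \<in> carrier F" "b' \<in> carrier F" using h' by auto
    have am': "a' \<in> m"
    proof -
      have "\<epsilon> \<otimes> u = \<epsilon> \<otimes> e \<oplus> \<epsilon> \<otimes> \<epsilon>" using eF eF' by (simp add: u_def r_distr)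
      then have eu: "\<epsilon> \<otimes> u \<in> n" using eE eps smod_add[OF n] by simp
      have "u \<otimes> (\<epsilon> \<otimes> u) = \<epsilon> \<otimes> (u \<otimes> u)" using eF u by (simp add: m_ac)
      also have "\<dots> = b' \<otimes> (\<epsilon> \<otimes> u) \<oplus> a' \<otimes> \<epsilon>" unfolding h'(3) using eF u hF' by (simp add: r_distr m_ac a_ac)
      finally have "b' \<otimes> (\<epsilon> \<otimes> u) \<oplus> a' \<otimes> \<epsilon> \<in> n" using smod_smult[OF nE' u(1) eu] by simp
      then have "a' \<otimes> \<epsilon> \<in> n"
        using smod_cancel[OF n subring smod_smult[OF n h'(2) eu]] eF hF' by simp
      then show ?thesis using aeps h' by blast
    qed
    define d where "d = b \<ominus> b'"
    have d: "d \<in> R" "d \<in> carrier F" using h h' by (auto simp: d_def)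
    have bd: "b = b' \<oplus> d" using hF hF' by (simp add: d_def add_minus_cancel)
    define p where "p = a \<oplus> (\<epsilon> \<otimes> e \<oplus> \<epsilon> \<otimes> e \<oplus> \<epsilon> \<otimes> \<epsilon>)"
    have pn: "p \<in> n" unfolding p_def using am mn eE eps smod_add[OF n] by blast
    have pF: "p \<in> carrier F" using pn nF by simp
    have key: "d \<otimes> e \<oplus> p = b' \<otimes> \<epsilon> \<oplus> a'"
    proof -
      have "u \<otimes> u = e \<otimes> e \<oplus> (\<epsilon> \<otimes> e \<oplus> \<epsilon> \<otimes> e \<oplus> \<epsilon> \<otimes> \<epsilon>)"
        unfolding u_def using eF eF' by (simp add: l_distr r_distr m_ac a_ac)
      also have "\<dots> = b' \<otimes> e \<oplus> (d \<otimes> e \<oplus> p)"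
        unfolding h(3) p_def bd using eF eF' hF hF' d by (simp add: l_distr a_ac)
      finally have "b' \<otimes> e \<oplus> (d \<otimes> e \<oplus> p) = a' \<oplus> b' \<otimes> u" using h'(3) by simp
      also have "\<dots> = b' \<otimes> e \<oplus> (b' \<otimes> \<epsilon> \<oplus> a')"
        unfolding u_def using eF eF' hF' by (simp add: r_distr a_ac)
      finally show ?thesis using eF eF' hF' d pF by simp
    qed
    show ?thesis
    proof (cases "d \<in> m")
      case False
      have "e \<otimes> (d \<otimes> e \<oplus> p) = e \<otimes> p \<oplus> d \<otimes> (e \<otimes> e)" using eF' d pF by (simp add: r_distr m_ac a_ac)
      moreover have "e \<otimes> (d \<otimes> e \<oplus> p) = b' \<otimes> (\<epsilon> \<otimes> e) \<oplus> e \<otimes> a'"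
        unfolding key using eF eF' hF' by (simp add: r_distr m_ac a_ac)
      moreover have "b' \<otimes> (\<epsilon> \<otimes> e) \<oplus> e \<otimes> a' \<in> n"
        using smod_add[OF n] smod_smult[OF n h'(2) eE(2)] smod_smult[OF nE' eE(1)] am' mn by blast
      ultimately have "e \<otimes> p \<oplus> d \<otimes> (e \<otimes> e) \<in> n" by simp
      then have "d \<otimes> (e \<otimes> e) \<in> n"
        using smod_cancel[OF n subring smod_smult[OF nE' eE(1) pn]] eF' d by simp
      then show ?thesis using unit_n[OF d(1) False] eF' by simp
    next
      case True
      have "d \<otimes> e = e \<otimes> d" using eF' d by (simp add: m_comm)
      then have "d \<otimes> e \<in> n" using smod_smult[OF nE' eE(1)] True mn by auto
      then have "d \<otimes> e \<oplus> p \<in> n" using pn smod_add[OF n] by blast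
      then have "a' \<oplus> b' \<otimes> \<epsilon> \<in> n" unfolding key using eF hF' by (simp add: a_comm)
      then have "b' \<otimes> \<epsilon> \<in> n"
        using smod_cancel[OF n subring, of a' "b' \<otimes> \<epsilon>"] am' mn eF hF' by auto
      then have "b' \<in> m" using aeps h' by blast
      then have "b \<in> m" using bd True by simp
      moreover have "b \<otimes> e = e \<otimes> b" using eF' hF by (simp add: m_comm)
      ultimately have "b \<otimes> e \<in> n" using smod_smult[OF nE' eE(1)] mn by auto
      then show ?thesis using h(3) am mn smod_add[OF n] by auto
    qed
  qed
  have NN: "x \<otimes> x' \<in> n" if "x \<in> N" "x' \<in> N" for x x'
    using square_zero_mult[OF E RE EV nE' mn] that NE Nsq by blast
  have NR: "smod R N" using smod_mono[OF N RE] .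
  have NF: "x \<in> carrier F" if "x \<in> N" for x using that NE EF by blast
  have N1: "\<one> \<notin> N" using eps(2) eF by (simp add: N_def)
  \<comment> \<open>\<open>e\<close> is \<open>- r\<close> modulo \<open>N\<close> for a unit
    \<open>r\<close> of \<open>R\<close>. With \<open>f = e + 2 r\<close> the product
    \<open>e f = (e + r)^2 - r^2\<close> is a unit of \<open>R\<close> plus \<open>q y\<close> with
    \<open>q\<close> in \<open>m\<close>, to which \<open>perturbed_unit\<close> applies.\<close>
  have unit_E: "inv e \<in> E" "e \<noteq> \<zero>" if e: "e \<in> E" "e \<notin> N" for e
  proof -
    have eF': "e \<in> carrier F" using e EF by simp
    show e0: "e \<noteq> \<zero>" using e smod_zero[OF N] by blast
    obtain r where r: "r \<in> R" "e \<oplus> r \<in> N" using lam e by blast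
    have rF: "r \<in> carrier F" using r by simp
    have rm: "r \<notin> m"
    proof
      assume "r \<in> m"
      then have "r \<in> N" using mn Nn by blast
      moreover have "r \<oplus> e \<in> N" using r eF' rF by (simp add: a_comm)
      ultimately have "e \<in> N" using smod_cancel[OF NR subring _ eF'] by blast
      then show False using e by simp
    qed
    define f where "f = e \<oplus> r \<oplus> r"
    have f: "f \<in> E" "f \<in> carrier F" using e r RE Ecl eF' rF unfolding f_def by auto
    have "r \<otimes> r \<oplus> e \<otimes> f = (e \<oplus> r) \<otimes> (e \<oplus> r)"
      using eF' rF by (simp add: f_def l_distr r_distr m_ac a_ac)
    moreover have "(e \<oplus> r) \<otimes> (e \<oplus> r) \<in> n" using Nsq r by blast
    ultimately obtain p q where pq: "p \<in> m" "q \<in> m" "r \<otimes> r \<oplus> e \<otimes> f = p \<oplus> q \<otimes> y"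
      unfolding n_def by auto
    have pF: "p \<in> carrier F" "q \<in> carrier F" using pq by auto
    have "e \<otimes> f = \<ominus> (r \<otimes> r) \<oplus> (r \<otimes> r \<oplus> e \<otimes> f)" using eF' f rF by (simp add: r_neg1)
    then have ef: "e \<otimes> f = (p \<ominus> r \<otimes> r) \<oplus> q \<otimes> y"
      unfolding pq(3) using eF' f rF pF yF by (simp add: a_minus_def a_ac)
    have c: "p \<ominus> r \<otimes> r \<in> R" "p \<ominus> r \<otimes> r \<notin> m"
    proof -
      show "p \<ominus> r \<otimes> r \<in> R" using pq r by simp
      show "p \<ominus> r \<otimes> r \<notin> m"
      proof
        assume "p \<ominus> r \<otimes> r \<in> m"
        then have "p \<oplus> \<ominus> (p \<ominus> r \<otimes> r) \<in> m" using pq by simp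
        moreover have "p \<oplus> \<ominus> (p \<ominus> r \<otimes> r) = r \<otimes> r"
          using pF rF by (simp add: a_minus_def minus_add r_neg2)
        ultimately show False using m_prime[OF r(1) r(1)] rm by simp
      qed
    qed
    obtain a b where ab: "a \<in> R" "b \<in> R" "y \<otimes> y = a \<oplus> b \<otimes> y" using quadratic[OF y] .
    have "(q \<otimes> y) \<otimes> (q \<otimes> y) = (q \<otimes> q) \<otimes> (y \<otimes> y)" using pF yF by (simp add: m_ac)
    also have "\<dots> = (q \<otimes> q) \<otimes> a \<oplus> (q \<otimes> b) \<otimes> (q \<otimes> y)"
      unfolding ab(3) using pF yF ab(1,2) by (simp add: r_distr m_ac)
    finally have "\<exists>g\<in>gen2 (q \<otimes> y) (q \<otimes> y). ((p \<ominus> r \<otimes> r) \<oplus> q \<otimes> y) \<otimes> g = \<one>"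
      using perturbed_unit[OF c, of "q \<otimes> y"] pq ab pF yF by simp
    then obtain g where g: "g \<in> gen2 (q \<otimes> y) (q \<otimes> y)" "e \<otimes> f \<otimes> g = \<one>" using ef by auto
    have "q \<otimes> y \<in> E" using pq RE yE Ecl by auto
    then have gE: "g \<in> E" using gen2_minimal[OF ER subringE(3)[OF E]] g by blast
    then have "e \<otimes> (f \<otimes> g) = \<one>" "f \<otimes> g \<in> carrier F" using g eF' f EF by (auto simp: m_assoc)
    then have "inv e = f \<otimes> g" using comm_inv_char[OF eF'] by simp
    then show "inv e \<in> E" using Ecl f gE by simp
  qed
  \<comment> \<open>Otherwise the products that generate the unit ideal of \<open>E\<close> by
    stability would all lie in the proper ideal \<open>N\<close>.\<close>
  have "\<exists>c x. c \<in> carrier F \<and> x \<in> n \<and> (\<forall>x\<in>n. \<forall>w\<in>n. c \<otimes> x \<otimes> w \<in> n) \<and> c \<otimes> x \<notin> N"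
  proof (rule ccontr)
    assume no: "\<not> ?thesis"
    have "\<one> \<in> N"
    proof (rule invertible_fractional[OF n p0n p0(2) s(1,2) sn])
      show "smod {} N" using smod_mono[OF N] by simp
    qed (use no in blast)+
    then show False using N1 by simp
  qed
  then obtain c z where cz: "c \<in> carrier F" "z \<in> n" "\<And>x w. x \<in> n \<Longrightarrow> w \<in> n \<Longrightarrow> c \<otimes> x \<otimes> w \<in> n"
    "c \<otimes> z \<notin> N" by blast
  have cnE: "c \<otimes> x \<in> E" if "x \<in> n" for x using cz(1,3) that nF by (simp add: E_def)
  note czu = unit_E[OF cnE[OF cz(2)] cz(4)]
  have zF: "z \<in> carrier F" using cz nF by blast
  have z0: "z \<noteq> \<zero>" using czu(2) cz(1) by auto
  have zE: "\<exists>e\<in>E. w = z \<otimes> e" if w: "w \<in> n" for w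
  proof
    show "inv (c \<otimes> z) \<otimes> (c \<otimes> w) \<in> E" using Ecl czu cnE[OF w] by blast
    have "z \<otimes> (inv (c \<otimes> z) \<otimes> (c \<otimes> w)) = (inv (c \<otimes> z) \<otimes> (c \<otimes> z)) \<otimes> w"
      using zF cz(1) nF[OF w] EF[OF czu(1)] by (simp add: m_ac)
    then show "w = z \<otimes> (inv (c \<otimes> z) \<otimes> (c \<otimes> w))" using zF cz(1) czu(2) nF[OF w] by simp
  qed
  have eps0: "\<epsilon> \<noteq> \<zero>" using eps(2) smod_zero[OF n] by blast
  \<comment> \<open>The quotient \<open>w = x / z\<close> carries \<open>N\<close> into
    \<open>E\<close>, because \<open>N N \<subseteq> n = z E\<close>. If it carries \<open>N\<close>
    into \<open>N\<close>, it is integral. Otherwise \<open>w y'\<close> is a unit of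
    \<open>E\<close> for some \<open>y'\<close> in \<open>N\<close>, so \<open>N = y' E\<close> is
    principal; this is refuted by an integral element outside \<open>E\<close>.\<close>
  have Nz: "\<exists>v\<in>V. x = z \<otimes> v" if x: "x \<in> N" for x
  proof -
    have xF: "x \<in> carrier F" using NF x .
    define w where "w = inv z \<otimes> x"
    have wF: "w \<in> carrier F" using zF z0 xF by (simp add: w_def)
    have zw: "z \<otimes> w = x" using zF z0 xF by (simp add: w_def m_assoc[symmetric])
    have wN: "w \<otimes> x' \<in> E" if x': "x' \<in> N" for x'
    proof -
      obtain e where e: "e \<in> E" "x \<otimes> x' = z \<otimes> e" using zE[OF NN[OF x x']] by blast
      have "z \<otimes> (w \<otimes> x') = z \<otimes> e" using e zw zF wF NF[OF x'] by (simp add: m_assoc[symmetric])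
      then have "w \<otimes> x' = e" using m_lcancel[OF z0 zF] wF NF[OF x'] EF[OF e(1)] by simp
      then show ?thesis using e by simp
    qed
    have "\<forall>x'\<in>N. w \<otimes> x' \<in> N"
    proof (rule ccontr)
      assume "\<not> ?thesis"
      then obtain y' where y': "y' \<in> N" "w \<otimes> y' \<notin> N" by blast
      note u = unit_E[OF wN[OF y'(1)] y'(2)]
      have y'F: "y' \<in> carrier F" using NF y' by blast
      have y'0: "y' \<noteq> \<zero>" using u(2) wF by auto
      have prin: "\<exists>e\<in>E. x' = y' \<otimes> e" if x': "x' \<in> N" for x'
      proof
        show "inv (w \<otimes> y') \<otimes> (w \<otimes> x') \<in> E" using Ecl u wN[OF x'] by blast
        have "y' \<otimes> (inv (w \<otimes> y') \<otimes> (w \<otimes> x')) = (inv (w \<otimes> y') \<otimes> (w \<otimes> y')) \<otimes> x'"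
          using y'F wF NF[OF x'] EF[OF u(1)] by (simp add: m_ac)
        then show "x' = y' \<otimes> (inv (w \<otimes> y') \<otimes> (w \<otimes> x'))" using y'F wF u(2) NF[OF x'] by simp
      qed
      \<comment> \<open>Either \<open>v\<close> or \<open>y' v\<close> will do, because
        \<open>y'^2\<close> is in \<open>n\<close> and \<open>n v \<subseteq> E\<close>. Then
        \<open>y' v'\<close> is nilpotent modulo \<open>N\<close>, hence in \<open>N = y' E\<close>,
        which puts \<open>v'\<close> into \<open>E\<close> after all.\<close>
      have "\<exists>v'\<in>V. v' \<notin> E \<and> y' \<otimes> v' \<in> E"
      proof (cases "y' \<otimes> v \<in> E")
        case False
        have "y' \<otimes> (y' \<otimes> v) = (y' \<otimes> y') \<otimes> v" using y'F vF by (simp add: m_assoc)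
        then have "y' \<otimes> (y' \<otimes> v) \<in> E" using nv[OF Nsq[OF y'(1)]] by simp
        moreover have "y' \<otimes> v \<in> V" using subringE(6)[OF V_subring] y' NE EV v by blast
        ultimately show ?thesis using False by blast
      qed (use v in blast)
      then obtain v' where v': "v' \<in> V" "v' \<notin> E" "y' \<otimes> v' \<in> E" by blast
      obtain j :: nat where j: "(y' \<otimes> v') [^] j \<in> N"
        using integral_radical[OF v'(1) E RE N NE y'(1) v'(3)] by blast
      have "y' \<otimes> v' \<in> N"
      proof (rule ccontr)
        assume no: "y' \<otimes> v' \<notin> N"
        define g where "g = y' \<otimes> v'"
        have g: "g \<in> E" "inv g \<in> E" "g \<noteq> \<zero>" "g \<in> carrier F" using unit_E v'(3) no EF by (auto simp: g_def)
        have "\<one> \<in> N" if "g [^] i \<in> N" for i :: nat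
          using that
        proof (induction i)
          case (Suc i)
          have "inv g \<otimes> g [^] Suc i \<in> N" using smod_smult[OF N g(2) Suc.prems] .
          moreover have "inv g \<otimes> g [^] Suc i = g [^] i \<otimes> (inv g \<otimes> g)"
            using g(4) EF[OF g(2)] by (simp add: m_lcomm)
          then have "inv g \<otimes> g [^] Suc i = g [^] i" using g by simp
          ultimately show ?case using Suc.IH by simp
        qed simp
        then show False using j N1 by (simp add: g_def)
      qed
      then obtain e where "e \<in> E" "y' \<otimes> v' = y' \<otimes> e" using prin by blast
      then have "v' = e" using m_lcancel[OF y'0 y'F, of v' e] v'(1) EF by simp
      then show False using \<open>e \<in> E\<close> v'(2) by simp
    qed
    then have "w \<in> V"
      by (intro stabilizer_integral[OF NR epsN eps0 s0 _ wF]) (use sE NE in auto)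
    then show ?thesis using zw by blast
  qed
  have "\<exists>r\<in>R. \<exists>v\<in>V. y \<oplus> r = z \<otimes> v" using lam[OF yE] Nz by blast
  moreover have "\<exists>v\<in>V. w = z \<otimes> v" if "w \<in> n" for w using zE[OF that] EV by blast
  ultimately show ?thesis using cz(2) z0 by blast
qed

text \<open>The \<open>z\<close> found for \<open>y = \<zero>\<close> satisfies
  \<open>m \<subseteq> z V\<close>. The \<open>z'\<close> found for another \<open>y\<close> is an
  element of \<open>m + m y\<close> and therefore a \<open>V\<close>-multiple of \<open>z\<close>,
  so that one \<open>z\<close> serves all \<open>y\<close>.\<close>

lemma exists_hub: "\<exists>z. hub F R z"
proof -
  note V = subringE[OF V_subring]
  have Vm: "\<exists>v\<in>V. z \<otimes> a \<oplus> z \<otimes> b = z \<otimes> v" if "z \<in> V" "a \<in> V" "b \<in> V" for z a b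
    using that V(7)[of a b] by (intro bexI[of _ "a \<oplus> b"]) (auto simp: r_distr)
  have n0: "{w. \<exists>p\<in>m. \<exists>q\<in>m. w = p \<oplus> q \<otimes> \<zero>} = m"
  proof (rule Set.set_eqI)
    fix w
    have "w = w \<oplus> \<zero> \<otimes> \<zero>" if "w \<in> m" using that by simp
    then show "w \<in> {w. \<exists>p\<in>m. \<exists>q\<in>m. w = p \<oplus> q \<otimes> \<zero>} \<longleftrightarrow> w \<in> m" by auto
  qed
  have "\<exists>z\<in>m. z \<noteq> \<zero> \<and> (\<forall>w\<in>m. \<exists>v\<in>V. w = z \<otimes> v) \<and> (\<exists>r\<in>R. \<exists>v\<in>V. \<zero> \<oplus> r = z \<otimes> v)"
    by (rule residue_lift[OF R_V[OF R_closed(1)], unfolded n0])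
  then obtain z where z: "z \<in> m" "z \<noteq> \<zero>" and mz: "\<And>w. w \<in> m \<Longrightarrow> \<exists>v\<in>V. w = z \<otimes> v"
    by blast
  have zV: "z \<in> V" using z by auto
  have zF: "z \<in> carrier F" using zV by simp
  have res: "\<exists>r\<in>R. \<exists>v\<in>V. y = r \<oplus> z \<otimes> v" if y: "y \<in> V" for y
  proof -
    define n where "n = {w. \<exists>p\<in>m. \<exists>q\<in>m. w = p \<oplus> q \<otimes> y}"
    have "\<exists>z\<in>n. z \<noteq> \<zero> \<and> (\<forall>w\<in>n. \<exists>v\<in>V. w = z \<otimes> v) \<and> (\<exists>r\<in>R. \<exists>v\<in>V. y \<oplus> r = z \<otimes> v)"
      unfolding n_def by (rule residue_lift[OF y])
    then obtain z' where z': "z' \<in> n" and z'v: "\<exists>r\<in>R. \<exists>v\<in>V. y \<oplus> r = z' \<otimes> v" by auto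
    obtain p q where pq: "p \<in> m" "q \<in> m" "z' = p \<oplus> q \<otimes> y" using z' unfolding n_def by blast
    from mz[OF pq(1)] mz[OF pq(2)]
    obtain v1 v2 where v: "v1 \<in> V" "v2 \<in> V" "p = z \<otimes> v1" "q = z \<otimes> v2" by auto
    have z'z: "z' = z \<otimes> (v1 \<oplus> v2 \<otimes> y)" unfolding pq(3) v(3,4) using v(1,2) zF y by (simp add: r_distr m_assoc)
    obtain r w where r: "r \<in> R" "w \<in> V" "y \<oplus> r = z' \<otimes> w" using z'v by blast
    define u where "u = (v1 \<oplus> v2 \<otimes> y) \<otimes> w"
    have u: "u \<in> V" unfolding u_def by (intro V(6,7)) (use v r y in auto)
    have e: "y \<oplus> r = z \<otimes> u" using r v zF y unfolding z'z u_def by (simp add: m_assoc)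
    have "r \<oplus> y = z \<otimes> u" using e y r(1) by (simp add: a_comm)
    moreover have "y = \<ominus> r \<oplus> (r \<oplus> y)" using y r(1) by (simp add: r_neg1)
    ultimately have "y = \<ominus> r \<oplus> z \<otimes> u" by simp
    then show ?thesis using u r by blast
  qed
  have "hub F R z"
  proof (intro hub.intro val_quasi.intro hub_axioms.intro val_quasi_axioms.intro quasi_axioms)
    show "subring V F" by (rule V_subring)
    show "z \<in> m" "z \<noteq> \<zero>" by fact+
    show "\<exists>r\<in>R. \<exists>v\<in>V. y = r \<oplus> z \<otimes> v" if "y \<in> V" for y by (rule res[OF that])
    \<comment> \<open>The part \<open>r\<close> of \<open>x\<close> is a unit, since otherwise
      \<open>z\<close> would divide \<open>x\<close>; the rest \<open>z v\<close> satisfies a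
      quadratic equation with coefficients in \<open>m\<close>.\<close>
    show "inv x \<in> V" if x: "x \<in> V" "\<And>v. v \<in> V \<Longrightarrow> x \<noteq> z \<otimes> v" for x
    proof -
      obtain r v where r: "r \<in> R" "v \<in> V" "x = r \<oplus> z \<otimes> v" using res x by blast
      have rm: "r \<notin> m"
      proof
        assume "r \<in> m"
        then obtain v' where "v' \<in> V" "r = z \<otimes> v'" using mz by blast
        then show False using Vm[OF zV, of v' v] r x by blast
      qed
      obtain a b where ab: "a \<in> R" "b \<in> R" "v \<otimes> v = a \<oplus> b \<otimes> v" using quadratic[OF r(2)] .
      have "(z \<otimes> v) \<otimes> (z \<otimes> v) = (z \<otimes> z) \<otimes> (v \<otimes> v)" using zF r(2) by (simp add: m_ac)
      also have "\<dots> = (z \<otimes> z) \<otimes> a \<oplus> (z \<otimes> b) \<otimes> (z \<otimes> v)"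
        unfolding ab(3) using zF r(2) ab(1,2) by (simp add: r_distr m_ac)
      finally have "\<exists>g\<in>gen2 (z \<otimes> v) (z \<otimes> v). (r \<oplus> z \<otimes> v) \<otimes> g = \<one>"
        using perturbed_unit[OF r(1) rm, of "z \<otimes> v"] z ab zF r(2) by simp
      then obtain g where g: "g \<in> gen2 (z \<otimes> v) (z \<otimes> v)" "x \<otimes> g = \<one>" using r by auto
      have "smod R V" by (intro smodI V(2,6,7)) auto
      then have "gen2 (z \<otimes> v) (z \<otimes> v) \<subseteq> V"
        by (rule gen2_minimal) (intro V(3,6) zV r(2))+
      then have "g \<in> V" using g by blast
      moreover have "inv x = g" using g x \<open>g \<in> V\<close> by (intro comm_inv_char) auto
      ultimately show ?thesis by simp
    qed
    \<comment> \<open>Some \<open>z^k\<close> is a multiple of \<open>s x\<close>. If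
      \<open>z^(k+1)\<close> divided \<open>x\<close>, then \<open>z\<close> would be a unit of
      \<open>V\<close>.\<close>
    show "\<exists>k::nat. \<forall>v\<in>V. x \<noteq> z [^] k \<otimes> v" if x: "x \<in> V" "x \<noteq> \<zero>" for x
    proof -
      have xF: "x \<in> carrier F" using x by simp
      obtain s where s: "s \<in> R" "s \<noteq> \<zero>" "s \<otimes> x \<in> R" using denom[OF xF] by blast
      have "s \<otimes> x \<noteq> \<zero>" using s x by (auto simp: integral_iff)
      then obtain k :: nat and a where k: "a \<in> R" "z [^] k = (s \<otimes> x) \<otimes> a"
        using power_in_principal[OF z(1) s(3)] by blast
      have "x \<noteq> z [^] Suc k \<otimes> v" if v: "v \<in> V" for v
      proof
        assume e: "x = z [^] Suc k \<otimes> v"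
        define w where "w = s \<otimes> (v \<otimes> a)"
        have w: "w \<in> V" unfolding w_def by (intro V(6)) (use s k v in auto)
        have "z [^] k = (s \<otimes> (z [^] Suc k \<otimes> v)) \<otimes> a" using k(2) e by simp
        also have "\<dots> = z [^] k \<otimes> (z \<otimes> w)" using s v k(1) zF by (simp add: w_def m_ac)
        finally have "z [^] k \<otimes> \<one> = z [^] k \<otimes> (z \<otimes> w)" using zF by simp
        moreover have "z [^] k \<noteq> \<zero>" by (induction k) (use z zF in \<open>auto simp: integral_iff\<close>)
        ultimately have "\<one> = z \<otimes> w" using m_lcancel[of "z [^] k" \<one> "z \<otimes> w"] zF w by simp
        then show False using m_V_nonunit[OF z(1) w] one_notin_m R_closed(2) by metis
      qed
      then show ?thesis by blast
    qed
    show "x \<otimes> y \<in> J" if "x \<in> V" "y \<in> V" "smod R J" "\<one> \<in> J" "x \<in> J" "y \<in> J" for x y J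
    proof -
      have c: "x \<in> carrier F" "y \<in> carrier F" using that by auto
      have "x \<otimes> y \<in> gen2 x y" by (rule gen2_ring(1)[OF that(1,2) gen2_gens(2,3)[OF c]])
      then show ?thesis using gen2_minimal[OF that(3-6)] by blast
    qed
  qed
  then show ?thesis by blast
qed

end

section \<open>Krull dimension and stability in terms of fractional ideals\<close>

context quasi
begin

lemma primeideal_quasilocal:
  assumes "primeideal P A" shows "P \<subseteq> m" "P \<noteq> {}" "\<zero> \<in> P" "primeideal {\<zero>} A" "primeideal m A"
proof -
  interpret A: domain A by (rule domain_A)
  have P: "P \<subseteq> R" "smod R P" using primeideal.axioms(1)[OF assms] ideal_A_iff by auto
  have n1: "\<one> \<notin> P"
    using ideal.one_imp_carrier[OF primeideal.axioms(1)[OF assms]] primeideal.I_notcarr[OF assms] by auto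
  show "P \<subseteq> m"
  proof
    fix x assume x: "x \<in> P"
    show "x \<in> m"
    proof (rule ccontr)
      assume n: "x \<notin> m"
      then have u: "inv x \<in> R" "x \<noteq> \<zero>" using unit_R x P by auto
      then have "inv x \<otimes> x \<in> P" using smod_smult[OF P(2)] x by blast
      then show False using u x P n1 by auto
    qed
  qed
  show "\<zero> \<in> P" using smod_zero[OF P(2)] .
  then show "P \<noteq> {}" by auto
  show "primeideal {\<zero>} A" using A.zeroprimeideal by simp
  show "primeideal m A" using A.maximalideal_prime[OF m_max] .
qed

text \<open>In a quasilocal domain \<open>{\<zero>}\<close> is the least and \<open>m\<close> the
  largest prime ideal, so length one means that they differ and that nothing lies strictly between
  them.\<close>

lemma krull_dim_one_iff:
  "krull_dim A = 1 \<longleftrightarrow> m \<noteq> {\<zero>} \<and> (\<forall>P. primeideal P A \<longrightarrow> P \<noteq> {\<zero>} \<longrightarrow> P = m)"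
proof -
  let ?S = "{n. \<exists>P. (\<forall>i\<le>n. primeideal (P i) A) \<and> (\<forall>i<n. P i \<subset> P (Suc i))}"
  interpret A: domain A by (rule domain_A)
  have z: "primeideal {\<zero>} A" using A.zeroprimeideal by simp
  have mp: "primeideal m A" using A.maximalideal_prime[OF m_max] .
  note sub = primeideal_quasilocal
  have le: "enat n \<le> krull_dim A" if "n \<in> ?S" for n
    unfolding krull_dim_def using that by (intro SUP_upper) auto
  show ?thesis
  proof
    assume k: "krull_dim A = 1"
    have "m \<noteq> {\<zero>}"
    proof
      assume m0: "m = {\<zero>}"
      have "n = 0" if n: "n \<in> ?S" for n
      proof (rule ccontr)
        assume n0: "n \<noteq> 0"
        obtain P :: "nat \<Rightarrow> 'a set" where P: "\<forall>i\<le>n. primeideal (P i) A" "\<forall>i<n. P i \<subset> P (Suc i)"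
          using n by auto
        have "primeideal (P 0) A" "primeideal (P 1) A" "P 0 \<subset> P 1" using P n0 by auto
        then show False using sub(1)[of "P 1"] sub(3)[of "P 0"] m0 by auto
      qed
      then have "krull_dim A \<le> 0" unfolding krull_dim_def
        by (intro SUP_least) (auto simp: zero_enat_def)
      then show False using k by simp
    qed
    moreover have "P = m" if P: "primeideal P A" "P \<noteq> {\<zero>}" for P
    proof (rule ccontr)
      assume n: "P \<noteq> m"
      let ?f = "\<lambda>i::nat. if i = 0 then {\<zero>} else if i = 1 then P else m"
      have "{\<zero>} \<subset> P" "P \<subset> m" using n P(2) sub(1,3)[OF P(1)] by auto
      then have c1: "\<forall>i<2. ?f i \<subset> ?f (Suc i)" by (simp add: less_2_cases_iff)
      have c2: "\<forall>i\<le>2. primeideal (?f i) A" using z mp P by simp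
      have "2 \<in> ?S" by (rule CollectI, rule exI[of _ ?f], rule conjI[OF c2 c1])
      from le[OF this] show False unfolding k by (simp add: one_enat_def)
    qed
    ultimately show "m \<noteq> {\<zero>} \<and> (\<forall>P. primeideal P A \<longrightarrow> P \<noteq> {\<zero>} \<longrightarrow> P = m)" by blast
  next
    assume a: "m \<noteq> {\<zero>} \<and> (\<forall>P. primeideal P A \<longrightarrow> P \<noteq> {\<zero>} \<longrightarrow> P = m)"
    let ?f = "\<lambda>i::nat. if i = 0 then {\<zero>} else m"
    have "{\<zero>} \<subset> m" using a sub(3)[OF mp] by blast
    then have c1: "\<forall>i<1. ?f i \<subset> ?f (Suc i)" by simp
    have c2: "\<forall>i\<le>1. primeideal (?f i) A" using z mp by simp
    have "1 \<in> ?S" by (rule CollectI, rule exI[of _ ?f], rule conjI[OF c2 c1])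
    from le[OF this] have "1 \<le> krull_dim A" by (simp add: one_enat_def)
    moreover have "krull_dim A \<le> 1"
      unfolding krull_dim_def
    proof (rule SUP_least)
      fix n assume "n \<in> ?S"
      then obtain P :: "nat \<Rightarrow> 'a set" where P: "\<forall>i\<le>n. primeideal (P i) A" "\<forall>i<n. P i \<subset> P (Suc i)" by auto
      have "\<not> 2 \<le> n"
      proof
        assume n: "2 \<le> n"
        have s: "P 0 \<subset> P 1" "P 1 \<subset> P 2" using P(2) n by (auto simp: numeral_2_eq_2)
        have p: "primeideal (P 0) A" "primeideal (P 1) A" "primeideal (P 2) A" using P(1) n by auto
        have "P 1 \<noteq> {\<zero>}" using s sub(3)[OF p(1)] by auto
        then have "P 1 = m" using a p by blast
        then show False using s sub(1)[OF p(3)] by auto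
      qed
      then show "enat n \<le> 1" by (simp add: one_enat_def)
    qed
    ultimately show "krull_dim A = 1" by (rule antisym[rotated])
  qed
qed

end

section \<open>Stability as invertibility over the endomorphism ring\<close>

context frac_field
begin

lemma mult_module_hom_iff:
  "f \<in> module_hom A (mult_module A I) (mult_module A I) \<longleftrightarrow>
    f \<in> I \<rightarrow> I \<and> (\<forall>x\<in>I. \<forall>y\<in>I. f (x \<oplus> y) = f x \<oplus> f y) \<and> (\<forall>r\<in>R. \<forall>x\<in>I. f (r \<otimes> x) = r \<otimes> f x)"
  by (simp add: module_hom_def mult_module_def)

lemma endo_ring_sel:
  "carrier (endo_ring A (mult_module A I)) =
    {f \<in> extensional I. f \<in> I \<rightarrow> I \<and> (\<forall>x\<in>I. \<forall>y\<in>I. f (x \<oplus> y) = f x \<oplus> f y) \<and>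
      (\<forall>r\<in>R. \<forall>x\<in>I. f (r \<otimes> x) = r \<otimes> f x)}"
  "f \<otimes>\<^bsub>endo_ring A (mult_module A I)\<^esub> g = compose I f g"
  "\<zero>\<^bsub>endo_ring A (mult_module A I)\<^esub> = (\<lambda>x\<in>I. \<zero>)"
  "f \<oplus>\<^bsub>endo_ring A (mult_module A I)\<^esub> g = (\<lambda>x\<in>I. f x \<oplus> g x)"
  using mult_module_hom_iff[of _ I]
  by (auto simp: endo_ring_def) (simp_all add: mult_module_def)

lemma endo_module_sel:
  "carrier (endo_module (mult_module A I)) = I"
  "add (endo_module (mult_module A I)) = add F"
  "f \<odot>\<^bsub>endo_module (mult_module A I)\<^esub> x = f x"
  by (simp_all add: endo_module_def mult_module_def)

text \<open>A dual basis argument. The coordinate \<open>b\<close> of the splitting \<open>i\<close>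
  sends \<open>x\<close> to the multiplication by \<open>q b \<otimes> x\<close>. The identity
  \<open>p (i x0) = x0\<close>, divided by \<open>x0\<close>, then writes \<open>\<one>\<close> as
  the sum of the \<open>q b \<otimes> p (\<delta> b)\<close>, all of which are in
  \<open>D\<close>.\<close>

lemma stable_ideal_invertible:
  assumes I: "ideal I A" "x0 \<in> I" "x0 \<noteq> \<zero>" and st: "stable_ideal A I" and D: "smod {} D"
    and h: "\<And>q x. q \<in> carrier F \<Longrightarrow> x \<in> I \<Longrightarrow> (\<And>x w. x \<in> I \<Longrightarrow> w \<in> I \<Longrightarrow> q \<otimes> x \<otimes> w \<in> I) \<Longrightarrow> q \<otimes> x \<in> D"
  shows "\<one> \<in> D"
proof -
  have IR: "I \<subseteq> R" and Is: "smod R I" using I(1) ideal_A_iff by auto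
  have IF: "x \<in> carrier F" if "x \<in> I" for x using smod_carrier[OF Is that] .
  define H where "H = endo_ring A (mult_module A I)"
  define M where "M = endo_module (mult_module A I)"
  let ?free = "\<lambda>B::'a set. direct_sum_module B (\<lambda>_. mult_module H (carrier H))"
  have "\<exists>B. \<exists>i \<in> module_hom H M (?free B). \<exists>p \<in> module_hom H (?free B) M. \<forall>x\<in>carrier M. p (i x) = x"
    using st unfolding stable_ideal_def projective_module_def H_def M_def Let_def .
  then obtain B where "\<exists>i \<in> module_hom H M (?free B). \<exists>p \<in> module_hom H (?free B) M. \<forall>x\<in>carrier M. p (i x) = x" ..
  then obtain i p where i: "i \<in> module_hom H M (?free B)" and p: "p \<in> module_hom H (?free B) M"
    and pi: "\<forall>x\<in>carrier M. p (i x) = x" by blast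
  note M = endo_module_sel[of I, folded M_def]
  note H = endo_ring_sel[of I, folded H_def]
  define C where "C = {f \<in> B \<rightarrow>\<^sub>E carrier H. finite {b \<in> B. f b \<noteq> (\<lambda>x\<in>I. \<zero>)}}"
  have free: "carrier (?free B) = C" "\<And>f g. f \<oplus>\<^bsub>?free B\<^esub> g = (\<lambda>b\<in>B. \<lambda>x\<in>I. f b x \<oplus> g b x)"
    "\<And>r f. r \<odot>\<^bsub>?free B\<^esub> f = (\<lambda>b\<in>B. compose I r (f b))"
    by (simp_all add: direct_sum_module_def C_def mult_module_def H(2-4))
  have iI: "i x \<in> C" if "x \<in> I" for x using i that unfolding module_hom_def M free by auto
  have iH: "i (f x) = (\<lambda>b\<in>B. compose I f (i x b))" if "f \<in> carrier H" "x \<in> I" for f x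
    using i that unfolding module_hom_def M free by auto
  have pC: "p f \<in> I" if "f \<in> C" for f using p that unfolding module_hom_def M free by auto
  have padd: "p (\<lambda>b\<in>B. \<lambda>x\<in>I. f b x \<oplus> g b x) = p f \<oplus> p g" if "f \<in> C" "g \<in> C" for f g
    using p that unfolding module_hom_def M free by auto
  have pH: "p (\<lambda>b\<in>B. compose I r (f b)) = r (p f)" if "r \<in> carrier H" "f \<in> C" for r f
    using p that unfolding module_hom_def M free by auto
  have Hm: "f x \<in> I" "f (r \<otimes> x) = r \<otimes> f x" if "f \<in> carrier H" "x \<in> I" "r \<in> R" for f x r
    using that by (auto simp: H(1))
  have H0: "f \<zero> = \<zero>" if "f \<in> carrier H" for f
    using Hm(2)[OF that, of \<zero> \<zero>] Hm(1)[OF that, of \<zero> \<zero>] smod_zero[OF Is] IF by simp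
  have Hext: "f \<in> extensional I" if "f \<in> carrier H" for f using that by (simp add: H(1))
  have zH: "(\<lambda>x\<in>I. \<zero>) \<in> carrier H"
    using smod_zero[OF Is] smod_add[OF Is] smod_smult[OF Is] by (auto simp: H(1))
  have oneH: "(\<lambda>x\<in>I. x) \<in> carrier H"
    using smod_add[OF Is] smod_smult[OF Is] by (auto simp: H(1))
  have mulH: "(\<lambda>x\<in>I. r \<otimes> x) \<in> carrier H" if "r \<in> R" for r
    using smod_add[OF Is] smod_smult[OF Is] IF that
    by (auto simp: H(1) r_distr m_lcomm)
  define \<delta> where "\<delta> b = (\<lambda>b'\<in>B. if b' = b then (\<lambda>x\<in>I. x) else (\<lambda>x\<in>I. \<zero>))" for b
  have dC: "\<delta> b \<in> C" if "b \<in> B" for b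
  proof -
    have "finite {b' \<in> B. \<delta> b b' \<noteq> (\<lambda>x\<in>I. \<zero>)}"
      by (rule finite_subset[of _ "{b}"]) (auto simp: \<delta>_def)
    then show ?thesis using zH oneH by (auto simp: C_def \<delta>_def)
  qed
  \<comment> \<open>Expansion in the unit vectors \<open>\<delta> b\<close>. As \<open>p\<close> is
    only known to be additive and linear over \<open>H\<close>, the support of \<open>f\<close> is
    removed one coordinate at a time.\<close>
  have pf: "finite T \<Longrightarrow> T \<subseteq> B \<Longrightarrow> f \<in> C \<Longrightarrow> {b \<in> B. f b \<noteq> (\<lambda>x\<in>I. \<zero>)} \<subseteq> T \<Longrightarrow>
      p f = (\<Oplus>b\<in>T. f b (p (\<delta> b)))" for f T
  proof (induction T arbitrary: f rule: finite_induct)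
    case empty
    have "f = (\<lambda>b\<in>B. compose I (\<lambda>x\<in>I. \<zero>) (f b))"
    proof
      fix b show "f b = (\<lambda>b\<in>B. compose I (\<lambda>x\<in>I. \<zero>) (f b)) b"
        using empty.prems smod_zero[OF Is] by (auto simp: C_def compose_def PiE_def extensional_def fun_eq_iff)
    qed
    then have "p f = (\<lambda>x\<in>I. \<zero>) (p f)" using pH[OF zH empty.prems(2)] by simp
    then show ?case using pC[OF empty.prems(2)] by simp
  next
    case (insert b T)
    define f' where "f' = f(b := (\<lambda>x\<in>I. \<zero>))"
    have b: "b \<in> B" using insert by auto
    have fbH: "f c \<in> carrier H" if "c \<in> B" for c using insert.prems(2) that by (auto simp: C_def)
    have sub: "{c \<in> B. f' c \<noteq> (\<lambda>x\<in>I. \<zero>)} \<subseteq> T" 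
    proof
      fix c assume c: "c \<in> {c \<in> B. f' c \<noteq> (\<lambda>x\<in>I. \<zero>)}"
      then have cb: "c \<noteq> b" unfolding f'_def by (auto simp only: fun_upd_same mem_Collect_eq)
      then have "f' c = f c" by (simp add: f'_def)
      then have "c \<in> {b \<in> B. f b \<noteq> (\<lambda>x\<in>I. \<zero>)}" using c by (simp only: mem_Collect_eq simp_thms)
      from subsetD[OF insert.prems(3) this] show "c \<in> T" using cb by simp
    qed
    have f': "f' \<in> C"
      using insert.prems(2) zH b finite_subset[OF sub insert.hyps(1)]
      by (auto simp: C_def f'_def PiE_def extensional_def)
    have g: "(\<lambda>c\<in>B. compose I (f b) (\<delta> b c)) \<in> C"
    proof -
      have c: "compose I (f b) (\<delta> b c) = (if c = b then f b else (\<lambda>x\<in>I. \<zero>))" if "c \<in> B" for c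
        using that Hext[OF fbH[OF b]] H0[OF fbH[OF b]]
        by (auto simp: \<delta>_def compose_def extensional_def fun_eq_iff)
      have "finite {c \<in> B. (\<lambda>c\<in>B. compose I (f b) (\<delta> b c)) c \<noteq> (\<lambda>x\<in>I. \<zero>)}"
        by (rule finite_subset[of _ "{b}"]) (auto simp: c)
      then show ?thesis using zH fbH b by (auto simp: C_def c)
    qed
    have "f = (\<lambda>c\<in>B. \<lambda>x\<in>I. f' c x \<oplus> (\<lambda>c\<in>B. compose I (f b) (\<delta> b c)) c x)"
    proof
      fix c
      show "f c = (\<lambda>c\<in>B. \<lambda>x\<in>I. f' c x \<oplus> (\<lambda>c\<in>B. compose I (f b) (\<delta> b c)) c x) c"
      proof (cases "c \<in> B")
        case False
        then show ?thesis using insert.prems(2) by (auto simp: C_def PiE_def extensional_def)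
      next
        case True
        have v: "f c x \<in> carrier F" if "x \<in> I" for x using Hm(1)[OF fbH[OF True] that, of \<zero>] IF by simp
        show ?thesis using True v Hext[OF fbH[OF True]] H0[OF fbH[OF b]] b
          by (auto simp: f'_def \<delta>_def compose_def extensional_def fun_eq_iff)
      qed
    qed
    then have "p f = p f' \<oplus> p (\<lambda>c\<in>B. compose I (f b) (\<delta> b c))" using padd[OF f' g] by simp
    also have "p (\<lambda>c\<in>B. compose I (f b) (\<delta> b c)) = f b (p (\<delta> b))" by (rule pH[OF fbH[OF b] dC[OF b]])
    also have "p f' = (\<Oplus>c\<in>T. f' c (p (\<delta> c)))" using insert.IH[OF _ f' sub] insert.prems(1) by simp
    also have "\<dots> = (\<Oplus>c\<in>T. f c (p (\<delta> c)))"
    proof (rule finsum_cong')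
      show "(\<lambda>c. f c (p (\<delta> c))) \<in> T \<rightarrow> carrier F"
        using insert.prems(1) Hm(1)[OF fbH _ R_closed(1)] pC dC IF by auto
    qed (use insert.hyps in \<open>auto simp: f'_def\<close>)
    finally have e: "p f = (\<Oplus>c\<in>T. f c (p (\<delta> c))) \<oplus> f b (p (\<delta> b))" .
    have v: "f c (p (\<delta> c)) \<in> carrier F" if "c \<in> insert b T" for c
    proof -
      have "c \<in> B" using that insert.prems(1) by blast
      then show ?thesis using Hm(1)[OF fbH _ R_closed(1)] pC[OF dC] IF by blast
    qed
    then have "(\<Oplus>c\<in>T. f c (p (\<delta> c))) \<in> carrier F" by (intro finsum_closed) auto
    then show ?case using e v insert.hyps by (subst finsum_insert) (auto simp: a_comm)
  qed
  define f where "f = i x0"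
  have fC: "f \<in> C" using iI I(2) by (simp add: f_def)
  define T where "T = {b \<in> B. f b \<noteq> (\<lambda>x\<in>I. \<zero>)}"
  have T: "finite T" "T \<subseteq> B" using fC by (auto simp: T_def C_def)
  have fH: "f b \<in> carrier H" if "b \<in> B" for b using fC that by (auto simp: C_def)
  have x0F: "x0 \<in> carrier F" "x0 \<in> R" using I IF IR by auto
  \<comment> \<open>By linearity over \<open>R\<close> every endomorphism of \<open>I\<close> is the
    multiplication by an element of \<open>F\<close>; for \<open>f b\<close> this element is
    \<open>x0 \<otimes> q b\<close>.\<close>
  define q where "q b = inv (x0 \<otimes> x0) \<otimes> f b x0" for b
  have fx0: "f b x0 \<in> carrier F" if "b \<in> B" for b using Hm(1)[OF fH[OF that] I(2) R_closed(1)] IF by simp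
  have xx: "x0 \<otimes> x0 \<noteq> \<zero>" "x0 \<otimes> x0 \<in> carrier F" using I x0F by (auto simp: integral_iff)
  have qF: "q b \<in> carrier F" if "b \<in> B" for b using fx0[OF that] xx by (simp add: q_def)
  have qx: "(x0 \<otimes> x0) \<otimes> q b = f b x0" if "b \<in> B" for b
    using fx0[OF that] xx by (simp add: q_def m_assoc[symmetric])
  have fw: "f b w = x0 \<otimes> (q b \<otimes> w)" if b: "b \<in> B" and w: "w \<in> I" for b w
  proof -
    have wF: "w \<in> carrier F" "w \<in> R" using w IF IR by auto
    have fwF: "f b w \<in> carrier F" using Hm(1)[OF fH[OF b] w R_closed(1)] IF by simp
    have "x0 \<otimes> f b w = f b (x0 \<otimes> w)" using Hm(2)[OF fH[OF b] w x0F(2)] by simp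
    also have "\<dots> = f b (w \<otimes> x0)" using x0F wF by (simp add: m_comm)
    also have "\<dots> = w \<otimes> f b x0" using Hm(2)[OF fH[OF b] I(2) wF(2)] .
    also have "\<dots> = x0 \<otimes> (x0 \<otimes> (q b \<otimes> w))" unfolding qx[OF b, symmetric] using x0F wF qF[OF b] by (simp add: m_ac)
    finally show ?thesis using m_lcancel[OF I(3) x0F(1) fwF] x0F wF qF[OF b] by simp
  qed
  \<comment> \<open>Applying \<open>i\<close> to \<open>x x0 = x0 x\<close> shows
    \<open>x (f b w) = x0 (i x b w)\<close>. So \<open>i x b\<close> is the multiplication by
    \<open>q b \<otimes> x\<close>, and it maps \<open>I\<close> to \<open>I\<close>.\<close>
  have qI: "q b \<otimes> x \<otimes> w \<in> I" if b: "b \<in> B" and x: "x \<in> I" and w: "w \<in> I" for b x w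
  proof -
    have xw: "x \<in> carrier F" "w \<in> carrier F" "x \<in> R" "w \<in> R" using x w IF IR by auto
    have ixC: "i x b \<in> carrier H" using iI[OF x] b by (auto simp: C_def)
    have ixw: "i x b w \<in> I" using Hm(1)[OF ixC w R_closed(1)] .
    have "i ((\<lambda>y\<in>I. x \<otimes> y) x0) b w = x \<otimes> i x0 b w"
      using iH[OF mulH[OF xw(3)] I(2)] b w Hm(1)[OF fH[OF b] w R_closed(1)] by (simp add: compose_def f_def)
    moreover have "i ((\<lambda>y\<in>I. x0 \<otimes> y) x) b w = x0 \<otimes> i x b w"
      using iH[OF mulH[OF x0F(2)] x] b w ixw by (simp add: compose_def)
    moreover have "x \<otimes> x0 = x0 \<otimes> x" using xw x0F by (simp add: m_comm)
    ultimately have "x0 \<otimes> i x b w = x \<otimes> f b w" using I(2) x by (simp add: f_def)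
    also have "\<dots> = x0 \<otimes> (q b \<otimes> x \<otimes> w)" unfolding fw[OF b w] using x0F xw qF[OF b] by (simp add: m_ac)
    finally have "i x b w = q b \<otimes> x \<otimes> w" using m_lcancel[OF I(3) x0F(1)] IF[OF ixw] xw qF[OF b] by simp
    then show ?thesis using ixw by simp
  qed
  have dI: "p (\<delta> b) \<in> I" if "b \<in> B" for b using pC dC that by blast
  have qD: "q b \<otimes> p (\<delta> b) \<in> D" if "b \<in> T" for b
    using that T by (intro h qF dI qI) auto
  define g where "g = (\<Oplus>b\<in>T. q b \<otimes> p (\<delta> b))"
  have gD: "g \<in> D" unfolding g_def by (rule smod_finsum[OF D qD])
  have cl: "(\<lambda>b. q b \<otimes> p (\<delta> b)) \<in> T \<rightarrow> carrier F" using qD smod_carrier[OF D] by blast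
  have "x0 = p f" using pi I(2) M by (simp add: f_def)
  also have "\<dots> = (\<Oplus>b\<in>T. f b (p (\<delta> b)))" using pf[OF T fC] by (simp add: T_def)
  also have "\<dots> = (\<Oplus>b\<in>T. x0 \<otimes> (q b \<otimes> p (\<delta> b)))"
    using cl x0F fw dI T by (intro finsum_cong') auto
  also have "\<dots> = x0 \<otimes> g" unfolding g_def using finsum_rdistr[OF T(1) x0F(1) cl] by simp
  finally have "x0 \<otimes> \<one> = x0 \<otimes> g" using x0F by simp
  then have "\<one> = g" using m_lcancel[OF I(3) x0F(1), of \<one> g] smod_carrier[OF D gD] by simp
  then show ?thesis using gD by simp
qed

end

lemma (in module) submodule_iff:
  "submodule H R M \<longleftrightarrow> H \<subseteq> carrier M \<and> \<zero>\<^bsub>M\<^esub> \<in> H \<and> (\<forall>a\<in>H. \<forall>b\<in>H. a \<oplus>\<^bsub>M\<^esub> b \<in> H) \<and>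
    (\<forall>a\<in>carrier R. \<forall>x\<in>H. a \<odot>\<^bsub>M\<^esub> x \<in> H)" (is "_ \<longleftrightarrow> ?r")
proof
  assume H: "submodule H R M"
  have "\<zero>\<^bsub>M\<^esub> \<in> H" using subgroup.one_closed[OF submodule.axioms(1)[OF H]] by simp
  then show ?r using submoduleE[OF H] by auto
next
  assume r: ?r
  have "\<ominus>\<^bsub>M\<^esub> x \<in> H" if x: "x \<in> H" for x
  proof -
    have "(\<ominus> \<one>) \<odot>\<^bsub>M\<^esub> x \<in> H" using r x by simp
    moreover have "(\<ominus> \<one>) \<odot>\<^bsub>M\<^esub> x = \<ominus>\<^bsub>M\<^esub> x" using smult_l_minus[of \<one> x] r x by auto
    ultimately show ?thesis by simp
  qed
  then show "submodule H R M" using r by (intro submoduleI) auto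
qed

context frac_field
begin

lemma module_mult_module:
  assumes L: "smod R L"
  shows "module A (mult_module F L)"
proof (rule moduleI)
  note c = smod_carrier[OF L]
  let ?M = "mult_module F L"
  show "cring A" by (rule cring_A)
  show "abelian_group ?M"
  proof (rule abelian_groupI)
    fix x assume "x \<in> carrier ?M"
    then have x: "x \<in> L" by (simp add: mult_module_def)
    then show "\<exists>y\<in>carrier ?M. y \<oplus>\<^bsub>?M\<^esub> x = \<zero>\<^bsub>?M\<^esub>"
      using smod_neg[OF L subring x] c by (auto simp: mult_module_def l_neg intro!: bexI[of _ "\<ominus> x"])
  qed (use c smod_zero[OF L] smod_add[OF L] in \<open>auto simp: mult_module_def a_ac\<close>)
qed (use smod_carrier[OF L] smod_smult[OF L] in \<open>auto simp: mult_module_def l_distr r_distr m_assoc\<close>)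

lemma submodule_mult_module_iff:
  assumes L: "smod R L"
  shows "submodule N A (mult_module F L) \<longleftrightarrow> N \<subseteq> L \<and> smod R N"
  using smod_carrier[OF L] unfolding module.submodule_iff[OF module_mult_module[OF L]]
  by (auto simp: smod_def mult_module_def)

end

lemma (in quasi) bad_noetherian_imp_bad:
  assumes "bad_noetherian_stable_domain F R"
  shows "bad F R"
proof -
  have b: "stable_domain A" "krull_dim A = 1" "\<not> finite_normalization F R" "noetherian_ring A"
    using assms by (auto simp: bad_noetherian_stable_domain_def bad_stable_domain_def)
  note k = b(2)[unfolded krull_dim_one_iff]
  show ?thesis
  proof (intro bad.intro noeth1.intro noeth.intro noeth_axioms.intro noeth1_axioms.intro
      bad_axioms.intro frac_field_axioms quasi_axioms)
    show "noetherian_ring A" by (rule b(4))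
    show "m \<noteq> {\<zero>}" using k ..
    show "P = m" if "primeideal P A" "P \<noteq> {\<zero>}" for P using k that by blast
    show "\<one> \<in> D" if I: "ideal I A" "I \<noteq> {\<zero>}" and D: "smod {} D"
      and h: "\<And>q x. q \<in> carrier F \<Longrightarrow> x \<in> I \<Longrightarrow> (\<And>x w. x \<in> I \<Longrightarrow> w \<in> I \<Longrightarrow> q \<otimes> x \<otimes> w \<in> I) \<Longrightarrow> q \<otimes> x \<in> D"
    for I D
    proof -
      have "\<zero> \<in> I" using I(1) ideal_A_iff smod_zero by blast
      then obtain x0 where "x0 \<in> I" "x0 \<noteq> \<zero>" using I(2) by blast
      moreover have "stable_ideal A I" using b(1) I by (auto simp: stable_domain_def)
      ultimately show ?thesis using stable_ideal_invertible[OF I(1) _ _ _ D h] by blast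
    qed
    show "\<exists>N\<subseteq>V. smod R N \<and> S \<subseteq> N \<and> N \<noteq> V" if S: "S \<subseteq> V" "finite S" for S
    proof -
      have c: "carrier (mult_module F V) = V" by (simp add: mult_module_def)
      obtain N where N: "submodule N A (mult_module F V)" "S \<subseteq> N" "N \<noteq> V"
        using b(3) S unfolding finite_normalization_def fg_module_def c by blast
      have g: "subgroup N (add_monoid (mult_module F V))" using N(1) by (rule submodule.axioms)
      have NV: "N \<subseteq> V" using subgroup.subset[OF g] by (simp add: c)
      moreover have "smod R N"
      proof (rule smodI)
        show "\<zero> \<in> N" using subgroup.one_closed[OF g] by (simp add: mult_module_def)
        show "x \<oplus> y \<in> N" if "x \<in> N" "y \<in> N" for x y
          using subgroup.m_closed[OF g that] by (simp add: mult_module_def)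
        show "r \<otimes> x \<in> N" if "r \<in> R" "x \<in> N" for r x
          using submodule.smult_closed[OF N(1), of r x] that by (simp add: mult_module_def)
      qed (use NV in auto)
      ultimately show ?thesis using N by blast
    qed
  qed
qed

section \<open>Embedding dimension\<close>

context frac_field
begin

definition msum :: "'a set \<Rightarrow> 'a set \<Rightarrow> 'a set" where
  "msum P L = {x. \<exists>a\<in>P. \<exists>b\<in>L. x = a \<oplus> b}"

lemma smod_msum:
  assumes P: "smod R P" and L: "smod R L"
  shows "smod R (msum P L)"
proof (rule smodI)
  note F = smod_carrier[OF P] smod_carrier[OF L]
  show "x \<in> carrier F" if "x \<in> msum P L" for x using that F by (auto simp: msum_def)
  have "\<zero> = \<zero> \<oplus> \<zero>" by simp
  then show "\<zero> \<in> msum P L" using smod_zero[OF P] smod_zero[OF L] unfolding msum_def by blast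
  fix x y assume "x \<in> msum P L" "y \<in> msum P L"
  then obtain a b a' b' where h: "a \<in> P" "b \<in> L" "a' \<in> P" "b' \<in> L" "x = a \<oplus> b" "y = a' \<oplus> b'"
    unfolding msum_def by blast
  then have "x \<oplus> y = (a \<oplus> a') \<oplus> (b \<oplus> b')" using F by (simp add: a_ac)
  then show "x \<oplus> y \<in> msum P L" using h smod_add[OF P] smod_add[OF L] unfolding msum_def by blast
next
  fix r x assume r: "r \<in> R" "x \<in> msum P L"
  then obtain a b where h: "a \<in> P" "b \<in> L" "x = a \<oplus> b" unfolding msum_def by blast
  then have "r \<otimes> x = r \<otimes> a \<oplus> r \<otimes> b" using r smod_carrier[OF P] smod_carrier[OF L] by (simp add: r_distr)
  then show "r \<otimes> x \<in> msum P L" using h r smod_smult[OF P] smod_smult[OF L] unfolding msum_def by blast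
qed

lemma msum_left:
  assumes "smod R P" "smod R L" shows "P \<subseteq> msum P L"
proof
  fix x assume "x \<in> P"
  moreover have "x = x \<oplus> \<zero>" if "x \<in> P" using smod_carrier[OF assms(1) that] by simp
  ultimately show "x \<in> msum P L" using smod_zero[OF assms(2)] unfolding msum_def by blast
qed

lemma msum_right:
  assumes "smod R P" "smod R L" shows "L \<subseteq> msum P L"
proof
  fix x assume "x \<in> L"
  moreover have "x = \<zero> \<oplus> x" if "x \<in> L" using smod_carrier[OF assms(2) that] by simp
  ultimately show "x \<in> msum P L" using smod_zero[OF assms(1)] unfolding msum_def by blast
qed

lemma msum_minimal:
  assumes "smod R N" "P \<subseteq> N" "L \<subseteq> N" shows "msum P L \<subseteq> N"
  using smod_add[OF assms(1)] assms(2,3) unfolding msum_def by blast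

text \<open>Coefficients and generators are families on \<open>I\<close>, so repetitions among the
  generators are allowed; a generating set \<open>S\<close> appears as
  \<open>lincomb S id\<close>.\<close>

definition lincomb :: "'i set \<Rightarrow> ('i \<Rightarrow> 'a) \<Rightarrow> 'a set" where
  "lincomb I r = {x. \<exists>c. c \<in> I \<rightarrow> R \<and> x = (\<Oplus>i\<in>I. c i \<otimes> r i)}"

lemma smod_lincomb:
  assumes fin: "finite I" and r: "r \<in> I \<rightarrow> carrier F"
  shows "smod R (lincomb I r)"
proof (rule smodI)
  have cl: "(\<lambda>i. c i \<otimes> r i) \<in> I \<rightarrow> carrier F" if "c \<in> I \<rightarrow> R" for c using that r by auto
  show "x \<in> carrier F" if "x \<in> lincomb I r" for x
    using that finsum_closed[OF cl] by (auto simp: lincomb_def)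
  have "(\<Oplus>i\<in>I. \<zero> \<otimes> r i) = (\<Oplus>i\<in>I. \<zero>)" using r by (intro finsum_cong') (auto simp: Pi_iff)
  then have "\<zero> = (\<Oplus>i\<in>I. \<zero> \<otimes> r i)" by simp
  then show "\<zero> \<in> lincomb I r" unfolding lincomb_def
    by (intro CollectI exI[of _ "\<lambda>i. \<zero>"]) auto
  show "x \<oplus> y \<in> lincomb I r" if "x \<in> lincomb I r" "y \<in> lincomb I r" for x y
  proof -
    obtain c c' where c: "c \<in> I \<rightarrow> R" "c' \<in> I \<rightarrow> R" "x = (\<Oplus>i\<in>I. c i \<otimes> r i)" "y = (\<Oplus>i\<in>I. c' i \<otimes> r i)"
      using \<open>x \<in> lincomb I r\<close> \<open>y \<in> lincomb I r\<close> unfolding lincomb_def by blast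
    have "x \<oplus> y = (\<Oplus>i\<in>I. c i \<otimes> r i \<oplus> c' i \<otimes> r i)" unfolding c(3,4) using cl c by (simp add: finsum_addf)
    also have "\<dots> = (\<Oplus>i\<in>I. (c i \<oplus> c' i) \<otimes> r i)"
      using c(1,2) r by (intro finsum_cong') (auto simp: l_distr Pi_def)
    finally show ?thesis using c(1,2) unfolding lincomb_def
      by (intro CollectI exI[of _ "\<lambda>i. c i \<oplus> c' i"]) auto
  qed
  show "s \<otimes> x \<in> lincomb I r" if s: "s \<in> R" and x: "x \<in> lincomb I r" for s x
  proof -
    obtain c where c: "c \<in> I \<rightarrow> R" "x = (\<Oplus>i\<in>I. c i \<otimes> r i)" using x unfolding lincomb_def by blast
    have "s \<otimes> x = (\<Oplus>i\<in>I. s \<otimes> (c i \<otimes> r i))" unfolding c(2)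
      using s fin cl[OF c(1)] by (intro finsum_rdistr) auto
    also have "\<dots> = (\<Oplus>i\<in>I. (s \<otimes> c i) \<otimes> r i)"
      using c(1) s r by (intro finsum_cong') (auto simp: m_assoc Pi_def)
    finally show ?thesis using c(1) s unfolding lincomb_def
      by (intro CollectI exI[of _ "\<lambda>i. s \<otimes> c i"]) auto
  qed
qed

lemma lincomb_gen:
  assumes fin: "finite I" and r: "r \<in> I \<rightarrow> carrier F" and i: "i \<in> I"
  shows "r i \<in> lincomb I r"
proof -
  have "(\<Oplus>k\<in>I. (if i = k then \<one> else \<zero>) \<otimes> r k) = (\<Oplus>k\<in>I. if i = k then r k else \<zero>)"
    using r by (intro finsum_cong') (auto simp: Pi_def)
  also have "\<dots> = r i" using finsum_singleton[OF i fin, of r] r by simp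
  finally have "r i = (\<Oplus>k\<in>I. (if i = k then \<one> else \<zero>) \<otimes> r k)" by simp
  then show ?thesis unfolding lincomb_def
    by (intro CollectI exI[of _ "\<lambda>k. if i = k then \<one> else \<zero>"]) auto
qed

lemma lincomb_minimal:
  assumes "smod R J" "r \<in> I \<rightarrow> J"
  shows "lincomb I r \<subseteq> J"
  using assms(2) unfolding lincomb_def
  by (auto intro!: smod_finsum[OF assms(1)] smod_smult[OF assms(1)])

lemma lincomb_insert:
  assumes "finite I" "i \<notin> I" "r \<in> insert i I \<rightarrow> carrier F" "c \<in> insert i I \<rightarrow> R"
  shows "(\<Oplus>k\<in>insert i I. c k \<otimes> r k) = c i \<otimes> r i \<oplus> (\<Oplus>k\<in>I. c k \<otimes> r k)"
  using assms by (subst finsum_insert) (auto simp: Pi_def)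

lemma genideal_lincomb:
  assumes fin: "finite I" and r: "r \<in> I \<rightarrow> R"
  shows "Idl\<^bsub>A\<^esub> (r ` I) = lincomb I r"
proof
  interpret A: cring A by (rule cring_A)
  have rF: "r \<in> I \<rightarrow> carrier F" using r by auto
  have sub: "r ` I \<subseteq> carrier A" using r by auto
  have "lincomb I r \<subseteq> R" using lincomb_minimal[OF smod_R r] .
  then have "ideal (lincomb I r) A" unfolding ideal_A_iff using smod_lincomb[OF fin rF] by blast
  moreover have "r ` I \<subseteq> lincomb I r" by (intro image_subsetI lincomb_gen[OF fin rF])
  ultimately show "Idl\<^bsub>A\<^esub> (r ` I) \<subseteq> lincomb I r" by (rule A.genideal_minimal)
  have "smod R (Idl\<^bsub>A\<^esub> (r ` I))" using A.genideal_ideal[OF sub] ideal_A_iff by blast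
  then show "lincomb I r \<subseteq> Idl\<^bsub>A\<^esub> (r ` I)"
    by (rule lincomb_minimal) (use A.genideal_self[OF sub] in auto)
qed

end

section \<open>Minimal generators of the maximal ideal\<close>

context hub
begin

text \<open>If \<open>p = z x\<close> and \<open>q = z y\<close>, then \<open>z\<close> clears both
  \<open>x\<close> and \<open>y\<close>, hence also \<open>x y\<close>, and
  \<open>w = z x y\<close>. In other words, \<open>m^2 = z m\<close>.\<close>

lemma m_square:
  assumes "p \<in> m" "q \<in> m"
  shows "\<exists>w\<in>m. p \<otimes> q = z \<otimes> w"
proof -
  obtain x y where xy: "x \<in> V" "y \<in> V" "p = z \<otimes> x" "q = z \<otimes> y"
    using iffD1[OF m_iff assms(1)] iffD1[OF m_iff assms(2)] by auto
  define w where "w = z \<otimes> (x \<otimes> y)"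
  have "w \<in> R" unfolding w_def using torsion_annihilator[OF z_R xy(1,2)] assms xy(3,4) by auto
  moreover have "\<exists>v\<in>V. w = z \<otimes> v" using xy unfolding w_def by blast
  ultimately have "w \<in> m" using m_iff by blast
  moreover have "p \<otimes> q = z \<otimes> w" unfolding xy(3,4) w_def using xy(1,2) by (simp add: m_ac)
  ultimately show ?thesis by blast
qed

lemma smod_zm: "smod R ((\<otimes>) z ` m)"
  by (rule smod_scale[OF smod_m z_F])

lemma z_notin_zm: "z \<notin> (\<otimes>) z ` m"
proof
  assume "z \<in> (\<otimes>) z ` m"
  then obtain w where w: "w \<in> m" "z \<otimes> \<one> = z \<otimes> w" by auto
  then have "\<one> = w" using m_lcancel[OF z_nz z_F, of \<one> w] by auto
  then show False using w(1) one_notin_m by metis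
qed

text \<open>\<open>r\<close> maps to a basis of the residue field vector space \<open>m / zR\<close>.\<close>

definition basis :: "'i set \<Rightarrow> ('i \<Rightarrow> 'a) \<Rightarrow> bool" where
  "basis I r \<longleftrightarrow> finite I \<and> r \<in> I \<rightarrow> m \<and>
    (\<forall>x\<in>m. \<exists>c d. c \<in> I \<rightarrow> R \<and> d \<in> R \<and> x = z \<otimes> d \<oplus> (\<Oplus>i\<in>I. c i \<otimes> r i)) \<and>
    (\<forall>c d. c \<in> I \<rightarrow> R \<longrightarrow> d \<in> R \<longrightarrow> (\<Oplus>i\<in>I. c i \<otimes> r i) = z \<otimes> d \<longrightarrow> (\<forall>i\<in>I. c i \<in> m))"

lemma basisD:
  assumes "basis I r"
  shows "finite I" "i \<in> I \<Longrightarrow> r i \<in> m"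
    "x \<in> m \<Longrightarrow> \<exists>c d. c \<in> I \<rightarrow> R \<and> d \<in> R \<and> x = z \<otimes> d \<oplus> (\<Oplus>i\<in>I. c i \<otimes> r i)"
    "c \<in> I \<rightarrow> R \<Longrightarrow> d \<in> R \<Longrightarrow> (\<Oplus>i\<in>I. c i \<otimes> r i) = z \<otimes> d \<Longrightarrow> i \<in> I \<Longrightarrow> c i \<in> m"
  using assms unfolding basis_def by blast+

lemma basis_reindex:
  assumes b: "basis I r" and h: "bij_betw h I' I"
  shows "basis I' (r \<circ> h)"
proof -
  have hi: "inj_on h I'" "h ` I' = I" using h by (auto simp: bij_betw_def)
  have rF: "r \<in> I \<rightarrow> carrier F" using basisD(2)[OF b] by auto
  have e: "(\<Oplus>i\<in>I. c i \<otimes> r i) = (\<Oplus>i\<in>I'. c (h i) \<otimes> r (h i))" if c: "c \<in> I \<rightarrow> R" for c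
    using finsum_reindex[of "\<lambda>i. c i \<otimes> r i" h I'] hi rF c by (simp add: Pi_iff)
  show ?thesis
    unfolding basis_def comp_def
  proof (intro conjI ballI allI impI)
    show "finite I'" using basisD(1)[OF b] h bij_betw_finite by blast
    show "(\<lambda>i. r (h i)) \<in> I' \<rightarrow> m" using basisD(2)[OF b] hi by auto
    show "\<exists>c d. c \<in> I' \<rightarrow> R \<and> d \<in> R \<and> x = z \<otimes> d \<oplus> (\<Oplus>i\<in>I'. c i \<otimes> r (h i))" if x: "x \<in> m" for x
    proof -
      obtain c d where c: "c \<in> I \<rightarrow> R" "d \<in> R" "x = z \<otimes> d \<oplus> (\<Oplus>i\<in>I. c i \<otimes> r i)"
        using basisD(3)[OF b x] by blast
      then show ?thesis using e[OF c(1)] hi by (intro exI[of _ "\<lambda>i. c (h i)"] exI[of _ d]) auto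
    qed
    fix c d i assume c: "c \<in> I' \<rightarrow> R" "d \<in> R" "(\<Oplus>i\<in>I'. c i \<otimes> r (h i)) = z \<otimes> d" "i \<in> I'"
    define c' where "c' = (\<lambda>k. c (inv_into I' h k))"
    have c'h: "c' (h i) = c i" if "i \<in> I'" for i using hi that by (simp add: c'_def)
    have c': "c' \<in> I \<rightarrow> R" unfolding hi(2)[symmetric] using c(1) c'h by auto
    have "(\<Oplus>i\<in>I. c' i \<otimes> r i) = (\<Oplus>i\<in>I'. c i \<otimes> r (h i))"
      unfolding e[OF c'] using c(1) c'h rF hi by (intro finsum_cong') (auto simp: Pi_iff)
    then have "c' (h i) \<in> m" using basisD(4)[OF b c' c(2)] c(3,4) hi by auto
    then show "c i \<in> m" using c'h c(4) by simp
  qed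
qed

text \<open>Since \<open>z\<close> is not in \<open>z m = m^2\<close>, some minimal generator
  \<open>j\<close> occurs in \<open>z\<close> with a unit coefficient and can be exchanged for
  \<open>z\<close>. The other \<open>n - 1\<close> generators form a basis modulo
  \<open>z R\<close>.\<close>

lemma embedding_dim_basis:
  assumes "has_embedding_dim A n"
  shows "\<exists>r :: nat \<Rightarrow> 'a. basis {..<n - 1} r"
proof -
  interpret A: cring A by (rule cring_A)
  obtain S where S: "S \<subseteq> R" "Idl\<^bsub>A\<^esub> S = m" "\<And>T. T \<subset> S \<Longrightarrow> Idl\<^bsub>A\<^esub> T \<noteq> m" "finite S" "card S = n"
    using assms m_unique unfolding has_embedding_dim_def by auto
  have Sm: "s \<in> m" if "s \<in> S" for s using A.genideal_self[of S] S(1,2) that by auto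
  have SF: "id \<in> T \<rightarrow> carrier F" "id \<in> T \<rightarrow> R" if "T \<subseteq> S" for T using that S(1) by auto
  have lc: "Idl\<^bsub>A\<^esub> T = lincomb T id" if "T \<subseteq> S" for T
    using genideal_lincomb[of T id] finite_subset[OF that S(4)] SF[OF that] by simp
  have mS: "m = lincomb S id" using lc S(2) by blast
  \<comment> \<open>A unit coefficient would express \<open>s\<close> by the other generators,
    against minimality.\<close>
  have rel: "c s \<in> m" if c: "c \<in> S \<rightarrow> R" and z0: "(\<Oplus>s\<in>S. c s \<otimes> id s) = \<zero>" and s: "s \<in> S" for c s
  proof (rule ccontr)
    assume n: "c s \<notin> m"
    let ?T = "S - {s}"
    have fT: "finite ?T" using S(4) by simp
    have ins: "insert s ?T = S" using s by blast
    note L = smod_lincomb[OF fT SF(1)[OF Diff_subset]]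
    define t where "t = (\<Oplus>k\<in>?T. c k \<otimes> id k)"
    have t: "t \<in> lincomb ?T id" unfolding lincomb_def t_def using c by (intro CollectI exI[of _ c]) auto
    have tF: "t \<in> carrier F" using smod_carrier[OF L t] .
    have sF: "s \<in> carrier F" "c s \<in> R" using s S(1) c by auto
    have "c s \<otimes> id s \<oplus> t = \<zero>"
      using lincomb_insert[OF fT, of s id c] SF(1)[OF subset_refl] c z0 unfolding ins t_def by simp
    then have "t \<oplus> c s \<otimes> s \<in> lincomb ?T id" using sF tF smod_zero[OF L] by (simp add: a_comm)
    then have "c s \<otimes> s \<in> lincomb ?T id"
      by (rule smod_cancel[OF L subring t, rotated]) (use sF in auto)
    then have "s \<in> lincomb ?T id" using smod_unit[OF L sF(2) n sF(1)] by blast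
    moreover have "k \<in> lincomb ?T id" if "k \<in> ?T" for k
      using lincomb_gen[OF fT SF(1)[OF Diff_subset] that] by simp
    ultimately have "id k \<in> lincomb ?T id" if "k \<in> S" for k using that by (cases "k = s") auto
    then have "id \<in> S \<rightarrow> lincomb ?T id" by (rule Pi_I)
    then have "m \<subseteq> lincomb ?T id" unfolding mS by (rule lincomb_minimal[OF L])
    moreover have "lincomb ?T id \<subseteq> m" using Sm by (intro lincomb_minimal[OF smod_m]) auto
    ultimately have "Idl\<^bsub>A\<^esub> ?T = m" using lc[OF Diff_subset] by blast
    then show False using S(3)[of ?T] s by blast
  qed
  obtain e where e: "e \<in> S \<rightarrow> R" "z = (\<Oplus>s\<in>S. e s \<otimes> id s)" using mS z_m unfolding lincomb_def by blast
  have "\<exists>j\<in>S. e j \<notin> m"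
  proof (rule ccontr)
    assume n: "\<not> ?thesis"
    have "e s \<otimes> id s \<in> (\<otimes>) z ` m" if s: "s \<in> S" for s
    proof -
      have "e s \<in> m" using n s by blast
      then obtain w where "w \<in> m" "e s \<otimes> s = z \<otimes> w" using m_square[OF _ Sm[OF s]] by blast
      then show ?thesis by auto
    qed
    then have "(\<Oplus>s\<in>S. e s \<otimes> id s) \<in> (\<otimes>) z ` m" by (rule smod_finsum[OF smod_zm])
    then show False using z_notin_zm by (simp only: e(2)[symmetric])
  qed
  then obtain j where j: "j \<in> S" "e j \<notin> m" by blast
  let ?I = "S - {j}"
  have fI: "finite ?I" using S(4) by simp
  have ins: "insert j ?I = S" using j by blast
  have jF: "j \<in> carrier F" "e j \<in> R" using j S(1) e by auto
  note L = smod_lincomb[OF fI SF(1)[OF Diff_subset]]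
  define t where "t = (\<Oplus>k\<in>?I. e k \<otimes> id k)"
  have t: "t \<in> lincomb ?I id" unfolding lincomb_def t_def using e by (intro CollectI exI[of _ e]) auto
  have tF: "t \<in> carrier F" using smod_carrier[OF L t] .
  have zt: "z = e j \<otimes> j \<oplus> t"
    using lincomb_insert[OF fI, of j id e] SF(1)[OF subset_refl] e unfolding ins t_def by simp
  have "basis ?I id"
    unfolding basis_def
  proof (intro conjI ballI allI impI)
    show "finite ?I" by (rule fI)
    show "id \<in> ?I \<rightarrow> m" using Sm by auto
    define J where "J = msum ((\<otimes>) z ` R) (lincomb ?I id)"
    have zR: "smod R ((\<otimes>) z ` R)" by (rule smod_scale[OF smod_R z_F])
    have J: "smod R J" unfolding J_def by (rule smod_msum[OF zR L])
    have LJ: "s \<in> J" if "s \<in> lincomb ?I id" for s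
      using msum_right[OF zR L] that by (auto simp: J_def)
    have "z \<otimes> \<one> \<in> (\<otimes>) z ` R" by blast
    then have "z \<in> J" using msum_left[OF zR L] by (auto simp: J_def)
    then have "t \<oplus> e j \<otimes> j \<in> J" using zt jF tF by (simp add: a_comm)
    then have "e j \<otimes> j \<in> J" by (rule smod_cancel[OF J subring LJ[OF t], rotated]) (use jF in auto)
    then have "j \<in> J" using smod_unit[OF J jF(2) j(2) jF(1)] by blast
    moreover have "k \<in> J" if "k \<in> ?I" for k
      using LJ lincomb_gen[OF fI SF(1)[OF Diff_subset] that] by simp
    ultimately have "id k \<in> J" if "k \<in> S" for k using that by (cases "k = j") auto
    then have "id \<in> S \<rightarrow> J" by (rule Pi_I)
    then have mJ: "m \<subseteq> J" unfolding mS by (rule lincomb_minimal[OF J])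
    show "\<exists>c d. c \<in> ?I \<rightarrow> R \<and> d \<in> R \<and> x = z \<otimes> d \<oplus> (\<Oplus>i\<in>?I. c i \<otimes> id i)" if "x \<in> m" for x
      using subsetD[OF mJ that] unfolding J_def msum_def lincomb_def by blast
    fix c d i assume c: "c \<in> ?I \<rightarrow> R" "d \<in> R" "(\<Oplus>i\<in>?I. c i \<otimes> id i) = z \<otimes> d" and i: "i \<in> ?I"
    \<comment> \<open>The relation is extended by \<open>\<zero>\<close> at \<open>j\<close>, and
      \<open>z d\<close> is expanded in all generators through \<open>e\<close>. The difference
      \<open>k\<close> is a relation among the generators, so its coefficients are in
      \<open>m\<close>. At \<open>j\<close> this says \<open>e j \<otimes> d \<in> m\<close>, whence
      \<open>d \<in> m\<close> and then \<open>c i \<in> m\<close>.\<close>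
    define c' where "c' = c(j := \<zero>)"
    have c': "c' \<in> S \<rightarrow> R" using c(1) by (auto simp: c'_def)
    have "(\<Oplus>s\<in>?I. c' s \<otimes> id s) = (\<Oplus>s\<in>?I. c s \<otimes> id s)"
      using c(1) SF(1)[of ?I] by (intro finsum_cong') (auto simp: c'_def Pi_iff)
    moreover have "(\<Oplus>s\<in>S. c' s \<otimes> id s) = c' j \<otimes> id j \<oplus> (\<Oplus>s\<in>?I. c' s \<otimes> id s)"
      using lincomb_insert[OF fI, of j id c'] SF(1)[OF subset_refl] c' unfolding ins by simp
    ultimately have c'z: "(\<Oplus>s\<in>S. c' s \<otimes> id s) = z \<otimes> d" using c jF by (simp add: c'_def)
    define k where "k s = c' s \<ominus> e s \<otimes> d" for s
    have k: "k \<in> S \<rightarrow> R" using c' e(1) c(2) by (auto simp: k_def Pi_iff)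
    have "(\<Oplus>s\<in>S. (e s \<otimes> d) \<otimes> id s) = (\<Oplus>s\<in>S. (e s \<otimes> id s) \<otimes> d)"
      using e(1) c(2) SF(1)[OF subset_refl] by (intro finsum_cong') (auto simp: m_ac Pi_def)
    also have "\<dots> = z \<otimes> d" unfolding e(2)
      using e(1) c(2) S(4) SF(1)[OF subset_refl] by (intro finsum_ldistr[symmetric]) (auto simp: Pi_iff)
    finally have ed: "(\<Oplus>s\<in>S. (e s \<otimes> d) \<otimes> id s) = z \<otimes> d" .
    have kF: "(\<lambda>s. k s \<otimes> id s) \<in> S \<rightarrow> carrier F" "(\<lambda>s. (e s \<otimes> d) \<otimes> id s) \<in> S \<rightarrow> carrier F"
      using k e(1) c(2) SF(1)[OF subset_refl] by (auto simp: Pi_iff)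
    have "(\<Oplus>s\<in>S. (e s \<otimes> d) \<otimes> id s) \<oplus> (\<Oplus>s\<in>S. k s \<otimes> id s) = (\<Oplus>s\<in>S. (e s \<otimes> d) \<otimes> id s \<oplus> k s \<otimes> id s)"
      using finsum_addf[OF kF(2,1)] by simp
    also have "\<dots> = (\<Oplus>s\<in>S. c' s \<otimes> id s)"
    proof (rule finsum_cong')
      fix s assume s: "s \<in> S"
      have F: "e s \<otimes> d \<in> carrier F" "c' s \<in> carrier F" "s \<in> carrier F" "k s \<in> carrier F"
        using s e(1) c(2) c' S(1) k by auto
      have "(e s \<otimes> d) \<otimes> id s \<oplus> k s \<otimes> id s = (e s \<otimes> d \<oplus> k s) \<otimes> id s" using F by (simp add: l_distr)
      also have "e s \<otimes> d \<oplus> k s = c' s" unfolding k_def using F by (intro add_minus_cancel) auto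
      finally show "(e s \<otimes> d) \<otimes> id s \<oplus> k s \<otimes> id s = c' s \<otimes> id s" .
    qed (use c' SF(1)[OF subset_refl] in \<open>auto simp: Pi_iff\<close>)
    finally have "z \<otimes> d \<oplus> (\<Oplus>s\<in>S. k s \<otimes> id s) = z \<otimes> d" unfolding ed c'z .
    then have "(\<Oplus>s\<in>S. k s \<otimes> id s) = \<zero>" using finsum_closed[OF kF(1)] c(2) by simp
    then have km: "k s \<in> m" if "s \<in> S" for s using rel[OF k] that by blast
    have F: "e j \<otimes> d \<in> R" "d \<in> carrier F" "e i \<in> R" "c i \<in> R" using jF c i e(1) by auto
    have "\<ominus> (k j) = e j \<otimes> d" using F(1) by (simp add: k_def c'_def a_minus_def)
    then have "e j \<otimes> d \<in> m" using max_closed(5)[OF km[OF j(1)]] by simp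
    then have dm: "d \<in> m" using m_prime[OF jF(2) c(2)] j(2) by blast
    have "e i \<otimes> d \<oplus> k i = c i" unfolding k_def c'_def using i F by (simp add: add_minus_cancel)
    then show "c i \<in> m" using km[of i] i dm F max_closed(2,3) by (metis DiffD1)
  qed
  moreover have "card {..<n - 1} = card ?I" using S(4,5) j by simp
  then obtain h :: "nat \<Rightarrow> 'a" where "bij_betw h {..<n - 1} ?I"
    using fI finite_same_card_bij[of "{..<n - 1}" ?I] by auto
  ultimately show ?thesis using basis_reindex by blast
qed

lemma basis_embedding_dim:
  assumes b: "basis {..<N} r" shows "has_embedding_dim A (Suc N)"
proof -
  interpret A: cring A by (rule cring_A)
  let ?I = "{..<N}"
  note rm = basisD(2)[OF b]
  have rF: "r \<in> T \<rightarrow> carrier F" "r \<in> T \<rightarrow> R" if "T \<subseteq> ?I" for T using rm that by auto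
  define J where "J T = msum ((\<otimes>) z ` R) (lincomb T r)" for T
  have J: "smod R (J T)" "z \<in> J T" "s \<in> lincomb T r \<Longrightarrow> s \<in> J T" "J T \<subseteq> R" if T: "T \<subseteq> ?I" for T s
  proof -
    have fT: "finite T" using T finite_subset by blast
    note L = smod_lincomb[OF fT rF(1)[OF T]]
    have zR: "smod R ((\<otimes>) z ` R)" by (rule smod_scale[OF smod_R z_F])
    show "smod R (J T)" unfolding J_def by (rule smod_msum[OF zR L])
    have "z \<otimes> \<one> \<in> (\<otimes>) z ` R" by blast
    then show "z \<in> J T" using msum_left[OF zR L] by (auto simp: J_def)
    show "s \<in> J T" if "s \<in> lincomb T r" using msum_right[OF zR L] that by (auto simp: J_def)
    show "J T \<subseteq> R" unfolding J_def
      using lincomb_minimal[OF smod_R rF(2)[OF T]] by (intro msum_minimal[OF smod_R]) auto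
  qed
  have indep: "r i \<notin> J (?I - {i})" if i: "i \<in> ?I" for i
  proof
    let ?T = "?I - {i}"
    assume "r i \<in> J ?T"
    then obtain d c where h: "d \<in> R" "c \<in> ?T \<rightarrow> R" "r i = z \<otimes> d \<oplus> (\<Oplus>k\<in>?T. c k \<otimes> r k)"
      unfolding J_def msum_def lincomb_def by blast
    define c' where "c' = c(i := \<ominus> \<one>)"
    have c': "c' \<in> ?I \<rightarrow> R" using h(2) by (auto simp: c'_def)
    have ins: "insert i ?T = ?I" using i by blast
    define t where "t = (\<Oplus>k\<in>?T. c k \<otimes> r k)"
    have tF: "t \<in> carrier F" unfolding t_def using h(2) rF(1)[of ?T] by (intro finsum_closed) (auto simp: Pi_iff)
    have "(\<Oplus>k\<in>?T. c' k \<otimes> r k) = t" unfolding t_def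
      using h(2) rF(1)[of ?T] by (intro finsum_cong') (auto simp: c'_def)
    then have "(\<Oplus>k\<in>?I. c' k \<otimes> r k) = \<ominus> \<one> \<otimes> r i \<oplus> t"
      using lincomb_insert[of ?T i r c'] rF(1)[OF subset_refl] c' unfolding ins by (simp add: c'_def)
    also have "\<dots> = \<ominus> (r i) \<oplus> t" using rm[OF i] by (simp add: l_minus)
    also have "\<dots> = z \<otimes> (\<ominus> d)" unfolding h(3) t_def[symmetric] using h(1) tF
      by (simp add: minus_add r_minus a_assoc l_neg)
    finally have "c' i \<in> m" using basisD(4)[OF b c', of "\<ominus> d"] h(1) i by blast
    then have "\<ominus> \<one> \<in> m" by (simp add: c'_def)
    then have "\<ominus> (\<ominus> \<one>) \<in> m" by blast
    then show False by simp
  qed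
  have zn: "z \<notin> lincomb ?I r"
  proof
    assume "z \<in> lincomb ?I r"
    then obtain c where c: "c \<in> ?I \<rightarrow> R" "z = (\<Oplus>k\<in>?I. c k \<otimes> r k)" unfolding lincomb_def by blast
    have "(\<Oplus>k\<in>?I. c k \<otimes> r k) = z \<otimes> \<one>" by (simp add: c(2)[symmetric])
    then have cm: "c k \<in> m" if "k \<in> ?I" for k
      using basisD(4)[OF b c(1) _ _ that] by blast
    have "c k \<otimes> r k \<in> (\<otimes>) z ` m" if k: "k \<in> ?I" for k
    proof -
      obtain w where "w \<in> m" "c k \<otimes> r k = z \<otimes> w" using m_square[OF cm[OF k] rm[OF k]] by blast
      then show ?thesis by auto
    qed
    then have "(\<Oplus>k\<in>?I. c k \<otimes> r k) \<in> (\<otimes>) z ` m" by (rule smod_finsum[OF smod_zm])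
    then show False using z_notin_zm by (simp only: c(2)[symmetric])
  qed
  let ?S = "insert z (r ` ?I)"
  have inT: "r k \<in> J (?I - {i})" if "k \<in> ?I" "k \<noteq> i" for i k
    by (rule J(3)) (use lincomb_gen[of "?I - {i}" r k] rF(1)[of "?I - {i}"] that in auto)
  have ne: "r i \<noteq> z" if "i \<in> ?I" for i using indep[OF that] J(2)[of "?I - {i}"] by auto
  have inj: "inj_on r ?I" using indep inT by (metis inj_onI)
  have card: "card ?S = Suc N" using ne by (subst card_insert_disjoint) (auto simp: card_image[OF inj])
  have SR: "?S \<subseteq> carrier A" using rm by auto
  have gen: "Idl\<^bsub>A\<^esub> ?S = m"
  proof
    show "Idl\<^bsub>A\<^esub> ?S \<subseteq> m" by (rule A.genideal_minimal[OF m_ideal]) (use rm in auto)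
    have I: "smod R (Idl\<^bsub>A\<^esub> ?S)" using A.genideal_ideal[OF SR] ideal_A_iff by blast
    have s: "?S \<subseteq> Idl\<^bsub>A\<^esub> ?S" by (rule A.genideal_self[OF SR])
    show "m \<subseteq> Idl\<^bsub>A\<^esub> ?S"
    proof
      fix x assume "x \<in> m"
      then obtain c d where h: "c \<in> ?I \<rightarrow> R" "d \<in> R" "x = z \<otimes> d \<oplus> (\<Oplus>i\<in>?I. c i \<otimes> r i)"
        using basisD(3)[OF b] by blast
      have "d \<otimes> z \<in> Idl\<^bsub>A\<^esub> ?S" using smod_smult[OF I h(2)] s by blast
      then have "z \<otimes> d \<in> Idl\<^bsub>A\<^esub> ?S" using h(2) by (simp add: m_comm)
      moreover have "(\<Oplus>i\<in>?I. c i \<otimes> r i) \<in> Idl\<^bsub>A\<^esub> ?S"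
        by (rule smod_finsum[OF I], rule smod_smult[OF I]) (use h(1) s in auto)
      ultimately show "x \<in> Idl\<^bsub>A\<^esub> ?S" unfolding h(3) by (rule smod_add[OF I])
    qed
  qed
  have "Idl\<^bsub>A\<^esub> T \<noteq> m" if T: "T \<subset> ?S" for T
  proof
    assume e: "Idl\<^bsub>A\<^esub> T = m"
    from T obtain s where s: "s \<in> ?S" "s \<notin> T" by blast
    show False
    proof (cases "s = z")
      case True
      have "lincomb ?I r \<subseteq> R" using lincomb_minimal[OF smod_R rF(2)[OF subset_refl]] .
      then have "ideal (lincomb ?I r) A" unfolding ideal_A_iff
        using smod_lincomb[OF _ rF(1)[OF subset_refl]] by simp
      moreover have "T \<subseteq> lincomb ?I r" using T s True lincomb_gen[OF _ rF(1)[OF subset_refl]] by auto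
      ultimately have "m \<subseteq> lincomb ?I r" unfolding e[symmetric] by (rule A.genideal_minimal)
      then show False using zn by blast
    next
      case False
      then obtain i where i: "i \<in> ?I" "s = r i" using s by blast
      have "ideal (J (?I - {i})) A" unfolding ideal_A_iff using J(1,4)[of "?I - {i}"] by blast
      moreover have "T \<subseteq> J (?I - {i})"
      proof
        fix x assume x: "x \<in> T"
        then consider "x = z" | k where "k \<in> ?I" "x = r k" using T by blast
        then show "x \<in> J (?I - {i})"
        proof cases
          case 2
          then have "k \<noteq> i" using x s(2) i(2) by blast
          then show ?thesis using inT 2 by blast
        qed (use J(2)[of "?I - {i}"] in blast)
      qed
      ultimately have "m \<subseteq> J (?I - {i})" unfolding e[symmetric] by (rule A.genideal_minimal)
      then show False using indep[OF i(1)] rm[OF i(1)] by blast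
    qed
  qed
  then show ?thesis unfolding has_embedding_dim_def
    using ql m_max SR gen card by (intro conjI exI[of _ m] exI[of _ ?S]) auto
qed

end

section \<open>The bad Noetherian stable domain of a basis\<close>

context frac_field
begin

text \<open>For modules \<open>P \<subseteq> L\<close> this says that \<open>L / P\<close> is a
  Noetherian module, without forming the quotient.\<close>

definition fg_between :: "'a set \<Rightarrow> 'a set \<Rightarrow> bool" where
  "fg_between P L \<longleftrightarrow> (\<forall>J. smod R J \<and> P \<subseteq> J \<and> J \<subseteq> L \<longrightarrow>
    (\<exists>S\<subseteq>J. finite S \<and> (\<forall>N. smod R N \<and> P \<subseteq> N \<and> S \<subseteq> N \<longrightarrow> J \<subseteq> N)))"

lemma fg_betweenD:
  assumes "fg_between P L" "smod R J" "P \<subseteq> J" "J \<subseteq> L"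
  obtains S where "S \<subseteq> J" "finite S" "\<And>N. smod R N \<Longrightarrow> P \<subseteq> N \<Longrightarrow> S \<subseteq> N \<Longrightarrow> J \<subseteq> N"
  using assms unfolding fg_between_def by meson

text \<open>Noetherian modules are closed under extensions: generators of
  \<open>J \<inter> L\<close> over \<open>P\<close> are joined with lifts to \<open>J\<close> of
  generators of \<open>J + L\<close> over \<open>L\<close>.\<close>

lemma fg_between_trans:
  assumes L: "smod R L" and PL: "P \<subseteq> L" and 1: "fg_between P L" and 2: "fg_between L T"
    and LT: "L \<subseteq> T" and T: "smod R T"
  shows "fg_between P T"
  unfolding fg_between_def
proof (intro allI impI, elim conjE)
  fix J assume J: "smod R J" "P \<subseteq> J" "J \<subseteq> T"
  have JL: "smod R (msum J L)" by (rule smod_msum[OF J(1) L])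
  obtain S1 where S1: "S1 \<subseteq> msum J L" "finite S1"
    "\<And>N. smod R N \<Longrightarrow> L \<subseteq> N \<Longrightarrow> S1 \<subseteq> N \<Longrightarrow> msum J L \<subseteq> N"
    using fg_betweenD[OF 2 JL msum_right[OF J(1) L] msum_minimal[OF T J(3) LT]] by blast
  have "\<forall>s\<in>S1. \<exists>g. g \<in> J \<and> (\<exists>b\<in>L. s = g \<oplus> b)" using S1(1) unfolding msum_def by blast
  then obtain g where g: "\<And>s. s \<in> S1 \<Longrightarrow> g s \<in> J \<and> (\<exists>b\<in>L. s = g s \<oplus> b)" by (auto dest!: bchoice)
  obtain S2 where S2: "S2 \<subseteq> J \<inter> L" "finite S2"
    "\<And>N. smod R N \<Longrightarrow> P \<subseteq> N \<Longrightarrow> S2 \<subseteq> N \<Longrightarrow> J \<inter> L \<subseteq> N"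
    using fg_betweenD[OF 1 smod_Int[OF J(1) L]] J(2) PL by blast
  have "J \<subseteq> N" if N: "smod R N" "P \<subseteq> N" "g ` S1 \<union> S2 \<subseteq> N" for N
  proof
    fix y assume y: "y \<in> J"
    have NJ: "smod R (N \<inter> J)" by (rule smod_Int[OF N(1) J(1)])
    have "S1 \<subseteq> msum (N \<inter> J) L"
    proof
      fix s assume "s \<in> S1"
      then have "g s \<in> N \<inter> J" "\<exists>b\<in>L. s = g s \<oplus> b" using g N(3) by auto
      then show "s \<in> msum (N \<inter> J) L" unfolding msum_def by blast
    qed
    then have "msum J L \<subseteq> msum (N \<inter> J) L"
      by (rule S1(3)[OF smod_msum[OF NJ L] msum_right[OF NJ L]])
    then have "y \<in> msum (N \<inter> J) L" using y msum_left[OF J(1) L] by blast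
    then obtain a b where ab: "a \<in> N" "a \<in> J" "b \<in> L" "y = a \<oplus> b" unfolding msum_def by blast
    have "b \<in> J"
      by (rule smod_cancel[OF J(1) subring ab(2)]) (use ab y smod_carrier[OF L] in auto)
    then have "b \<in> N" using S2(3)[OF N(1,2)] N(3) ab(3) by blast
    then show "y \<in> N" using ab smod_add[OF N(1)] by blast
  qed
  then show "\<exists>S\<subseteq>J. finite S \<and> (\<forall>N. smod R N \<and> P \<subseteq> N \<and> S \<subseteq> N \<longrightarrow> J \<subseteq> N)"
    using S1(2) S2(1,2) g by (intro exI[of _ "g ` S1 \<union> S2"]) auto
qed

lemma fg_between_scale:
  assumes a: "a \<in> carrier F" "a \<noteq> \<zero>" and P: "P \<subseteq> carrier F" and L: "L \<subseteq> carrier F" and 1: "fg_between P L"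
  shows "fg_between ((\<otimes>) a ` P) ((\<otimes>) a ` L)"
  unfolding fg_between_def
proof (intro allI impI, elim conjE)
  fix J assume J: "smod R J" "(\<otimes>) a ` P \<subseteq> J" "J \<subseteq> (\<otimes>) a ` L"
  let ?pre = "\<lambda>J. {x \<in> carrier F. a \<otimes> x \<in> J}"
  have "?pre J \<subseteq> L"
  proof
    fix x assume x: "x \<in> ?pre J"
    then obtain y where "y \<in> L" "a \<otimes> x = a \<otimes> y" using J(3) by blast
    then show "x \<in> L" using m_lcancel[OF a(2,1), of x y] x L by auto
  qed
  then obtain S where S: "S \<subseteq> ?pre J" "finite S"
    "\<And>N. smod R N \<Longrightarrow> P \<subseteq> N \<Longrightarrow> S \<subseteq> N \<Longrightarrow> ?pre J \<subseteq> N"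
    using fg_betweenD[OF 1 smod_preimage[OF J(1) a(1)]] J(2) P by blast
  have "J \<subseteq> N" if N: "smod R N" "(\<otimes>) a ` P \<subseteq> N" "(\<otimes>) a ` S \<subseteq> N" for N
  proof
    fix y assume y: "y \<in> J"
    then obtain x where x: "x \<in> L" "y = a \<otimes> x" using J(3) by blast
    have "?pre J \<subseteq> ?pre N" by (rule S(3)[OF smod_preimage[OF N(1) a(1)]]) (use N S(1) P in auto)
    then show "y \<in> N" using x y L by blast
  qed
  then show "\<exists>S\<subseteq>J. finite S \<and> (\<forall>N. smod R N \<and> (\<otimes>) a ` P \<subseteq> N \<and> S \<subseteq> N \<longrightarrow> J \<subseteq> N)"
    using S(1,2) by (intro exI[of _ "(\<otimes>) a ` S"]) auto
qed

lemma smod_multiples: "x \<in> carrier F \<Longrightarrow> smod R ((\<lambda>c. c \<otimes> x) ` R)"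
proof (rule smodI)
  assume x: "x \<in> carrier F"
  have "\<zero> = \<zero> \<otimes> x" using x by simp
  then show "\<zero> \<in> (\<lambda>c. c \<otimes> x) ` R" by blast
  show "u \<oplus> v \<in> (\<lambda>c. c \<otimes> x) ` R" if "u \<in> (\<lambda>c. c \<otimes> x) ` R" "v \<in> (\<lambda>c. c \<otimes> x) ` R" for u v
    using that x by (auto simp: l_distr[symmetric])
  show "r \<otimes> u \<in> (\<lambda>c. c \<otimes> x) ` R" if "r \<in> R" "u \<in> (\<lambda>c. c \<otimes> x) ` R" for r u
    using that x by (auto simp: m_assoc[symmetric])
qed auto

end

text \<open>The quotient is zero or a copy of the residue field. Any element outside
  \<open>P\<close> has a unit coefficient at \<open>x\<close> and so recovers \<open>x\<close>
  modulo \<open>P\<close>.\<close>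

lemma (in quasi) fg_between_simple:
  assumes P: "smod R P" and x: "x \<in> carrier F" and mx: "\<And>r. r \<in> m \<Longrightarrow> r \<otimes> x \<in> P"
  shows "fg_between P (msum P ((\<lambda>c. c \<otimes> x) ` R))"
  unfolding fg_between_def
proof (intro allI impI, elim conjE)
  fix J assume J: "smod R J" "P \<subseteq> J" "J \<subseteq> msum P ((\<lambda>c. c \<otimes> x) ` R)"
  show "\<exists>S\<subseteq>J. finite S \<and> (\<forall>N. smod R N \<and> P \<subseteq> N \<and> S \<subseteq> N \<longrightarrow> J \<subseteq> N)"
  proof (cases "J \<subseteq> P")
    case True
    then show ?thesis by (intro exI[of _ "{}"]) auto
  next
    case False
    then obtain y where y: "y \<in> J" "y \<notin> P" by blast
    then obtain p r where pr: "p \<in> P" "r \<in> R" "y = p \<oplus> r \<otimes> x" using J(3) unfolding msum_def by blast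
    have rm: "r \<notin> m" using mx pr y smod_add[OF P] by blast
    have "J \<subseteq> N" if N: "smod R N" "P \<subseteq> N" "{y} \<subseteq> N" for N
    proof -
      have "p \<oplus> r \<otimes> x \<in> N" using N(3) pr(3) by simp
      then have "r \<otimes> x \<in> N"
        by (rule smod_cancel[OF N(1) subring, rotated -1]) (use N(2) pr x in auto)
      then have "x \<in> N" using smod_unit[OF N(1) pr(2) rm x] by blast
      then have "msum P ((\<lambda>c. c \<otimes> x) ` R) \<subseteq> N"
        by (intro msum_minimal[OF N(1,2)]) (use smod_smult[OF N(1)] in auto)
      then show ?thesis using J(3) by blast
    qed
    then show ?thesis using y by (intro exI[of _ "{y}"]) auto
  qed
qed

section \<open>Noetherianity, dimension, stability and failure of finiteness\<close>

context hub
begin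

text \<open>\<open>W k\<close> adjoins \<open>r 0, ..., r (k-1)\<close> to \<open>z R\<close>. Each
  step is killed by \<open>m\<close>, because \<open>m (r k) \<subseteq> m^2 = z m\<close>, and the
  last step is \<open>R / m\<close>.\<close>

lemma basis_fg_between:
  assumes b: "basis {..<N::nat} r"
  shows "fg_between ((\<otimes>) z ` R) R"
proof -
  define W where "W = rec_nat ((\<otimes>) z ` R) (\<lambda>k P. msum P ((\<lambda>c. c \<otimes> r k) ` R))"
  have W0: "W 0 = (\<otimes>) z ` R" and WS: "W (Suc k) = msum (W k) ((\<lambda>c. c \<otimes> r k) ` R)" for k
    by (simp_all add: W_def)
  have zR: "smod R ((\<otimes>) z ` R)" by (rule smod_scale[OF smod_R z_F])
  note rm = basisD(2)[OF b]
  have W: "smod R (W k) \<and> (\<otimes>) z ` R \<subseteq> W k \<and> W k \<subseteq> m \<and> fg_between ((\<otimes>) z ` R) (W k) \<and>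
      (\<forall>i<k. r i \<in> W k)" if "k \<le> N" for k
    using that
  proof (induction k)
    case 0
    have "fg_between ((\<otimes>) z ` R) ((\<otimes>) z ` R)" unfolding fg_between_def
      by (intro allI impI exI[of _ "{}"]) auto
    then show ?case using zR by (auto simp: W0 m_comm[of z])
  next
    case (Suc k)
    then have IH: "smod R (W k)" "(\<otimes>) z ` R \<subseteq> W k" "W k \<subseteq> m" "fg_between ((\<otimes>) z ` R) (W k)" "\<forall>i<k. r i \<in> W k"
      by auto
    have rk: "r k \<in> m" using rm Suc.prems by simp
    have rF: "r k \<in> carrier F" using rk by auto
    note Rr = smod_multiples[OF rF]
    have step: "fg_between (W k) (W (Suc k))" unfolding WS
    proof (rule fg_between_simple[OF IH(1) rF])
      fix p assume "p \<in> m"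
      then obtain w where "w \<in> m" "p \<otimes> r k = z \<otimes> w" using m_square rk by blast
      then show "p \<otimes> r k \<in> W k" using IH(2) by blast
    qed
    have sm: "smod R (W (Suc k))" unfolding WS by (rule smod_msum[OF IH(1) Rr])
    have sub: "W k \<subseteq> W (Suc k)" unfolding WS by (rule msum_left[OF IH(1) Rr])
    have "r k = \<one> \<otimes> r k" using rF by simp
    then have "r k \<in> W (Suc k)" using msum_right[OF IH(1) Rr] unfolding WS by blast
    moreover have "W (Suc k) \<subseteq> m" unfolding WS
      by (rule msum_minimal[OF smod_m IH(3)]) (use rk in auto)
    moreover have "fg_between ((\<otimes>) z ` R) (W (Suc k))"
      by (rule fg_between_trans[OF IH(1,2,4) step sub sm])
    ultimately show ?case using IH sub sm by (auto simp: less_Suc_eq)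
  qed
  note WN = W[OF order_refl]
  have "m \<subseteq> W N"
  proof
    fix x assume "x \<in> m"
    then obtain c d where h: "c \<in> {..<N} \<rightarrow> R" "d \<in> R" "x = z \<otimes> d \<oplus> (\<Oplus>i\<in>{..<N}. c i \<otimes> r i)"
      using basisD(3)[OF b] by blast
    have sN: "smod R (W N)" using WN by blast
    have "(\<Oplus>i\<in>{..<N}. c i \<otimes> r i) \<in> W N"
      by (rule smod_finsum[OF sN], rule smod_smult[OF sN]) (use h WN in auto)
    moreover have "z \<otimes> d \<in> W N" using WN h(2) by blast
    ultimately show "x \<in> W N" unfolding h(3) by (intro smod_add[OF sN])
  qed
  then have "fg_between ((\<otimes>) z ` R) m" using WN by auto
  moreover have "fg_between m R"
  proof -
    have "msum m ((\<lambda>c. c \<otimes> \<one>) ` R) = R"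
    proof
      show "msum m ((\<lambda>c. c \<otimes> \<one>) ` R) \<subseteq> R" by (rule msum_minimal[OF smod_R]) auto
      have "(\<lambda>c. c \<otimes> \<one>) ` R = R" by (auto simp: image_iff)
      then show "R \<subseteq> msum m ((\<lambda>c. c \<otimes> \<one>) ` R)" using msum_right[OF smod_m smod_R] by simp
    qed
    then show ?thesis using fg_between_simple[OF smod_m one_closed] by simp
  qed
  moreover have "(\<otimes>) z ` R \<subseteq> m" by (auto simp: m_comm[of z])
  ultimately show ?thesis using fg_between_trans[OF smod_m _ _ _ _ smod_R] m_R by blast
qed

lemma power_multiple:
  assumes "r \<in> R" "r \<noteq> \<zero>"
  obtains k :: nat and a where "a \<in> R" "z [^] k = r \<otimes> a"
proof -
  have F: "r \<in> carrier F" "inv r \<in> carrier F" using assms by auto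
  obtain k :: nat where k: "z [^] k \<otimes> inv r \<in> R" using z_pow_denom[OF F(2)] by blast
  have "r \<otimes> (z [^] k \<otimes> inv r) = z [^] k \<otimes> (r \<otimes> inv r)" using F by (simp add: m_lcomm)
  then have "z [^] k = r \<otimes> (z [^] k \<otimes> inv r)" using assms by simp
  then show ?thesis using that k by blast
qed

text \<open>A nonzero ideal contains some \<open>z^k\<close>, and \<open>R / z^k R\<close> is
  Noetherian: scaling \<open>R / z R\<close> by powers of \<open>z\<close> gives the successive
  layers.\<close>

lemma basis_noetherian:
  assumes b: "basis {..<N::nat} r"
  shows "noetherian_ring A"
proof -
  interpret A: cring A by (rule cring_A)
  have bt: "fg_between ((\<otimes>) (z [^] k) ` R) R \<and> (\<otimes>) (z [^] k) ` R \<subseteq> R" for k :: nat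
  proof (induction k)
    case 0
    have "(\<otimes>) (z [^] (0::nat)) ` R = R" by (auto simp: image_iff)
    moreover have "fg_between R R" unfolding fg_between_def
      by (intro allI impI exI[of _ "{}"]) auto
    ultimately show ?case by simp
  next
    case (Suc k)
    have e: "(\<otimes>) (z [^] k) ` ((\<otimes>) z ` R) = (\<otimes>) (z [^] Suc k) ` R"
      unfolding image_image by (rule image_cong) (auto simp: m_assoc)
    have "fg_between ((\<otimes>) (z [^] k) ` ((\<otimes>) z ` R)) ((\<otimes>) (z [^] k) ` R)"
      by (rule fg_between_scale[OF _ _ _ _ basis_fg_between[OF b]]) auto
    moreover have sub: "(\<otimes>) (z [^] Suc k) ` R \<subseteq> (\<otimes>) (z [^] k) ` R"
      unfolding e[symmetric] by (intro image_mono) auto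
    ultimately have "fg_between ((\<otimes>) (z [^] Suc k) ` R) R"
      unfolding e using fg_between_trans[OF smod_scale[OF smod_R, of "z [^] k"] sub _ _ _ smod_R] Suc.IH by auto
    then show ?case using sub Suc.IH by blast
  qed
  show ?thesis
  proof (rule A.noetherian_ringI)
    fix I assume I: "ideal I A"
    then have Is: "I \<subseteq> R" "smod R I" using ideal_A_iff by auto
    show "\<exists>S\<subseteq>carrier A. finite S \<and> I = Idl\<^bsub>A\<^esub> S"
    proof (cases "I \<subseteq> {\<zero>}")
      case True
      then have e: "I = {\<zero>}" using smod_zero[OF Is(2)] by blast
      have "Idl\<^bsub>A\<^esub> {\<zero>} = {\<zero>}"
      proof
        show "Idl\<^bsub>A\<^esub> {\<zero>} \<subseteq> {\<zero>}" using I e by (intro A.genideal_minimal) auto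
        show "{\<zero>} \<subseteq> Idl\<^bsub>A\<^esub> {\<zero>}" by (rule A.genideal_self) auto
      qed
      then show ?thesis using e by (intro exI[of _ "{\<zero>}"]) auto
    next
      case False
      then obtain s where s: "s \<in> I" "s \<noteq> \<zero>" by blast
      have sR: "s \<in> R" using s Is(1) by blast
      obtain k :: nat and a where k: "a \<in> R" "z [^] k = s \<otimes> a"
        by (rule power_multiple[OF sR s(2)])
      have "z [^] k = a \<otimes> s" unfolding k(2) using k(1) s Is(1) by (auto simp: m_comm)
      then have zI: "z [^] k \<in> I" using smod_smult[OF Is(2) k(1) s(1)] by simp
      have sub: "(\<otimes>) (z [^] k) ` R \<subseteq> J" if "smod R J" "z [^] k \<in> J" for J
        using smod_smult[OF that(1) _ that(2)] by (auto simp: m_comm[of "z [^] k"])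
      obtain S where S: "S \<subseteq> I" "finite S"
        "\<And>N. smod R N \<Longrightarrow> (\<otimes>) (z [^] k) ` R \<subseteq> N \<Longrightarrow> S \<subseteq> N \<Longrightarrow> I \<subseteq> N"
        using fg_betweenD[OF conjunct1[OF bt[of k]] Is(2) sub[OF Is(2) zI] Is(1)] by blast
      let ?T = "insert (z [^] k) S"
      have T: "?T \<subseteq> I" "?T \<subseteq> carrier A" using S zI Is by auto
      have "Idl\<^bsub>A\<^esub> ?T \<subseteq> I" by (rule A.genideal_minimal[OF I T(1)])
      moreover have g: "?T \<subseteq> Idl\<^bsub>A\<^esub> ?T" by (rule A.genideal_self[OF T(2)])
      have "smod R (Idl\<^bsub>A\<^esub> ?T)" using A.genideal_ideal[OF T(2)] ideal_A_iff by blast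
      then have "I \<subseteq> Idl\<^bsub>A\<^esub> ?T" using S(3) sub g by blast
      ultimately show ?thesis using T S(2) by (intro exI[of _ ?T]) auto
    qed
  qed
qed

text \<open>A nonzero prime contains a power of \<open>z\<close>, hence \<open>z\<close>, and by
  \<open>integral_radical\<close> also every \<open>z v\<close> that lies in \<open>R\<close>; these
  elements exhaust \<open>m\<close>.\<close>

lemma krull_dim_A: "krull_dim A = 1"
  unfolding krull_dim_one_iff
proof (intro conjI allI impI)
  show "m \<noteq> {\<zero>}" using z_m z_nz by blast
  fix P assume P: "primeideal P A" "P \<noteq> {\<zero>}"
  note sub = primeideal_quasilocal[OF P(1)]
  have Ps: "P \<subseteq> R" "smod R P" using primeideal.axioms(1)[OF P(1)] ideal_A_iff by auto
  have n1: "\<one> \<notin> P" using sub(1) by auto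
  have pw: "x \<in> P" if "x \<in> R" "x [^] (k::nat) \<in> P" for x k
    using that(2)
  proof (induction k)
    case (Suc k)
    then show ?case using primeideal.I_prime[OF P(1), of "x [^] k" x] that(1) by auto
  qed (use n1 in simp)
  obtain r where r: "r \<in> P" "r \<noteq> \<zero>" using P(2) sub(3) by blast
  have rR: "r \<in> R" using r Ps(1) by blast
  obtain k :: nat and a where k: "a \<in> R" "z [^] k = r \<otimes> a" by (rule power_multiple[OF rR r(2)])
  have "z [^] k = a \<otimes> r" unfolding k(2) using k(1) r Ps(1) by (auto simp: m_comm)
  then have "z [^] k \<in> P" using smod_smult[OF Ps(2) k(1) r(1)] by simp
  then have zP: "z \<in> P" using pw by blast
  show "P = m"
  proof
    show "m \<subseteq> P"
    proof
      fix x assume x: "x \<in> m"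
      obtain v where v: "v \<in> V" "x = z \<otimes> v" using iffD1[OF m_iff x] by blast
      have "\<exists>k::nat. (z \<otimes> v) [^] k \<in> P"
        by (rule integral_radical[OF v(1) subring subset_refl Ps(2,1) zP]) (use v x in auto)
      then show "x \<in> P" using pw[of x] v(2) x by auto
    qed
  qed (rule sub(1))
qed

text \<open>An \<open>x\<close> whose factorization \<open>z^k u\<close> has the least exponent
  divides all other elements in \<open>V\<close>.\<close>

lemma minimal_valuation:
  assumes I: "I \<subseteq> V" "s \<in> I" "s \<noteq> \<zero>"
  shows "\<exists>x\<in>I. x \<noteq> \<zero> \<and> (\<forall>y\<in>I. \<exists>v\<in>V. y = x \<otimes> v)"
proof -
  let ?Q = "\<lambda>k::nat. \<exists>x\<in>I. \<exists>u\<in>V. x \<noteq> \<zero> \<and> u \<noteq> \<zero> \<and> inv u \<in> V \<and> x = z [^] k \<otimes> u"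
  have fac: "\<exists>k. \<exists>u\<in>V. u \<noteq> \<zero> \<and> inv u \<in> V \<and> s = z [^] (k::nat) \<otimes> u" if "s \<in> I" "s \<noteq> \<zero>" for s
  proof -
    have "s \<in> V" using that I(1) by blast
    then show ?thesis by (rule factor_z[OF _ that(2)]) blast
  qed
  then have "\<exists>k. ?Q k" using I(2,3) by blast
  define k where "k = (LEAST k. ?Q k)"
  have "?Q k" unfolding k_def by (rule LeastI_ex) fact
  then obtain x u where x: "x \<in> I" "u \<in> V" "x \<noteq> \<zero>" "u \<noteq> \<zero>" "inv u \<in> V" "x = z [^] k \<otimes> u" by blast
  have xF: "x \<in> carrier F" using I(1) x by blast
  have div: "\<exists>v\<in>V. y = x \<otimes> v" if y: "y \<in> I" for y
  proof (cases "y = \<zero>")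
    case True
    then have "y = x \<otimes> \<zero>" using xF by simp
    then show ?thesis by blast
  next
    case False
    obtain l :: nat and w where w: "w \<in> V" "w \<noteq> \<zero>" "inv w \<in> V" "y = z [^] l \<otimes> w" using fac[OF y False] by blast
    then have "?Q l" using y False by blast
    then have kl: "k \<le> l" unfolding k_def by (rule Least_le)
    define u' where "u' = inv u"
    have u': "u' \<in> V" "u \<otimes> u' = \<one>" using x by (auto simp: u'_def)
    have "x \<otimes> (z [^] (l - k) \<otimes> (w \<otimes> u')) = (z [^] k \<otimes> z [^] (l - k)) \<otimes> w \<otimes> (u \<otimes> u')"
      unfolding x(6) using x(2) w(1) u'(1) by (simp add: m_ac)
    also have "\<dots> = y" unfolding u'(2) w(4) using kl w(1) by (simp add: nat_pow_mult)
    finally have "y = x \<otimes> (z [^] (l - k) \<otimes> (w \<otimes> u'))" by simp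
    moreover have "z [^] (l - k) \<otimes> (w \<otimes> u') \<in> V" using w u' by blast
    ultimately show ?thesis by blast
  qed
  show ?thesis using x(1,3) div by blast
qed

text \<open>For \<open>x\<close> of minimal value, \<open>J = I / x\<close> lies between
  \<open>R\<close> and \<open>V\<close> and is therefore a ring. So \<open>I = x J\<close> and
  \<open>I I = x I\<close>.\<close>

lemma principal_over_endomorphisms:
  assumes I: "ideal I A" "I \<noteq> {\<zero>}"
  obtains x where "x \<in> I" "x \<noteq> \<zero>" "\<And>y w. y \<in> I \<Longrightarrow> w \<in> I \<Longrightarrow> inv x \<otimes> y \<otimes> w \<in> I"
proof -
  have Is: "I \<subseteq> R" "smod R I" using I ideal_A_iff by auto
  have IF: "y \<in> carrier F" if "y \<in> I" for y using that Is by auto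
  have IV: "I \<subseteq> V" using Is(1) by auto
  obtain s where s: "s \<in> I" "s \<noteq> \<zero>" using I(2) smod_zero[OF Is(2)] by blast
  obtain x where x: "x \<in> I" "x \<noteq> \<zero>" and div: "\<forall>y\<in>I. \<exists>v\<in>V. y = x \<otimes> v"
    using minimal_valuation[OF IV s] by auto
  have xF: "x \<in> carrier F" using IF x by blast
  let ?J = "{v \<in> carrier F. x \<otimes> v \<in> I}"
  have J: "smod R ?J" by (rule smod_preimage[OF Is(2) xF])
  have J1: "\<one> \<in> ?J" using x xF by simp
  have inv: "inv x \<otimes> y \<otimes> w \<in> I" if y: "y \<in> I" and w: "w \<in> I" for y w
  proof -
    obtain v v' where v: "v \<in> V" "v' \<in> V" "y = x \<otimes> v" "w = x \<otimes> v'"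
      using bspec[OF div y] bspec[OF div w] by auto
    have "v \<otimes> v' \<in> ?J" by (rule Q[OF v(1,2) J J1]) (use y w v in auto)
    moreover have "ix \<otimes> y \<otimes> w = (ix \<otimes> x) \<otimes> (x \<otimes> (v \<otimes> v'))" if "ix \<in> carrier F" for ix
      unfolding v(3,4) using v(1,2) xF that by (simp add: m_ac)
    from this[of "inv x"] have "inv x \<otimes> y \<otimes> w = x \<otimes> (v \<otimes> v')" using v(1,2) xF x(2) by simp
    ultimately show ?thesis by simp
  qed
  show ?thesis using that[OF x inv] by blast
qed

text \<open>\<open>I\<close> is free of rank one over its endomorphism ring. The basis is
  \<open>{x}\<close>, the coordinate of \<open>y\<close> is the multiplication by
  \<open>y / x\<close>, and \<open>p\<close> recovers \<open>y\<close> by evaluating this coordinate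
  at \<open>x\<close>.\<close>

lemma stable_ideal_A:
  assumes I: "ideal I A" "I \<noteq> {\<zero>}"
  shows "stable_ideal A I"
proof -
  obtain x where x: "x \<in> I" "x \<noteq> \<zero>" and inv: "\<And>y w. y \<in> I \<Longrightarrow> w \<in> I \<Longrightarrow> inv x \<otimes> y \<otimes> w \<in> I"
    using principal_over_endomorphisms[OF I] by blast
  have IR: "I \<subseteq> R" and Is: "smod R I" using I(1) ideal_A_iff by auto
  have IF: "y \<in> carrier F" if "y \<in> I" for y using that IR by auto
  have xF: "x \<in> carrier F" "x \<in> R" using x IF IR by auto
  have ixF: "inv x \<in> carrier F" using xF x by simp
  define H where "H = endo_ring A (mult_module A I)"
  define M where "M = endo_module (mult_module A I)"
  define free where "free = direct_sum_module {x} (\<lambda>_. mult_module H (carrier H))"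
  note M = endo_module_sel[of I, folded M_def]
  note H = endo_ring_sel[of I, folded H_def]
  have free: "carrier free = ({x} \<rightarrow>\<^sub>E carrier H)" "\<And>f g. f \<oplus>\<^bsub>free\<^esub> g = (\<lambda>b\<in>{x}. \<lambda>y\<in>I. f b y \<oplus> g b y)"
    "\<And>r f. r \<odot>\<^bsub>free\<^esub> f = (\<lambda>b\<in>{x}. compose I r (f b))"
    by (simp_all add: free_def direct_sum_module_def mult_module_def H(2-4))
  define \<mu> where "\<mu> y = (\<lambda>w\<in>I. inv x \<otimes> y \<otimes> w)" for y
  have mu: "\<mu> y \<in> carrier H" if y: "y \<in> I" for y
    using y IF[OF y] IF ixF inv smod_add[OF Is] smod_smult[OF Is]
    by (auto simp: H(1) \<mu>_def r_distr m_ac)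
  have muadd: "\<mu> (y \<oplus> y') = (\<lambda>w\<in>I. \<mu> y w \<oplus> \<mu> y' w)" if "y \<in> I" "y' \<in> I" for y y'
  proof
    fix w
    show "\<mu> (y \<oplus> y') w = (\<lambda>w\<in>I. \<mu> y w \<oplus> \<mu> y' w) w"
      using that IF ixF by (cases "w \<in> I") (auto simp: \<mu>_def r_distr l_distr)
  qed
  \<comment> \<open>\<open>f\<close> commutes with the multiplications by \<open>x\<close> and by
    \<open>w\<close>. So \<open>x t = w y\<close> for \<open>t = w y / x\<close> implies
    \<open>x (f t) = w (f y)\<close>.\<close>
  have muH: "\<mu> (f y) = compose I f (\<mu> y)" if f: "f \<in> carrier H" and y: "y \<in> I" for f y
  proof
    fix w
    show "\<mu> (f y) w = compose I f (\<mu> y) w"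
    proof (cases "w \<in> I")
      case True
      have fl: "f (r \<otimes> v) = r \<otimes> f v" "f v \<in> I" if "r \<in> R" "v \<in> I" for r v using f that by (auto simp: H(1))
      define t where "t = inv x \<otimes> y \<otimes> w"
      have t: "t \<in> I" using inv[OF y True] by (simp add: t_def)
      have yw: "y \<in> carrier F" "w \<in> carrier F" "w \<in> R" "f y \<in> carrier F" "f t \<in> carrier F"
        using y True IF IR fl[of \<zero>] t by auto
      have "x \<otimes> t = (x \<otimes> inv x) \<otimes> (w \<otimes> y)" unfolding t_def using xF(1) ixF yw(1,2) by (simp only: m_ac m_closed)
      then have xt: "x \<otimes> t = w \<otimes> y" using xF x yw by simp
      have "x \<otimes> f t = f (x \<otimes> t)" using fl[OF xF(2) t] by simp
      also have "\<dots> = w \<otimes> f y" unfolding xt using fl[OF yw(3) y] by simp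
      finally have "inv x \<otimes> (x \<otimes> f t) = inv x \<otimes> (w \<otimes> f y)" by simp
      moreover have "inv x \<otimes> (x \<otimes> f t) = f t" using xF x yw by (simp add: m_assoc[symmetric])
      moreover have "inv x \<otimes> (w \<otimes> f y) = inv x \<otimes> f y \<otimes> w" using ixF yw by (simp add: m_ac)
      ultimately have "inv x \<otimes> f y \<otimes> w = f t" by simp
      then show ?thesis using True by (simp add: \<mu>_def compose_def t_def)
    qed (simp add: \<mu>_def compose_def)
  qed
  define i where "i y = (\<lambda>b\<in>{x}. \<mu> y)" for y
  define p where "p f = f x x" for f :: "'a \<Rightarrow> 'a \<Rightarrow> 'a"
  have "i \<in> module_hom H M free"
    unfolding module_hom_def M free
    using mu by (auto simp: i_def muadd muH fun_eq_iff)
  moreover have "p \<in> module_hom H free M"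
    unfolding module_hom_def M free p_def
  proof (intro CollectI conjI ballI Pi_I)
    show "f x x \<in> I" if "f \<in> {x} \<rightarrow>\<^sub>E carrier H" for f
      using x(1) PiE_mem[OF that, of x] by (auto simp: H(1))
  qed (use x(1) in \<open>simp_all add: compose_def\<close>)
  moreover have "p (i y) = y" if "y \<in> carrier M" for y
  proof -
    have y: "y \<in> I" using that by (simp add: M)
    have "p (i y) = inv x \<otimes> y \<otimes> x" using x by (simp add: p_def i_def \<mu>_def)
    also have "\<dots> = (inv x \<otimes> x) \<otimes> y" using ixF xF IF[OF y] by (simp add: m_ac)
    finally show ?thesis using xF x IF[OF y] by simp
  qed
  ultimately have "\<exists>i\<in>module_hom H M free. \<exists>p\<in>module_hom H free M. \<forall>y\<in>carrier M. p (i y) = y"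
    by blast
  then have "projective_module H M"
    unfolding projective_module_def Let_def free_def by (rule exI)
  then show ?thesis unfolding stable_ideal_def H_def M_def .
qed

text \<open>Finitely many generators have a common denominator \<open>z^K\<close>, so
  \<open>V = R + z^K V\<close> would equal \<open>R\<close>. But \<open>r 0 = z y\<close> with
  \<open>y\<close> in \<open>R\<close> contradicts independence; \<open>0 < N\<close> provides
  \<open>r 0\<close>.\<close>

lemma basis_not_finite_normalization:
  assumes b: "basis {..<N::nat} r" and N: "0 < N"
  shows "\<not> finite_normalization F R"
proof
  assume "finite_normalization F R"
  then obtain S where S: "S \<subseteq> V" "finite S" "\<And>N. submodule N A (mult_module F V) \<Longrightarrow> S \<subseteq> N \<Longrightarrow> N = V"
    unfolding finite_normalization_def fg_module_def by (auto simp: mult_module_def)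
  have Vm: "smod R V" by (rule smodI) auto
  have "\<exists>K::nat. \<forall>s\<in>S. z [^] K \<otimes> s \<in> R"
    using S(2,1)
  proof (induction S rule: finite_induct)
    case (insert s S)
    then obtain K :: nat where K: "\<forall>s\<in>S. z [^] K \<otimes> s \<in> R" by blast
    have sF: "s \<in> carrier F" "\<And>s. s \<in> S \<Longrightarrow> s \<in> carrier F" using insert.prems by auto
    obtain k :: nat where k: "z [^] k \<otimes> s \<in> R" using z_pow_denom[OF sF(1)] by blast
    have "z [^] (K + k) \<otimes> t \<in> R" if "t \<in> insert s S" for t
      using that K k sF z_pow_mono[of K t "K + k"] z_pow_mono[of k s "K + k"] by auto
    then show ?case by blast
  qed simp
  then obtain K :: nat where K: "\<forall>s\<in>S. z [^] K \<otimes> s \<in> R" by blast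
  let ?N = "V \<inter> {v \<in> carrier F. z [^] K \<otimes> v \<in> R}"
  have "smod R ?N" by (intro smod_Int[OF Vm] smod_preimage[OF smod_R]) auto
  then have "submodule ?N A (mult_module F V)" using submodule_mult_module_iff[OF Vm] by blast
  then have "?N = V" by (rule S(3)) (use S(1) K in auto)
  then have KV: "z [^] K \<otimes> v \<in> R" if "v \<in> V" for v using that by blast
  have r0: "r 0 \<in> m" using basisD(2)[OF b] N by simp
  then obtain y where y: "y \<in> V" "r 0 = z \<otimes> y" using m_iff by blast
  obtain c w where cw: "c \<in> R" "w \<in> V" "y = c \<oplus> z [^] K \<otimes> w" using V_res_pow[OF y(1)] by blast
  then have yR: "y \<in> R" using KV by simp
  let ?c = "\<lambda>i. if 0 = i then \<one> else \<zero>"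
  have "(\<Oplus>i\<in>{..<N}. ?c i \<otimes> r i) = (\<Oplus>i\<in>{..<N}. if 0 = i then r i else \<zero>)"
    using basisD(2)[OF b] by (intro finsum_cong') auto
  also have "\<dots> = r 0" using finsum_singleton[of 0 "{..<N}" r] N basisD(2)[OF b] by auto
  finally have "(\<Oplus>i\<in>{..<N}. ?c i \<otimes> r i) = z \<otimes> y" using y(2) by simp
  then have "?c 0 \<in> m" using basisD(4)[OF b _ yR, of ?c 0] N by auto
  then show False by simp
qed

theorem basis_bad_noetherian:
  assumes b: "basis {..<N::nat} r" and N: "0 < N"
  shows "bad_noetherian_stable_domain F R" "has_embedding_dim A (Suc N)"
  using basis_noetherian[OF b] krull_dim_A basis_not_finite_normalization[OF b N] ql
    basis_embedding_dim[OF b] domain_A stable_ideal_A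
  by (auto simp: bad_noetherian_stable_domain_def bad_stable_domain_def stable_domain_def)

end

section \<open>Quotient modules and direct sums\<close>

context frac_field
begin

text \<open>The coset of \<open>x\<close> depends only on \<open>L\<close>, so one term serves every
  quotient \<open>T / L\<close> with \<open>L \<subseteq> T\<close>.\<close>

definition cos :: "'a set \<Rightarrow> 'a \<Rightarrow> 'a set" where
  "cos L x = (\<lambda>a. a \<oplus> x) ` L"

lemma cos_eq_iff:
  assumes L: "smod R L" and x: "x \<in> carrier F" and y: "y \<in> carrier F"
  shows "cos L x = cos L y \<longleftrightarrow> x \<ominus> y \<in> L"
proof
  have LF: "a \<in> carrier F" if "a \<in> L" for a using smod_carrier[OF L that] .
  assume e: "cos L x = cos L y"
  have "\<zero> \<oplus> x \<in> cos L x" unfolding cos_def using smod_zero[OF L] by blast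
  then have "x \<in> cos L y" using x e by simp
  then obtain a where a: "a \<in> L" "x = a \<oplus> y" by (auto simp: cos_def)
  then have "x \<ominus> y = a" using LF y by (simp add: a_minus_def a_assoc r_neg)
  then show "x \<ominus> y \<in> L" using a by simp
next
  have LF: "a \<in> carrier F" if "a \<in> L" for a using smod_carrier[OF L that] .
  have sub: "cos L x \<subseteq> cos L y" if d: "x \<ominus> y \<in> L" and x: "x \<in> carrier F" and y: "y \<in> carrier F" for x y
  proof
    fix w assume "w \<in> cos L x"
    then obtain a where a: "a \<in> L" "w = a \<oplus> x" by (auto simp: cos_def)
    have "w = (a \<oplus> (x \<ominus> y)) \<oplus> y"
      using LF[OF a(1)] x y by (simp add: a(2) a_minus_def a_assoc l_neg)
    then show "w \<in> cos L y" unfolding cos_def using smod_add[OF L a(1) d] by blast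
  qed
  assume d: "x \<ominus> y \<in> L"
  have "y \<ominus> x = \<ominus> (x \<ominus> y)" using x y by (simp add: a_minus_def minus_add a_comm)
  then have "y \<ominus> x \<in> L" using smod_neg[OF L subring d] by simp
  then show "cos L x = cos L y" using sub d x y by blast
qed

lemma cos_zero: "smod R L \<Longrightarrow> cos L \<zero> = L"
  using smod_carrier[of R L] by (force simp: cos_def image_iff)

lemma cos_zero_iff: "smod R L \<Longrightarrow> x \<in> carrier F \<Longrightarrow> cos L x = L \<longleftrightarrow> x \<in> L"
  using cos_eq_iff[of L x \<zero>] by (simp add: cos_zero a_minus_def)

lemma quot_sel:
  assumes L: "smod R L" and T: "smod R T" and LT: "L \<subseteq> T"
  defines "Q \<equiv> quot_module (mult_module F T) L"
  shows "carrier Q = cos L ` T" "\<zero>\<^bsub>Q\<^esub> = cos L \<zero>"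
    "x \<in> T \<Longrightarrow> y \<in> T \<Longrightarrow> cos L x \<oplus>\<^bsub>Q\<^esub> cos L y = cos L (x \<oplus> y)"
    "r \<in> R \<Longrightarrow> x \<in> T \<Longrightarrow> r \<odot>\<^bsub>Q\<^esub> cos L x = cos L (r \<otimes> x)"
proof -
  note LF = smod_carrier[OF L] and TF = smod_carrier[OF T]
  have c: "a_r_coset (mult_module F T) L x = cos L x" for x
    by (auto simp: a_r_coset_def r_coset_def mult_module_def cos_def)
  show "carrier Q = cos L ` T"
    by (auto simp: Q_def quot_module_def A_RCOSETS_def RCOSETS_def c[unfolded a_r_coset_def] mult_module_def
        cos_def r_coset_def)
  show "\<zero>\<^bsub>Q\<^esub> = cos L \<zero>" by (simp add: Q_def quot_module_def cos_zero[OF L])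
  show "cos L x \<oplus>\<^bsub>Q\<^esub> cos L y = cos L (x \<oplus> y)" if xy: "x \<in> T" "y \<in> T"
  proof -
    have "cos L x \<oplus>\<^bsub>Q\<^esub> cos L y = {(a \<oplus> x) \<oplus> (b \<oplus> y) | a b. a \<in> L \<and> b \<in> L}"
      by (auto simp: Q_def quot_module_def set_add_def set_mult_def mult_module_def cos_def)
    also have "\<dots> = cos L (x \<oplus> y)"
    proof
      show "{(a \<oplus> x) \<oplus> (b \<oplus> y) | a b. a \<in> L \<and> b \<in> L} \<subseteq> cos L (x \<oplus> y)"
      proof
        fix w assume "w \<in> {(a \<oplus> x) \<oplus> (b \<oplus> y) | a b. a \<in> L \<and> b \<in> L}"
        then obtain a b where ab: "a \<in> L" "b \<in> L" "w = (a \<oplus> x) \<oplus> (b \<oplus> y)" by blast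
        then have "w = (a \<oplus> b) \<oplus> (x \<oplus> y)" using LF TF xy by (simp add: a_ac)
        then show "w \<in> cos L (x \<oplus> y)" using smod_add[OF L ab(1,2)] unfolding cos_def by blast
      qed
      show "cos L (x \<oplus> y) \<subseteq> {(a \<oplus> x) \<oplus> (b \<oplus> y) | a b. a \<in> L \<and> b \<in> L}"
      proof
        fix w assume "w \<in> cos L (x \<oplus> y)"
        then obtain a where a: "a \<in> L" "w = a \<oplus> (x \<oplus> y)" by (auto simp: cos_def)
        then have "w = (a \<oplus> x) \<oplus> (\<zero> \<oplus> y)" using LF TF xy by (simp add: a_ac)
        then show "w \<in> {(a \<oplus> x) \<oplus> (b \<oplus> y) | a b. a \<in> L \<and> b \<in> L}" using a smod_zero[OF L] by blast
      qed
    qed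
    finally show ?thesis .
  qed
  show "r \<odot>\<^bsub>Q\<^esub> cos L x = cos L (r \<otimes> x)" if r: "r \<in> R" and x: "x \<in> T"
  proof -
    have "r \<odot>\<^bsub>Q\<^esub> cos L x = (\<Union>y\<in>cos L x. cos L (r \<otimes> y))"
      unfolding Q_def quot_module_def module.simps by (simp add: c) (simp add: mult_module_def)
    moreover have "cos L (r \<otimes> y) = cos L (r \<otimes> x)" if y: "y \<in> cos L x" for y
    proof -
      obtain a where a: "a \<in> L" "y = a \<oplus> x" using y by (auto simp: cos_def)
      have "r \<otimes> y \<ominus> r \<otimes> x = r \<otimes> a"
        unfolding a(2) using a(1) r x LF TF by (simp add: r_distr a_minus_def a_assoc r_neg)
      then have "r \<otimes> y \<ominus> r \<otimes> x \<in> L" using smod_smult[OF L r a(1)] by simp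
      then show ?thesis using cos_eq_iff[OF L] r x a LF TF by simp
    qed
    moreover have "cos L x \<noteq> {}" using smod_zero[OF L] by (auto simp: cos_def)
    ultimately show ?thesis by auto
  qed
qed

lemma module_quot:
  assumes L: "smod R L" and T: "smod R T" and LT: "L \<subseteq> T"
  shows "module A (quot_module (mult_module F T) L)"
proof -
  let ?Q = "quot_module (mult_module F T) L"
  note sel = quot_sel[OF L T LT]
  note TF = smod_carrier[OF T] and Tc = smod_zero[OF T] smod_add[OF T] smod_smult[OF T]
  have Tn: "\<ominus> x \<in> T" if "x \<in> T" for x using smod_neg[OF T subring that] .
  show ?thesis
  proof (rule moduleI)
    show "cring A" by (rule cring_A)
    show "abelian_group ?Q"
    proof (rule abelian_groupI)
      fix u assume "u \<in> carrier ?Q"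
      then obtain x where x: "x \<in> T" "u = cos L x" by (auto simp: sel(1))
      have "cos L (\<ominus> x) \<oplus>\<^bsub>?Q\<^esub> u = \<zero>\<^bsub>?Q\<^esub>" using x Tn TF by (simp add: sel l_neg)
      then show "\<exists>v\<in>carrier ?Q. v \<oplus>\<^bsub>?Q\<^esub> u = \<zero>\<^bsub>?Q\<^esub>" using Tn x by (auto simp: sel(1))
    qed (use Tc TF in \<open>auto simp: sel a_ac\<close>)
  qed (use Tc TF in \<open>auto simp: sel l_distr r_distr m_assoc\<close>)
qed

lemma direct_sum_sel:
  assumes "finite I"
  shows "carrier (direct_sum_module I K) = (\<Pi>\<^sub>E i\<in>I. carrier (K i))"
    "f \<oplus>\<^bsub>direct_sum_module I K\<^esub> g = (\<lambda>i\<in>I. f i \<oplus>\<^bsub>K i\<^esub> g i)"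
    "r \<odot>\<^bsub>direct_sum_module I K\<^esub> f = (\<lambda>i\<in>I. r \<odot>\<^bsub>K i\<^esub> f i)"
  using assms by (auto simp: direct_sum_module_def)

end

text \<open>An isomorphism from \<open>V / R\<close> to the direct sum of the \<open>K i\<close>,
  pulled back to coordinate maps \<open>d i\<close> on \<open>V\<close>. Injectivity becomes
  \<open>d_ker\<close>; surjectivity becomes \<open>d_surj\<close>, which prescribes all coordinates
  at once.\<close>

locale lifted_sum = quasi +
  fixes N :: nat and K :: "nat \<Rightarrow> ('a, 'k) module" and d :: "nat \<Rightarrow> 'a \<Rightarrow> 'k"
  assumes V_ring: "subring V F"
    and K_module: "i < N \<Longrightarrow> module A (K i)"
    and d_closed: "i < N \<Longrightarrow> v \<in> V \<Longrightarrow> d i v \<in> carrier (K i)"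
    and d_add: "i < N \<Longrightarrow> v \<in> V \<Longrightarrow> w \<in> V \<Longrightarrow> d i (v \<oplus> w) = d i v \<oplus>\<^bsub>K i\<^esub> d i w"
    and d_smult: "i < N \<Longrightarrow> r \<in> R \<Longrightarrow> v \<in> V \<Longrightarrow> d i (r \<otimes> v) = r \<odot>\<^bsub>K i\<^esub> d i v"
    and d_ker: "v \<in> V \<Longrightarrow> v \<in> R \<longleftrightarrow> (\<forall>i<N. d i v = \<zero>\<^bsub>K i\<^esub>)"
    and d_surj: "(\<And>i. i < N \<Longrightarrow> y i \<in> carrier (K i)) \<Longrightarrow> \<exists>v\<in>V. \<forall>i<N. d i v = y i"

lemma (in quasi) module_isomorphic_lift:
  fixes K :: "nat \<Rightarrow> ('a, 'k) module"
  assumes V: "subring V F" and K: "\<And>i. i < N \<Longrightarrow> module A (K i)"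
    and iso: "module_isomorphic A (quot_module (mult_module F V) R) (direct_sum_module {..<N} K)"
  shows "\<exists>d. lifted_sum F R N K d"
proof -
  note VE = subringE[OF V]
  have Vs: "smod R V" by (intro smodI VE(2,6,7)) auto
  have RV: "R \<subseteq> V" by auto
  let ?Q = "quot_module (mult_module F V) R"
  note sel = quot_sel[OF smod_R Vs RV]
  note ds = direct_sum_sel[OF finite_lessThan[of N], of K]
  obtain f where f: "f \<in> module_hom A ?Q (direct_sum_module {..<N} K)"
    "bij_betw f (carrier ?Q) (carrier (direct_sum_module {..<N} K))"
    using iso unfolding module_isomorphic_def by blast
  have f1: "f (cos R v) \<in> (\<Pi>\<^sub>E i\<in>{..<N}. carrier (K i))" if "v \<in> V" for v
    using f(1) that unfolding module_hom_def ds sel by auto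
  have f2: "f (cos R (v \<oplus> w)) = (\<lambda>i\<in>{..<N}. f (cos R v) i \<oplus>\<^bsub>K i\<^esub> f (cos R w) i)"
    if "v \<in> V" "w \<in> V" for v w
    unfolding sel(3)[OF that, symmetric] using f(1) that unfolding module_hom_def ds sel(1) by auto
  have f3: "f (cos R (r \<otimes> v)) = (\<lambda>i\<in>{..<N}. r \<odot>\<^bsub>K i\<^esub> f (cos R v) i)" if "r \<in> R" "v \<in> V" for r v
    unfolding sel(4)[OF that, symmetric] using f(1) that unfolding module_hom_def ds sel(1) by auto
  have cV: "cos R v \<in> carrier ?Q" if "v \<in> V" for v using that by (auto simp: sel(1))
  have inj: "cos R v = cos R w" if "v \<in> V" "w \<in> V" "f (cos R v) = f (cos R w)" for v w
    using f(2) cV that unfolding bij_betw_def inj_on_def by blast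
  define d where "d i v = f (cos R v) i" for i v
  have dz: "d i \<zero> = \<zero>\<^bsub>K i\<^esub>" if i: "i < N" for i
  proof -
    interpret module A "K i" by (rule K[OF i])
    have "f (cos R (\<zero> \<otimes> \<zero>)) i = (\<lambda>i\<in>{..<N}. \<zero> \<odot>\<^bsub>K i\<^esub> f (cos R \<zero>) i) i"
      by (rule fun_cong[OF f3]) auto
    then have "d i (\<zero> \<otimes> \<zero>) = \<zero> \<odot>\<^bsub>K i\<^esub> d i \<zero>"
      by (simp only: d_def i restrict_apply lessThan_iff if_True)
    moreover have "\<zero> \<otimes> \<zero> = \<zero>" by simp
    moreover have "d i \<zero> \<in> carrier (K i)" using f1[of \<zero>] i by (auto simp: d_def)
    ultimately show ?thesis using smult_l_null by simp
  qed
  have "lifted_sum F R N K d"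
  proof (intro lifted_sum.intro lifted_sum_axioms.intro quasi_axioms)
    show "subring V F" by (rule V)
    show "module A (K i)" if "i < N" for i by (rule K[OF that])
    show "d i v \<in> carrier (K i)" if "i < N" "v \<in> V" for i v
      using f1[OF that(2)] that(1) by (auto simp: d_def)
    show "d i (v \<oplus> w) = d i v \<oplus>\<^bsub>K i\<^esub> d i w" if "i < N" "v \<in> V" "w \<in> V" for i v w
      using f2[OF that(2,3)] that(1) by (simp add: d_def)
    show "d i (r \<otimes> v) = r \<odot>\<^bsub>K i\<^esub> d i v" if "i < N" "r \<in> R" "v \<in> V" for i r v
      using f3[OF that(2,3)] that(1) by (simp add: d_def)
    show "v \<in> R \<longleftrightarrow> (\<forall>i<N. d i v = \<zero>\<^bsub>K i\<^esub>)" if v: "v \<in> V" for v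
    proof
      assume "v \<in> R"
      then have "cos R v = cos R \<zero>" using cos_zero_iff[OF smod_R, of v] cos_zero[OF smod_R] by simp
      then show "\<forall>i<N. d i v = \<zero>\<^bsub>K i\<^esub>" using dz by (simp add: d_def)
    next
      assume z: "\<forall>i<N. d i v = \<zero>\<^bsub>K i\<^esub>"
      have "f (cos R v) = f (cos R \<zero>)"
        by (rule PiE_ext[OF f1[OF v] f1]) (use z dz in \<open>auto simp: d_def\<close>)
      then have "cos R v = cos R \<zero>" using inj[OF v] by blast
      then show "v \<in> R" using cos_zero_iff[OF smod_R, of v] cos_zero[OF smod_R] v by simp
    qed
    show "\<exists>v\<in>V. \<forall>i<N. d i v = y i" if y: "\<And>i. i < N \<Longrightarrow> y i \<in> carrier (K i)" for y
    proof -
      have "(\<lambda>i\<in>{..<N}. y i) \<in> carrier (direct_sum_module {..<N} K)" unfolding ds using y by auto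
      then obtain C where "C \<in> carrier ?Q" "f C = (\<lambda>i\<in>{..<N}. y i)"
        using f(2) unfolding bij_betw_def by (metis imageE)
      then obtain v where v: "v \<in> V" "f (cos R v) = (\<lambda>i\<in>{..<N}. y i)" unfolding sel(1) by blast
      then show ?thesis by (intro bexI[of _ v]) (auto simp: d_def)
    qed
  qed
  then show ?thesis by blast
qed

section \<open>Uniformizers of the normalization\<close>

context quasi
begin

lemma frac_field_V: "subring V F \<Longrightarrow> frac_field F V"
proof (intro frac_field.intro frac_field_axioms.intro field_axioms)
  show "\<exists>a\<in>V. \<exists>b\<in>V - {\<zero>}. x = a \<otimes> inv b" if "x \<in> carrier F" for x
    using frac[OF that] by blast
qed

text \<open>\<open>t\<close> generates the maximal ideal. The elementwise form of a DVR is needed so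
  that an element of \<open>R\<close> can later take the place of \<open>t\<close>.\<close>

lemma dvr_uniformizer:
  assumes dvr: "dvr (F\<lparr>carrier := V\<rparr>)"
  shows "subring V F \<and> (\<exists>t\<in>V. t \<noteq> \<zero> \<and> (\<forall>v\<in>V. t \<otimes> v \<noteq> \<one>) \<and>
    (\<forall>x\<in>V. (\<forall>v\<in>V. x \<noteq> t \<otimes> v) \<longrightarrow> inv x \<in> V) \<and>
    (\<forall>x\<in>V. x \<noteq> \<zero> \<longrightarrow> (\<exists>k::nat. \<forall>v\<in>V. x \<noteq> t [^] k \<otimes> v)))"
proof -
  let ?B = "F\<lparr>carrier := V\<rparr>"
  interpret B: principal_domain ?B using dvr by (simp add: dvr_def)
  have V: "subring V F" using subring_iff[of V] B.ring_axioms by auto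
  note VE = subringE[OF V]
  interpret W: frac_field F V by (rule frac_field_V[OF V])
  obtain M where M: "maximalideal M ?B" and Mu: "\<And>M'. maximalideal M' ?B \<Longrightarrow> M' = M"
    using dvr unfolding dvr_def quasilocal_def by blast
  have Mi: "ideal M ?B" using M by (rule maximalideal.axioms)
  obtain t where t: "t \<in> V" "M = PIdl\<^bsub>?B\<^esub> t" using B.exists_gen[OF Mi] by auto
  have Mt: "x \<in> M \<longleftrightarrow> (\<exists>v\<in>V. x = t \<otimes> v)" for x
    unfolding t(2) cgenideal_def using t(1) by (auto simp: m_comm)
  have M1: "\<one> \<notin> M"
    using ideal.one_imp_carrier[OF Mi] maximalideal.I_notcarr[OF M] by auto
  have t0: "t \<noteq> \<zero>"
  proof
    assume "t = \<zero>"
    then have "M = {\<zero>}" using Mt VE(2) by auto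
    then have "field ?B" using B.zeromaximalideal_fieldI M by simp
    then show False using dvr by (simp add: dvr_def)
  qed
  have nu: "t \<otimes> v \<noteq> \<one>" if "v \<in> V" for v using M1 Mt that by metis
  show ?thesis
  proof (intro conjI bexI[of _ t] ballI impI V t(1) t0)
    show "t \<otimes> v \<noteq> \<one>" if "v \<in> V" for v by (rule nu[OF that])
    show "inv x \<in> V" if x: "x \<in> V" "\<forall>v\<in>V. x \<noteq> t \<otimes> v" for x
    proof -
      have "x \<notin> M" using Mt x(2) by blast
      then have "x \<in> Units ?B" using B.nonunit_in_maximalideal[of x] Mu x(1) by auto
      then obtain y where y: "y \<in> V" "x \<otimes> y = \<one>" by (auto simp: Units_def)
      then have "inv x = y" using x(1) by (intro comm_inv_char) auto
      then show ?thesis using y by simp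
    qed
    show "\<exists>k::nat. \<forall>v\<in>V. x \<noteq> t [^] k \<otimes> v" if x: "x \<in> V" "x \<noteq> \<zero>" for x
    proof (rule ccontr)
      assume n: "\<not> ?thesis"
      \<comment> \<open>These are the elements that some power of \<open>t\<close> carries into
        \<open>x V\<close>. For a generator \<open>g\<close> with \<open>t^k g\<close> in
        \<open>x V\<close>, the factor \<open>v\<close> in \<open>x = t^(k+1) v\<close> is a
        multiple of \<open>g\<close>, so \<open>x\<close> would be a multiple of \<open>t x\<close>
        and \<open>t\<close> a unit.\<close>
      define I where "I = {y \<in> V. \<exists>k::nat. \<exists>w\<in>V. t [^] k \<otimes> y = x \<otimes> w}"
      have tF: "t \<in> carrier F" "x \<in> carrier F" using t x by auto
      have tk: "t [^] (k::nat) \<in> V" for k using t(1) by (rule W.R_pow)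
      have "smod V I"
      proof (rule smodI)
        have "t [^] (0::nat) \<otimes> \<zero> = x \<otimes> \<zero>" using tF by simp
        then show "\<zero> \<in> I" unfolding I_def using VE(2) by blast
      next
        fix y y' assume "y \<in> I" "y' \<in> I"
        then obtain k k' :: nat and w w' where h: "y \<in> V" "y' \<in> V" "w \<in> V" "w' \<in> V"
          "t [^] k \<otimes> y = x \<otimes> w" "t [^] k' \<otimes> y' = x \<otimes> w'" unfolding I_def by blast
        have F: "y \<in> carrier F" "y' \<in> carrier F" "w \<in> carrier F" "w' \<in> carrier F" using h by auto
        have "t [^] (k + k') \<otimes> (y \<oplus> y') = t [^] k' \<otimes> (t [^] k \<otimes> y) \<oplus> t [^] k \<otimes> (t [^] k' \<otimes> y')"
          using F tF by (simp add: nat_pow_mult[symmetric] r_distr m_ac)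
        also have "\<dots> = x \<otimes> (t [^] k' \<otimes> w \<oplus> t [^] k \<otimes> w')"
          unfolding h(5,6) using F tF by (simp add: r_distr m_ac)
        finally have "t [^] (k + k') \<otimes> (y \<oplus> y') = x \<otimes> (t [^] k' \<otimes> w \<oplus> t [^] k \<otimes> w')" .
        moreover have "y \<oplus> y' \<in> V" "t [^] k' \<otimes> w \<oplus> t [^] k \<otimes> w' \<in> V"
          by (intro VE(6,7) tk h)+
        ultimately show "y \<oplus> y' \<in> I" unfolding I_def by blast
      next
        fix r y assume r: "r \<in> V" "y \<in> I"
        then obtain k :: nat and w where h: "y \<in> V" "w \<in> V" "t [^] k \<otimes> y = x \<otimes> w" unfolding I_def by blast
        have "t [^] k \<otimes> (r \<otimes> y) = r \<otimes> (t [^] k \<otimes> y)" using tF h r by (simp add: m_lcomm)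
        also have "\<dots> = x \<otimes> (r \<otimes> w)" unfolding h(3) using tF h r by (simp add: m_lcomm)
        finally have "t [^] k \<otimes> (r \<otimes> y) = x \<otimes> (r \<otimes> w)" .
        moreover have "r \<otimes> y \<in> V" "r \<otimes> w \<in> V" by (intro VE(6) r h)+
        ultimately show "r \<otimes> y \<in> I" unfolding I_def by blast
      qed (auto simp: I_def)
      then have "ideal I ?B" using W.ideal_A_iff[of I] by (auto simp: I_def)
      then obtain g where g: "g \<in> V" "I = PIdl\<^bsub>?B\<^esub> g" using B.exists_gen by auto
      have "g \<in> I" using B.cgenideal_self[of g] g by simp
      then obtain k :: nat and w where w: "w \<in> V" "t [^] k \<otimes> g = x \<otimes> w" unfolding I_def by blast
      obtain v where v: "v \<in> V" "x = t [^] Suc k \<otimes> v" using n by blast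
      have "t [^] Suc k \<otimes> v = x \<otimes> \<one>" using v tF by simp
      then have "v \<in> I" unfolding I_def using v(1) VE(3) by blast
      then obtain c where c: "c \<in> V" "v = c \<otimes> g" unfolding g(2) cgenideal_def by auto
      have F: "c \<in> carrier F" "g \<in> carrier F" "w \<in> carrier F" using c g w by auto
      have "x = t [^] Suc k \<otimes> (c \<otimes> g)" using v(2) c(2) by simp
      also have "\<dots> = (t \<otimes> c) \<otimes> (t [^] k \<otimes> g)" using F tF by (simp add: m_ac)
      also have "\<dots> = x \<otimes> (t \<otimes> (c \<otimes> w))" unfolding w(2) using F tF by (simp add: m_ac)
      finally have "x \<otimes> \<one> = x \<otimes> (t \<otimes> (c \<otimes> w))" using tF by simp
      then have "\<one> = t \<otimes> (c \<otimes> w)" using m_lcancel[OF x(2) tF(2), of \<one> "t \<otimes> (c \<otimes> w)"] F tF by simp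
      then show False using nu[of "c \<otimes> w"] VE(6) c w by metis
    qed
  qed
qed

text \<open>For a uniformizer \<open>t = a / b\<close> of \<open>V\<close> we have
  \<open>a^2 = t^2 b^2\<close>, so the remainder \<open>c\<close> of \<open>t\<close> modulo
  \<open>a^2\<close> differs from \<open>t\<close> by a multiple of \<open>t^2\<close>. It is
  \<open>t\<close> times a unit of \<open>V\<close> and lies in \<open>R\<close>. A remainder modulo
  \<open>a\<close> would only be known to be divisible by \<open>t\<close>.\<close>

lemma dvr_divisible_val_quasi:
  assumes dvr: "dvr (F\<lparr>carrier := V\<rparr>)"
    and div: "\<And>r x. r \<in> R \<Longrightarrow> r \<noteq> \<zero> \<Longrightarrow> x \<in> V \<Longrightarrow> \<exists>c\<in>R. \<exists>v\<in>V. x = c \<oplus> r \<otimes> v"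
  shows "\<exists>z. val_quasi F R z"
proof -
  note du = dvr_uniformizer[OF dvr]
  have V: "subring V F" by (rule conjunct1[OF du])
  obtain t where tV: "t \<in> V" and tt: "t \<noteq> \<zero> \<and> (\<forall>v\<in>V. t \<otimes> v \<noteq> \<one>) \<and>
    (\<forall>x\<in>V. (\<forall>v\<in>V. x \<noteq> t \<otimes> v) \<longrightarrow> inv x \<in> V) \<and>
    (\<forall>x\<in>V. x \<noteq> \<zero> \<longrightarrow> (\<exists>k::nat. \<forall>v\<in>V. x \<noteq> t [^] k \<otimes> v))"
    using conjunct2[OF du] ..
  have t: "t \<in> V" "t \<noteq> \<zero>" "\<And>v. v \<in> V \<Longrightarrow> t \<otimes> v \<noteq> \<one>"
    using tV tt[THEN conjunct1] tt[THEN conjunct2, THEN conjunct1] by blast+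
  have u: "inv x \<in> V" if "x \<in> V" "\<And>v. v \<in> V \<Longrightarrow> x \<noteq> t \<otimes> v" for x
    using that tt[THEN conjunct2, THEN conjunct2, THEN conjunct1] by blast
  have sep: "\<exists>k::nat. \<forall>v\<in>V. x \<noteq> t [^] k \<otimes> v" if "x \<in> V" "x \<noteq> \<zero>" for x
    using that tt[THEN conjunct2, THEN conjunct2, THEN conjunct2] by blast
  note VE = subringE[OF V]
  have tF: "t \<in> carrier F" using t by simp
  obtain a b where ab: "a \<in> R" "b \<in> R" "b \<noteq> \<zero>" "t = a \<otimes> inv b" using frac[OF tF] by blast
  have abF: "a \<in> carrier F" "b \<in> carrier F" using ab by auto
  have a0: "a \<noteq> \<zero>" using ab t abF by auto
  have atb: "a = t \<otimes> b" unfolding ab(4) using abF ab(3) by (simp add: m_assoc)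
  obtain c v where cv: "c \<in> R" "v \<in> V" "t = c \<oplus> (a \<otimes> a) \<otimes> v"
    using div[of "a \<otimes> a" t] ab a0 abF t(1) by (auto simp: integral_iff)
  define s where "s = b \<otimes> (b \<otimes> v)"
  have s: "s \<in> V" unfolding s_def by (intro VE(6) R_V ab cv)
  have sF: "s \<in> carrier F" "c \<in> carrier F" "v \<in> carrier F" using s cv by auto
  have ct: "t \<otimes> (t \<otimes> s) \<oplus> c = t"
  proof -
    have e: "(a \<otimes> a) \<otimes> v = t \<otimes> (t \<otimes> s)" unfolding atb s_def using tF abF sF by (simp add: m_ac)
    have "t \<otimes> (t \<otimes> s) \<oplus> c = c \<oplus> t \<otimes> (t \<otimes> s)" using sF tF by (intro a_comm) auto
    also have "\<dots> = t" using cv(3) unfolding e by (rule sym)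
    finally show ?thesis .
  qed
  define e where "e = \<one> \<ominus> t \<otimes> s"
  have e: "e \<in> V" unfolding e_def a_minus_def by (intro VE(3,5,6,7) t s)
  have eF: "e \<in> carrier F" using e by simp
  have e1: "t \<otimes> s \<oplus> e = \<one>" unfolding e_def using tF sF by (intro add_minus_cancel) auto
  have "t \<otimes> (t \<otimes> s) \<oplus> t \<otimes> e = t \<otimes> (t \<otimes> s \<oplus> e)" using tF sF eF by (simp add: r_distr)
  also have "\<dots> = t \<otimes> (t \<otimes> s) \<oplus> c" unfolding e1 ct using tF by simp
  finally have cte: "c = t \<otimes> e" using tF sF eF by simp
  have ie: "inv e \<in> V"
  proof (rule u[OF e])
    fix w assume w: "w \<in> V"
    show "e \<noteq> t \<otimes> w"
    proof
      assume "e = t \<otimes> w"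
      then have "t \<otimes> (s \<oplus> w) = \<one>" using e1 tF sF w by (simp add: r_distr)
      then show False using t(3)[of "s \<oplus> w"] VE(7)[OF s w] by blast
    qed
  qed
  have e0: "e \<noteq> \<zero>"
  proof
    assume "e = \<zero>"
    then have "t \<otimes> s = \<one>" using e1 tF sF by simp
    then show False using t(3) s by blast
  qed
  have c0: "c \<noteq> \<zero>" using cte t(2) e0 tF eF by (simp add: integral_iff)
  have tc: "t = c \<otimes> inv e" unfolding cte using tF eF e0 by (simp add: m_assoc)
  have ieF: "inv e \<in> carrier F" using ie by simp
  have "val_quasi F R c"
  proof (intro val_quasi.intro val_quasi_axioms.intro quasi_axioms)
    show "subring V F" by (rule V)
    show "c \<in> m"
    proof (rule ccontr)
      assume "c \<notin> m"
      then have i: "inv c \<in> V" using unit_R(1) cv(1) by blast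
      have "t \<otimes> (e \<otimes> inv c) = c \<otimes> inv c" using cte tF eF i by (simp add: m_assoc)
      then show False using t(3)[of "e \<otimes> inv c"] VE(6)[OF e i] c0 sF by simp
    qed
    show "c \<noteq> \<zero>" by (rule c0)
    show "inv x \<in> V" if x: "x \<in> V" "\<And>v. v \<in> V \<Longrightarrow> x \<noteq> c \<otimes> v" for x
    proof (rule u[OF x(1)])
      fix v assume v: "v \<in> V"
      have "t \<otimes> v = c \<otimes> (inv e \<otimes> v)" using v sF ieF by (subst tc) (simp add: m_assoc)
      then show "x \<noteq> t \<otimes> v" using x(2)[of "inv e \<otimes> v"] VE(6)[OF ie v] by simp
    qed
    show "\<exists>k::nat. \<forall>v\<in>V. x \<noteq> c [^] k \<otimes> v" if x: "x \<in> V" "x \<noteq> \<zero>" for x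
    proof -
      obtain k :: nat where k: "\<forall>v\<in>V. x \<noteq> t [^] k \<otimes> v" using sep[OF x] by blast
      have ek: "e [^] k \<in> V" using e VE(3,6) by (induction k) auto
      have "x \<noteq> c [^] k \<otimes> v" if v: "v \<in> V" for v
      proof -
        have "c [^] k \<otimes> v = t [^] k \<otimes> (e [^] k \<otimes> v)"
          unfolding cte using tF eF v by (simp add: nat_pow_distrib m_assoc)
        then show ?thesis using k VE(6)[OF ek v] by simp
      qed
      then show ?thesis by blast
    qed
    show "\<exists>r\<in>R. \<exists>v\<in>V. x = r \<oplus> c \<otimes> v" if "x \<in> V" for x by (rule div[OF cv(1) c0 that])
  qed
  then show ?thesis by blast
qed

end

section \<open>From a divisible uniserial decomposition to a basis\<close>

context lifted_sum
begin

lemma K_laws: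
  assumes i: "i < N"
  shows "r \<in> R \<Longrightarrow> x \<in> carrier (K i) \<Longrightarrow> r \<odot>\<^bsub>K i\<^esub> x \<in> carrier (K i)"
    "r \<in> R \<Longrightarrow> s \<in> R \<Longrightarrow> x \<in> carrier (K i) \<Longrightarrow> (r \<otimes> s) \<odot>\<^bsub>K i\<^esub> x = r \<odot>\<^bsub>K i\<^esub> (s \<odot>\<^bsub>K i\<^esub> x)"
    "r \<in> R \<Longrightarrow> s \<in> R \<Longrightarrow> x \<in> carrier (K i) \<Longrightarrow> (r \<oplus> s) \<odot>\<^bsub>K i\<^esub> x = r \<odot>\<^bsub>K i\<^esub> x \<oplus>\<^bsub>K i\<^esub> s \<odot>\<^bsub>K i\<^esub> x"
    "r \<in> R \<Longrightarrow> x \<in> carrier (K i) \<Longrightarrow> y \<in> carrier (K i) \<Longrightarrow>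
      r \<odot>\<^bsub>K i\<^esub> (x \<oplus>\<^bsub>K i\<^esub> y) = r \<odot>\<^bsub>K i\<^esub> x \<oplus>\<^bsub>K i\<^esub> r \<odot>\<^bsub>K i\<^esub> y"
    "x \<in> carrier (K i) \<Longrightarrow> \<one> \<odot>\<^bsub>K i\<^esub> x = x"
    "x \<in> carrier (K i) \<Longrightarrow> \<zero> \<odot>\<^bsub>K i\<^esub> x = \<zero>\<^bsub>K i\<^esub>"
    "r \<in> R \<Longrightarrow> r \<odot>\<^bsub>K i\<^esub> \<zero>\<^bsub>K i\<^esub> = \<zero>\<^bsub>K i\<^esub>"
    "\<zero>\<^bsub>K i\<^esub> \<in> carrier (K i)"
    "x \<in> carrier (K i) \<Longrightarrow> y \<in> carrier (K i) \<Longrightarrow> x \<oplus>\<^bsub>K i\<^esub> y \<in> carrier (K i)"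
    "x \<in> carrier (K i) \<Longrightarrow> x \<oplus>\<^bsub>K i\<^esub> \<zero>\<^bsub>K i\<^esub> = x" "x \<in> carrier (K i) \<Longrightarrow> \<zero>\<^bsub>K i\<^esub> \<oplus>\<^bsub>K i\<^esub> x = x"
proof -
  interpret KM: module A "K i" by (rule K_module[OF i])
  show "r \<in> R \<Longrightarrow> x \<in> carrier (K i) \<Longrightarrow> r \<odot>\<^bsub>K i\<^esub> x \<in> carrier (K i)"
    using KM.smult_closed[of r x] by simp
  show "r \<in> R \<Longrightarrow> s \<in> R \<Longrightarrow> x \<in> carrier (K i) \<Longrightarrow> (r \<otimes> s) \<odot>\<^bsub>K i\<^esub> x = r \<odot>\<^bsub>K i\<^esub> (s \<odot>\<^bsub>K i\<^esub> x)"
    using KM.smult_assoc1[of r s x] by simp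
  show "r \<in> R \<Longrightarrow> s \<in> R \<Longrightarrow> x \<in> carrier (K i) \<Longrightarrow> (r \<oplus> s) \<odot>\<^bsub>K i\<^esub> x = r \<odot>\<^bsub>K i\<^esub> x \<oplus>\<^bsub>K i\<^esub> s \<odot>\<^bsub>K i\<^esub> x"
    using KM.smult_l_distr[of r s x] by simp
  show "r \<in> R \<Longrightarrow> x \<in> carrier (K i) \<Longrightarrow> y \<in> carrier (K i) \<Longrightarrow>
      r \<odot>\<^bsub>K i\<^esub> (x \<oplus>\<^bsub>K i\<^esub> y) = r \<odot>\<^bsub>K i\<^esub> x \<oplus>\<^bsub>K i\<^esub> r \<odot>\<^bsub>K i\<^esub> y"
    using KM.smult_r_distr[of r x y] by simp
  show "x \<in> carrier (K i) \<Longrightarrow> \<one> \<odot>\<^bsub>K i\<^esub> x = x" using KM.smult_one[of x] by simp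
  show "x \<in> carrier (K i) \<Longrightarrow> \<zero> \<odot>\<^bsub>K i\<^esub> x = \<zero>\<^bsub>K i\<^esub>" using KM.smult_l_null[of x] by simp
  show "r \<in> R \<Longrightarrow> r \<odot>\<^bsub>K i\<^esub> \<zero>\<^bsub>K i\<^esub> = \<zero>\<^bsub>K i\<^esub>" using KM.smult_r_null[of r] by simp
  show "\<zero>\<^bsub>K i\<^esub> \<in> carrier (K i)" by (rule KM.M.zero_closed)
  show "x \<in> carrier (K i) \<Longrightarrow> y \<in> carrier (K i) \<Longrightarrow> x \<oplus>\<^bsub>K i\<^esub> y \<in> carrier (K i)" by (rule KM.M.a_closed)
  show "x \<in> carrier (K i) \<Longrightarrow> x \<oplus>\<^bsub>K i\<^esub> \<zero>\<^bsub>K i\<^esub> = x" by (rule KM.M.r_zero)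
  show "x \<in> carrier (K i) \<Longrightarrow> \<zero>\<^bsub>K i\<^esub> \<oplus>\<^bsub>K i\<^esub> x = x" by (rule KM.M.l_zero)
qed

lemma d_surj_one:
  assumes "i < N" "u \<in> carrier (K i)"
  obtains v where "v \<in> V" "d i v = u" "\<And>j. j < N \<Longrightarrow> j \<noteq> i \<Longrightarrow> d j v = \<zero>\<^bsub>K j\<^esub>"
proof -
  have "\<exists>v\<in>V. \<forall>j<N. d j v = (if j = i then u else \<zero>\<^bsub>K j\<^esub>)"
    by (rule d_surj) (use assms K_laws(8) in auto)
  then show ?thesis using that assms by auto
qed

text \<open>Each \<open>y i\<close> lives in the single coordinate \<open>i\<close>, so
  \<open>d j\<close> sees only the term with index \<open>j\<close>.\<close>

lemma d_finsum:
  assumes "j < N" "T \<subseteq> {..<N}" "c \<in> T \<rightarrow> R" "\<And>i. i \<in> T \<Longrightarrow> y i \<in> V"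
    "\<And>i k. i \<in> T \<Longrightarrow> k < N \<Longrightarrow> k \<noteq> i \<Longrightarrow> d k (y i) = \<zero>\<^bsub>K k\<^esub>"
  shows "(\<Oplus>i\<in>T. c i \<otimes> y i) \<in> V \<and>
    d j (\<Oplus>i\<in>T. c i \<otimes> y i) = (if j \<in> T then c j \<odot>\<^bsub>K j\<^esub> d j (y j) else \<zero>\<^bsub>K j\<^esub>)"
  using finite_subset[OF assms(2) finite_lessThan] assms(2-)
proof (induction T rule: finite_induct)
  case empty
  then show ?case using d_ker[of \<zero>] assms(1) by auto
next
  case (insert i T)
  have IH: "(\<Oplus>i\<in>T. c i \<otimes> y i) \<in> V"
    "d j (\<Oplus>i\<in>T. c i \<otimes> y i) = (if j \<in> T then c j \<odot>\<^bsub>K j\<^esub> d j (y j) else \<zero>\<^bsub>K j\<^esub>)"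
    using insert.IH insert.prems by auto
  have ci: "c i \<in> R" "y i \<in> V" "i < N" using insert.prems by auto
  have cy: "c i \<otimes> y i \<in> V" by (rule subringE(6)[OF V_ring]) (use ci in auto)
  have e: "(\<Oplus>i\<in>insert i T. c i \<otimes> y i) = c i \<otimes> y i \<oplus> (\<Oplus>i\<in>T. c i \<otimes> y i)"
    using insert.hyps insert.prems cy by (subst finsum_insert) (auto simp: Pi_iff)
  have V': "c i \<otimes> y i \<oplus> (\<Oplus>i\<in>T. c i \<otimes> y i) \<in> V" by (rule subringE(7)[OF V_ring cy IH(1)])
  have s: "d j (c i \<otimes> y i \<oplus> (\<Oplus>i\<in>T. c i \<otimes> y i)) =
    c i \<odot>\<^bsub>K j\<^esub> d j (y i) \<oplus>\<^bsub>K j\<^esub> (if j \<in> T then c j \<odot>\<^bsub>K j\<^esub> d j (y j) else \<zero>\<^bsub>K j\<^esub>)"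
    using d_add[OF assms(1) cy IH(1)] d_smult[OF assms(1) ci(1,2)] IH(2) by simp
  show ?case
  proof (cases "j = i")
    case True
    then show ?thesis unfolding e using V' s insert.hyps(2) K_laws(1,10)[OF assms(1)] ci d_closed[OF assms(1)] by simp
  next
    case False
    have z: "d j (y i) = \<zero>\<^bsub>K j\<^esub>" using insert.prems(4)[of i j] False assms(1) by auto
    have "j \<in> T \<Longrightarrow> c j \<odot>\<^bsub>K j\<^esub> d j (y j) \<in> carrier (K j)"
      using K_laws(1)[OF assms(1)] d_closed[OF assms(1)] insert.prems(2,3) by (auto simp: Pi_iff)
    then show ?thesis unfolding e using V' s False z K_laws(7,8,11)[OF assms(1)] ci(1) by simp
  qed
qed

text \<open>Dividing each coordinate of \<open>x\<close> by \<open>r\<close> and lifting the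
  quotients to \<open>v\<close> leaves \<open>x - r v\<close> in the common kernel
  \<open>R\<close>.\<close>

lemma divisible_V:
  assumes div: "\<And>i. i < N \<Longrightarrow> divisible_module A (K i)" and r: "r \<in> R" "r \<noteq> \<zero>" and x: "x \<in> V"
  shows "\<exists>c\<in>R. \<exists>v\<in>V. x = c \<oplus> r \<otimes> v"
proof -
  have "\<forall>i<N. \<exists>y. y \<in> carrier (K i) \<and> d i x = r \<odot>\<^bsub>K i\<^esub> y"
    using div r d_closed[OF _ x] unfolding divisible_module_def by (auto simp: image_iff) blast
  then obtain y where y: "\<And>i. i < N \<Longrightarrow> y i \<in> carrier (K i) \<and> d i x = r \<odot>\<^bsub>K i\<^esub> y i" by metis
  then obtain v where v: "v \<in> V" "\<And>i. i < N \<Longrightarrow> d i v = y i" using d_surj by metis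
  define c where "c = x \<ominus> r \<otimes> v"
  have rv: "r \<otimes> v \<in> V" by (rule subringE(6)[OF V_ring]) (use r v in auto)
  have cV: "c \<in> V" unfolding c_def a_minus_def by (intro subringE(5,7)[OF V_ring] x rv)
  have e: "x = c \<oplus> r \<otimes> v" using add_minus_cancel[of "r \<otimes> v" x] rv x cV by (simp add: c_def a_comm)
  have "d i c = \<zero>\<^bsub>K i\<^esub>" if i: "i < N" for i
  proof -
    interpret KM: abelian_group "K i" using module.axioms(2)[OF K_module[OF i]] .
    have "d i c \<oplus>\<^bsub>K i\<^esub> d i (r \<otimes> v) = d i x" using d_add[OF i cV rv] e by simp
    moreover have "d i (r \<otimes> v) = d i x" using d_smult[OF i r(1) v(1)] v y i by simp
    ultimately show ?thesis using d_closed[OF i] cV x KM.l_zero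
      by (metis KM.add.r_cancel KM.zero_closed)
  qed
  then have "c \<in> R" using d_ker[OF cV] by blast
  then show ?thesis using e v by blast
qed

text \<open>The annihilator order on \<open>K i\<close> defines a valuation of \<open>F\<close> whose ring contains \<open>R\<close>, hence the
  integral closure \<open>V\<close>. This is stated here in terms of annihilators.\<close>

lemma uniserial_annihilator:
  assumes i: "i < N" and div: "divisible_module A (K i)" and uni: "uniserial_module A (K i)"
    and s: "s \<in> R" and v: "v \<in> V" "s \<otimes> v \<in> R" and u: "u \<in> carrier (K i)" "s \<odot>\<^bsub>K i\<^esub> u = \<zero>\<^bsub>K i\<^esub>"
  shows "(s \<otimes> v) \<odot>\<^bsub>K i\<^esub> u = \<zero>\<^bsub>K i\<^esub>"
proof (cases "s \<otimes> v = \<zero>")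
  case True
  then show ?thesis using K_laws(6)[OF i u(1)] by simp
next
  case False
  note Kf = K_laws[OF i]
  define r where "r = s \<otimes> v"
  have r: "r \<in> R" "r \<noteq> \<zero>" using v False by (auto simp: r_def)
  have rsF: "r \<in> carrier F" "s \<in> carrier F" using r s by auto
  let ?ann = "\<lambda>r. {x \<in> carrier (K i). r \<odot>\<^bsub>K i\<^esub> x = \<zero>\<^bsub>K i\<^esub>}"
  have sub: "submodule (?ann r) A (K i)" if "r \<in> R" for r
    unfolding module.submodule_iff[OF K_module[OF i]]
  proof (intro conjI ballI)
    fix a x assume a: "a \<in> carrier A" and x: "x \<in> ?ann r"
    have "r \<odot>\<^bsub>K i\<^esub> (a \<odot>\<^bsub>K i\<^esub> x) = (r \<otimes> a) \<odot>\<^bsub>K i\<^esub> x" using Kf(2)[of r a x] that a x by simp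
    also have "\<dots> = a \<odot>\<^bsub>K i\<^esub> (r \<odot>\<^bsub>K i\<^esub> x)" using Kf(2)[of a r x] that a x by (simp add: m_comm)
    finally show "a \<odot>\<^bsub>K i\<^esub> x \<in> ?ann r" using a x Kf(1,7) by simp
  qed (use that Kf in auto)
  have "?ann s \<subseteq> ?ann r"
  proof (rule ccontr)
    assume ns: "\<not> ?ann s \<subseteq> ?ann r"
    then have rs: "?ann r \<subseteq> ?ann s" using uni sub r(1) s unfolding uniserial_module_def by blast
    obtain n :: nat where n0: "\<forall>s\<in>carrier F. \<forall>C. smod R C \<longrightarrow>
        (\<forall>i<n. (s \<otimes> v) [^] i \<otimes> s [^] (n - i) \<in> C) \<longrightarrow> (s \<otimes> v) [^] n \<in> C"
      using integral_power[OF v(1)] ..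
    have n: "r [^] n \<in> C" if "smod R C" "\<forall>i<n. r [^] i \<otimes> s [^] (n - i) \<in> C" for C
      using bspec[OF n0 rsF(2)] that unfolding r_def by blast
    \<comment> \<open>For \<open>n = 0\<close> the condition on \<open>C\<close> is vacuous, and
      \<open>\<one>\<close> would lie in the zero module.\<close>
    have "n \<noteq> 0"
    proof
      assume "n = 0"
      moreover have "smod R {\<zero>}" by (rule smodI) auto
      ultimately have "\<one> \<in> {\<zero>}" using n[of "{\<zero>}"] by simp
      then show False by simp
    qed
    then obtain n' where n': "n = Suc n'" by (cases n) auto
    have "w \<in> ?ann r" if w: "w \<in> ?ann s" for w
    proof -
      have wK: "w \<in> carrier (K i)" "s \<odot>\<^bsub>K i\<^esub> w = \<zero>\<^bsub>K i\<^esub>" using w by auto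
      have "r [^] n' \<noteq> \<zero>" using r by (induction n') (auto simp: integral_iff)
      then have rn: "r [^] n' \<in> R - {\<zero>}" using r by simp
      \<comment> \<open>Divisibility by \<open>r^(n-1)\<close> makes room for a homogeneous equation
        of degree \<open>n\<close>: \<open>r\<close> kills \<open>w\<close> exactly when
        \<open>r^n\<close> kills \<open>y\<close>.\<close>
      obtain y where y: "y \<in> carrier (K i)" "w = (r [^] n') \<odot>\<^bsub>K i\<^esub> y"
        using div wK(1) rn unfolding divisible_module_def by (auto simp: image_iff)
      let ?C = "{a \<in> R. a \<odot>\<^bsub>K i\<^esub> y = \<zero>\<^bsub>K i\<^esub>}"
      have C: "smod R ?C"
      proof (rule smodI)
        fix a x assume a: "a \<in> R" "x \<in> ?C"
        then show "a \<otimes> x \<in> ?C" using Kf(2)[of a x y] Kf(7)[of a] y(1) by simp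
      next
        fix a b assume "a \<in> ?C" "b \<in> ?C"
        then show "a \<oplus> b \<in> ?C" using Kf(3)[of a b y] Kf(8,10) y(1) by simp
      qed (use Kf(6) y in auto)
      \<comment> \<open>From \<open>r^(n-1) s y = s w = 0\<close> each step trades a factor
        \<open>r\<close> for \<open>s\<close>, which is allowed since everything killed by
        \<open>r\<close> is assumed to be killed by \<open>s\<close>. All lower terms of the
        integral equation therefore kill \<open>y\<close>, and so does \<open>r^n\<close>.\<close>
      have st: "r [^] (n' - l) \<otimes> s [^] Suc l \<in> ?C" if "l \<le> n'" for l
        using that
      proof (induction l)
        case 0
        have "(r [^] n' \<otimes> s) \<odot>\<^bsub>K i\<^esub> y = (s \<otimes> r [^] n') \<odot>\<^bsub>K i\<^esub> y" using rsF by (simp add: m_comm)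
        also have "\<dots> = s \<odot>\<^bsub>K i\<^esub> w" unfolding y(2) using Kf(2)[of s "r [^] n'" y] s r y(1) by simp
        finally show ?case using wK rsF s r by simp
      next
        case (Suc l)
        have e: "n' - l = Suc (n' - Suc l)" using Suc.prems by simp
        define t where "t = r [^] (n' - Suc l) \<otimes> s [^] Suc l"
        have t: "t \<in> R" using r s by (simp add: t_def)
        have rt: "r [^] (n' - l) \<otimes> s [^] Suc l = r \<otimes> t" unfolding e t_def using rsF by (simp add: m_ac)
        have "t \<odot>\<^bsub>K i\<^esub> y \<in> ?ann r" using Suc.IH Suc.prems Kf(1,2) t r(1) y(1) unfolding rt by simp
        then have "s \<odot>\<^bsub>K i\<^esub> (t \<odot>\<^bsub>K i\<^esub> y) = \<zero>\<^bsub>K i\<^esub>" using rs by blast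
        then have "(s \<otimes> t) \<odot>\<^bsub>K i\<^esub> y = \<zero>\<^bsub>K i\<^esub>" using Kf(2) s t y(1) by simp
        then have "s \<otimes> t \<in> ?C" using s t by simp
        moreover have "s \<otimes> t = r [^] (n' - Suc l) \<otimes> s [^] Suc (Suc l)"
          unfolding t_def using rsF by (simp add: m_ac)
        ultimately show ?case by (simp only:)
      qed
      have "\<forall>k<n. r [^] k \<otimes> s [^] (n - k) \<in> ?C"
      proof (intro allI impI)
        fix k assume k: "k < n"
        have "n' - (n' - k) = k" "Suc (n' - k) = n - k" using k n' by auto
        then show "r [^] k \<otimes> s [^] (n - k) \<in> ?C" using st[of "n' - k"] by simp
      qed
      then have "r [^] n \<in> ?C" by (rule n[OF C])
      then have "(r \<otimes> r [^] n') \<odot>\<^bsub>K i\<^esub> y = \<zero>\<^bsub>K i\<^esub>" unfolding n' using rsF by (simp add: m_comm)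
      then have "r \<odot>\<^bsub>K i\<^esub> w = \<zero>\<^bsub>K i\<^esub>" unfolding y(2) using Kf(2)[of r "r [^] n'" y] r y(1) by simp
      then show "w \<in> ?ann r" using wK by simp
    qed
    then show False using ns by blast
  qed
  then show ?thesis using u unfolding r_def by blast
qed

text \<open>Multiplication by \<open>z\<close> identifies the part of \<open>V / R\<close> killed by
  \<open>z\<close> with \<open>m / z R\<close>. In each \<open>K i\<close> that part is generated by
  one element \<open>e i\<close>, by uniseriality, and lifts of the \<open>e i\<close> multiplied by
  \<open>z\<close> form the basis.\<close>

theorem exists_hub_basis:
  assumes dvr: "dvr (F\<lparr>carrier := V\<rparr>)"
    and K: "\<And>i. i < N \<Longrightarrow> carrier (K i) \<noteq> {\<zero>\<^bsub>K i\<^esub>} \<and> divisible_module A (K i) \<and> uniserial_module A (K i)"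
  shows "\<exists>z. hub F R z \<and> (\<exists>r. hub.basis F R z {..<N} r)"
proof -
  have "\<exists>c\<in>R. \<exists>v\<in>V. x = c \<oplus> r \<otimes> v" if "r \<in> R" "r \<noteq> \<zero>" "x \<in> V" for r x
    by (rule divisible_V[OF _ that]) (use K in blast)
  then have "\<exists>z. val_quasi F R z" by (rule dvr_divisible_val_quasi[OF dvr])
  then obtain z where vq: "val_quasi F R z" ..
  have ann: "(s \<otimes> v) \<odot>\<^bsub>K i\<^esub> u = \<zero>\<^bsub>K i\<^esub>"
    if "i < N" "s \<in> R" "v \<in> V" "s \<otimes> v \<in> R" "u \<in> carrier (K i)" "s \<odot>\<^bsub>K i\<^esub> u = \<zero>\<^bsub>K i\<^esub>" for i s v u
    by (rule uniserial_annihilator[OF that(1) _ _ that(2-)]) (use K[OF that(1)] in simp_all)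
  have tors: "s \<otimes> (v \<otimes> y) \<in> R" if s: "s \<in> R" and v: "v \<in> V" and y: "y \<in> V"
    and sy: "s \<otimes> y \<in> R" and sv: "s \<otimes> v \<in> R" for s v y
  proof -
    have "d i (s \<otimes> v \<otimes> y) = \<zero>\<^bsub>K i\<^esub>" if i: "i < N" for i
    proof -
      have "s \<odot>\<^bsub>K i\<^esub> d i y = \<zero>\<^bsub>K i\<^esub>" using d_smult[OF i s y] d_ker[of "s \<otimes> y"] sy i by auto
      then show ?thesis using ann[OF i s v sv d_closed[OF i y]] d_smult[OF i sv y] by simp
    qed
    moreover have "s \<otimes> v \<otimes> y \<in> V" by (rule subringE(6)[OF V_ring]) (use sv y in auto)
    ultimately have "s \<otimes> v \<otimes> y \<in> R" using d_ker by blast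
    then show ?thesis using s v y by (simp add: m_assoc)
  qed
  have hub: "hub F R z"
  proof (intro hub.intro hub_axioms.intro vq)
    show "x \<otimes> y \<in> J" if "x \<in> V" "y \<in> V" "smod R J" "\<one> \<in> J" "x \<in> J" "y \<in> J" for x y J
      by (rule val_quasi.Q_from_torsion[OF vq tors that])
  qed
  interpret hub F R z by (rule hub)
  \<comment> \<open>A power of \<open>z\<close> that clears the denominator of a lift of
    \<open>u\<close> kills \<open>u\<close>; the last nonzero \<open>z^j u\<close> is then killed by
    \<open>z\<close>.\<close>
  have "\<exists>e\<in>carrier (K i). e \<noteq> \<zero>\<^bsub>K i\<^esub> \<and> z \<odot>\<^bsub>K i\<^esub> e = \<zero>\<^bsub>K i\<^esub>" if i: "i < N" for i
  proof -
    note Kf = K_laws[OF i]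
    obtain u where u: "u \<in> carrier (K i)" "u \<noteq> \<zero>\<^bsub>K i\<^esub>" using K[OF i] Kf(8) by blast
    obtain v where v: "v \<in> V" "d i v = u" using d_surj_one[OF i u(1)] by blast
    obtain k0 :: nat where "z [^] k0 \<otimes> v \<in> R" using z_pow_denom[OF V_carrier[OF v(1)]] by blast
    then have ex: "(z [^] k0) \<odot>\<^bsub>K i\<^esub> u = \<zero>\<^bsub>K i\<^esub>"
      using d_smult[OF i _ v(1), of "z [^] k0"] d_ker[of "z [^] k0 \<otimes> v"] v i by auto
    define k where "k = (LEAST k::nat. (z [^] k) \<odot>\<^bsub>K i\<^esub> u = \<zero>\<^bsub>K i\<^esub>)"
    have k: "(z [^] k) \<odot>\<^bsub>K i\<^esub> u = \<zero>\<^bsub>K i\<^esub>" unfolding k_def by (rule LeastI, rule ex)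
    have "(z [^] (0::nat)) \<odot>\<^bsub>K i\<^esub> u \<noteq> \<zero>\<^bsub>K i\<^esub>" using u Kf(5) by simp
    then have "k \<noteq> 0" using k by metis
    then obtain j where j: "k = Suc j" by (cases k) auto
    have "(z [^] j) \<odot>\<^bsub>K i\<^esub> u \<noteq> \<zero>\<^bsub>K i\<^esub>"
      using not_less_Least[of j "\<lambda>k. (z [^] k) \<odot>\<^bsub>K i\<^esub> u = \<zero>\<^bsub>K i\<^esub>"] j k_def by simp
    moreover have "z \<odot>\<^bsub>K i\<^esub> ((z [^] j) \<odot>\<^bsub>K i\<^esub> u) = (z \<otimes> z [^] j) \<odot>\<^bsub>K i\<^esub> u" using Kf(2) u by simp
    then have "z \<odot>\<^bsub>K i\<^esub> ((z [^] j) \<odot>\<^bsub>K i\<^esub> u) = \<zero>\<^bsub>K i\<^esub>" using k unfolding j by (simp add: m_comm)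
    moreover have "(z [^] j) \<odot>\<^bsub>K i\<^esub> u \<in> carrier (K i)" using Kf(1) u by simp
    ultimately show ?thesis by blast
  qed
  then obtain e where e: "\<And>i. i < N \<Longrightarrow> e i \<in> carrier (K i) \<and> e i \<noteq> \<zero>\<^bsub>K i\<^esub> \<and> z \<odot>\<^bsub>K i\<^esub> e i = \<zero>\<^bsub>K i\<^esub>"
    by metis
  have ek: "c \<in> m" if "i < N" "c \<in> R" "c \<odot>\<^bsub>K i\<^esub> e i = \<zero>\<^bsub>K i\<^esub>" for i c
  proof (rule ccontr)
    assume n: "c \<notin> m"
    note Kf = K_laws[OF that(1)] and u = unit_R[OF that(2) n]
    have "(inv c \<otimes> c) \<odot>\<^bsub>K i\<^esub> e i = \<zero>\<^bsub>K i\<^esub>"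
      using Kf(2)[OF u(1) that(2), of "e i"] Kf(7)[OF u(1)] that e[OF that(1)] by simp
    then show False using u that e Kf(5) by simp
  qed
  \<comment> \<open>\<open>c\<close> is a \<open>V\<close>-multiple of \<open>z\<close>, and
    annihilators in \<open>K i\<close> respect divisibility in \<open>V\<close>.\<close>
  have em: "c \<odot>\<^bsub>K i\<^esub> u = \<zero>\<^bsub>K i\<^esub>" if i: "i < N" and c: "c \<in> m" and u: "u \<in> carrier (K i)" "z \<odot>\<^bsub>K i\<^esub> u = \<zero>\<^bsub>K i\<^esub>" for i c u
  proof -
    obtain v where v: "v \<in> V" "c = z \<otimes> v" using iffD1[OF m_iff c] by blast
    then show ?thesis using ann[OF i z_R v(1) _ u] c by auto
  qed
  have span: "\<exists>c\<in>R. u = c \<odot>\<^bsub>K i\<^esub> e i"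
    if i: "i < N" and u: "u \<in> carrier (K i)" "z \<odot>\<^bsub>K i\<^esub> u = \<zero>\<^bsub>K i\<^esub>" for i u
  proof -
    note Kf = K_laws[OF i]
    have sub: "submodule ((\<lambda>c. c \<odot>\<^bsub>K i\<^esub> w) ` R) A (K i)" if w: "w \<in> carrier (K i)" for w
      unfolding module.submodule_iff[OF K_module[OF i]]
    proof (intro conjI ballI)
      show "\<zero>\<^bsub>K i\<^esub> \<in> (\<lambda>c. c \<odot>\<^bsub>K i\<^esub> w) ` R" using Kf(6)[OF w] R_closed(1) by (metis image_eqI)
      show "a \<oplus>\<^bsub>K i\<^esub> b \<in> (\<lambda>c. c \<odot>\<^bsub>K i\<^esub> w) ` R"
        if "a \<in> (\<lambda>c. c \<odot>\<^bsub>K i\<^esub> w) ` R" "b \<in> (\<lambda>c. c \<odot>\<^bsub>K i\<^esub> w) ` R" for a b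
        using that Kf(3)[OF _ _ w, symmetric] by auto
      show "a \<odot>\<^bsub>K i\<^esub> b \<in> (\<lambda>c. c \<odot>\<^bsub>K i\<^esub> w) ` R"
        if "a \<in> carrier A" "b \<in> (\<lambda>c. c \<odot>\<^bsub>K i\<^esub> w) ` R" for a b
        using that Kf(2)[OF _ _ w, symmetric] by auto
    qed (use Kf(1) w in auto)
    have self: "w \<in> (\<lambda>c. c \<odot>\<^bsub>K i\<^esub> w) ` R" if "w \<in> carrier (K i)" for w
      using Kf(5)[OF that] R_closed(2) by (metis image_eqI)
    have ei: "e i \<in> carrier (K i)" "e i \<noteq> \<zero>\<^bsub>K i\<^esub>" using e[OF i] by auto
    \<comment> \<open>The two cyclic submodules are comparable. If \<open>e i = c u\<close>, then
      \<open>c\<close> is a unit, because \<open>m\<close> kills \<open>u\<close> but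
      \<open>e i\<close> is nonzero.\<close>
    have "(\<lambda>c. c \<odot>\<^bsub>K i\<^esub> u) ` R \<subseteq> (\<lambda>c. c \<odot>\<^bsub>K i\<^esub> e i) ` R \<or> (\<lambda>c. c \<odot>\<^bsub>K i\<^esub> e i) ` R \<subseteq> (\<lambda>c. c \<odot>\<^bsub>K i\<^esub> u) ` R"
      using K[OF i] sub[OF u(1)] sub[OF ei(1)] unfolding uniserial_module_def by blast
    then show ?thesis
    proof
      assume "(\<lambda>c. c \<odot>\<^bsub>K i\<^esub> u) ` R \<subseteq> (\<lambda>c. c \<odot>\<^bsub>K i\<^esub> e i) ` R"
      then show ?thesis using self[OF u(1)] by blast
    next
      assume "(\<lambda>c. c \<odot>\<^bsub>K i\<^esub> e i) ` R \<subseteq> (\<lambda>c. c \<odot>\<^bsub>K i\<^esub> u) ` R"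
      then obtain c where c: "c \<in> R" "e i = c \<odot>\<^bsub>K i\<^esub> u" using self[OF ei(1)] by blast
      have "c \<notin> m" using em[OF i _ u] c ei by metis
      note cu = unit_R[OF c(1) this]
      have "inv c \<odot>\<^bsub>K i\<^esub> e i = (inv c \<otimes> c) \<odot>\<^bsub>K i\<^esub> u"
        using Kf(2)[OF cu(1) c(1) u(1)] c(2) by simp
      then have "u = inv c \<odot>\<^bsub>K i\<^esub> e i" using cu c u Kf(5) by simp
      then show ?thesis using cu by blast
    qed
  qed
  have "\<forall>i<N. \<exists>v. v \<in> V \<and> d i v = e i \<and> (\<forall>k<N. k \<noteq> i \<longrightarrow> d k v = \<zero>\<^bsub>K k\<^esub>)"
  proof (intro allI impI)
    fix i assume i: "i < N"
    have "e i \<in> carrier (K i)" using e[OF i] by blast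
    then show "\<exists>v. v \<in> V \<and> d i v = e i \<and> (\<forall>k<N. k \<noteq> i \<longrightarrow> d k v = \<zero>\<^bsub>K k\<^esub>)"
      using d_surj_one[OF i] by metis
  qed
  then obtain y where y: "\<And>i. i < N \<Longrightarrow> y i \<in> V" "\<And>i. i < N \<Longrightarrow> d i (y i) = e i"
    "\<And>i k. i < N \<Longrightarrow> k < N \<Longrightarrow> k \<noteq> i \<Longrightarrow> d k (y i) = \<zero>\<^bsub>K k\<^esub>" by metis
  have zy: "z \<otimes> y i \<in> m" if i: "i < N" for i
  proof -
    have "d k (z \<otimes> y i) = \<zero>\<^bsub>K k\<^esub>" if k: "k < N" for k
      using d_smult[OF k z_R y(1)[OF i]] y(2,3) e i k K_laws(7)[OF k z_R] by (cases "k = i") auto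
    then have "z \<otimes> y i \<in> R" using d_ker[of "z \<otimes> y i"] y(1)[OF i] by blast
    then show ?thesis using m_iff y(1)[OF i] by blast
  qed
  let ?I = "{..<N}"
  have comb: "(\<Oplus>i\<in>?I. c i \<otimes> y i) \<in> V" "j < N \<Longrightarrow> d j (\<Oplus>i\<in>?I. c i \<otimes> y i) = c j \<odot>\<^bsub>K j\<^esub> e j"
    if c: "c \<in> ?I \<rightarrow> R" for c j
  proof -
    have *: "(\<Oplus>i\<in>?I. c i \<otimes> y i) \<in> V \<and> d j (\<Oplus>i\<in>?I. c i \<otimes> y i) = c j \<odot>\<^bsub>K j\<^esub> e j" if j: "j < N" for j
      using d_finsum[OF j subset_refl c, of y] y j by simp
    then show "j < N \<Longrightarrow> d j (\<Oplus>i\<in>?I. c i \<otimes> y i) = c j \<odot>\<^bsub>K j\<^esub> e j" by blast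
    show "(\<Oplus>i\<in>?I. c i \<otimes> y i) \<in> V"
    proof (cases "N = 0")
      case False
      then show ?thesis using *[of 0] by blast
    qed simp
  qed
  have zcomb: "z \<otimes> (\<Oplus>i\<in>?I. c i \<otimes> y i) = (\<Oplus>i\<in>?I. c i \<otimes> (z \<otimes> y i))" if c: "c \<in> ?I \<rightarrow> R" for c
  proof -
    have "z \<otimes> (\<Oplus>i\<in>?I. c i \<otimes> y i) = (\<Oplus>i\<in>?I. z \<otimes> (c i \<otimes> y i))"
      using c y(1) by (intro finsum_rdistr) (auto simp: Pi_iff)
    also have "\<dots> = (\<Oplus>i\<in>?I. c i \<otimes> (z \<otimes> y i))"
      using c y(1) by (intro finsum_cong') (auto simp: Pi_iff m_lcomm)
    finally show ?thesis .
  qed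
  have "basis ?I (\<lambda>i. z \<otimes> y i)"
    unfolding basis_def
  proof (intro conjI ballI allI impI)
    show "(\<lambda>i. z \<otimes> y i) \<in> ?I \<rightarrow> m" using zy by auto
    show "\<exists>c t. c \<in> ?I \<rightarrow> R \<and> t \<in> R \<and> x = z \<otimes> t \<oplus> (\<Oplus>i\<in>?I. c i \<otimes> (z \<otimes> y i))" if x: "x \<in> m" for x
    proof -
      obtain w where w: "w \<in> V" "x = z \<otimes> w" using iffD1[OF m_iff x] by blast
      have "z \<odot>\<^bsub>K i\<^esub> d i w = \<zero>\<^bsub>K i\<^esub>" if "i < N" for i
        using d_smult[OF that z_R w(1)] d_ker[of x] w x that by auto
      then have "\<forall>i<N. \<exists>c\<in>R. d i w = c \<odot>\<^bsub>K i\<^esub> e i" using span d_closed[OF _ w(1)] by blast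
      then obtain c where c: "\<And>i. i < N \<Longrightarrow> c i \<in> R \<and> d i w = c i \<odot>\<^bsub>K i\<^esub> e i" by metis
      have cR: "c \<in> ?I \<rightarrow> R" using c by auto
      define q where "q = (\<Oplus>i\<in>?I. c i \<otimes> y i)"
      have q: "q \<in> V" "\<And>i. i < N \<Longrightarrow> d i q = d i w" using comb[OF cR] c by (auto simp: q_def)
      define t where "t = w \<ominus> q"
      have tV: "t \<in> V" using w q by (simp add: t_def)
      have wt: "q \<oplus> t = w" unfolding t_def using w q by (intro add_minus_cancel) auto
      have "d i t = \<zero>\<^bsub>K i\<^esub>" if i: "i < N" for i
      proof -
        interpret KM: abelian_group "K i" using module.axioms(2)[OF K_module[OF i]] .
        have "d i q \<oplus>\<^bsub>K i\<^esub> d i t = d i q \<oplus>\<^bsub>K i\<^esub> \<zero>\<^bsub>K i\<^esub>"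
          using d_add[OF i q(1) tV] wt q(2)[OF i] d_closed[OF i q(1)] by simp
        then show ?thesis using d_closed[OF i] q(1) tV by simp
      qed
      then have tR: "t \<in> R" using d_ker[OF tV] by blast
      have "x = z \<otimes> t \<oplus> z \<otimes> q" unfolding w(2) wt[symmetric] using q tV by (simp add: r_distr a_comm)
      then show ?thesis using zcomb[OF cR] cR tR unfolding q_def by (intro exI[of _ c] exI[of _ t]) simp
    qed
    fix c t i assume c: "c \<in> ?I \<rightarrow> R" "t \<in> R" "(\<Oplus>i\<in>?I. c i \<otimes> (z \<otimes> y i)) = z \<otimes> t" and i: "i \<in> ?I"
    have "z \<otimes> (\<Oplus>i\<in>?I. c i \<otimes> y i) = z \<otimes> t" using zcomb[OF c(1)] c(3) by simp
    then have "(\<Oplus>i\<in>?I. c i \<otimes> y i) = t" using m_lcancel[OF z_nz z_F] comb(1)[OF c(1)] c(2) by simp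
    then have "c i \<odot>\<^bsub>K i\<^esub> e i = \<zero>\<^bsub>K i\<^esub>" using comb(2)[OF c(1), of i] d_ker[of t] c(2) i by auto
    then show "c i \<in> m" using ek[of i "c i"] c(1) i by auto
  qed auto
  then show ?thesis using hub by blast
qed

end

section \<open>The quotient of the normalization\<close>

context hub
begin

lemma dvr_V: "dvr (F\<lparr>carrier := V\<rparr>)"
proof -
  let ?B = "F\<lparr>carrier := V\<rparr>"
  interpret W: frac_field F V by (rule frac_field_V[OF V_ring])
  interpret B: domain ?B by (rule W.domain_A)
  have zV: "z \<in> V" by auto
  have pid: "PIdl\<^bsub>?B\<^esub> x = {y. \<exists>v\<in>V. y = x \<otimes> v}" if "x \<in> V" for x
    unfolding cgenideal_def using that by (auto simp: m_comm)
  have principal: "\<exists>x\<in>carrier ?B. I = PIdl\<^bsub>?B\<^esub> x" if I: "ideal I ?B" for I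
  proof -
    have Is: "I \<subseteq> V" "smod V I" using I W.ideal_A_iff by auto
    show ?thesis
    proof (cases "\<exists>s\<in>I. s \<noteq> \<zero>")
      case True
      then obtain x where x: "x \<in> I" "x \<noteq> \<zero>" "\<forall>y\<in>I. \<exists>v\<in>V. y = x \<otimes> v"
        using minimal_valuation[OF Is(1)] by blast
      have xV: "x \<in> V" using x(1) Is(1) by blast
      have "x \<otimes> v \<in> I" if "v \<in> V" for v
        using smod_smult[OF Is(2) that x(1)] that xV by (simp add: m_comm)
      then have "I = PIdl\<^bsub>?B\<^esub> x" unfolding pid[OF xV] using x(3) by auto
      then show ?thesis using xV by auto
    next
      case False
      then have "I = {\<zero>}" using smod_zero[OF Is(2)] by blast
      moreover have "PIdl\<^bsub>?B\<^esub> \<zero> = {\<zero>}" using pid[of \<zero>] by (auto intro: exI[of _ \<zero>])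
      ultimately show ?thesis by (intro bexI[of _ \<zero>]) auto
    qed
  qed
  have pd: "principal_domain ?B"
    by (intro principal_domain.intro principal_domain_axioms.intro B.domain_axioms) (use principal in blast)
  define M where "M = PIdl\<^bsub>?B\<^esub> z"
  have M: "M = {y. \<exists>v\<in>V. y = z \<otimes> v}" unfolding M_def by (rule pid[OF zV])
  have Mi: "ideal M ?B" unfolding M_def using B.cgenideal_ideal[of z] zV by simp
  have M1: "\<one> \<notin> M" unfolding M using z_noninv by force
  have big: "J = V" if J: "ideal J ?B" "y \<in> J" "y \<notin> M" for J y
  proof -
    have Js: "J \<subseteq> V" "smod V J" using J W.ideal_A_iff by auto
    have yV: "y \<in> V" using J Js by blast
    have nz: "y \<noteq> z \<otimes> v" if "v \<in> V" for v using J(3) M that by blast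
    have i: "inv y \<in> V" by (rule V_unit[OF yV nz])
    have "y \<noteq> \<zero>" using nz[of \<zero>] by auto
    then have "\<one> \<in> J" using smod_smult[OF Js(2) i J(2)] yV by simp
    then show "J = V" using ideal.one_imp_carrier[OF J(1)] by simp
  qed
  have max: "maximalideal M ?B"
  proof (rule maximalidealI[OF Mi])
    show "carrier ?B \<noteq> M" using M1 by auto
    show "J = M \<or> J = carrier ?B" if "ideal J ?B" "M \<subseteq> J" "J \<subseteq> carrier ?B" for J
      using big[OF that(1)] that(2) by auto
  qed
  have uniq: "M' = M" if M': "maximalideal M' ?B" for M'
  proof -
    have i: "ideal M' ?B" using M' by (rule maximalideal.axioms)
    have ne: "carrier ?B \<noteq> M'" by (rule maximalideal.I_notcarr[OF M'])
    have "M' \<subseteq> M" using big[OF i] ne by auto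
    moreover have "M \<subseteq> carrier ?B" using ideal.axioms(1)[OF Mi] additive_subgroup.a_subset by blast
    ultimately have "M = M' \<or> M = carrier ?B" using maximalideal.I_maximal[OF M' Mi] by blast
    then show ?thesis using M1 by auto
  qed
  have "quasilocal ?B" unfolding quasilocal_def using B.cring_axioms max uniq by blast
  moreover have "\<not> field ?B"
  proof
    assume f: "field ?B"
    have "z \<in> Units ?B" using field.field_Units[OF f] zV by simp
    then obtain v where "v \<in> V" "z \<otimes> v = \<one>" by (auto simp: Units_def)
    then show False using z_noninv by blast
  qed
  ultimately show ?thesis using pd by (simp add: dvr_def)
qed

end

section \<open>The isomorphism with copies of \<open>F / V\<close>\<close>

locale hub_basis = hub +
  fixes N :: nat and r :: "nat \<Rightarrow> 'a"
  assumes bas: "basis {..<N} r"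
begin

text \<open>\<open>V = R + z V\<close> allows repeated division by \<open>z\<close> modulo
  \<open>R\<close>. The value \<open>\<zero>\<close> at position 0 fits the pattern because
  \<open>z y\<close> is in \<open>R\<close>.\<close>

lemma chain_exists:
  assumes y: "y \<in> V" "z \<otimes> y \<in> R"
  shows "\<exists>Y. Y (0::nat) = \<zero> \<and> Y 1 = y \<and> (\<forall>k. Y k \<in> V \<and> (\<exists>s\<in>R. Y k = s \<oplus> z \<otimes> Y (Suc k)))"
proof -
  have "\<forall>v\<in>V. \<exists>w. w \<in> V \<and> (\<exists>s\<in>R. v = s \<oplus> z \<otimes> w)" using V_res by blast
  then obtain g where g: "\<And>v. v \<in> V \<Longrightarrow> g v \<in> V \<and> (\<exists>s\<in>R. v = s \<oplus> z \<otimes> g v)" by (auto dest!: bchoice)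
  define Y where "Y k = (case k of 0 \<Rightarrow> \<zero> | Suc j \<Rightarrow> (g ^^ j) y)" for k
  have gV: "(g ^^ j) y \<in> V" for j by (induction j) (use y g in auto)
  have "Y k \<in> V \<and> (\<exists>s\<in>R. Y k = s \<oplus> z \<otimes> Y (Suc k))" for k
  proof (cases k)
    case 0
    have "\<zero> = \<ominus> (z \<otimes> y) \<oplus> z \<otimes> y" using y by (simp add: l_neg)
    moreover have "\<ominus> (z \<otimes> y) \<in> R" using y by simp
    ultimately have "\<exists>s\<in>R. \<zero> = s \<oplus> z \<otimes> y" by blast
    then show ?thesis using 0 by (auto simp: Y_def)
  next
    case (Suc j)
    then show ?thesis using g[OF gV[of j]] gV[of j] by (simp add: Y_def)
  qed
  then show ?thesis by (intro exI[of _ Y]) (auto simp: Y_def)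
qed

text \<open>Under the isomorphism constructed here, \<open>chain i k\<close> represents \<open>z\<^sup>-\<^sup>k\<close> in the \<open>i\<close>-th copy of \<open>F / V\<close>.\<close>

definition chain where
  "chain = (SOME Y. \<forall>i<N. Y i (0::nat) = \<zero> \<and> z \<otimes> Y i 1 = r i \<and>
    (\<forall>k. Y i k \<in> V \<and> (\<exists>s\<in>R. Y i k = s \<oplus> z \<otimes> Y i (Suc k))))"

lemma chain:
  assumes i: "i < N"
  shows "chain i 0 = \<zero>" "z \<otimes> chain i 1 = r i" "chain i k \<in> V"
    "\<exists>s\<in>R. chain i k = s \<oplus> z \<otimes> chain i (Suc k)"
proof -
  have "\<exists>Y. Y (0::nat) = \<zero> \<and> z \<otimes> Y 1 = r i \<and> (\<forall>k. Y k \<in> V \<and> (\<exists>s\<in>R. Y k = s \<oplus> z \<otimes> Y (Suc k)))"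
    if i: "i < N" for i
  proof -
    have rm: "r i \<in> m" using basisD(2)[OF bas] i by simp
    obtain y where y: "y \<in> V" "r i = z \<otimes> y" using iffD1[OF m_iff rm] by blast
    show ?thesis using chain_exists[OF y(1)] rm y(2) by auto
  qed
  then have "\<exists>Y. \<forall>i<N. Y i (0::nat) = \<zero> \<and> z \<otimes> Y i 1 = r i \<and>
    (\<forall>k. Y i k \<in> V \<and> (\<exists>s\<in>R. Y i k = s \<oplus> z \<otimes> Y i (Suc k)))" by metis
  then have "\<forall>i<N. chain i (0::nat) = \<zero> \<and> z \<otimes> chain i 1 = r i \<and>
    (\<forall>k. chain i k \<in> V \<and> (\<exists>s\<in>R. chain i k = s \<oplus> z \<otimes> chain i (Suc k)))"
    unfolding chain_def by (rule someI_ex)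
  then show "chain i 0 = \<zero>" "z \<otimes> chain i 1 = r i" "chain i k \<in> V"
    "\<exists>s\<in>R. chain i k = s \<oplus> z \<otimes> chain i (Suc k)" using i by blast+
qed

lemma chain_F [simp]: "i < N \<Longrightarrow> chain i k \<in> carrier F"
  using chain(3) by blast

lemma chain_shift:
  assumes i: "i < N" and c: "c \<in> R"
  shows "\<exists>s\<in>R. c \<otimes> chain i k = s \<oplus> (z [^] l \<otimes> c) \<otimes> chain i (k + l)"
proof (induction l)
  case 0
  have "c \<otimes> chain i k = \<zero> \<oplus> (z [^] (0::nat) \<otimes> c) \<otimes> chain i (k + 0)" using i c by simp
  then show ?case by blast
next
  case (Suc l)
  then obtain s where s: "s \<in> R" "c \<otimes> chain i k = s \<oplus> (z [^] l \<otimes> c) \<otimes> chain i (k + l)" by blast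
  obtain s' where s': "s' \<in> R" "chain i (k + l) = s' \<oplus> z \<otimes> chain i (Suc (k + l))" using chain(4)[OF i] by blast
  have "c \<otimes> chain i k = (s \<oplus> (z [^] l \<otimes> c) \<otimes> s') \<oplus> (z [^] Suc l \<otimes> c) \<otimes> chain i (k + Suc l)"
    unfolding s(2) s'(2) using s(1) s'(1) c i by (simp add: r_distr a_assoc m_ac)
  moreover have "s \<oplus> (z [^] l \<otimes> c) \<otimes> s' \<in> R" using s s' c by simp
  ultimately show ?case by blast
qed

lemma zk_chain:
  assumes i: "i < N" shows "z [^] k \<otimes> chain i k \<in> R"
proof -
  obtain s where s: "s \<in> R" "\<one> \<otimes> chain i 0 = s \<oplus> (z [^] k \<otimes> \<one>) \<otimes> chain i (0 + k)"
    using chain_shift[OF i, of \<one> 0 k] by blast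
  have "s \<oplus> z [^] k \<otimes> chain i k = \<zero>" using s i chain(1)[OF i] by simp
  then have "s \<oplus> z [^] k \<otimes> chain i k \<in> R" by simp
  then show ?thesis by (rule smod_cancel[OF smod_R subring s(1), rotated]) (use i in simp)
qed

text \<open>The map back to \<open>V / R\<close> on representatives: reading \<open>f i\<close> as
  \<open>(z^k f i) z^(-k)\<close>, the factor \<open>z^(-k)\<close> is replaced by
  \<open>chain i k\<close>. Here \<open>z^k\<close> is a common denominator; by
  \<open>T_shift\<close> passing to a larger exponent changes nothing modulo
  \<open>R\<close>.\<close>

definition T :: "nat \<Rightarrow> (nat \<Rightarrow> 'a) \<Rightarrow> 'a" where
  "T k f = (\<Oplus>i\<in>{..<N}. (z [^] k \<otimes> f i) \<otimes> chain i k)"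

definition den :: "nat \<Rightarrow> (nat \<Rightarrow> 'a) \<Rightarrow> bool" where
  "den k f \<longleftrightarrow> (\<forall>i<N. f i \<in> carrier F \<and> z [^] k \<otimes> f i \<in> R)"

lemma T_V [simp, intro]: "den k f \<Longrightarrow> T k f \<in> V"
proof -
  assume f: "den k f"
  have "smod R V" by (rule smodI) auto
  then show ?thesis unfolding T_def
    by (rule smod_finsum) (use f chain(3) in \<open>auto simp: den_def\<close>)
qed

lemma den_add: "den k f \<Longrightarrow> den k g \<Longrightarrow> den k (\<lambda>i. f i \<oplus> g i)"
  by (auto simp: den_def r_distr)

lemma den_smult: "c \<in> R \<Longrightarrow> den k f \<Longrightarrow> den k (\<lambda>i. c \<otimes> f i)"
  unfolding den_def by (auto simp: m_lcomm)

lemma T_add: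
  assumes "den k f" "den k g"
  shows "T k (\<lambda>i. f i \<oplus> g i) = T k f \<oplus> T k g"
proof -
  have F: "f i \<in> carrier F" "g i \<in> carrier F" if "i < N" for i using assms that by (auto simp: den_def)
  have "T k (\<lambda>i. f i \<oplus> g i) = (\<Oplus>i\<in>{..<N}. (z [^] k \<otimes> f i) \<otimes> chain i k \<oplus> (z [^] k \<otimes> g i) \<otimes> chain i k)"
    unfolding T_def using F by (intro finsum_cong') (auto simp: r_distr l_distr)
  also have "\<dots> = T k f \<oplus> T k g"
    unfolding T_def using F by (intro finsum_addf) auto
  finally show ?thesis .
qed

lemma T_smult:
  assumes "c \<in> R" "den k f"
  shows "T k (\<lambda>i. c \<otimes> f i) = c \<otimes> T k f"
proof -
  have F: "f i \<in> carrier F" if "i < N" for i using assms that by (auto simp: den_def)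
  have "c \<otimes> T k f = (\<Oplus>i\<in>{..<N}. c \<otimes> ((z [^] k \<otimes> f i) \<otimes> chain i k))"
    unfolding T_def using F assms(1) by (intro finsum_rdistr) auto
  also have "\<dots> = T k (\<lambda>i. c \<otimes> f i)"
    unfolding T_def using F assms(1) by (intro finsum_cong') (auto simp: m_ac)
  finally show ?thesis by simp
qed

lemma den_mono: "den k f \<Longrightarrow> k \<le> l \<Longrightarrow> den l f"
  unfolding den_def using z_pow_mono by blast

lemma finsum_cong_mod_R:
  assumes "\<And>i. i < N \<Longrightarrow> g i \<in> carrier F" "\<And>i. i < N \<Longrightarrow> \<exists>s\<in>R. f i = s \<oplus> g i"
  shows "\<exists>s\<in>R. (\<Oplus>i\<in>{..<N}. f i) = s \<oplus> (\<Oplus>i\<in>{..<N}. g i)"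
proof -
  obtain s where s: "\<And>i. i < N \<Longrightarrow> s i \<in> R \<and> f i = s i \<oplus> g i" using assms(2) by metis
  have "(\<Oplus>i\<in>{..<N}. f i) = (\<Oplus>i\<in>{..<N}. s i \<oplus> g i)"
    using s assms(1) by (intro finsum_cong') auto
  also have "\<dots> = (\<Oplus>i\<in>{..<N}. s i) \<oplus> (\<Oplus>i\<in>{..<N}. g i)"
    using s assms(1) by (intro finsum_addf) auto
  finally have "(\<Oplus>i\<in>{..<N}. f i) = (\<Oplus>i\<in>{..<N}. s i) \<oplus> (\<Oplus>i\<in>{..<N}. g i)" .
  moreover have "(\<Oplus>i\<in>{..<N}. s i) \<in> R" by (rule smod_finsum[OF smod_R]) (use s in auto)
  ultimately show ?thesis by blast
qed

lemma T_shift: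
  assumes f: "den k f"
  shows "\<exists>s\<in>R. T k f = s \<oplus> T (k + l) f"
  unfolding T_def
proof (rule finsum_cong_mod_R)
  fix i assume i: "i < N"
  have F: "f i \<in> carrier F" "z [^] k \<otimes> f i \<in> R" using f i by (auto simp: den_def)
  show "z [^] (k + l) \<otimes> f i \<otimes> chain i (k + l) \<in> carrier F" using F i by simp
  have "z [^] l \<otimes> (z [^] k \<otimes> f i) = z [^] (k + l) \<otimes> f i"
    using F by (simp add: nat_pow_mult[symmetric] m_ac)
  then show "\<exists>s\<in>R. z [^] k \<otimes> f i \<otimes> chain i k = s \<oplus> z [^] (k + l) \<otimes> f i \<otimes> chain i (k + l)"
    using chain_shift[OF i F(2), of k l] by simp
qed

lemma T_integral:
  assumes f: "den k f" and fV: "\<And>i. i < N \<Longrightarrow> f i \<in> V"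
  shows "T k f \<in> R"
  unfolding T_def
proof (rule smod_finsum[OF smod_R])
  fix i assume "i \<in> {..<N}"
  then have i: "i < N" by simp
  have "z [^] k \<otimes> (f i \<otimes> chain i k) \<in> R"
    using torsion_annihilator[of "z [^] k" "f i" "chain i k"] f fV[OF i] chain(3)[OF i] zk_chain[OF i] i
    by (auto simp: den_def)
  then show "z [^] k \<otimes> f i \<otimes> chain i k \<in> R" using fV[OF i] i by (simp add: m_assoc)
qed

text \<open>Multiplication by \<open>z^k\<close> brings \<open>chain i (k+1)\<close> down to
  \<open>chain i 1\<close> modulo \<open>R\<close>. There \<open>z \<otimes> chain i 1 = r i\<close>
  gives access to the basis.\<close>

lemma T_socle:
  assumes f: "den (Suc k) f"
  shows "\<exists>s\<in>R. z [^] k \<otimes> T (Suc k) f = s \<oplus> (\<Oplus>i\<in>{..<N}. (z [^] Suc k \<otimes> f i) \<otimes> chain i 1)"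
proof -
  have F: "f i \<in> carrier F" "z [^] Suc k \<otimes> f i \<in> R" if "i < N" for i using f that by (auto simp: den_def)
  have e: "z [^] k \<otimes> T (Suc k) f = (\<Oplus>i\<in>{..<N}. z [^] k \<otimes> ((z [^] Suc k \<otimes> f i) \<otimes> chain i (Suc k)))"
    unfolding T_def using F by (intro finsum_rdistr) auto
  show ?thesis unfolding e
  proof (rule finsum_cong_mod_R)
    fix i assume i: "i < N"
    define c where "c = z [^] Suc k \<otimes> f i"
    have c: "c \<in> R" using F(2)[OF i] by (simp add: c_def)
    show "z [^] Suc k \<otimes> f i \<otimes> chain i 1 \<in> carrier F" using F(1)[OF i] i by simp
    obtain s where s: "s \<in> R" "c \<otimes> chain i 1 = s \<oplus> (z [^] k \<otimes> c) \<otimes> chain i (1 + k)"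
      using chain_shift[OF i c, of 1 k] by blast
    have "z [^] k \<otimes> (c \<otimes> chain i (Suc k)) = (z [^] k \<otimes> c) \<otimes> chain i (1 + k)" using c i by (simp add: m_assoc)
    also have "\<dots> = \<ominus> s \<oplus> (s \<oplus> (z [^] k \<otimes> c) \<otimes> chain i (1 + k))" using s(1) c i by (simp add: r_neg1)
    also have "\<dots> = \<ominus> s \<oplus> c \<otimes> chain i 1" unfolding s(2) ..
    finally have "z [^] k \<otimes> (c \<otimes> chain i (Suc k)) = \<ominus> s \<oplus> c \<otimes> chain i 1" .
    moreover have "\<ominus> s \<in> R" using s by simp
    ultimately show "\<exists>s\<in>R. z [^] k \<otimes> (z [^] Suc k \<otimes> f i \<otimes> chain i (Suc k)) = s \<oplus> z [^] Suc k \<otimes> f i \<otimes> chain i 1"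
      unfolding c_def by blast
  qed
qed

text \<open>Induction on the exponent of the denominator. The sum of the
  \<open>c i \<otimes> r i\<close> with \<open>c i = z^(k+1) f i\<close> is in \<open>z R\<close>,
  so the \<open>c i\<close> are in \<open>m\<close> and the \<open>z^k f i\<close> are in
  \<open>V\<close>. Removing integral parts \<open>t i\<close> by means of
  \<open>V = R + z^k V\<close> leaves \<open>g = f - t\<close> with the smaller denominator
  \<open>z^k\<close>.\<close>

lemma T_in_R:
  assumes "den k f" "T k f \<in> R" "i < N"
  shows "f i \<in> V"
  using assms
proof (induction k arbitrary: f i)
  case 0
  have fF: "f i \<in> carrier F" and "z [^] (0::nat) \<otimes> f i \<in> R"
    using "0.prems"(1,3) unfolding den_def by blast+
  then have "f i \<in> R" by simp
  then show ?case by simp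
next
  case (Suc k)
  have F: "f i \<in> carrier F" "z [^] Suc k \<otimes> f i \<in> R" if "i < N" for i
    using Suc.prems(1) that by (auto simp: den_def)
  define c where "c i = z [^] Suc k \<otimes> f i" for i
  have c: "c \<in> {..<N} \<rightarrow> R" using F(2) by (auto simp: c_def)
  have cF: "c i \<in> carrier F" if "i < N" for i using F[OF that] by (simp add: c_def)
  define S where "S = (\<Oplus>i\<in>{..<N}. c i \<otimes> chain i 1)"
  have SF: "S \<in> carrier F" unfolding S_def using cF by (intro finsum_closed) auto
  obtain s where s: "s \<in> R" "z [^] k \<otimes> T (Suc k) f = s \<oplus> S"
    using T_socle[OF Suc.prems(1)] unfolding S_def c_def by blast
  have "s \<oplus> S \<in> R" unfolding s(2)[symmetric] using Suc.prems(2) by simp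
  then have SR: "S \<in> R" by (rule smod_cancel[OF smod_R subring s(1) SF])
  have "z \<otimes> S = (\<Oplus>i\<in>{..<N}. z \<otimes> (c i \<otimes> chain i 1))"
    unfolding S_def using cF by (intro finsum_rdistr) auto
  also have "\<dots> = (\<Oplus>i\<in>{..<N}. c i \<otimes> r i)"
  proof (rule finsum_cong')
    fix i assume "i \<in> {..<N}"
    then have i: "i < N" by simp
    have "z \<otimes> (c i \<otimes> chain i 1) = c i \<otimes> (z \<otimes> chain i 1)" using cF[OF i] i by (simp add: m_lcomm)
    then show "z \<otimes> (c i \<otimes> chain i 1) = c i \<otimes> r i" using chain(2)[OF i] by simp
  qed (use cF basisD(2)[OF bas] in auto)
  finally have "(\<Oplus>i\<in>{..<N}. c i \<otimes> r i) = z \<otimes> S" by simp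
  then have cm: "c i \<in> m" if "i < N" for i using basisD(4)[OF bas c SR] that by blast
  have "\<exists>a t. a \<in> R \<and> t \<in> V \<and> z [^] k \<otimes> f i = a \<oplus> z [^] k \<otimes> t" if i: "i < N" for i
  proof -
    obtain w where w: "w \<in> V" "c i = z \<otimes> w" using iffD1[OF m_iff cm[OF i]] by blast
    have "z \<otimes> (z [^] k \<otimes> f i) = z \<otimes> w" using w F(1)[OF i] by (simp add: c_def m_ac)
    then have "z [^] k \<otimes> f i = w" using m_lcancel[OF z_nz z_F, of "z [^] k \<otimes> f i" w] w F(1)[OF i] by simp
    then show ?thesis using V_res_pow[OF w(1), of k] by blast
  qed
  then obtain a t where at: "\<And>i. i < N \<Longrightarrow> a i \<in> R \<and> t i \<in> V \<and> z [^] k \<otimes> f i = a i \<oplus> z [^] k \<otimes> t i" by metis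
  define g where "g i = f i \<ominus> t i" for i
  have gF: "g i \<in> carrier F" if "i < N" for i using at[OF that] F(1)[OF that] by (simp add: g_def)
  have tg: "t i \<oplus> g i = f i" if "i < N" for i
    unfolding g_def using at[OF that] F(1)[OF that] by (intro add_minus_cancel) auto
  have zg: "z [^] k \<otimes> g i = a i" if i: "i < N" for i
  proof -
    have ti: "t i \<in> carrier F" "a i \<in> carrier F" using at[OF i] by auto
    have "z [^] k \<otimes> t i \<oplus> z [^] k \<otimes> g i = z [^] k \<otimes> f i"
      unfolding tg[OF i, symmetric] using ti gF[OF i] by (simp add: r_distr)
    also have "\<dots> = z [^] k \<otimes> t i \<oplus> a i" using at[OF i] ti by (simp add: a_comm)
    finally show ?thesis using ti gF[OF i] by simp
  qed
  have dg: "den k g" unfolding den_def using gF zg at by simp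
  have dg': "den (Suc k) g" by (rule den_mono[OF dg]) simp
  have dt: "den (Suc k) t"
    unfolding den_def
  proof (intro allI impI conjI)
    fix i assume i: "i < N"
    show tF: "t i \<in> carrier F" using at[OF i] by auto
    have "z [^] Suc k \<otimes> g i \<oplus> z [^] Suc k \<otimes> t i = z [^] Suc k \<otimes> f i"
      unfolding tg[OF i, symmetric] using tF gF[OF i] by (simp add: r_distr a_comm)
    then have "z [^] Suc k \<otimes> g i \<oplus> z [^] Suc k \<otimes> t i \<in> R" using F(2)[OF i] by simp
    then show "z [^] Suc k \<otimes> t i \<in> R"
      by (rule smod_cancel[OF smod_R subring, rotated -1]) (use dg' i tF in \<open>auto simp: den_def\<close>)
  qed
  have Tt: "T (Suc k) t \<in> R" by (rule T_integral[OF dt]) (use at in blast)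
  have "T (Suc k) f = T (Suc k) (\<lambda>i. t i \<oplus> g i)"
    unfolding T_def using tg F(1) by (intro finsum_cong') auto
  then have "T (Suc k) t \<oplus> T (Suc k) g \<in> R" using T_add[OF dt dg'] Suc.prems(2) by simp
  then have "T (Suc k) g \<in> R" by (rule smod_cancel[OF smod_R subring Tt, rotated]) (use dg' in auto)
  moreover obtain s where "s \<in> R" "T k g = s \<oplus> T (k + 1) g" using T_shift[OF dg, of 1] by blast
  ultimately have "T k g \<in> R" by simp
  then have "g i \<in> V" using Suc.IH[OF dg] Suc.prems(3) by blast
  then show ?case using tg[OF Suc.prems(3)] at[OF Suc.prems(3)] V_closed(1) by metis
qed

text \<open>The graph, on representatives, of the isomorphism from \<open>V / R\<close> to the sum of \<open>N\<close> copies of \<open>F / V\<close>.\<close>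

definition Rel :: "'a \<Rightarrow> (nat \<Rightarrow> 'a) \<Rightarrow> bool" where
  "Rel v f \<longleftrightarrow> (\<exists>k. den k f \<and> (\<exists>s\<in>R. v = s \<oplus> T k f))"

lemma Rel_add:
  assumes "Rel v f" "Rel w g" shows "Rel (v \<oplus> w) (\<lambda>i. f i \<oplus> g i)"
proof -
  obtain k s where k: "den k f" "s \<in> R" "v = s \<oplus> T k f" using assms(1) by (auto simp: Rel_def)
  obtain l s' where l: "den l g" "s' \<in> R" "w = s' \<oplus> T l g" using assms(2) by (auto simp: Rel_def)
  obtain a where a: "a \<in> R" "T k f = a \<oplus> T (k + l) f" using T_shift[OF k(1)] by blast
  obtain b where b: "b \<in> R" "T l g = b \<oplus> T (l + k) g" using T_shift[OF l(1)] by blast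
  have b': "T l g = b \<oplus> T (k + l) g" using b(2) by (simp only: add.commute)
  have "den (k + l) f" by (rule den_mono[OF k(1)]) simp
  moreover have "den (k + l) g" by (rule den_mono[OF l(1)]) simp
  ultimately have d: "den (k + l) f" "den (k + l) g" .
  have TF: "T (k + l) f \<in> carrier F" "T (k + l) g \<in> carrier F" using d by auto
  have "v \<oplus> w = (s \<oplus> a \<oplus> (s' \<oplus> b)) \<oplus> (T (k + l) f \<oplus> T (k + l) g)"
    unfolding k(3) l(3) a(2) b' using k(2) l(2) a(1) b(1) TF by (simp add: a_ac)
  moreover have "s \<oplus> a \<oplus> (s' \<oplus> b) \<in> R" using k(2) l(2) a(1) b(1) by simp
  ultimately show ?thesis unfolding Rel_def T_add[OF d, symmetric]
    using den_add[OF d] by blast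
qed

lemma Rel_smult:
  assumes c: "c \<in> R" and "Rel v f" shows "Rel (c \<otimes> v) (\<lambda>i. c \<otimes> f i)"
proof -
  obtain k s where k: "den k f" "s \<in> R" "v = s \<oplus> T k f" using assms(2) by (auto simp: Rel_def)
  have "T k f \<in> carrier F" using k by auto
  then have "c \<otimes> v = c \<otimes> s \<oplus> T k (\<lambda>i. c \<otimes> f i)"
    unfolding k(3) T_smult[OF c k(1)] using k(2) c by (simp add: r_distr)
  moreover have "c \<otimes> s \<in> R" using c k(2) by simp
  ultimately show ?thesis unfolding Rel_def using den_smult[OF c k(1)] by blast
qed

lemma Rel_V: "Rel v f \<Longrightarrow> v \<in> V"
  by (auto simp: Rel_def)

lemma Rel_F: "Rel v f \<Longrightarrow> i < N \<Longrightarrow> f i \<in> carrier F"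
  by (auto simp: Rel_def den_def)

lemma Rel_integral:
  assumes "Rel v f" shows "v \<in> R \<longleftrightarrow> (\<forall>i<N. f i \<in> V)"
proof -
  obtain k s where k: "den k f" "s \<in> R" "v = s \<oplus> T k f" using assms by (auto simp: Rel_def)
  have "v \<in> R \<longleftrightarrow> T k f \<in> R"
  proof
    assume "v \<in> R"
    then have "s \<oplus> T k f \<in> R" unfolding k(3) .
    then show "T k f \<in> R" by (rule smod_cancel[OF smod_R subring k(2), rotated]) (use k in auto)
  qed (use k in simp)
  then show ?thesis using T_integral[OF k(1)] T_in_R[OF k(1)] by blast
qed

lemma Rel_total_right:
  assumes f: "\<And>i. i < N \<Longrightarrow> f i \<in> carrier F" shows "\<exists>v. Rel v f"
proof -
  have "\<exists>k. \<forall>i<n. z [^] (k::nat) \<otimes> f i \<in> R" if "n \<le> N" for n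
    using that
  proof (induction n)
    case (Suc n)
    then obtain k :: nat where k: "\<forall>i<n. z [^] k \<otimes> f i \<in> R" by auto
    have fF: "f i \<in> carrier F" if "i < Suc n" for i using f that Suc.prems by simp
    obtain l :: nat where l: "z [^] l \<otimes> f n \<in> R" using z_pow_denom[OF fF[of n]] by blast
    have "z [^] (k + l) \<otimes> f i \<in> R" if i: "i < Suc n" for i
    proof (cases "i = n")
      case True
      then show ?thesis using z_pow_mono[OF l fF] by simp
    next
      case False
      then have "z [^] k \<otimes> f i \<in> R" using k i by simp
      then show ?thesis using z_pow_mono[OF _ fF[OF i]] by simp
    qed
    then show ?case by blast
  qed simp
  then obtain k :: nat where "\<forall>i<N. z [^] k \<otimes> f i \<in> R" by blast
  then have k: "den k f" using f by (simp add: den_def)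
  then have "T k f = \<zero> \<oplus> T k f" by auto
  then show ?thesis using k unfolding Rel_def by blast
qed

text \<open>Induction on the exponent of a denominator of \<open>v\<close>. Here
  \<open>z^(n+1) v\<close> is in \<open>m\<close>; its basis coefficients divided by
  \<open>z^(n+1)\<close> form a family \<open>f\<close> whose image under \<open>T\<close> differs
  from \<open>v\<close> by an element with denominator \<open>z^n\<close>.\<close>

lemma Rel_total_left:
  assumes "v \<in> V" shows "\<exists>f. Rel v f"
proof -
  have "\<exists>f. Rel v f" if "z [^] n \<otimes> v \<in> R" "v \<in> V" for n :: nat and v
    using that
  proof (induction n arbitrary: v)
    case 0
    have d: "den 0 (\<lambda>i. \<zero>)" by (simp add: den_def)
    have "T 0 (\<lambda>i. \<zero>) \<in> R" by (rule T_integral[OF d]) auto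
    moreover have "v \<in> R" using 0 by simp
    ultimately have "v \<ominus> T 0 (\<lambda>i. \<zero>) \<in> R" "v = (v \<ominus> T 0 (\<lambda>i. \<zero>)) \<oplus> T 0 (\<lambda>i. \<zero>)"
      by (auto simp: a_minus_def a_assoc l_neg)
    then show ?case unfolding Rel_def using d by blast
  next
    case (Suc n)
    define x where "x = z [^] n \<otimes> v"
    have xV: "x \<in> V" using Suc.prems(2) by (simp add: x_def)
    have zx: "z \<otimes> x = z [^] Suc n \<otimes> v" using Suc.prems(2) by (simp add: x_def m_ac)
    then have "z \<otimes> x \<in> m" using m_iff Suc.prems(1) xV by metis
    then obtain c d where cd: "c \<in> {..<N} \<rightarrow> R" "d \<in> R" "z \<otimes> x = z \<otimes> d \<oplus> (\<Oplus>i\<in>{..<N}. c i \<otimes> r i)"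
      using basisD(3)[OF bas] by blast
    have cR: "c i \<in> R" if "i < N" for i using cd(1) that by auto
    define S where "S = (\<Oplus>i\<in>{..<N}. c i \<otimes> chain i 1)"
    have SF: "S \<in> carrier F" unfolding S_def using cR by (intro finsum_closed) auto
    have "z \<otimes> S = (\<Oplus>i\<in>{..<N}. z \<otimes> (c i \<otimes> chain i 1))"
      unfolding S_def using cR by (intro finsum_rdistr) auto
    also have "\<dots> = (\<Oplus>i\<in>{..<N}. c i \<otimes> r i)"
    proof (rule finsum_cong')
      fix i assume "i \<in> {..<N}"
      then have i: "i < N" by simp
      have "z \<otimes> (c i \<otimes> chain i 1) = c i \<otimes> (z \<otimes> chain i 1)" using cR[OF i] i by (simp add: m_lcomm)
      then show "z \<otimes> (c i \<otimes> chain i 1) = c i \<otimes> r i" using chain(2)[OF i] by simp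
    qed (use cR basisD(2)[OF bas] in auto)
    finally have "z \<otimes> x = z \<otimes> (d \<oplus> S)" unfolding cd(3) using cd(2) SF by (simp add: r_distr)
    then have xS: "x = d \<oplus> S" using m_lcancel[OF z_nz z_F, of x "d \<oplus> S"] xV cd(2) SF by simp
    define f where "f i = inv (z [^] Suc n) \<otimes> c i" for i
    have nzk: "z [^] Suc n \<noteq> \<zero>" "z [^] Suc n \<in> carrier F" using zk_nz[of "Suc n"] by auto
    have zf: "z [^] Suc n \<otimes> f i = c i" if "i < N" for i
      unfolding f_def using inv_F[OF nzk(2,1)] cR[OF that] nzk(2) by (simp add: m_assoc[symmetric] del: nat_pow_Suc)
    have df: "den (Suc n) f"
      unfolding den_def using zf cR inv_F(1)[OF nzk(2,1)] by (simp add: f_def del: nat_pow_Suc)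
    obtain s where s: "s \<in> R" "z [^] n \<otimes> T (Suc n) f = s \<oplus> (\<Oplus>i\<in>{..<N}. (z [^] Suc n \<otimes> f i) \<otimes> chain i 1)"
      using T_socle[OF df] by blast
    have "(\<Oplus>i\<in>{..<N}. (z [^] Suc n \<otimes> f i) \<otimes> chain i 1) = S"
      unfolding S_def using zf cR by (intro finsum_cong') (auto simp del: nat_pow_Suc)
    then have zT: "z [^] n \<otimes> T (Suc n) f = s \<oplus> S" using s(2) by simp
    have TV: "T (Suc n) f \<in> V" using df by auto
    define v' where "v' = v \<ominus> T (Suc n) f"
    have v': "v' \<in> V" using TV Suc.prems(2) by (simp add: v'_def)
    have vv: "T (Suc n) f \<oplus> v' = v" unfolding v'_def using TV Suc.prems(2) by (intro add_minus_cancel) auto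
    have "S \<oplus> (s \<oplus> z [^] n \<otimes> v') = z [^] n \<otimes> T (Suc n) f \<oplus> z [^] n \<otimes> v'"
      unfolding zT using s(1) SF v' by (simp add: a_ac)
    also have "\<dots> = z [^] n \<otimes> v" unfolding vv[symmetric] using TV v' by (simp add: r_distr)
    also have "\<dots> = S \<oplus> d" using xS SF cd(2) by (simp add: x_def a_comm)
    finally have "s \<oplus> z [^] n \<otimes> v' = d" using s(1) SF v' cd(2) by simp
    then have "s \<oplus> z [^] n \<otimes> v' \<in> R" using cd(2) by simp
    then have "z [^] n \<otimes> v' \<in> R" by (rule smod_cancel[OF smod_R subring s(1), rotated]) (use v' in auto)
    then obtain g where g: "Rel v' g" using Suc.IH v' by blast
    have "T (Suc n) f = \<zero> \<oplus> T (Suc n) f" using TV by simp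
    then have "Rel (T (Suc n) f) f" unfolding Rel_def using df by blast
    then show ?case using Rel_add[OF _ g] vv by metis
  qed
  then show ?thesis using z_pow_denom[OF V_carrier[OF assms]] assms by blast
qed

text \<open>Read from left to right this is well-definedness of the induced map on cosets, read from
  right to left its injectivity.\<close>

lemma Rel_diff:
  assumes "Rel v f" "Rel w g"
  shows "v \<ominus> w \<in> R \<longleftrightarrow> (\<forall>i<N. f i \<ominus> g i \<in> V)"
proof -
  have F: "f i \<in> carrier F" "g i \<in> carrier F" if "i < N" for i using Rel_F assms that by auto
  have "Rel (v \<oplus> \<ominus> \<one> \<otimes> w) (\<lambda>i. f i \<oplus> \<ominus> \<one> \<otimes> g i)"
    by (rule Rel_add[OF assms(1) Rel_smult[OF _ assms(2)]]) simp
  then have "v \<oplus> \<ominus> \<one> \<otimes> w \<in> R \<longleftrightarrow> (\<forall>i<N. f i \<oplus> \<ominus> \<one> \<otimes> g i \<in> V)" by (rule Rel_integral)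
  moreover have "v \<oplus> \<ominus> \<one> \<otimes> w = v \<ominus> w" using Rel_V[OF assms(2)] by (simp add: l_minus a_minus_def)
  moreover have "f i \<oplus> \<ominus> \<one> \<otimes> g i = f i \<ominus> g i" if "i < N" for i
    using F(2)[OF that] by (simp add: l_minus a_minus_def)
  ultimately show ?thesis by simp
qed

theorem normalization_quotient:
  "module_isomorphic A (quot_module (mult_module F V) R)
    (direct_sum_module {..<N} (\<lambda>_. quot_module (mult_module F (carrier F)) V))"
proof -
  have Vs: "smod R V" by (rule smodI) auto
  have Fs: "smod R (carrier F)" by (rule smodI) auto
  let ?Q = "quot_module (mult_module F V) R" and ?K = "quot_module (mult_module F (carrier F)) V"
  have RV: "R \<subseteq> V" and VF: "V \<subseteq> carrier F" by auto
  note q = quot_sel[OF smod_R Vs RV] and k = quot_sel[OF Vs Fs VF]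
  note ds = direct_sum_sel[OF finite_lessThan[of N], of "\<lambda>_. ?K"]
  \<comment> \<open>\<open>h\<close> uses an arbitrary related pair over the coset;
    \<open>Rel_diff\<close> makes the choice irrelevant.\<close>
  define h where "h C = (\<lambda>i\<in>{..<N}. cos V (snd (SOME p. C = cos R (fst p) \<and> Rel (fst p) (snd p)) i))" for C
  have h: "h (cos R v) = (\<lambda>i\<in>{..<N}. cos V (f i))" if vf: "Rel v f" for v f
  proof -
    define p where "p = (SOME p. cos R v = cos R (fst p) \<and> Rel (fst p) (snd p))"
    have "\<exists>p. cos R v = cos R (fst p) \<and> Rel (fst p) (snd p)" using vf by (intro exI[of _ "(v, f)"]) simp
    then have p: "cos R v = cos R (fst p)" "Rel (fst p) (snd p)" unfolding p_def by (metis (mono_tags, lifting) someI_ex)+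
    have "v \<ominus> fst p \<in> R" using p(1) cos_eq_iff[OF smod_R] Rel_V[OF vf] Rel_V[OF p(2)] by simp
    then have "f i \<ominus> snd p i \<in> V" if "i < N" for i using Rel_diff[OF vf p(2)] that by blast
    then have "cos V (snd p i) = cos V (f i)" if "i < N" for i
      using cos_eq_iff[OF Vs, of "f i" "snd p i"] Rel_F[OF vf that] Rel_F[OF p(2) that] that by simp
    then show ?thesis unfolding h_def p_def[symmetric] by (intro restrict_ext) simp
  qed
  have hC: "h (cos R v) \<in> (\<Pi>\<^sub>E i\<in>{..<N}. carrier ?K)" if v: "v \<in> V" for v
  proof -
    obtain f where f: "Rel v f" using Rel_total_left[OF v] by blast
    show ?thesis unfolding h[OF f] using Rel_F[OF f] by (auto simp: k(1))
  qed
  have "h \<in> module_hom A ?Q (direct_sum_module {..<N} (\<lambda>_. ?K))"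
    unfolding module_hom_def ds
  proof (intro CollectI conjI ballI)
    show "h \<in> carrier ?Q \<rightarrow> (\<Pi>\<^sub>E i\<in>{..<N}. carrier ?K)" using hC by (auto simp: q(1))
  next
    fix B C assume "B \<in> carrier ?Q" "C \<in> carrier ?Q"
    then obtain v w where vw: "v \<in> V" "w \<in> V" "B = cos R v" "C = cos R w" unfolding q(1) by blast
    obtain f g where fg: "Rel v f" "Rel w g" using Rel_total_left vw by blast
    have "h (B \<oplus>\<^bsub>?Q\<^esub> C) = (\<lambda>i\<in>{..<N}. cos V (f i \<oplus> g i))"
      unfolding vw(3,4) q(3)[OF vw(1,2)] by (rule h[OF Rel_add[OF fg]])
    also have "\<dots> = (\<lambda>i\<in>{..<N}. h B i \<oplus>\<^bsub>?K\<^esub> h C i)"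
      unfolding vw(3,4) h[OF fg(1)] h[OF fg(2)] using Rel_F[OF fg(1)] Rel_F[OF fg(2)]
      by (intro restrict_ext) (simp add: k(3))
    finally show "h (B \<oplus>\<^bsub>?Q\<^esub> C) = (\<lambda>i\<in>{..<N}. h B i \<oplus>\<^bsub>?K\<^esub> h C i)" .
  next
    fix c B assume "c \<in> carrier A" "B \<in> carrier ?Q"
    then obtain v where vw: "c \<in> R" "v \<in> V" "B = cos R v" unfolding q(1) by auto
    obtain f where f: "Rel v f" using Rel_total_left vw by blast
    have "h (c \<odot>\<^bsub>?Q\<^esub> B) = (\<lambda>i\<in>{..<N}. cos V (c \<otimes> f i))"
      unfolding vw(3) q(4)[OF vw(1,2)] by (rule h[OF Rel_smult[OF vw(1) f]])
    also have "\<dots> = (\<lambda>i\<in>{..<N}. c \<odot>\<^bsub>?K\<^esub> h B i)"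
      unfolding vw(3) h[OF f] using Rel_F[OF f] vw(1) by (intro restrict_ext) (simp add: k(4))
    finally show "h (c \<odot>\<^bsub>?Q\<^esub> B) = (\<lambda>i\<in>{..<N}. c \<odot>\<^bsub>?K\<^esub> h B i)" .
  qed
  moreover have "bij_betw h (carrier ?Q) (carrier (direct_sum_module {..<N} (\<lambda>_. ?K)))"
    unfolding bij_betw_def ds
  proof
    show "inj_on h (carrier ?Q)"
    proof (rule inj_onI)
      fix B C assume "B \<in> carrier ?Q" "C \<in> carrier ?Q" and e: "h B = h C"
      then obtain v w where vw: "v \<in> V" "w \<in> V" "B = cos R v" "C = cos R w" unfolding q(1) by blast
      obtain f g where fg: "Rel v f" "Rel w g" using Rel_total_left vw by blast
      have "f i \<ominus> g i \<in> V" if i: "i < N" for i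
      proof -
        have "cos V (f i) = cos V (g i)"
          using fun_cong[OF e, of i] i unfolding vw(3,4) h[OF fg(1)] h[OF fg(2)] by simp
        then show ?thesis using cos_eq_iff[OF Vs] Rel_F[OF fg(1) i] Rel_F[OF fg(2) i] by blast
      qed
      then have "v \<ominus> w \<in> R" using Rel_diff[OF fg] by blast
      then show "B = C" using cos_eq_iff[OF smod_R, of v w] vw by simp
    qed
    show "h ` carrier ?Q = (\<Pi>\<^sub>E i\<in>{..<N}. carrier ?K)"
    proof
      show "h ` carrier ?Q \<subseteq> (\<Pi>\<^sub>E i\<in>{..<N}. carrier ?K)" using hC by (auto simp: q(1))
      show "(\<Pi>\<^sub>E i\<in>{..<N}. carrier ?K) \<subseteq> h ` carrier ?Q"
      proof
        fix u assume u: "u \<in> (\<Pi>\<^sub>E i\<in>{..<N}. carrier ?K)"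
        have "\<forall>i<N. \<exists>x. x \<in> carrier F \<and> u i = cos V x"
        proof (intro allI impI)
          fix i assume "i < N"
          then have "u i \<in> carrier ?K" using u by auto
          then show "\<exists>x. x \<in> carrier F \<and> u i = cos V x" unfolding k(1) by blast
        qed
        then obtain f where f: "\<And>i. i < N \<Longrightarrow> f i \<in> carrier F \<and> u i = cos V (f i)" by metis
        obtain v where v: "Rel v f" using Rel_total_right[of f] f by blast
        have "h (cos R v) = u"
          unfolding h[OF v]
        proof
          fix i show "(\<lambda>i\<in>{..<N}. cos V (f i)) i = u i"
            using f[of i] u by (cases "i < N") (auto simp: PiE_def extensional_def)
        qed
        moreover have "cos R v \<in> carrier ?Q" using Rel_V[OF v] by (auto simp: q(1))
        ultimately show "u \<in> h ` carrier ?Q" by blast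
      qed
    qed
  qed
  ultimately show ?thesis unfolding module_isomorphic_def by blast
qed

end

section \<open>Submodules of the divisible uniserial module\<close>

context val_quasi
begin

lemma smod_V_total:
  assumes P: "smod V P" and Q: "smod V Q"
  shows "P \<subseteq> Q \<or> Q \<subseteq> P"
proof (rule ccontr)
  assume "\<not> ?thesis"
  then obtain x y where x: "x \<in> P" "x \<notin> Q" and y: "y \<in> Q" "y \<notin> P" by blast
  have F: "x \<in> carrier F" "y \<in> carrier F" using smod_carrier[OF P x(1)] smod_carrier[OF Q y(1)] .
  from V_total[OF F] show False
  proof
    assume "\<exists>v\<in>V. x = y \<otimes> v"
    then obtain v where v: "v \<in> V" "x = y \<otimes> v" by blast
    have "v \<otimes> y \<in> Q" by (rule smod_smult[OF Q v(1) y(1)])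
    then show False using x(2) v F by (simp add: m_comm)
  next
    assume "\<exists>v\<in>V. y = x \<otimes> v"
    then obtain v where v: "v \<in> V" "y = x \<otimes> v" by blast
    have "v \<otimes> x \<in> P" by (rule smod_smult[OF P v(1) x(1)])
    then show False using y(2) v F by (simp add: m_comm)
  qed
qed

text \<open>A \<open>V\<close>-module strictly between \<open>V\<close> and \<open>F\<close> is
  determined by the least exponent of \<open>z\<close> that carries it into \<open>V\<close>. Unless
  the chain is constantly \<open>F\<close>, these exponents exist from some index on, and where
  their minimum is attained the chain becomes constant.\<close>

lemma smod_V_descending:
  assumes P: "\<And>i::nat. smod V (P i)" and VP: "\<And>i. V \<subseteq> P i" and dec: "\<And>i. P (Suc i) \<subseteq> P i"
  shows "\<exists>k. \<forall>i\<ge>k. P i = P k"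
proof (cases "\<forall>i. P i = carrier F")
  case False
  have anti: "P j \<subseteq> P i" if "i \<le> j" for i j using lift_Suc_antimono_le[of P] dec that by blast
  obtain k x where kx: "x \<in> carrier F" "x \<notin> P k" using False smod_carrier[OF P] by blast
  obtain l :: nat where l: "z [^] l \<otimes> x \<in> R" using z_pow_denom[OF kx(1)] by blast
  \<comment> \<open>\<open>x\<close> is not a \<open>V\<close>-multiple of \<open>y\<close>, so by
    comparability \<open>y\<close> is one of \<open>x\<close>, and a denominator of \<open>x\<close>
    serves all of \<open>P k\<close>.\<close>
  have bounded: "z [^] l \<otimes> y \<in> V" if y: "y \<in> P k" for y
  proof -
    have yF: "y \<in> carrier F" by (rule smod_carrier[OF P y])
    have "x \<noteq> y \<otimes> v" if v: "v \<in> V" for v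
      using smod_smult[OF P v y] kx(2) v yF by (auto simp: m_comm)
    then obtain v where v: "v \<in> V" "y = x \<otimes> v" using V_total[OF kx(1) yF] by blast
    have "z [^] l \<otimes> y = (z [^] l \<otimes> x) \<otimes> v" unfolding v(2) using v(1) kx(1) by (simp add: m_assoc)
    then show ?thesis using l v(1) by simp
  qed
  define E where "E i j \<longleftrightarrow> (\<forall>y\<in>P i. z [^] (j::nat) \<otimes> y \<in> V)" for i j
  have "\<exists>j. E k j" using bounded unfolding E_def by blast
  then have "\<exists>j i. k \<le> i \<and> E i j" by blast
  define j where "j = (LEAST j. \<exists>i\<ge>k. E i j)"
  obtain i0 where i0: "k \<le> i0" "E i0 j"
    using LeastI_ex[OF \<open>\<exists>j i. k \<le> i \<and> E i j\<close>] unfolding j_def by blast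
  have "P i0 \<subseteq> P i" if i: "i0 \<le> i" for i
  proof
    fix y assume y: "y \<in> P i0"
    have yF: "y \<in> carrier F" by (rule smod_carrier[OF P y])
    have zy: "z [^] j \<otimes> y \<in> V" using i0(2) y by (simp add: E_def)
    show "y \<in> P i"
    proof (cases j)
      case 0
      then have "y \<in> V" using zy yF by simp
      then show ?thesis using VP by blast
    next
      case (Suc j')
      \<comment> \<open>Minimality of \<open>j\<close> over all later indices provides an element
        \<open>w\<close> of \<open>P i\<close> that needs the full exponent; every \<open>y\<close>
        with \<open>z^j y\<close> in \<open>V\<close> is a \<open>V\<close>-multiple of it.\<close>
      have "\<not> E i j'" using not_less_Least[of j' "\<lambda>j. \<exists>i\<ge>k. E i j"] Suc i i0(1) unfolding j_def by auto
      then obtain w where w: "w \<in> P i" "z [^] j' \<otimes> w \<notin> V" unfolding E_def by blast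
      have wF: "w \<in> carrier F" by (rule smod_carrier[OF P w(1)])
      from V_total[OF wF yF] show ?thesis
      proof
        assume "\<exists>v\<in>V. y = w \<otimes> v"
        then obtain v where v: "v \<in> V" "y = w \<otimes> v" by blast
        show ?thesis using smod_smult[OF P v(1) w(1)] v wF by (simp add: m_comm)
      next
        assume "\<exists>v\<in>V. w = y \<otimes> v"
        then obtain v where v: "v \<in> V" "w = y \<otimes> v" by blast
        have "v \<noteq> z \<otimes> u" if u: "u \<in> V" for u
        proof
          assume "v = z \<otimes> u"
          then have "z [^] j' \<otimes> w = (z [^] j \<otimes> y) \<otimes> u" unfolding v(2) Suc using u yF by (simp add: m_ac)
          then show False using w(2) zy u by simp
        qed
        then have vi: "inv v \<in> V" using V_unit v(1) by blast
        have "v \<noteq> \<zero>" using w(2) v(2) yF by auto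
        then have "inv v \<otimes> w = y" unfolding v(2) using inv_F[of v] v(1) yF by (simp add: m_lcomm)
        then show ?thesis using smod_smult[OF P vi w(1)] by simp
      qed
    qed
  qed
  then show ?thesis using anti by blast
qed simp

context
  fixes H
  assumes H: "submodule H A (quot_module (mult_module F (carrier F)) V)"
begin

lemma quot_submodule_preimage:
  "smod V {x \<in> carrier F. cos V x \<in> H}" (is "smod V ?P") "V \<subseteq> {x \<in> carrier F. cos V x \<in> H}"
  "H = cos V ` {x \<in> carrier F. cos V x \<in> H}"
proof -
  have Vs: "smod R V" by (rule smodI) auto
  have Fs: "smod R (carrier F)" by (rule smodI) auto
  have VF: "V \<subseteq> carrier F" by auto
  note k = quot_sel[OF Vs Fs VF]
  note Hs = iffD1[OF module.submodule_iff[OF module_quot[OF Vs Fs VF]] H, unfolded k(1)]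
  have add: "cos V (x \<oplus> y) \<in> H" if "x \<in> ?P" "y \<in> ?P" for x y
  proof -
    have "cos V x \<oplus>\<^bsub>quot_module (mult_module F (carrier F)) V\<^esub> cos V y \<in> H" using Hs that by blast
    then show ?thesis using k(3)[of x y] that by simp
  qed
  have sm: "cos V (c \<otimes> x) \<in> H" if "c \<in> R" "x \<in> ?P" for c x
  proof -
    have "\<forall>x\<in>H. c \<odot>\<^bsub>quot_module (mult_module F (carrier F)) V\<^esub> x \<in> H" using Hs that(1) by simp
    then have "c \<odot>\<^bsub>quot_module (mult_module F (carrier F)) V\<^esub> cos V x \<in> H" using that(2) by simp
    then show ?thesis using k(4)[of c x] that by simp
  qed
  have zH: "cos V \<zero> \<in> H" using Hs by (simp add: k(2))
  have "cos V x \<in> H" if x: "x \<in> V" for x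
    using zH cos_zero[OF Vs] iffD2[OF cos_zero_iff[OF Vs V_carrier[OF x]] x] by simp
  then show VP: "V \<subseteq> ?P" by auto
  show "smod V ?P"
  proof (rule smodI)
    show "\<zero> \<in> ?P" using zH by simp
  next
    fix v x assume v: "v \<in> V" and x: "x \<in> ?P"
    obtain k :: nat where k: "z [^] k \<otimes> x \<in> R" using z_pow_denom[of x] x by blast
    \<comment> \<open>The exponent \<open>k\<close> comes from a denominator of \<open>x\<close>, so
      \<open>v x\<close> and \<open>c x\<close> agree modulo \<open>V\<close>.\<close>
    obtain c w where cw: "c \<in> R" "w \<in> V" "v = c \<oplus> z [^] k \<otimes> w" using V_res_pow[OF v] by blast
    have "v \<otimes> x = c \<otimes> x \<oplus> w \<otimes> (z [^] k \<otimes> x)"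
      unfolding cw(3) using cw(1,2) x by (simp add: l_distr m_assoc m_lcomm)
    moreover have "w \<otimes> (z [^] k \<otimes> x) \<in> V" using cw(2) k by simp
    then have "w \<otimes> (z [^] k \<otimes> x) \<in> ?P" using VP by blast
    moreover have "c \<otimes> x \<in> ?P" using sm[OF cw(1) x] cw(1) x by simp
    ultimately have "cos V (v \<otimes> x) \<in> H" using add by simp
    then show "v \<otimes> x \<in> ?P" using v x by simp
  qed (use add in auto)
  show "H = cos V ` ?P" using Hs by blast
qed

end

lemma uniserial_F_mod_V: "uniserial_module A (quot_module (mult_module F (carrier F)) V)"
  unfolding uniserial_module_def
proof (intro allI impI, elim conjE)
  fix H H' assume H: "submodule H A (quot_module (mult_module F (carrier F)) V)"
    and H': "submodule H' A (quot_module (mult_module F (carrier F)) V)"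
  from smod_V_total[OF quot_submodule_preimage(1)[OF H] quot_submodule_preimage(1)[OF H']]
  show "H \<subseteq> H' \<or> H' \<subseteq> H"
  proof
    assume "{x \<in> carrier F. cos V x \<in> H} \<subseteq> {x \<in> carrier F. cos V x \<in> H'}"
    then have "H \<subseteq> H'" by (subst quot_submodule_preimage(3)[OF H]) blast
    then show ?thesis ..
  next
    assume "{x \<in> carrier F. cos V x \<in> H'} \<subseteq> {x \<in> carrier F. cos V x \<in> H}"
    then have "H' \<subseteq> H" by (subst quot_submodule_preimage(3)[OF H']) blast
    then show ?thesis ..
  qed
qed

lemma artinian_F_mod_V: "artinian_module A (quot_module (mult_module F (carrier F)) V)"
  unfolding artinian_module_def
proof (intro allI impI, elim conjE)
  fix H :: "nat \<Rightarrow> 'a set set"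
  assume H: "\<forall>i. submodule (H i) A (quot_module (mult_module F (carrier F)) V)"
    and dec: "\<forall>i. H (Suc i) \<subseteq> H i"
  note pre = quot_submodule_preimage[OF spec[OF H]]
  have "\<exists>k. \<forall>i\<ge>k. {x \<in> carrier F. cos V x \<in> H i} = {x \<in> carrier F. cos V x \<in> H k}"
    by (rule smod_V_descending[OF pre(1,2)]) (use dec in blast)
  then obtain k where k: "\<And>i. k \<le> i \<Longrightarrow> {x \<in> carrier F. cos V x \<in> H i} = {x \<in> carrier F. cos V x \<in> H k}"
    by blast
  have "H i = H k" if "k \<le> i" for i
    using pre(3)[of i] unfolding k[OF that] pre(3)[of k, symmetric] .
  then show "\<exists>k. \<forall>i\<ge>k. H i = H k" by blast
qed

end

section \<open>The properties of \<open>F / V\<close> under the isomorphism\<close>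

context quasi
begin

lemma divisible_F_mod_V:
  assumes V: "subring V F"
  shows "divisible_module A (quot_module (mult_module F (carrier F)) V)"
proof -
  have Vs: "smod R V" by (intro smodI subringE(2,6,7)[OF V]) auto
  have Fs: "smod R (carrier F)" by (rule smodI) auto
  have VF: "V \<subseteq> carrier F" by auto
  note k = quot_sel[OF Vs Fs VF]
  let ?K = "quot_module (mult_module F (carrier F)) V"
  have "(\<lambda>x. r \<odot>\<^bsub>?K\<^esub> x) ` carrier ?K = carrier ?K" if r: "r \<in> R" "r \<noteq> \<zero>" for r
  proof
    show "(\<lambda>x. r \<odot>\<^bsub>?K\<^esub> x) ` carrier ?K \<subseteq> carrier ?K"
      unfolding k(1) using r(1) by (auto simp: k(4))
    show "carrier ?K \<subseteq> (\<lambda>x. r \<odot>\<^bsub>?K\<^esub> x) ` carrier ?K"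
      unfolding k(1)
    proof (intro subsetI, elim imageE)
      fix C x assume x: "C = cos V x" "x \<in> carrier F"
      note i = inv_F[OF R_carrier[OF r(1)] r(2)]
      have "r \<otimes> (inv r \<otimes> x) = x" using i x(2) r(1) by (simp add: m_assoc[symmetric])
      then have "C = r \<odot>\<^bsub>?K\<^esub> cos V (inv r \<otimes> x)" using k(4)[OF r(1), of "inv r \<otimes> x"] i x by simp
      then show "C \<in> (\<lambda>x. r \<odot>\<^bsub>?K\<^esub> x) ` cos V ` carrier F" using i(1) x(2) by blast
    qed
  qed
  then show ?thesis by (simp add: divisible_module_def)
qed

text \<open>Divisibility of \<open>F / V\<close> passes to \<open>V / R\<close> through the
  isomorphism and thereby yields a uniformizer in \<open>R\<close>, on which the Artinian and
  uniserial properties rest. The inverse of a uniformizer shows that \<open>F / V\<close> is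
  nonzero.\<close>

lemma F_mod_V_summand:
  fixes N :: nat
  assumes dvr: "dvr (F\<lparr>carrier := V\<rparr>)"
    and iso: "module_isomorphic A (quot_module (mult_module F V) R)
      (direct_sum_module {..<N} (\<lambda>_. quot_module (mult_module F (carrier F)) V))"
  defines "K \<equiv> quot_module (mult_module F (carrier F)) V"
  shows "module A K \<and> carrier K \<noteq> {\<zero>\<^bsub>K\<^esub>} \<and> divisible_module A K \<and> artinian_module A K \<and> uniserial_module A K"
proof -
  obtain t where V: "subring V F" and t: "t \<in> V" "t \<noteq> \<zero>" "\<And>v. v \<in> V \<Longrightarrow> t \<otimes> v \<noteq> \<one>"
    using dvr_uniformizer[OF dvr] by blast
  have Vs: "smod R V" by (intro smodI subringE(2,6,7)[OF V]) auto
  have Fs: "smod R (carrier F)" by (rule smodI) auto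
  have VF: "V \<subseteq> carrier F" by auto
  note k = quot_sel[OF Vs Fs VF, folded K_def]
  have M: "module A K" unfolding K_def by (rule module_quot[OF Vs Fs VF])
  have D: "divisible_module A K" unfolding K_def by (rule divisible_F_mod_V[OF V])
  have tF: "t \<in> carrier F" using t(1) by auto
  have "inv t \<notin> V" using t(3)[of "inv t"] inv_F[OF tF t(2)] by blast
  then have "cos V (inv t) \<noteq> \<zero>\<^bsub>K\<^esub>"
    using cos_zero_iff[OF Vs, of "inv t"] cos_zero[OF Vs] inv_F[OF tF t(2)] by (simp add: k(2))
  moreover have "cos V (inv t) \<in> carrier K" unfolding k(1) using inv_F[OF tF t(2)] by blast
  ultimately have nz: "carrier K \<noteq> {\<zero>\<^bsub>K\<^esub>}" by blast
  obtain d where d: "lifted_sum F R N (\<lambda>_. K) d"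
    using module_isomorphic_lift[OF V, of N "\<lambda>_. K"] M iso unfolding K_def by blast
  have "\<exists>z. val_quasi F R z"
    by (rule dvr_divisible_val_quasi[OF dvr lifted_sum.divisible_V[OF d D]])
  then obtain z where z: "val_quasi F R z" ..
  show ?thesis using M nz D val_quasi.artinian_F_mod_V[OF z] val_quasi.uniserial_F_mod_V[OF z]
    unfolding K_def by blast
qed

end

text \<open>The summands in (2) are required to be nonzero, since zero modules would make their
  number meaningless. Elements of the \<open>K i\<close> are taken in \<open>'a set\<close> without
  loss: a summand is isomorphic to a submodule of the quotient by \<open>R\<close>, whose elements
  are cosets.\<close>

theorem corollary4p3:
  fixes F :: "('a, 'm) ring_scheme" and R :: "'a set" and n :: nat
  assumes "quotient_field F R"
    and "quasilocal (F\<lparr>carrier := R\<rparr>)"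
    and "n > 1"
  shows
    "let A = F\<lparr>carrier := R\<rparr>;
         Rbar = integral_closure F R;
         Rbar_mod_R = quot_module (mult_module F Rbar) R;
         F_mod_Rbar = quot_module (mult_module F (carrier F)) Rbar;
         stmt1 = bad_noetherian_stable_domain F R \<and> has_embedding_dim A n;
         stmt2 = dvr (F\<lparr>carrier := Rbar\<rparr>) \<and>
           (\<exists>K :: nat \<Rightarrow> ('a, 'a set) module.
              (\<forall>i<n - 1. module A (K i) \<and> carrier (K i) \<noteq> {\<zero>\<^bsub>K i\<^esub>} \<and>
                 divisible_module A (K i) \<and> artinian_module A (K i) \<and> uniserial_module A (K i)) \<and>
              module_isomorphic A Rbar_mod_R (direct_sum_module {..<n - 1} K));
         stmt3 = dvr (F\<lparr>carrier := Rbar\<rparr>) \<and>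
           module_isomorphic A Rbar_mod_R (direct_sum_module {..<n - 1} (\<lambda>_. F_mod_Rbar))
     in (stmt1 \<longleftrightarrow> stmt2) \<and> (stmt2 \<longleftrightarrow> stmt3)"
proof -
  have qf: "field F" "subring R F" "\<And>x. x \<in> carrier F \<Longrightarrow> \<exists>a\<in>R. \<exists>b\<in>R - {\<zero>\<^bsub>F\<^esub>}. x = a \<otimes>\<^bsub>F\<^esub> inv\<^bsub>F\<^esub> b"
    using assms(1) by (auto simp: quotient_field_def subdomain_def subcring_def)
  interpret quasi F R
    by (intro quasi.intro quasi_axioms.intro frac_field.intro frac_field_axioms.intro qf assms(2))
  let ?Q = "quot_module (mult_module F V) R" and ?K = "quot_module (mult_module F (carrier F)) V"
  let ?good = "\<lambda>K :: ('a, 'a set) module. module A K \<and> carrier K \<noteq> {\<zero>\<^bsub>K\<^esub>} \<and> divisible_module A K \<and>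
    artinian_module A K \<and> uniserial_module A K"
  let ?s1 = "bad_noetherian_stable_domain F R \<and> has_embedding_dim A n"
  let ?s2 = "dvr (F\<lparr>carrier := V\<rparr>) \<and> (\<exists>K :: nat \<Rightarrow> ('a, 'a set) module.
    (\<forall>i<n - 1. ?good (K i)) \<and> module_isomorphic A ?Q (direct_sum_module {..<n - 1} K))"
  let ?s3 = "dvr (F\<lparr>carrier := V\<rparr>) \<and> module_isomorphic A ?Q (direct_sum_module {..<n - 1} (\<lambda>_. ?K))"
  \<comment> \<open>There is at least one summand; this is what keeps \<open>V\<close> from being
    finite over \<open>R\<close>.\<close>
  have n: "0 < n - 1" "Suc (n - 1) = n" using assms(3) by auto
  have 13: ?s3 if s: ?s1
  proof -
    obtain z where z: "hub F R z" using bad.exists_hub[OF bad_noetherian_imp_bad[OF conjunct1[OF s]]] ..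
    obtain r where "hub.basis F R z {..<n - 1} r" using hub.embedding_dim_basis[OF z conjunct2[OF s]] ..
    then have b: "hub_basis F R z (n - 1) r" by (intro hub_basis.intro hub_basis_axioms.intro z)
    show ?thesis using hub.dvr_V[OF z] hub_basis.normalization_quotient[OF b] ..
  qed
  have 32: ?s2 if s: ?s3
  proof -
    have "?good ?K" by (rule F_mod_V_summand[OF conjunct1[OF s] conjunct2[OF s]])
    then show ?thesis using s by (intro conjI exI[of _ "\<lambda>_. ?K"]) auto
  qed
  have 21: ?s1 if s: ?s2
  proof -
    obtain K :: "nat \<Rightarrow> ('a, 'a set) module" where K: "\<And>i. i < n - 1 \<Longrightarrow> ?good (K i)"
      "module_isomorphic A ?Q (direct_sum_module {..<n - 1} K)" using conjunct2[OF s] by blast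
    have V: "subring V F" using dvr_uniformizer[OF conjunct1[OF s]] ..
    have "\<exists>d. lifted_sum F R (n - 1) K d"
      by (rule module_isomorphic_lift[OF V _ K(2)]) (use K(1) in blast)
    then obtain d where d: "lifted_sum F R (n - 1) K d" ..
    have "\<exists>z. hub F R z \<and> (\<exists>r. hub.basis F R z {..<n - 1} r)"
      by (rule lifted_sum.exists_hub_basis[OF d conjunct1[OF s]]) (use K(1) in blast)
    then obtain z r where z: "hub F R z" "hub.basis F R z {..<n - 1} r" by blast
    show ?thesis using hub.basis_bad_noetherian[OF z n(1)] unfolding n(2) ..
  qed
  have "?s1 \<longleftrightarrow> ?s2" using 13 32 21 by blast
  moreover have "?s2 \<longleftrightarrow> ?s3" using 13 32 21 by blast
  ultimately show ?thesis unfolding Let_def ..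
qed

end
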